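(* Let $X$ be a simply-laced root system with all irreducible components having the same Coxeter number $m$. There exists at most one weight $1$ index $m$ meromorphic Jacobi form $\psi^X$ satisfying the following two conditions. First, its polar part is $$(\psi^X)^P=\mu_{m,0}\,\big|\,\mathcal{W}^X .$$ Second, its finite part $(\psi^X)^F=\psi^X-(\psi^X)^P=\sum_{r\ (\mathrm{mod}\ 2m)}h^X_r(\tau)\,\theta_{m,r}(\tau,z)$ satisfies the optimal growth condition $$q^{1/4m}\,h_r^X(\tau)=O(1)\quad\text{as }\tau\to i\infty,\ \text{for all } r\in\mathbb{Z}/2m\mathbb{Z}.$$
   Context: Notation: $\tau\in\mathbb{H}$, $z\in\mathbb{C}$, $e(x)=e^{2\pi ix}$, $q=e(\tau)$, $y=e(z)$. Meromorphic Jacobi form of weight $1$ and index $m$: a meromorphic function $\psi$ on $\mathbb{H}\times\mathbb{C}$ with $\psi(\tau,z)=e(m(\lambda^2\tau+2\lambda z))\psi(\tau,z+\lambda\tau+\mu)$ for $\lambda,\mu\in\mathbb{Z}$, and $\psi(\tau,z)=e\left(-m\tfrac{cz^2}{c\tau+d}\right)(c\tau+d)^{-1}\psi\left(\tfrac{a\tau+b}{c\tau+d},\tfrac{z}{c\tau+d}\right)$ for $\begin{pmatrix}a&b\\c&d\end{pmatrix}\in SL_2(\mathbb{Z})$, whose only singularities are simple poles in $z$ at torsion points $z\in\mathbb{Q}\tau+\mathbb{Q}$ (here: at $n$-torsion points with $n|m$). As usual there is at most exponential growth at the cusp. Polar part: let $\mathrm{Av}_m[F(y)]=\sum_{k\in\mathbb{Z}}q^{mk^2}y^{2mk}F(q^ky)$.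 For a pole $z_s=\alpha\tau+\beta$ with $\alpha,\beta\in(-1,0]$, and $y_s=e(z_s)$, put $$\psi^P_{z_s}(\tau,z)=\pi i\,\mathrm{Res}_{z=z_s}(\psi(\tau,z))\,\mathrm{Av}_m\left[\left(\tfrac{y}{y_s}\right)^{-2m\alpha}\frac{y/y_s+1}{y/y_s-1}\right].$$ The polar part $\psi^P$ is the sum of the $\psi^P_{z_s}$ over the poles $z_s$ in this fundamental cell; the finite part is $\psi^F=\psi-\psi^P$. It is holomorphic in $z$ and invariant under the elliptic transformations, so has a theta expansion $\psi^F=\sum_{r\,(\mathrm{mod}\,2m)}h_r\theta_{m,r}$ with $\theta_{m,r}(\tau,z)=\sum_{k\equiv r\,(2m)}q^{k^2/4m}y^k$. $\mu_{m,0}(\tau,z)=\mathrm{Av}_m\left[\frac{y+1}{y-1}\right]$. Eichler–Zagier operators: for $n|m$, $$(f|\mathcal{W}_m(n))(\tau,z)=\frac1n\sum_{a,b=0}^{n-1}e\left(m\left(\tfrac{a^2}{n^2}\tau+2\tfrac anz+\tfrac{ab}{n^2}\right)\right)f\left(\tau,z+\tfrac an\tau+\tfrac bn\right),$$ extended linearly: $f|\sum_ic_i\mathcal{W}_m(n_i)=\sum_ic_i(f|\mathcal{W}_m(n_i))$. For irreducible $X$ with Coxeter number $m$: $\mathcal{W}^{A_{m-1}}=\mathcal{W}_m(1)$; $\mathcal{W}^{D_{m/2+1}}=\mathcal{W}_m(1)+\mathcal{W}_m(m/2)$; $\mathcal{W}^{E_6}=\mathcal{W}_{12}(1)+\mathcal{W}_{12}(4)+\mathcal{W}_{12}(6)$;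 $\mathcal{W}^{E_7}=\mathcal{W}_{18}(1)+\mathcal{W}_{18}(6)+\mathcal{W}_{18}(9)$; $\mathcal{W}^{E_8}=\mathcal{W}_{30}(1)+\mathcal{W}_{30}(6)+\mathcal{W}_{30}(10)+\mathcal{W}_{30}(15)$. For a union $X=\bigcup_iX_i$ of irreducible simply-laced root systems with the same Coxeter number, $\mathcal{W}^X=\sum_i\mathcal{W}^{X_i}$. *)

theory Defs
  imports
    "HOL-Complex_Analysis.Complex_Analysis"
    "HOL-Library.Landau_Symbols"
    "HOL-Number_Theory.Cong"
begin

section \<open>Simply-laced root systems\<close>

definition reflection :: "'a::euclidean_space \<Rightarrow> 'a \<Rightarrow> 'a" where
  "reflection \<alpha> x = x - (2 * (x \<bullet> \<alpha>) / (\<alpha> \<bullet> \<alpha>)) *\<^sub>R \<alpha>"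

definition root_system :: "'a::euclidean_space set \<Rightarrow> bool" where
  "root_system \<Phi> \<longleftrightarrow>
     finite \<Phi> \<and> 0 \<notin> \<Phi> \<and> span \<Phi> = UNIV \<and>
     (\<forall>\<alpha>\<in>\<Phi>. \<forall>\<beta>\<in>\<Phi>. reflection \<alpha> \<beta> \<in> \<Phi>) \<and>
     (\<forall>\<alpha>\<in>\<Phi>. \<forall>\<beta>\<in>\<Phi>. 2 * (\<beta> \<bullet> \<alpha>) / (\<alpha> \<bullet> \<alpha>) \<in> \<int>) \<and>
     (\<forall>\<alpha>\<in>\<Phi>. \<forall>c. c *\<^sub>R \<alpha> \<in> \<Phi> \<longrightarrow> c = 1 \<or> c = -1)"

text \<open>The irreducible components are the classes of the equivalence relation generated by
  non-orthogonality; it is reflexive on the roots because these are nonzero.\<close>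

definition root_components :: "'a::euclidean_space set \<Rightarrow> 'a set set" where
  "root_components \<Phi> = \<Phi> // ({(\<alpha>, \<beta>). \<alpha> \<in> \<Phi> \<and> \<beta> \<in> \<Phi> \<and> \<alpha> \<bullet> \<beta> \<noteq> 0}\<^sup>+)"

text \<open>Lengths of roots in different components are not compared.\<close>

definition simply_laced_root_system :: "'a::euclidean_space set \<Rightarrow> bool" where
  "simply_laced_root_system \<Phi> \<longleftrightarrow> root_system \<Phi> \<and>
     (\<forall>C\<in>root_components \<Phi>. \<forall>\<alpha>\<in>C. \<forall>\<beta>\<in>C. norm \<alpha> = norm \<beta>)"

text \<open>Simple roots, listed in some order.\<close>

definition is_base :: "'a::euclidean_space set \<Rightarrow> 'a list \<Rightarrow> bool" where
  "is_base C \<alpha>s \<longleftrightarrow>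
     distinct \<alpha>s \<and> set \<alpha>s \<subseteq> C \<and> independent (set \<alpha>s) \<and>
     (\<forall>\<beta>\<in>C. \<exists>c::'a \<Rightarrow> nat.
        \<beta> = (\<Sum>\<alpha>\<in>set \<alpha>s. real (c \<alpha>) *\<^sub>R \<alpha>) \<or> \<beta> = - (\<Sum>\<alpha>\<in>set \<alpha>s. real (c \<alpha>) *\<^sub>R \<alpha>))"

definition coxeter_element :: "'a::euclidean_space list \<Rightarrow> 'a \<Rightarrow> 'a" where
  "coxeter_element \<alpha>s = foldr (\<lambda>\<alpha> w. reflection \<alpha> \<circ> w) \<alpha>s id"

text \<open>The Coxeter number is the order of a Coxeter element; all Coxeter elements of an
  irreducible root system are conjugate, so the choice of base and ordering is immaterial.\<close>

definition has_coxeter_number :: "'a::euclidean_space set \<Rightarrow> nat \<Rightarrow> bool" where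
  "has_coxeter_number C h \<longleftrightarrow>
     (\<exists>\<alpha>s. is_base C \<alpha>s \<and> 0 < h \<and> coxeter_element \<alpha>s ^^ h = id \<and>
           (\<forall>k. 0 < k \<and> k < h \<longrightarrow> coxeter_element \<alpha>s ^^ k \<noteq> id))"

datatype ade = Type_A nat | Type_D nat | Type_E6 | Type_E7 | Type_E8

fun ade_rank :: "ade \<Rightarrow> nat" where
  "ade_rank (Type_A n) = n"
| "ade_rank (Type_D n) = n"
| "ade_rank Type_E6 = 6"
| "ade_rank Type_E7 = 7"
| "ade_rank Type_E8 = 8"

text \<open>Edges \<open>i < j\<close> of the Dynkin diagram with nodes \<open>0, \<dots>, n - 1\<close>. In types D and E, the nodes
  \<open>0, \<dots>, n - 2\<close> form a chain and the node \<open>n - 1\<close> is attached to \<open>n - 3\<close> (type D) or \<open>2\<close> (type E).\<close>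

definition branched_edge :: "nat \<Rightarrow> nat \<Rightarrow> nat \<Rightarrow> nat \<Rightarrow> bool" where
  "branched_edge n b i j \<longleftrightarrow> (j = i + 1 \<and> j < n - 1) \<or> (i = b \<and> j = n - 1)"

fun ade_edge :: "ade \<Rightarrow> nat \<Rightarrow> nat \<Rightarrow> bool" where
  "ade_edge (Type_A n) i j = (j = i + 1)"
| "ade_edge (Type_D n) i j = branched_edge n (n - 3) i j"
| "ade_edge Type_E6 i j = branched_edge 6 2 i j"
| "ade_edge Type_E7 i j = branched_edge 7 2 i j"
| "ade_edge Type_E8 i j = branched_edge 8 2 i j"

text \<open>The bound on the rank in type D avoids the coincidence of \<open>D\<^sub>3\<close> with \<open>A\<^sub>3\<close>, so that an irreducible
  simply-laced root system has exactly one type.\<close>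

definition has_ade_type :: "'a::euclidean_space set \<Rightarrow> ade \<Rightarrow> bool" where
  "has_ade_type C T \<longleftrightarrow>
     (\<forall>n. T = Type_D n \<longrightarrow> n \<ge> 4) \<and>
     (\<exists>\<alpha>s. is_base C \<alpha>s \<and> length \<alpha>s = ade_rank T \<and>
       (\<forall>i j. i < j \<and> j < length \<alpha>s \<longrightarrow>
          2 * (\<alpha>s ! i \<bullet> \<alpha>s ! j) / (\<alpha>s ! i \<bullet> \<alpha>s ! i) = (if ade_edge T i j then -1 else 0)))"

definition ade_type :: "'a::euclidean_space set \<Rightarrow> ade" where
  "ade_type C = (THE T. has_ade_type C T)"


section \<open>Meromorphic Jacobi forms\<close>

definition e2pi :: "complex \<Rightarrow> complex" where
  "e2pi x = exp (2 * of_real pi * \<i> * x)"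

text \<open>The filter \<open>\<tau> \<rightarrow> i\<infinity>\<close>, uniformly in the real part.\<close>

definition at_cusp :: "complex filter" where
  "at_cusp = filtercomap Im at_top"

definition holomorphic2_on :: "(complex \<Rightarrow> complex \<Rightarrow> complex) \<Rightarrow> (complex \<times> complex) set \<Rightarrow> bool" where
  "holomorphic2_on f S \<longleftrightarrow>
     (\<forall>p\<in>S. \<exists>a b. ((\<lambda>(\<tau>, z). f \<tau> z) has_derivative (\<lambda>(h, k). a * h + b * k)) (at p))"

text \<open>The points of order dividing \<open>m\<close> modulo \<open>\<int>\<tau> + \<int>\<close>, i.e. the \<open>n\<close>-torsion points with \<open>n\<close> dividing \<open>m\<close>.\<close>

definition torsion_points :: "nat \<Rightarrow> complex \<Rightarrow> complex set" where
  "torsion_points m \<tau> = {(of_int a * \<tau> + of_int b) / of_nat m | a b :: int. True}"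

text \<open>A meromorphic function on \<open>\<H> \<times> \<complex>\<close> with poles at most at the \<open>m\<close>-torsion points is represented by
  a total function whose values at these points (a closed nowhere dense set, stable under all the
  transformations involved) carry no meaning. Equality of such meromorphic functions is therefore
  equality elsewhere.\<close>

definition mero_eq ::
  "nat \<Rightarrow> (complex \<Rightarrow> complex \<Rightarrow> complex) \<Rightarrow> (complex \<Rightarrow> complex \<Rightarrow> complex) \<Rightarrow> bool" where
  "mero_eq m f g \<longleftrightarrow> (\<forall>\<tau> z. Im \<tau> > 0 \<and> z \<notin> torsion_points m \<tau> \<longrightarrow> f \<tau> z = g \<tau> z)"

text \<open>Holomorphic in both variables outside the torsion points, with at most a simple pole along each
  branch \<open>z = (a \<tau> + b) / m\<close>.\<close>

definition simple_poles_at_torsion :: "nat \<Rightarrow> (complex \<Rightarrow> complex \<Rightarrow> complex) \<Rightarrow> bool" where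
  "simple_poles_at_torsion m \<psi> \<longleftrightarrow>
     holomorphic2_on \<psi> {(\<tau>, z). Im \<tau> > 0 \<and> z \<notin> torsion_points m \<tau>} \<and>
     (\<forall>\<tau>\<^sub>0. \<forall>a b :: int. Im \<tau>\<^sub>0 > 0 \<longrightarrow>
        (\<exists>U F. open U \<and> (\<tau>\<^sub>0, (of_int a * \<tau>\<^sub>0 + of_int b) / of_nat m) \<in> U \<and> holomorphic2_on F U \<and>
           (\<forall>(\<tau>, z)\<in>U. Im \<tau> > 0 \<and> z \<notin> torsion_points m \<tau> \<longrightarrow>
              (z - (of_int a * \<tau> + of_int b) / of_nat m) * \<psi> \<tau> z = F \<tau> z)))"

definition elliptic_invariant :: "nat \<Rightarrow> (complex \<Rightarrow> complex \<Rightarrow> complex) \<Rightarrow> bool" where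
  "elliptic_invariant m \<psi> \<longleftrightarrow>
     (\<forall>l \<mu> :: int. mero_eq m \<psi>
        (\<lambda>\<tau> z. e2pi (of_nat m * ((of_int l)\<^sup>2 * \<tau> + 2 * of_int l * z)) *
               \<psi> \<tau> (z + of_int l * \<tau> + of_int \<mu>)))"

definition modular_invariant_wt1 :: "nat \<Rightarrow> (complex \<Rightarrow> complex \<Rightarrow> complex) \<Rightarrow> bool" where
  "modular_invariant_wt1 m \<psi> \<longleftrightarrow>
     (\<forall>a b c d :: int. a * d - b * c = 1 \<longrightarrow> mero_eq m \<psi>
        (\<lambda>\<tau> z. e2pi (- of_nat m * (of_int c * z\<^sup>2 / (of_int c * \<tau> + of_int d))) *
               inverse (of_int c * \<tau> + of_int d) *
               \<psi> ((of_int a * \<tau> + of_int b) / (of_int c * \<tau> + of_int d)) (z / (of_int c * \<tau> + of_int d))))"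

text \<open>At most exponential growth at the cusp, along the sections \<open>z = \<alpha> \<tau> + \<beta>\<close> avoiding the torsion points.\<close>

definition exponential_growth_at_cusp :: "nat \<Rightarrow> (complex \<Rightarrow> complex \<Rightarrow> complex) \<Rightarrow> bool" where
  "exponential_growth_at_cusp m \<psi> \<longleftrightarrow>
     (\<forall>\<alpha> \<beta> :: real. \<not> (real m * \<alpha> \<in> \<int> \<and> real m * \<beta> \<in> \<int>) \<longrightarrow>
        (\<exists>C::real. (\<lambda>\<tau>. \<psi> \<tau> (of_real \<alpha> * \<tau> + of_real \<beta>)) \<in> O[at_cusp](\<lambda>\<tau>. of_real (exp (C * Im \<tau>)))))"

definition meromorphic_jacobi_form_wt1 :: "nat \<Rightarrow> (complex \<Rightarrow> complex \<Rightarrow> complex) \<Rightarrow> bool" where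
  "meromorphic_jacobi_form_wt1 m \<psi> \<longleftrightarrow>
     simple_poles_at_torsion m \<psi> \<and> elliptic_invariant m \<psi> \<and>
     modular_invariant_wt1 m \<psi> \<and> exponential_growth_at_cusp m \<psi>"


section \<open>Polar part and finite part\<close>

definition Av :: "nat \<Rightarrow> (complex \<Rightarrow> complex) \<Rightarrow> complex \<Rightarrow> complex \<Rightarrow> complex" where
  "Av m F \<tau> z = (\<Sum>\<^sub>\<infinity>k::int. e2pi \<tau> powi (int m * k\<^sup>2) * e2pi z powi (2 * int m * k) * F (e2pi \<tau> powi k * e2pi z))"

text \<open>For \<open>m\<close>-torsion poles the exponent \<open>- 2 m \<alpha>\<close> below is an integer, so \<open>powr\<close> involves no choice of
  branch.\<close>

definition polar_part_at ::
  "nat \<Rightarrow> (complex \<Rightarrow> complex \<Rightarrow> complex) \<Rightarrow> real \<Rightarrow> real \<Rightarrow> complex \<Rightarrow> complex \<Rightarrow> complex" where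
  "polar_part_at m \<psi> \<alpha> \<beta> \<tau> z =
     (let z\<^sub>s = of_real \<alpha> * \<tau> + of_real \<beta>; y\<^sub>s = e2pi z\<^sub>s in
      of_real pi * \<i> * residue (\<psi> \<tau>) z\<^sub>s *
      Av m (\<lambda>y. (y / y\<^sub>s) powr of_real (- 2 * real m * \<alpha>) * ((y / y\<^sub>s + 1) / (y / y\<^sub>s - 1))) \<tau> z)"

definition polar_part :: "nat \<Rightarrow> (complex \<Rightarrow> complex \<Rightarrow> complex) \<Rightarrow> complex \<Rightarrow> complex \<Rightarrow> complex" where
  "polar_part m \<psi> \<tau> z =
     (\<Sum>(\<alpha>, \<beta>)\<in>{(\<alpha>, \<beta>). \<alpha> \<in> {-1<..0} \<and> \<beta> \<in> {-1<..0} \<and> is_pole (\<psi> \<tau>) (of_real \<alpha> * \<tau> + of_real \<beta>)}.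
        polar_part_at m \<psi> \<alpha> \<beta> \<tau> z)"

text \<open>The singularities of \<open>\<psi> - \<psi>\<^sup>P\<close> are removable; \<^term>\<open>remove_sings\<close> supplies the correct values there.\<close>

definition finite_part :: "nat \<Rightarrow> (complex \<Rightarrow> complex \<Rightarrow> complex) \<Rightarrow> complex \<Rightarrow> complex \<Rightarrow> complex" where
  "finite_part m \<psi> \<tau> = remove_sings (\<lambda>z. \<psi> \<tau> z - polar_part m \<psi> \<tau> z)"

definition theta :: "nat \<Rightarrow> int \<Rightarrow> complex \<Rightarrow> complex \<Rightarrow> complex" where
  "theta m r \<tau> z = (\<Sum>\<^sub>\<infinity>k\<in>{k. [k = r] (mod 2 * int m)}. e2pi ((of_int k)\<^sup>2 / (4 * of_nat m) * \<tau>) * e2pi z powi k)"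

text \<open>The theta coefficients \<open>h\<^sub>r\<close> are determined by \<open>\<phi>\<close>, since the \<open>\<theta>\<^sub>m\<^sub>,\<^sub>r(\<tau>, \<cdot>)\<close>, \<open>r mod 2m\<close>, are linearly
  independent.\<close>

definition optimal_growth :: "nat \<Rightarrow> (complex \<Rightarrow> complex \<Rightarrow> complex) \<Rightarrow> bool" where
  "optimal_growth m \<phi> \<longleftrightarrow>
     (\<exists>h :: int \<Rightarrow> complex \<Rightarrow> complex.
        (\<forall>\<tau> z. Im \<tau> > 0 \<longrightarrow> \<phi> \<tau> z = (\<Sum>r\<in>{0..<2 * int m}. h r \<tau> * theta m r \<tau> z)) \<and>
        (\<forall>r\<in>{0..<2 * int m}. (\<lambda>\<tau>. e2pi (\<tau> / (4 * of_nat m)) * h r \<tau>) \<in> O[at_cusp](\<lambda>_. 1)))"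

definition mu0 :: "nat \<Rightarrow> complex \<Rightarrow> complex \<Rightarrow> complex" where
  "mu0 m = Av m (\<lambda>y. (y + 1) / (y - 1))"


section \<open>Eichler--Zagier operators\<close>

definition EZ :: "nat \<Rightarrow> nat \<Rightarrow> (complex \<Rightarrow> complex \<Rightarrow> complex) \<Rightarrow> complex \<Rightarrow> complex \<Rightarrow> complex" where
  "EZ m n f \<tau> z = 1 / of_nat n * (\<Sum>a<n. \<Sum>b<n.
     e2pi (of_nat m * ((of_nat a)\<^sup>2 / (of_nat n)\<^sup>2 * \<tau> + 2 * (of_nat a / of_nat n) * z
                       + of_nat a * of_nat b / (of_nat n)\<^sup>2)) *
     f \<tau> (z + of_nat a / of_nat n * \<tau> + of_nat b / of_nat n))"

text \<open>\<open>A\<^sub>n\<close> and \<open>D\<^sub>n\<close> have Coxeter numbers \<open>n + 1\<close> and \<open>2n - 2\<close>.\<close>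

fun EZ_ade :: "ade \<Rightarrow> (complex \<Rightarrow> complex \<Rightarrow> complex) \<Rightarrow> complex \<Rightarrow> complex \<Rightarrow> complex" where
  "EZ_ade (Type_A n) f \<tau> z = EZ (n + 1) 1 f \<tau> z"
| "EZ_ade (Type_D n) f \<tau> z = EZ (2 * n - 2) 1 f \<tau> z + EZ (2 * n - 2) (n - 1) f \<tau> z"
| "EZ_ade Type_E6 f \<tau> z = EZ 12 1 f \<tau> z + EZ 12 4 f \<tau> z + EZ 12 6 f \<tau> z"
| "EZ_ade Type_E7 f \<tau> z = EZ 18 1 f \<tau> z + EZ 18 6 f \<tau> z + EZ 18 9 f \<tau> z"
| "EZ_ade Type_E8 f \<tau> z = EZ 30 1 f \<tau> z + EZ 30 6 f \<tau> z + EZ 30 10 f \<tau> z + EZ 30 15 f \<tau> z"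

definition EZ_root_system ::
  "'a::euclidean_space set \<Rightarrow> (complex \<Rightarrow> complex \<Rightarrow> complex) \<Rightarrow> complex \<Rightarrow> complex \<Rightarrow> complex" where
  "EZ_root_system X f \<tau> z = (\<Sum>C\<in>root_components X. EZ_ade (ade_type C) f \<tau> z)"

end

theory Submission
  imports Defs "HOL-Number_Theory.Number_Theory" "HOL-Computational_Algebra.Squarefree"
begin

text \<open>The difference of two solutions has no polar part, so it is a combination of theta functions whose
  coefficients obey the growth bound: a weak Jacobi form of weight one with Fourier coefficients
  \<open>c(n, r)\<close> supported on \<open>D = r\<^sup>2 - 4mn \<le> 1\<close>. Averaging over torsion points moves a coefficient with
  \<open>D = 1\<close> to the constant term of a form whose \<open>z\<close>-derivative at \<open>0\<close> is modular of weight two, and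
  such a form has constant term zero; hence \<open>D \<le> 0\<close>.

  That holomorphic Jacobi forms of weight one vanish is shown by induction on \<open>m\<close>. Dividing by powers of
  the prime form \<open>K = \<theta>\<^sub>1\<^sub>1 / \<theta>\<^sub>1\<^sub>1'(0)\<close> and pairing the leading Taylor coefficients with modular forms of
  negative weight shows that all coefficient arrays lie in the complex span of finitely many integral
  ones. On integral arrays the Hecke operator at a prime \<open>p\<close> not dividing \<open>2m\<close> is injective modulo \<open>p\<close>,
  and the recursion \<open>p x\<^sub>k\<^sub>+\<^sub>1 = T x\<^sub>k - x\<^sub>k\<^sub>-\<^sub>1\<close> for \<open>x\<^sub>k = c(p\<^sup>2\<^sup>k n, p\<^sup>k r)\<close> has to stay integral. This kills the
  coefficients with \<open>D\<close> exactly divisible by \<open>p\<close> and forces the eigenvalue \<open>(D/p) (p + 1)\<close> on those with \<open>D\<close>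
  prime to \<open>p\<close>. Quadratic reciprocity provides primes which separate the remaining square classes of
  \<open>D\<close>, and in a form supported on a single class all \<open>r\<close> are divisible by one prime \<open>q\<close>: such a form
  comes from index \<open>m / q\<^sup>2\<close>.\<close>

section \<open>Exponential sums\<close>

text \<open>Theta coefficients of a weight one form have weight 1/2, where nonzero unary theta
  series exist, so no estimate of growth or weight can force vanishing; arithmetic has to do it. The
  Hecke step: put x_(k+1) = \<lambda> x_k in the recursion, so p \<lambda>^2 - T \<lambda> + 1 = 0.
  The roots have product 1/p and sum T/p. As T is invertible mod p, one root is a p-adic unit and
  the other has denominator p, which integrality for all k excludes. A starting relation T x_0 = p
  x_1 + \<epsilon> x_0 then gives \<epsilon> \<lambda> = 1: impossible for \<epsilon> = 0 unless x_0
  = 0, while \<epsilon> = 1 or -1 gives \<lambda> = \<epsilon> and T = \<epsilon> (p + 1).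
  Injectivity mod p implies invertibility only in finite rank; this is the purpose of the integral
  spanning arrays. Complex coefficients have no reduction mod p, so they are first mapped to the
  rationals by additive functionals.\<close>

abbreviation tpi :: complex where "tpi == 2 * of_real pi * \<i>"

lemma e2pi_add: "e2pi (x + y) = e2pi x * e2pi y" by (simp add: e2pi_def exp_add distrib_left)

lemma e2pi_0 [simp]: "e2pi 0 = 1" by (simp add: e2pi_def)

lemma e2pi_nonzero [simp]: "e2pi x \<noteq> 0" by (simp add: e2pi_def)

lemma e2pi_minus: "e2pi (- x) = inverse (e2pi x)" by (simp add: e2pi_def exp_minus)

lemma e2pi_diff: "e2pi (x - y) = e2pi x / e2pi y" by (simp add: e2pi_def exp_diff right_diff_distrib)

lemma norm_e2pi: "norm (e2pi x) = exp (- 2 * pi * Im x)" by (simp add: e2pi_def)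

lemma e2pi_of_int [simp]: "e2pi (of_int n) = 1"
proof -
  have "exp (complex_of_real (2 * pi * of_int n) * \<i>) = 1" by (simp add: exp_eq_1)
  thus ?thesis by (simp add: e2pi_def mult_ac)
qed

lemma e2pi_of_nat [simp]: "e2pi (of_nat n) = 1" using e2pi_of_int[of "int n"] by simp

lemma e2pi_1 [simp]: "e2pi 1 = 1" using e2pi_of_int[of 1] by simp

lemma e2pi_plus_int [simp]: "e2pi (x + of_int n) = e2pi x" by (simp add: e2pi_add)

lemma e2pi_plus_1 [simp]: "e2pi (x + 1) = e2pi x" by (simp add: e2pi_add)

lemma e2pi_eq_1_iff: "e2pi x = 1 \<longleftrightarrow> (\<exists>n. x = of_int n)"
proof
  assume "e2pi x = 1"
  hence "exp (tpi * x) = exp 0" by (simp add: e2pi_def)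
  then obtain n :: int where "tpi * x = 0 + (of_int (2 * n) * pi) * \<i>" unfolding exp_eq by auto
  hence "x = of_int n" by (simp add: field_simps)
  thus "\<exists>n. x = of_int n" by blast
qed auto

lemma e2pi_half: "e2pi (1/2) = -1" by (simp add: e2pi_def)

lemma e2pi_pow: "e2pi x ^ n = e2pi (of_nat n * x)" by (simp add: e2pi_def exp_of_nat_mult [symmetric] mult_ac)

lemma e2pi_powi: "e2pi x powi n = e2pi (of_int n * x)" by (simp add: e2pi_def exp_power_int mult_ac)

lemma has_field_derivative_e2pi [derivative_intros]:
  assumes "(f has_field_derivative f') (at x within A)"
  shows "((\<lambda>x. e2pi (f x)) has_field_derivative (tpi * f' * e2pi (f x))) (at x within A)" unfolding e2pi_def by (auto intro!: derivative_eq_intros assms)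

lemma holomorphic_on_e2pi [holomorphic_intros]:
  "f holomorphic_on A ==> (\<lambda>x. e2pi (f x)) holomorphic_on A" unfolding e2pi_def by (intro holomorphic_intros)

lemma continuous_on_e2pi [continuous_intros]:
  "continuous_on A f ==> continuous_on A (\<lambda>x. e2pi (f x))" unfolding e2pi_def by (intro continuous_intros)

definition upper :: "complex set" where "upper = {t. Im t > 0}"

lemma upper_iff [simp]: "t \<in> upper \<longleftrightarrow> Im t > 0" by (simp add: upper_def)

lemma open_upper [simp, intro]: "open upper" unfolding upper_def by (simp add: open_halfspace_Im_gt)

lemma convex_upper [simp, intro]: "convex upper" unfolding upper_def by (simp add: convex_halfspace_Im_gt)

lemma upper_nonzero: "Im t > 0 ==> t \<noteq> 0" by auto

lemma Im_minus_inverse: "Im (- 1 / t) = Im t / (norm t)\<^sup>2" by (simp add: Im_divide cmod_power2)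

lemma Im_minus_inverse_pos [simp]: "Im t > 0 ==> Im (- 1 / t) > 0" by (subst Im_minus_inverse) (auto intro!: divide_pos_pos)

lemma abs_summable_has_sum_complex:
  fixes f :: "'a => complex"
  shows "(f has_sum s) A ==> (\<lambda>x. norm (f x)) summable_on A" using has_sum_imp_summable summable_on_iff_abs_summable_on_complex by blast

lemma has_integral_e2pi_int:
  "((\<lambda>x::real. e2pi (of_int n * of_real x)) has_integral (if n = 0 then 1 else 0)) {0..1}"
proof (cases "n = 0")
  case True
  thus ?thesis using has_integral_const_real[of "1::complex" 0 1] by simp
next
  case False
  define c where "c = tpi * of_int n"
  have c: "c \<noteq> 0" using False by (simp add: c_def)
  have "((\<lambda>x. e2pi (of_int n * of_real x)) has_integral
      (e2pi (of_int n * of_real 1) / c - e2pi (of_int n * of_real 0) / c)) {0..1::real}"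
  proof (rule fundamental_theorem_of_calculus)
    fix x :: real assume "x \<in> {0..1}"
    have "DERIV (\<lambda>w. e2pi (of_int n * w) / c) (of_real x) :> e2pi (of_int n * of_real x)" using c by (auto intro!: derivative_eq_intros simp: c_def)
    thus "((\<lambda>x. e2pi (of_int n * of_real x) / c) has_vector_derivative e2pi (of_int n * of_real x)) (at x within {0..1})" by (rule has_vector_derivative_real_field)
  qed simp
  thus ?thesis using False by simp
qed

text \<open>Evaluation at x = 0 shows that the coefficients are absolutely summable, so the series
  converges uniformly on [0, 1], and integration against e(-kx) isolates a k.\<close>

lemma fourier_coeff_unique:
  fixes a :: "int => complex"
  assumes "\<And>x::real. ((\<lambda>k. a k * e2pi (of_int k * of_real x)) has_sum 0) UNIV"
  shows "a k = 0"
proof -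
  have sm: "(\<lambda>k. norm (a k)) summable_on UNIV" using abs_summable_has_sum_complex[OF assms[of 0]] by simp
  define f where "f = (\<lambda>j x. a j * e2pi (of_int (j - k) * complex_of_real x))"
  have ul: "uniform_limit (cbox 0 1) (\<lambda>X x. \<Sum>j\<in>X. f j x) (\<lambda>x::real. 0) (finite_subsets_at_top UNIV)"
  proof (rule Weierstrass_m_test_general')
    fix j :: int and x :: real
    show "norm (f j x) \<le> norm (a j)" by (simp add: f_def norm_mult norm_e2pi)
  next
    fix x :: real
    have "((\<lambda>j. a j * e2pi (of_int j * of_real x) * e2pi (- of_int k * of_real x)) has_sum 0 * e2pi (- of_int k * of_real x)) UNIV" by (intro has_sum_cmult_left assms)
    thus "((\<lambda>j. f j x) has_sum 0) UNIV" by (simp add: f_def mult.assoc e2pi_add[symmetric] ring_distribs)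
  qed (rule sm)
  obtain I J where IJ: "\<And>X. ((\<lambda>x. \<Sum>j\<in>X. f j x) has_integral I X) (cbox 0 (1::real))"
    "((\<lambda>x. 0) has_integral J) (cbox 0 (1::real))" "(I \<longlongrightarrow> J) (finite_subsets_at_top (UNIV :: int set))"
    by (rule uniform_limit_integral_cbox[OF ul]) (auto simp: f_def intro!: continuous_intros)
  have J: "J = 0" using has_integral_unique[OF IJ(2) has_integral_0] .
  have "I X = a k" if "finite X" "k \<in> X" for X
  proof -
    have "((\<lambda>x. \<Sum>j\<in>X. f j x) has_integral (\<Sum>j\<in>X. a j * (if j - k = 0 then 1 else 0))) {0..1::real}" unfolding f_def using that(1)
      by (intro has_integral_sum has_integral_mult_right has_integral_e2pi_int)
    hence "I X = (\<Sum>j\<in>X. a j * (if j - k = 0 then 1 else 0))" using IJ(1)[of X] unfolding cbox_interval by (rule has_integral_unique[rotated])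
    also have "\<dots> = (\<Sum>j\<in>X. if j = k then a j else 0)" by (intro sum.cong) auto
    finally show ?thesis using that by simp
  qed
  hence "eventually (\<lambda>X. I X = a k) (finite_subsets_at_top UNIV)" unfolding eventually_finite_subsets_at_top by (intro exI[of _ "{k}"]) auto
  hence "(I \<longlongrightarrow> a k) (finite_subsets_at_top UNIV)" by (rule tendsto_eventually)
  hence "J = a k" using IJ(3) by (intro tendsto_unique[OF finite_subsets_at_top_neq_bot])
  thus ?thesis using J by simp
qed

text \<open>The Weierstrass test for unordered sums: a local majorant gives uniform convergence
  along the filter of finite subsets.\<close>

lemma holomorphic_on_has_sum:
  fixes f :: "'a => complex => complex"
  assumes "open S"
    and hol: "\<And>k. f k holomorphic_on S"
    and sum: "\<And>x. x \<in> S ==> ((\<lambda>k. f k x) has_sum F x) UNIV"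
    and bd: "\<And>x. x \<in> S ==> \<exists>r>0. \<exists>M. M summable_on UNIV \<and> cball x r \<subseteq> S \<and> (\<forall>k. \<forall>y\<in>cball x r. norm (f k y) \<le> M k)"
  shows "F holomorphic_on S"
proof -
  have "F field_differentiable at x" if x: "x \<in> S" for x
  proof -
    obtain r M where r: "r > 0" "cball x r \<subseteq> S" and M: "M summable_on UNIV" "\<And>k y. y \<in> cball x r ==> norm (f k y) \<le> M k" using bd[OF x] by blast
    have ul: "uniform_limit (cball x r) (\<lambda>X y. \<Sum>k\<in>X. f k y) F (finite_subsets_at_top UNIV)" by (rule Weierstrass_m_test_general'[OF M(2) sum M(1)]) (use r in auto)
    have h: "(\<lambda>y. \<Sum>k\<in>X. f k y) holomorphic_on cball x r" for X using hol r by (intro holomorphic_on_sum) (auto intro: holomorphic_on_subset)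
    have "F holomorphic_on ball x r" by (rule holomorphic_uniform_limit[OF _ ul])
         (auto intro!: always_eventually holomorphic_on_imp_continuous_on[OF h] holomorphic_on_subset[OF h])
    thus ?thesis using r(1) by (meson centre_in_ball holomorphic_on_imp_differentiable_at open_ball)
  qed
  thus ?thesis by (simp add: holomorphic_on_def field_differentiable_at_within)
qed

lemma higher_deriv_has_sum:
  fixes f :: "'a => complex => complex"
  assumes "open S" "x \<in> S"
    and hol: "\<And>k. f k holomorphic_on S"
    and sum: "\<And>x. x \<in> S ==> ((\<lambda>k. f k x) has_sum F x) UNIV"
    and bd: "\<And>x. x \<in> S ==> \<exists>r>0. \<exists>M. M summable_on UNIV \<and> cball x r \<subseteq> S \<and> (\<forall>k. \<forall>y\<in>cball x r. norm (f k y) \<le> M k)"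
  shows "((\<lambda>k. (deriv ^^ n) (f k) x) has_sum (deriv ^^ n) F x) UNIV"
proof -
  obtain r M where r: "r > 0" "cball x r \<subseteq> S" and M: "M summable_on UNIV" "\<And>k y. y \<in> cball x r ==> norm (f k y) \<le> M k" using bd[OF assms(2)] by blast
  have ul: "uniform_limit (ball x r) (\<lambda>X y. \<Sum>k\<in>X. f k y) F (finite_subsets_at_top UNIV)" by (rule Weierstrass_m_test_general'[OF M(2) sum M(1)]) (use r in auto)
  have h: "f k holomorphic_on ball x r" for k using hol r by (meson ball_subset_cball holomorphic_on_subset)
  have "((\<lambda>X. (deriv ^^ n) (\<lambda>y. \<Sum>k\<in>X. f k y) x) \<longlongrightarrow> (deriv ^^ n) F x) (finite_subsets_at_top UNIV)" by (rule higher_deriv_complex_uniform_limit[OF ul])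
       (use r h in \<open>auto intro!: always_eventually holomorphic_on_sum\<close>)
  moreover have "(deriv ^^ n) (\<lambda>y. \<Sum>k\<in>X. f k y) x = (\<Sum>k\<in>X. (deriv ^^ n) (f k) x)" for X
  proof (cases "finite X")
    case True
    thus ?thesis
    proof (induction X)
      case empty
      show ?case by (cases n) (auto simp: higher_deriv_const)
    next
      case (insert k X)
      have "(deriv ^^ n) (\<lambda>y. f k y + (\<Sum>j\<in>X. f j y)) x = (deriv ^^ n) (f k) x + (deriv ^^ n) (\<lambda>y. \<Sum>j\<in>X. f j y) x"
        by (rule higher_deriv_add[of _ "ball x r"]) (use r h in \<open>auto intro!: holomorphic_on_sum\<close>)
      thus ?case using insert by simp
    qed
  next
    case False
    thus ?thesis by (cases n) (auto simp: higher_deriv_const)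
  qed
  ultimately show ?thesis by (simp add: has_sum_def)
qed

section \<open>Double Fourier expansions\<close>

abbreviation fterm :: "(int => int => complex) => complex => complex => int \<times> int => complex" where
  "fterm c t z \<equiv> (\<lambda>(n, r). c n r * e2pi (of_int n * t + of_int r * z))"

text \<open>\<open>has_sum\<close> is unconditional, so convergence at all points already carries
  holomorphy in each variable, both periodicities and termwise differentiation. Negative n are still
  allowed here.\<close>

definition expands :: "(complex => complex => complex) => (int => int => complex) => bool" where
  "expands F c \<longleftrightarrow> (\<forall>t z. Im t > 0 --> (fterm c t z has_sum F t z) UNIV)"

lemma expandsD: "expands F c ==> Im t > 0 ==> (fterm c t z has_sum F t z) UNIV" by (simp add: expands_def)

lemma expandsI: "(\<And>t z. Im t > 0 ==> (fterm c t z has_sum F t z) UNIV) ==> expands F c" by (simp add: expands_def)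

lemma expands_cong: "(\<And>t z. Im t > 0 ==> F t z = G t z) ==> expands F c ==> expands G c" by (simp add: expands_def)

lemma expands_fun_unique: "expands F c ==> expands G c ==> Im t > 0 ==> F t z = G t z" unfolding expands_def using has_sum_unique by blast

lemma expands_add: "expands F c ==> expands G d ==> expands (\<lambda>t z. F t z + G t z) (\<lambda>n r. c n r + d n r)"
proof (rule expandsI)
  fix t z :: complex assume a: "expands F c" "expands G d" "Im t > 0"
  show "(fterm (\<lambda>n r. c n r + d n r) t z has_sum F t z + G t z) UNIV" using has_sum_add[OF expandsD[OF a(1,3)] expandsD[OF a(2,3)], of z z] by (simp add: case_prod_unfold ring_distribs)
qed

lemma expands_cmult: "expands F c ==> expands (\<lambda>t z. a * F t z) (\<lambda>n r. a * c n r)"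
proof (rule expandsI)
  fix t z :: complex assume a: "expands F c" "Im t > 0"
  show "(fterm (\<lambda>n r. a * c n r) t z has_sum a * F t z) UNIV" using has_sum_cmult_right[OF expandsD[OF a, of z], where c = a] by (simp add: case_prod_unfold mult_ac)
qed

lemma expands_diff: "expands F c ==> expands G d ==> expands (\<lambda>t z. F t z - G t z) (\<lambda>n r. c n r - d n r)"
  using expands_add[of F c "\<lambda>t z. -1 * G t z" "\<lambda>n r. -1 * d n r"] expands_cmult[of G d "-1"] by simp

lemma expands_sum:
  "finite A ==> (\<And>i. i \<in> A ==> expands (F i) (c i)) ==> expands (\<lambda>t z. \<Sum>i\<in>A. F i t z) (\<lambda>n r. \<Sum>i\<in>A. c i n r)"
proof (induction A rule: finite_induct)
  case empty
  show ?case by (simp add: expands_def case_prod_unfold)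
next
  case (insert i A)
  thus ?case by (simp add: expands_add)
qed

lemma expands_summable: "expands F c ==> Im t > 0 ==> (\<lambda>x. norm (fterm c t z x)) summable_on UNIV" by (rule abs_summable_has_sum_complex[OF expandsD])

text \<open>For fixed t the sums over n are Fourier coefficients in z on the real line, hence
  vanish; each of them is in turn a Fourier series in Re t on the line Im t = 1.\<close>

lemma expands_coeff_eq_0:
  assumes "expands F c" "\<And>t z. Im t > 0 ==> F t z = 0"
  shows "c n r = 0"
proof -
  define a where "a = (\<lambda>t r. \<Sum>\<^sub>\<infinity>n. c n r * e2pi (of_int n * t))"
  have a: "((\<lambda>n. c n r * e2pi (of_int n * t)) has_sum a t r) UNIV" if "Im t > 0" for t r
  proof -
    have "fterm c t 0 summable_on range (\<lambda>n. (n, r))" using has_sum_imp_summable[OF expandsD[OF assms(1) that]] by (rule summable_on_subset_banach) auto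
    hence "(fterm c t 0 \<circ> (\<lambda>n. (n, r))) summable_on UNIV" by (subst (asm) summable_on_reindex) (auto simp: inj_on_def)
    thus ?thesis unfolding a_def by (intro has_sum_infsum) (simp add: o_def)
  qed
  have a0: "a t r = 0" if t: "Im t > 0" for t r
  proof (rule fourier_coeff_unique[where a = "a t"])
    fix x :: real
    have "(fterm c t (of_real x) has_sum 0) (UNIV \<times> UNIV)" using expandsD[OF assms(1) t, of "of_real x"] assms(2)[OF t, of "of_real x"] by simp
    hence "((\<lambda>(r, n). fterm c t (of_real x) (n, r)) has_sum 0) (UNIV \<times> UNIV)" by (subst has_sum_swap[symmetric]) simp
    thus "((\<lambda>k. a t k * e2pi (of_int k * of_real x)) has_sum 0) UNIV"
    proof (rule has_sum_SigmaD)
      fix k :: int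
      show "((\<lambda>y. case (k, y) of (r, n) => fterm c t (of_real x) (n, r)) has_sum a t k * e2pi (of_int k * of_real x)) UNIV"
        using has_sum_cmult_left[OF a[OF t], of k "e2pi (of_int k * of_real x)"] by (simp add: e2pi_add mult_ac)
    qed
  qed
  have "c n r * e2pi (of_int n * \<i>) = 0"
  proof (rule fourier_coeff_unique[where a = "\<lambda>n. c n r * e2pi (of_int n * \<i>)"])
    fix x :: real
    show "((\<lambda>k. c k r * e2pi (of_int k * \<i>) * e2pi (of_int k * of_real x)) has_sum 0) UNIV"
      using a[of "\<i> + of_real x" r] a0[of "\<i> + of_real x" r] by (simp add: e2pi_add ring_distribs mult_ac)
  qed
  thus ?thesis by simp
qed

lemma expands_coeff_unique:
  assumes "expands F c" "expands G d" "\<And>t z. Im t > 0 ==> F t z = G t z"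
  shows "c = d"
proof (intro ext)
  fix n r
  have "c n r - d n r = 0" by (rule expands_coeff_eq_0[OF expands_diff[OF assms(1,2)]]) (simp add: assms(3))
  thus "c n r = d n r" by simp
qed

text \<open>On an interval exp(s y) is at most the sum of its values at the end points. So the four
  series at the corners Im t = y1, y2 and Im z = -v, v together majorise the terms on the whole
  strip.\<close>

lemma expands_bound:
  assumes "expands F c" "0 < y1"
  obtains M where "M summable_on UNIV"
    "\<And>t z x. y1 \<le> Im t ==> Im t \<le> y2 ==> \<bar>Im z\<bar> \<le> v ==> norm (fterm c t z x) \<le> M x"
proof (cases "y1 \<le> y2")
  case False
  thus ?thesis by (intro that[of "\<lambda>_. 0"]) auto
next
  case True
  define N where "N = (\<lambda>y w x. norm (fterm c (\<i> * of_real y) (\<i> * of_real w) x))"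
  have N: "N y w summable_on UNIV" if "y > 0" for y w unfolding N_def by (rule expands_summable[OF assms(1)]) (use that in simp)
  define M where "M = (\<lambda>x. (N y1 v x + N y1 (-v) x) + (N y2 v x + N y2 (-v) x))"
  have Mx: "exp (s * y) \<le> exp (s * l) + exp (s * u)" if "l \<le> y" "y \<le> u" for s y l u :: real
  proof (cases "s \<ge> 0")
    case True
    hence "exp (s * y) \<le> exp (s * u)" using that by (simp add: mult_left_mono)
    thus ?thesis using exp_gt_zero[of "s * l"] exp_gt_zero[of "s * u"] by linarith
  next
    case False
    hence "exp (s * y) \<le> exp (s * l)" using that by (simp add: mult_left_mono_neg)
    thus ?thesis using exp_gt_zero[of "s * l"] exp_gt_zero[of "s * u"] by linarith
  qed
  show ?thesis
  proof (rule that)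
    show "M summable_on UNIV" unfolding M_def using True assms(2) by (intro summable_on_add N) auto
    fix t z :: complex and x :: "int \<times> int"
    assume h: "y1 \<le> Im t" "Im t \<le> y2" "\<bar>Im z\<bar> \<le> v"
    obtain n r where x: "x = (n, r)" by force
    have e: "norm (e2pi (of_int n * t + of_int r * z)) = exp ((- 2 * pi * n) * Im t) * exp ((- 2 * pi * r) * Im z)" for t z by (simp add: norm_e2pi exp_add[symmetric] algebra_simps)
    have Nx: "N y w x = norm (c n r) * (exp ((- 2 * pi * n) * y) * exp ((- 2 * pi * r) * w))" for y w using e[of "\<i> * of_real y" "\<i> * of_real w"] by (simp add: N_def x norm_mult)
    have "norm (fterm c t z x) = norm (c n r) * (exp ((- 2 * pi * n) * Im t) * exp ((- 2 * pi * r) * Im z))" by (simp add: x norm_mult e del: mult_minus_left)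
    also have "\<dots> \<le> norm (c n r) * ((exp ((- 2 * pi * n) * y1) + exp ((- 2 * pi * n) * y2)) * (exp ((- 2 * pi * r) * (-v)) + exp ((- 2 * pi * r) * v)))"
      by (intro mult_left_mono mult_mono Mx) (use h in auto)
    also have "\<dots> = M x" by (simp only: M_def Nx ring_distribs)
    finally show "norm (fterm c t z x) \<le> M x" .
  qed
qed

lemma expands_bound_cball:
  assumes "expands F c" "0 < Im t0"
  shows "\<exists>d>0. \<exists>M. M summable_on UNIV \<and> cball t0 d \<subseteq> upper \<and>
    (\<forall>t\<in>cball t0 d. \<forall>z\<in>cball z0 d. \<forall>x. norm (fterm c t z x) \<le> M x)"
proof -
  define d where "d = Im t0 / 2"
  obtain M where M: "M summable_on UNIV" "\<And>t z x. Im t0 / 2 \<le> Im t ==> Im t \<le> 2 * Im t0 ==> \<bar>Im z\<bar> \<le> \<bar>Im z0\<bar> + d ==> norm (fterm c t z x) \<le> M x"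
    using expands_bound[OF assms(1), of "Im t0 / 2" "2 * Im t0" "\<bar>Im z0\<bar> + d"] assms(2) by auto
  have I: "\<bar>Im w - Im u\<bar> \<le> d" if "w \<in> cball u d" for w u using that abs_Im_le_cmod[of "w - u"] by (simp add: dist_norm norm_minus_commute)
  show ?thesis
  proof (intro exI[of _ d] exI[of _ M] conjI ballI allI subsetI)
    show "d > 0" using assms(2) by (simp add: d_def)
    show "t \<in> upper" if "t \<in> cball t0 d" for t using I[OF that] assms(2) unfolding d_def upper_iff by linarith
    show "norm (fterm c t z x) \<le> M x" if "t \<in> cball t0 d" "z \<in> cball z0 d" for t z x using I[OF that(1)] I[OF that(2)] assms(2) unfolding d_def by (intro M(2)) (unfold d_def, linarith+)
  qed (rule M)
qed

lemma expands_holomorphic_z: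
  assumes "expands F c" "Im t > 0"
  shows "F t holomorphic_on A"
proof -
  have "F t holomorphic_on UNIV"
  proof (rule holomorphic_on_has_sum)
    show "(\<lambda>z. fterm c t z x) holomorphic_on UNIV" for x by (cases x) (auto intro!: holomorphic_intros)
    show "((\<lambda>x. fterm c t z x) has_sum F t z) UNIV" for z using expandsD[OF assms] .
    fix z0
    obtain d M where "d > 0" "M summable_on UNIV"
        "\<forall>t\<in>cball t d. \<forall>z\<in>cball z0 d. \<forall>x. norm (fterm c t z x) \<le> M x" using expands_bound_cball[OF assms, of z0] by blast
    thus "\<exists>r>0. \<exists>M. M summable_on UNIV \<and> cball z0 r \<subseteq> UNIV \<and> (\<forall>k. \<forall>y\<in>cball z0 r. norm (fterm c t y k) \<le> M k)"
      by (intro exI[of _ d] conjI exI[of _ M]) simp_all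
  qed auto
  thus ?thesis by (rule holomorphic_on_subset) auto
qed

lemma expands_holomorphic_tau:
  assumes "expands F c"
  shows "(\<lambda>t. F t z) holomorphic_on upper"
proof (rule holomorphic_on_has_sum)
  show "(\<lambda>t. fterm c t z x) holomorphic_on upper" for x by (cases x) (auto intro!: holomorphic_intros)
  show "((\<lambda>x. fterm c t z x) has_sum F t z) UNIV" if "t \<in> upper" for t using expandsD[OF assms] that by simp
  fix t assume t: "t \<in> upper"
  obtain d M where "d > 0" "M summable_on UNIV" "cball t d \<subseteq> upper"
        "\<forall>t\<in>cball t d. \<forall>z'\<in>cball z d. \<forall>x. norm (fterm c t z' x) \<le> M x" using expands_bound_cball[OF assms t[unfolded upper_iff], of z] by blast
  thus "\<exists>r>0. \<exists>M. M summable_on UNIV \<and> cball t r \<subseteq> upper \<and> (\<forall>k. \<forall>y\<in>cball t r. norm (fterm c y z k) \<le> M k)"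
    by (intro exI[of _ d] conjI exI[of _ M]) simp_all
qed auto

lemma higher_deriv_e2pi: "(deriv ^^ k) (\<lambda>z. a * e2pi (b + of_int r * z)) = (\<lambda>z. a * (tpi * of_int r) ^ k * e2pi (b + of_int r * z))"
proof (induction k)
  case (Suc k)
  have "deriv (\<lambda>z. a * (tpi * of_int r) ^ k * e2pi (b + of_int r * z)) z
      = a * (tpi * of_int r) ^ Suc k * e2pi (b + of_int r * z)" for z by (rule DERIV_imp_deriv) (auto intro!: derivative_eq_intros)
  thus ?case unfolding funpow.simps o_def Suc by blast
qed simp

lemma expands_higher_deriv:
  assumes "expands F c"
  shows "expands (\<lambda>t. (deriv ^^ k) (F t)) (\<lambda>n r. (tpi * of_int r) ^ k * c n r)"
proof (rule expandsI)
  fix t z0 :: complex assume t: "Im t > 0"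
  have "((\<lambda>x. (deriv ^^ k) (\<lambda>z. fterm c t z x) z0) has_sum (deriv ^^ k) (F t) z0) UNIV"
  proof (rule higher_deriv_has_sum)
    show "(\<lambda>z. fterm c t z x) holomorphic_on UNIV" for x by (cases x) (auto intro!: holomorphic_intros)
    show "((\<lambda>x. fterm c t z x) has_sum F t z) UNIV" for z using expandsD[OF assms t] .
    fix z0
    obtain d M where "d > 0" "M summable_on UNIV"
        "\<forall>t\<in>cball t d. \<forall>z\<in>cball z0 d. \<forall>x. norm (fterm c t z x) \<le> M x" using expands_bound_cball[OF assms t, of z0] by blast
    thus "\<exists>r>0. \<exists>M. M summable_on UNIV \<and> cball z0 r \<subseteq> UNIV \<and> (\<forall>k. \<forall>y\<in>cball z0 r. norm (fterm c t y k) \<le> M k)"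
      by (intro exI[of _ d] conjI exI[of _ M]) simp_all
  qed auto
  thus "(fterm (\<lambda>n r. (tpi * of_int r) ^ k * c n r) t z0 has_sum (deriv ^^ k) (F t) z0) UNIV" by (rule back_subst[of "\<lambda>f. (f has_sum _) UNIV"])
       (simp add: fun_eq_iff, simp only: higher_deriv_e2pi, simp add: mult_ac)
qed

section \<open>Products and integrality of double expansions\<close>

definition fourier_nice :: "(int => int => 'a::zero) => bool" where
  "fourier_nice c \<longleftrightarrow> (\<forall>n r. c n r \<noteq> 0 --> n \<ge> 0) \<and> (\<forall>n. finite {r. c n r \<noteq> 0})"

text \<open>Restriction to nonzero c k s keeps the sum finite. For \<open>fourier_nice\<close>
  arrays it is the full Cauchy product, as both are supported on n \<ge> 0.\<close>

definition conv :: "(int => int => 'a::comm_ring_1) => (int => int => 'a) => int => int => 'a" where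
  "conv c d n r = (\<Sum>(k, s)\<in>{(k, s). 0 \<le> k \<and> k \<le> n \<and> c k s \<noteq> 0}. c k s * d (n - k) (r - s))"

lemma fourier_nice_finite: "fourier_nice c ==> finite {(k, s). 0 \<le> k \<and> k \<le> (n::int) \<and> c k s \<noteq> 0}"
proof -
  assume "fourier_nice c"
  hence "finite (SIGMA k:{0..n}. {s. c k s \<noteq> 0})" by (auto simp: fourier_nice_def)
  moreover have "{(k, s). 0 \<le> k \<and> k \<le> n \<and> c k s \<noteq> 0} = (SIGMA k:{0..n}. {s. c k s \<noteq> 0})" by auto
  ultimately show ?thesis by simp
qed

lemma fourier_nice_conv:
  assumes "fourier_nice c" "fourier_nice d"
  shows "fourier_nice (conv c d)" unfolding fourier_nice_def
proof (intro conjI allI impI)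
  fix n r assume "conv c d n r \<noteq> 0"
  then obtain x where "x \<in> {(k, s). 0 \<le> k \<and> k \<le> n \<and> c k s \<noteq> 0}" unfolding conv_def by (rule sum.not_neutral_contains_not_neutral)
  thus "0 \<le> n" by auto
next
  fix n
  let ?S = "{(k, s). 0 \<le> k \<and> k \<le> n \<and> c k s \<noteq> 0}"
  have "{r. conv c d n r \<noteq> 0} \<subseteq> (\<Union>(k, s)\<in>?S. (\<lambda>t. t + s) ` {t. d (n - k) t \<noteq> 0})"
  proof
    fix r assume "r \<in> {r. conv c d n r \<noteq> 0}"
    hence "conv c d n r \<noteq> 0" by simp
    then obtain x where x: "x \<in> ?S" "(case x of (k, s) => c k s * d (n - k) (r - s)) \<noteq> 0" unfolding conv_def by (rule sum.not_neutral_contains_not_neutral)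
    obtain k s where ks: "x = (k, s)" by force
    have "r \<in> (\<lambda>t. t + s) ` {t. d (n - k) t \<noteq> 0}" using x(2) by (intro image_eqI[of _ _ "r - s"]) (auto simp: ks)
    thus "r \<in> (\<Union>(k, s)\<in>?S. (\<lambda>t. t + s) ` {t. d (n - k) t \<noteq> 0})" using x(1) unfolding ks by blast
  qed
  moreover have "finite (\<Union>(k, s)\<in>?S. (\<lambda>t. t + s) ` {t. d (n - k) t \<noteq> 0})" using fourier_nice_finite[OF assms(1)] assms(2) by (auto simp: fourier_nice_def)
  ultimately show "finite {r. conv c d n r \<noteq> 0}" by (rule finite_subset)
qed

lemma has_sum_times:
  fixes f g :: "'a => complex"
  assumes "(f has_sum a) A" "(g has_sum b) B"
  shows "((\<lambda>(x, y). f x * g y) has_sum a * b) (A \<times> B)"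
proof (rule has_sum_SigmaI)
  show "((\<lambda>y. case (x, y) of (x, y) => f x * g y) has_sum f x * b) B" for x using has_sum_cmult_right[OF assms(2)] by simp
  show "((\<lambda>x. f x * b) has_sum a * b) A" using has_sum_cmult_left[OF assms(1)] by simp
  have "(\<lambda>x. norm (case x of (x, y) => f x * g y)) summable_on (A \<times> B)"
  proof (rule summable_on_SigmaI)
    fix x
    show "((\<lambda>y. norm (case (x, y) of (x, y) => f x * g y)) has_sum norm (f x) * (\<Sum>\<^sub>\<infinity>y\<in>B. norm (g y))) B" unfolding prod.case norm_mult
      by (intro has_sum_cmult_right has_sum_infsum abs_summable_has_sum_complex[OF assms(2)])
  qed (auto intro!: summable_on_cmult_left abs_summable_has_sum_complex[OF assms(1)])
  thus "(\<lambda>(x, y). f x * g y) summable_on A \<times> B" by (rule abs_summable_summable)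
qed

text \<open>By absolute convergence the product is a sum over pairs of indices, regrouped by total
  exponents; each group is finite by \<open>fourier_nice\<close>.\<close>

lemma expands_mult:
  assumes "expands F c" "expands G d" "fourier_nice c" "fourier_nice d"
  shows "expands (\<lambda>t z. F t z * G t z) (conv c d)"
proof (rule expandsI)
  fix t z :: complex assume t: "Im t > 0"
  have "((\<lambda>(x, y). fterm c t z x * fterm d t z y) has_sum F t z * G t z) (UNIV \<times> UNIV)" by (rule has_sum_times[OF expandsD[OF assms(1) t] expandsD[OF assms(2) t]])
  also have "?this \<longleftrightarrow> ((\<lambda>((n, r), (k, s)). fterm c t z (k, s) * fterm d t z (n - k, r - s)) has_sum F t z * G t z) (UNIV \<times> UNIV)"
    by (rule has_sum_reindex_bij_witness[where j = "\<lambda>((k, s), (l, t)). ((k + l, s + t), (k, s))" and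
          i = "\<lambda>((n, r), (k, s)). ((k, s), (n - k, r - s))"]) auto
  finally have "((\<lambda>((n, r), (k, s)). fterm c t z (k, s) * fterm d t z (n - k, r - s)) has_sum F t z * G t z) (UNIV \<times> UNIV)" .
  moreover define h where "h = (\<lambda>((n, r), (k, s)). fterm c t z (k, s) * fterm d t z (n - k, r - s))"
  ultimately have H: "(h has_sum F t z * G t z) (UNIV \<times> UNIV)" by simp
  show "(fterm (conv c d) t z has_sum F t z * G t z) UNIV"
  proof (rule has_sum_SigmaD[OF H])
    fix x :: "int \<times> int"
    obtain n r where x: "x = (n, r)" by force
    let ?S = "{(k, s). 0 \<le> k \<and> k \<le> n \<and> c k s \<noteq> 0}"
    let ?e = "e2pi (of_int n * t + of_int r * z)"
    have "((\<lambda>(k, s). c k s * d (n - k) (r - s) * ?e) has_sum (\<Sum>(k, s)\<in>?S. c k s * d (n - k) (r - s) * ?e)) UNIV"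
    proof (rule has_sum_finite_neutralI[OF fourier_nice_finite[OF assms(3)]])
      fix y assume "y \<in> UNIV - ?S"
      then obtain k s where y: "y = (k, s)" "(k, s) \<notin> ?S" by (cases y) auto
      have "c k s = 0 \<or> d (n - k) (r - s) = 0"
      proof (rule ccontr)
        assume a: "\<not> ?thesis"
        hence "0 \<le> k" "0 \<le> n - k" using assms(3,4) unfolding fourier_nice_def by blast+
        with a y(2) show False by auto
      qed
      thus "(case y of (k, s) => c k s * d (n - k) (r - s) * ?e) = 0" using y by auto
    qed (auto)
    moreover have "(\<lambda>y. h (x, y)) = (\<lambda>(k, s). c k s * d (n - k) (r - s) * ?e)"
    proof
      fix y :: "int \<times> int"
      obtain k s where y: "y = (k, s)" by force
      have "e2pi (of_int k * t + of_int s * z) * e2pi (of_int (n - k) * t + of_int (r - s) * z) = ?e" unfolding e2pi_add[symmetric] by (rule arg_cong[where f = e2pi]) (simp add: algebra_simps)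
      thus "h (x, y) = (case y of (k, s) => c k s * d (n - k) (r - s) * ?e)" by (simp add: h_def x y mult_ac)
    qed
    moreover have "fterm (conv c d) t z x = (\<Sum>(k, s)\<in>?S. c k s * d (n - k) (r - s) * ?e)" by (simp add: x conv_def sum_distrib_right case_prod_unfold)
    ultimately show "((\<lambda>y. h (x, y)) has_sum fterm (conv c d) t z x) UNIV" by simp
  qed
qed

lemma expands_T: "expands F c ==> Im t > 0 ==> F (t + 1) z = F t z"
proof -
  assume a: "expands F c" "Im t > 0"
  have "fterm c (t + 1) z = fterm c t z" by (auto simp: fun_eq_iff ring_distribs e2pi_add)
  thus ?thesis using expandsD[OF a(1), of "t + 1" z] expandsD[OF a, of z] a(2) has_sum_unique by fastforce
qed

lemma expands_z1: "expands F c ==> Im t > 0 ==> F t (z + 1) = F t z"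
proof -
  assume a: "expands F c" "Im t > 0"
  have "fterm c t (z + 1) = fterm c t z" by (auto simp: fun_eq_iff ring_distribs e2pi_add)
  thus ?thesis using expandsD[OF a, of "z + 1"] expandsD[OF a, of z] has_sum_unique by fastforce
qed

definition int_expansion :: "(complex => complex => complex) => bool" where
  "int_expansion F \<longleftrightarrow> (\<exists>c. expands F c \<and> fourier_nice c \<and> (\<forall>n r. c n r \<in> \<int>))"

lemma int_expansion_cong: "(\<And>t z. Im t > 0 ==> F t z = G t z) ==> int_expansion F ==> int_expansion G" unfolding int_expansion_def using expands_cong by blast

lemma int_expansion_mult: "int_expansion F ==> int_expansion G ==> int_expansion (\<lambda>t z. F t z * G t z)"
proof -
  assume "int_expansion F" "int_expansion G"
  then obtain c d where "expands F c" "fourier_nice c" "\<And>n r. c n r \<in> \<int>" "expands G d" "fourier_nice d" "\<And>n r. d n r \<in> \<int>" unfolding int_expansion_def by blast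
  thus ?thesis unfolding int_expansion_def by (intro exI[of _ "conv c d"] conjI expands_mult fourier_nice_conv allI)
       (auto simp: conv_def intro!: Ints_sum)
qed

lemma int_expansion_add: "int_expansion F ==> int_expansion G ==> int_expansion (\<lambda>t z. F t z + G t z)"
proof -
  assume "int_expansion F" "int_expansion G"
  then obtain c d where h: "expands F c" "fourier_nice c" "\<And>n r. c n r \<in> \<int>" "expands G d" "fourier_nice d" "\<And>n r. d n r \<in> \<int>" unfolding int_expansion_def by blast
  have "fourier_nice (\<lambda>n r. c n r + d n r)" unfolding fourier_nice_def
  proof (intro conjI allI impI)
    fix n r assume "c n r + d n r \<noteq> 0"
    hence "c n r \<noteq> 0 \<or> d n r \<noteq> 0" by auto
    thus "0 \<le> n" using h(2,5) by (auto simp: fourier_nice_def)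
  next
    fix n
    have "finite ({r. c n r \<noteq> 0} \<union> {r. d n r \<noteq> 0})" using h(2,5) by (auto simp: fourier_nice_def)
    thus "finite {r. c n r + d n r \<noteq> 0}" by (rule finite_subset[rotated]) auto
  qed
  thus ?thesis unfolding int_expansion_def using h by (intro exI[of _ "\<lambda>n r. c n r + d n r"] conjI expands_add) auto
qed

lemma int_expansion_const: "a \<in> \<int> ==> int_expansion (\<lambda>t z. a)"
proof -
  assume a: "a \<in> \<int>"
  define c where "c = (\<lambda>(n::int) (r::int). if n = 0 \<and> r = 0 then a else (0::complex))"
  have "expands (\<lambda>t z. a) c"
  proof (rule expandsI)
    fix t z :: complex
    show "(fterm c t z has_sum a) UNIV" by (rule has_sum_finite_neutralI[of "{(0,0)}"]) (auto simp: c_def split: if_splits)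
  qed
  moreover have "finite {r. c n r \<noteq> 0}" for n by (rule finite_subset[of _ "{0}"]) (auto simp: c_def split: if_splits)
  hence "fourier_nice c"  unfolding fourier_nice_def by (auto simp: c_def split: if_splits)
  moreover have "c n r \<in> \<int>" for n r using a by (simp add: c_def)
  ultimately show ?thesis unfolding int_expansion_def by blast
qed

lemma int_expansion_power:
  assumes "int_expansion F"
  shows "int_expansion (\<lambda>t z. F t z ^ k)"
proof (induction k)
  case 0
  show ?case unfolding power_0 by (rule int_expansion_const) simp
next
  case (Suc k)
  show ?case unfolding power_Suc by (rule int_expansion_mult[OF assms Suc])
qed

section \<open>Jacobi forms of weight one and Hecke operators\<close>

lemma Im_inverse_neg [simp]: "Im t > 0 ==> Im (1 / t) < 0" using Im_minus_inverse_pos[of t] by simp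

lemma has_sum_sum:
  fixes f :: "'a => 'b => complex"
  shows "finite A ==> (\<And>a. a \<in> A ==> (f a has_sum s a) B) ==> ((\<lambda>x. \<Sum>a\<in>A. f a x) has_sum (\<Sum>a\<in>A. s a)) B"
  by (induction A rule: finite_induct) (auto intro: has_sum_add)

text \<open>Weight one and index m, stated on generators: the translations t + 1 and z + 1 are
  contained in \<open>expands\<close>, and the general laws are derived below. The array c is part
  of the relation because most arguments act on it; conditions on its support are added where they
  are used.\<close>

definition jac :: "nat => (complex => complex => complex) => (int => int => complex) => bool" where
  "jac m F c \<longleftrightarrow> expands F c \<and>
     (\<forall>t z. Im t > 0 --> e2pi (of_nat m * (t + 2 * z)) * F t (z + t) = F t z) \<and>
     (\<forall>t z. Im t > 0 --> F (- 1 / t) (z / t) = t * e2pi (of_nat m * z\<^sup>2 / t) * F t z)"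

lemma jac_expands: "jac m F c ==> expands F c" by (simp add: jac_def)

lemma jac_elliptic: "jac m F c ==> Im t > 0 ==> e2pi (of_nat m * (t + 2 * z)) * F t (z + t) = F t z" by (simp add: jac_def)

lemma jac_S: "jac m F c ==> Im t > 0 ==> F (- 1 / t) (z / t) = t * e2pi (of_nat m * z\<^sup>2 / t) * F t z" by (simp add: jac_def)

lemma jac_add: "jac m F c ==> jac m G d ==> jac m (\<lambda>t z. F t z + G t z) (\<lambda>n r. c n r + d n r)" unfolding jac_def by (auto simp: expands_add distrib_left)

lemma jac_cmult: "jac m F c ==> jac m (\<lambda>t z. a * F t z) (\<lambda>n r. a * c n r)" unfolding jac_def by (auto simp: expands_cmult)

lemma jac_diff: "jac m F c ==> jac m G d ==> jac m (\<lambda>t z. F t z - G t z) (\<lambda>n r. c n r - d n r)"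
  using jac_add[of m F c "\<lambda>t z. -1 * G t z" "\<lambda>n r. -1 * d n r"] jac_cmult[of m G d "-1"] by simp

lemma expands_shift:
  assumes "expands F c"
  shows "expands (\<lambda>t z. e2pi (of_nat m * (t + 2 * z)) * F t (z + t)) (\<lambda>n r. c (n - r + int m) (r - 2 * int m))"
proof (rule expandsI)
  fix t z :: complex assume t: "Im t > 0"
  have "((\<lambda>x. e2pi (of_nat m * (t + 2 * z)) * fterm c t (z + t) x) has_sum e2pi (of_nat m * (t + 2 * z)) * F t (z + t)) UNIV" by (intro has_sum_cmult_right expandsD[OF assms t])
  also have "?this \<longleftrightarrow> (fterm (\<lambda>n r. c (n - r + int m) (r - 2 * int m)) t z has_sum e2pi (of_nat m * (t + 2 * z)) * F t (z + t)) UNIV"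
  proof (rule has_sum_reindex_bij_witness[where j = "\<lambda>(n, r). (n + r + int m, r + 2 * int m)" and
        i = "\<lambda>(n, r). (n - r + int m, r - 2 * int m)"])
    fix a :: "int \<times> int"
    obtain n r where a: "a = (n, r)" by force
    have "e2pi (of_nat m * (t + 2 * z)) * e2pi (of_int n * t + of_int r * (z + t))
        = e2pi (of_int (n + r + int m) * t + of_int (r + 2 * int m) * z)" unfolding e2pi_add[symmetric] by (rule arg_cong[where f = e2pi]) (simp add: algebra_simps)
    thus "fterm (\<lambda>n r. c (n - r + int m) (r - 2 * int m)) t z (case a of (n, r) => (n + r + int m, r + 2 * int m))
        = e2pi (of_nat m * (t + 2 * z)) * fterm c t (z + t) a" by (simp add: a)
  qed auto
  finally show "(fterm (\<lambda>n r. c (n - r + int m) (r - 2 * int m)) t z has_sum e2pi (of_nat m * (t + 2 * z)) * F t (z + t)) UNIV" .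
qed

lemma elliptic_coeff_iterate:
  fixes c :: "int => int => 'a"
  assumes "\<And>n r. c (n + r + m) (r + 2 * m) = c n r"
  shows "c (n + l * r + m * l\<^sup>2) (r + 2 * m * l) = c n r"
proof -
  have nat: "c (n + int k * r + m * (int k)\<^sup>2) (r + 2 * m * int k) = c n r" for n r k
  proof (induction k)
    case (Suc k)
    have "c (n + int (Suc k) * r + m * (int (Suc k))\<^sup>2) (r + 2 * m * int (Suc k))
        = c ((n + int k * r + m * (int k)\<^sup>2) + (r + 2 * m * int k) + m) ((r + 2 * m * int k) + 2 * m)" by (rule arg_cong2[where f = c]) (auto simp: algebra_simps power2_eq_square)
    also have "\<dots> = c n r" by (simp only: assms Suc)
    finally show ?case .
  qed simp
  show ?thesis
  proof (cases "l \<ge> 0")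
    case True
    thus ?thesis using nat[of n "nat l" r] by simp
  next
    case False
    define k where "k = nat (- l)"
    have l: "l = - int k" using False by (simp add: k_def)
    have "c (n + l * r + m * l\<^sup>2) (r + 2 * m * l)
       = c ((n + l * r + m * l\<^sup>2) + int k * (r + 2 * m * l) + m * (int k)\<^sup>2) ((r + 2 * m * l) + 2 * m * int k)" by (rule nat[symmetric])
    also have "\<dots> = c n r" by (rule arg_cong2[where f = c]) (auto simp: l algebra_simps power2_eq_square)
    finally show ?thesis .
  qed
qed

text \<open>Uniqueness of coefficients turns the shift z + t into a symmetry of c. The orbits are
  described by r mod 2m together with r^2 - 4mn.\<close>

lemma jac_coeff:
  assumes "jac m F c"
  shows "c (n + l * r + int m * l\<^sup>2) (r + 2 * int m * l) = c n r"
proof (rule elliptic_coeff_iterate)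
  fix n r
  have "(\<lambda>n r. c (n - r + int m) (r - 2 * int m)) = c" by (rule expands_coeff_unique[OF expands_shift[OF jac_expands[OF assms]] jac_expands[OF assms]])
       (rule jac_elliptic[OF assms])
  from fun_cong[OF fun_cong[OF this], of "n + r + int m" "r + 2 * int m"]
  show "c (n + r + int m) (r + 2 * int m) = c n r" by simp
qed

lemma jac_elliptic_int:
  assumes "jac m F c" "Im t > 0"
  shows "e2pi (of_nat m * ((of_int l)\<^sup>2 * t + 2 * of_int l * z)) * F t (z + of_int l * t) = F t z"
proof -
  have nat: "e2pi (of_nat m * ((of_nat k)\<^sup>2 * t + 2 * of_nat k * z)) * F t (z + of_nat k * t) = F t z" for k z
  proof (induction k)
    case (Suc k)
    have "F t z = e2pi (of_nat m * ((of_nat k)\<^sup>2 * t + 2 * of_nat k * z)) * F t (z + of_nat k * t)" using Suc by simp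
    also have "F t (z + of_nat k * t) = e2pi (of_nat m * (t + 2 * (z + of_nat k * t))) * F t (z + of_nat k * t + t)" by (rule jac_elliptic[OF assms, symmetric])
    also have "e2pi (of_nat m * ((of_nat k)\<^sup>2 * t + 2 * of_nat k * z)) * (e2pi (of_nat m * (t + 2 * (z + of_nat k * t))) * F t (z + of_nat k * t + t))
      = e2pi (of_nat m * ((of_nat (Suc k))\<^sup>2 * t + 2 * of_nat (Suc k) * z)) * F t (z + of_nat (Suc k) * t)" unfolding mult.assoc[symmetric] e2pi_add[symmetric]
      by (rule arg_cong2[where f = "\<lambda>a b. e2pi a * F t b"]) (simp_all add: algebra_simps power2_eq_square)
    finally show ?case by simp
  qed simp
  show ?thesis
  proof (cases "l \<ge> 0")
    case True
    thus ?thesis using nat[of "nat l" z] by simp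
  next
    case False
    define k where "k = nat (- l)"
    have l: "l = - int k" using False by (simp add: k_def)
    have "F t (z + of_int l * t) = e2pi (of_nat m * ((of_nat k)\<^sup>2 * t + 2 * of_nat k * (z + of_int l * t))) * F t (z + of_int l * t + of_nat k * t)" using nat by simp
    also have "F t (z + of_int l * t + of_nat k * t) = F t z" by (simp add: l)
    finally have "e2pi (of_nat m * ((of_int l)\<^sup>2 * t + 2 * of_int l * z)) * F t (z + of_int l * t)
      = e2pi (of_nat m * ((of_int l)\<^sup>2 * t + 2 * of_int l * z) + of_nat m * ((of_nat k)\<^sup>2 * t + 2 * of_nat k * (z + of_int l * t))) * F t z" by (simp add: e2pi_add)
    also have "of_nat m * ((of_int l)\<^sup>2 * t + 2 * of_int l * z) + of_nat m * ((of_nat k)\<^sup>2 * t + 2 * of_nat k * (z + of_int l * t)) = 0" by (simp add: l algebra_simps power2_eq_square)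
    finally show ?thesis by simp
  qed
qed

lemma jac_z_int: "jac m F c ==> Im t > 0 ==> F t (z + of_int \<mu>) = F t z"
proof -
  assume a: "jac m F c" "Im t > 0"
  have "fterm c t (z + of_int \<mu>) = fterm c t z" by (auto simp: fun_eq_iff ring_distribs e2pi_add simp flip: of_int_mult)
  thus ?thesis using expandsD[OF jac_expands[OF a(1)] a(2), of "z + of_int \<mu>"] expandsD[OF jac_expands[OF a(1)] a(2), of z] has_sum_unique by fastforce
qed

lemma jac_tau_int: "jac m F c ==> Im t > 0 ==> F (t + of_int \<mu>) z = F t z"
proof -
  assume a: "jac m F c" "Im t > 0"
  have "fterm c (t + of_int \<mu>) z = fterm c t z" by (auto simp: fun_eq_iff ring_distribs e2pi_add simp flip: of_int_mult)
  thus ?thesis using expandsD[OF jac_expands[OF a(1)], of "t + of_int \<mu>" z] expandsD[OF jac_expands[OF a(1)] a(2), of z] a(2) has_sum_unique by fastforce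
qed

text \<open>Applying the inversion twice returns to t but sends z to -z; weight one leaves the
  factor t (-1/t) = -1.\<close>

lemma jac_odd:
  assumes "jac m F c" "Im t > 0"
  shows "F t (- z) = - F t z"
proof -
  have t: "t \<noteq> 0" using assms(2) by auto
  have "F (- 1 / (- 1 / t)) ((z / t) / (- 1 / t)) = (- 1 / t) * e2pi (of_nat m * (z / t)\<^sup>2 / (- 1 / t)) * F (- 1 / t) (z / t)" by (rule jac_S[OF assms(1)]) (use assms(2) in simp)
  also have "F (- 1 / t) (z / t) = t * e2pi (of_nat m * z\<^sup>2 / t) * F t z" by (rule jac_S[OF assms])
  also have "of_nat m * (z / t)\<^sup>2 / (- 1 / t) = - (of_nat m * z\<^sup>2 / t)" using t by (simp add: field_simps power2_eq_square)
  finally show ?thesis using t by (simp add: e2pi_minus)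
qed

text \<open>Euclid's algorithm on the lower row writes a unimodular matrix in terms of the generators.\<close>

lemma jac_modular:
  assumes "jac m F e"
  shows "a * d - b * c = 1 ==> Im t > 0 ==>
    F ((of_int a * t + of_int b) / (of_int c * t + of_int d)) (z / (of_int c * t + of_int d))
      = (of_int c * t + of_int d) * e2pi (of_nat m * of_int c * z\<^sup>2 / (of_int c * t + of_int d)) * F t z"
proof (induction "nat \<bar>c\<bar>" arbitrary: a b c d t z rule: less_induct)
  case less
  show ?case
  proof (cases "c = 0")
    case True
    hence "a * d = 1" using less by simp
    then consider "a = 1" "d = 1" | "a = -1" "d = -1" using zmult_eq_1_iff by auto
    thus ?thesis
    proof cases
      case 1
      thus ?thesis using True jac_tau_int[OF assms less(3)] by simp
    next
      case 2
      have "F (t + of_int (- b)) (- z) = - F t z" using jac_tau_int[OF assms less(3), of "- b" "- z"] jac_odd[OF assms less(3)] by simp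
      thus ?thesis using True 2 by simp
    qed
  next
    case False
    define q r where "q = d div c" and "r = d mod c"
    have d: "d = q * c + r" by (simp add: q_def r_def)
    define u where "u = t + of_int q"
    have u: "Im u > 0" using less(3) by (simp add: u_def)
    hence u: "Im u > 0" "u \<noteq> 0" by auto
    define w where "w = of_int c * t + of_int d"
    have "Im w = of_int c * Im t" by (simp add: w_def)
    hence "Im w \<noteq> 0" using False less(3) by simp
    hence w: "w \<noteq> 0" by auto
    have w': "of_int (- r) * (- 1 / u) + of_int c = w / u" using u by (simp add: w_def d u_def field_simps)
    \<comment> \<open>The matrix (aq - b, a; -r, c) acting on -1/u gives (at + b)/(ct + d). Its
      lower left entry is the remainder r = d mod c up to sign, so the induction hypothesis
      applies.\<close>
    have "F ((of_int (a * q - b) * (- 1 / u) + of_int a) / (of_int (- r) * (- 1 / u) + of_int c)) ((z / u) / (of_int (- r) * (- 1 / u) + of_int c))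
      = (of_int (- r) * (- 1 / u) + of_int c) * e2pi (of_nat m * of_int (- r) * (z / u)\<^sup>2 / (of_int (- r) * (- 1 / u) + of_int c)) * F (- 1 / u) (z / u)"
    proof (rule less(1))
      show "nat \<bar>- r\<bar> < nat \<bar>c\<bar>" using False abs_mod_less[of c d] by (simp add: r_def)
      show "(a * q - b) * c - a * - r = 1" using less(2) by (simp add: d algebra_simps)
      show "Im (- 1 / u) > 0" using u by simp
    qed
    also have "(of_int (a * q - b) * (- 1 / u) + of_int a) / (of_int (- r) * (- 1 / u) + of_int c) = (of_int a * t + of_int b) / w"
    proof -
      have "of_int (a * q - b) * (- 1 / u) + of_int a = (of_int a * t + of_int b) / u" using u(2) by (simp add: divide_simps) (simp add: u_def algebra_simps)
      thus ?thesis unfolding w' using u w by simp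
    qed
    also have "(z / u) / (of_int (- r) * (- 1 / u) + of_int c) = z / w" unfolding w' using u w by simp
    also have "F (- 1 / u) (z / u) = u * e2pi (of_nat m * z\<^sup>2 / u) * F t z" using jac_S[OF assms u(1)] jac_tau_int[OF assms less(3)] by (simp add: u_def)
    also have "(of_int (- r) * (- 1 / u) + of_int c) * e2pi (of_nat m * of_int (- r) * (z / u)\<^sup>2 / (of_int (- r) * (- 1 / u) + of_int c)) * (u * e2pi (of_nat m * z\<^sup>2 / u) * F t z)
      = w * e2pi (of_nat m * of_int (- r) * (z / u)\<^sup>2 / (w / u) + of_nat m * z\<^sup>2 / u) * F t z" unfolding w' using u by (subst e2pi_add) simp
    also have "of_nat m * of_int (- r) * (z / u)\<^sup>2 / (w / u) + of_nat m * z\<^sup>2 / u = of_nat m * of_int c * z\<^sup>2 / w"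
    proof -
      have wr: "w - of_int r = of_int c * u" by (simp add: w_def d u_def algebra_simps)
      have "of_nat m * of_int (- r) * (z / u)\<^sup>2 / (w / u) + of_nat m * z\<^sup>2 / u = of_nat m * z\<^sup>2 * (w - of_int r) / (u * w)" using u w by (simp add: field_simps power2_eq_square)
      also have "\<dots> = of_nat m * of_int c * z\<^sup>2 / w" unfolding wr using u w by simp
      finally show ?thesis .
    qed
    finally show ?thesis by (simp add: w_def)
  qed
qed

lemma sum_roots_of_unity:
  assumes "p > 0"
  shows "(\<Sum>b<p. e2pi (of_int n * of_nat b / of_nat p)) = (if int p dvd n then of_nat p else 0)"
proof (cases "int p dvd n")
  case True
  then obtain k where k: "n = int p * k" by auto
  have "e2pi (of_int n * of_nat b / of_nat p) = 1" for b
  proof -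
    have "of_int n * of_nat b / of_nat p = (of_int (k * int b) :: complex)" using assms by (simp add: k)
    thus ?thesis by (simp only: e2pi_of_int)
  qed
  thus ?thesis using True by simp
next
  case False
  define w where "w = e2pi (of_int n / of_nat p)"
  have "w \<noteq> 1"
  proof
    assume "w = 1"
    then obtain k :: int where "of_int n / of_nat p = (of_int k :: complex)" unfolding w_def e2pi_eq_1_iff by blast
    hence "of_int n = (of_int (k * int p) :: complex)" using assms by (simp add: field_simps)
    hence "n = k * int p" by (simp only: of_int_eq_iff)
    thus False using False by simp
  qed
  moreover have "w ^ p = 1" using assms by (simp add: w_def e2pi_pow)
  ultimately have "(\<Sum>b<p. w ^ b) = 0" using geometric_sum[of w p] by simp
  thus ?thesis using False by (simp add: w_def e2pi_pow mult_ac)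
qed

section \<open>The operator V_p, raising the index by a prime\<close>

definition V_fun :: "nat => (complex => complex => complex) => complex => complex => complex" where
  "V_fun p F t z = F (of_nat p * t) (of_nat p * z) + (\<Sum>b<p. F ((t + of_nat b) / of_nat p) z) / of_nat p"

text \<open>In weight one the divisor weights a^(k-1) of the Eichler-Zagier operator V_p are all 1.
  The operator is polymorphic because it acts on complex, rational and integer arrays.\<close>

definition V_coeff :: "nat => (int => int => 'a::comm_ring_1) => int => int => 'a" where
  "V_coeff p c n r = (if int p dvd n \<and> int p dvd r then c (n div int p) (r div int p) else 0) + c (int p * n) r"

lemma expands_V:
  assumes "expands F c" "p > 0"
  shows "expands (V_fun p F) (V_coeff p c)"
proof -
  have 1: "expands (\<lambda>t z. F (of_nat p * t) (of_nat p * z)) (\<lambda>n r. if int p dvd n \<and> int p dvd r then c (n div int p) (r div int p) else 0)"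
  proof (rule expandsI)
    fix t z :: complex assume t: "Im t > 0"
    let ?d = "\<lambda>n r. if int p dvd n \<and> int p dvd r then c (n div int p) (r div int p) else 0"
    have "(fterm c (of_nat p * t) (of_nat p * z) has_sum F (of_nat p * t) (of_nat p * z)) UNIV" by (rule expandsD[OF assms(1)]) (use t assms(2) in simp)
    also have "?this \<longleftrightarrow> (fterm ?d t z has_sum F (of_nat p * t) (of_nat p * z)) {(n, r). int p dvd n \<and> int p dvd r}"
      by (rule has_sum_reindex_bij_witness[where j = "\<lambda>(n, r). (int p * n, int p * r)" and i = "\<lambda>(n, r). (n div int p, r div int p)"])
         (use assms(2) in \<open>auto simp: algebra_simps\<close>)
    also have "\<dots> \<longleftrightarrow> (fterm ?d t z has_sum F (of_nat p * t) (of_nat p * z)) UNIV" by (rule has_sum_cong_neutral) (auto split: if_splits)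
    finally show "(fterm ?d t z has_sum F (of_nat p * t) (of_nat p * z)) UNIV" .
  qed
  have 2: "expands (\<lambda>t z. (\<Sum>b<p. F ((t + of_nat b) / of_nat p) z) / of_nat p) (\<lambda>n r. c (int p * n) r)"
  proof (rule expandsI)
    fix t z :: complex assume t: "Im t > 0"
    let ?S = "(\<Sum>b<p. F ((t + of_nat b) / of_nat p) z) / of_nat p"
    have "((\<lambda>x. (\<Sum>b<p. fterm c ((t + of_nat b) / of_nat p) z x) / of_nat p) has_sum ?S) UNIV"
      by (intro has_sum_divide_const has_sum_sum expandsD[OF assms(1)]) (use t assms(2) in \<open>auto simp: Im_divide_of_nat\<close>)
    moreover have "(\<Sum>b<p. fterm c ((t + of_nat b) / of_nat p) z (n, r)) / of_nat p
        = (if int p dvd n then c n r * e2pi (of_int n * t / of_nat p + of_int r * z) else 0)" for n r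
    proof -
      have "(\<Sum>b<p. fterm c ((t + of_nat b) / of_nat p) z (n, r))
        = (\<Sum>b<p. c n r * e2pi (of_int n * t / of_nat p + of_int r * z) * e2pi (of_int n * of_nat b / of_nat p))"
        by (intro sum.cong refl) (simp add: mult.assoc e2pi_add[symmetric] add_divide_distrib distrib_left add_ac)
      also have "\<dots> = c n r * e2pi (of_int n * t / of_nat p + of_int r * z) * (if int p dvd n then of_nat p else 0)" by (simp only: sum_distrib_left[symmetric] sum_roots_of_unity[OF assms(2)])
      finally show ?thesis using assms(2) by simp
    qed
    ultimately have "((\<lambda>(n, r). if int p dvd n then c n r * e2pi (of_int n * t / of_nat p + of_int r * z) else 0) has_sum ?S) UNIV" by (simp add: case_prod_unfold)
    also have "?this \<longleftrightarrow> ((\<lambda>(n, r). c n r * e2pi (of_int n * t / of_nat p + of_int r * z)) has_sum ?S) {(n, r). int p dvd n}" by (rule has_sum_cong_neutral) auto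
    also have "\<dots> \<longleftrightarrow> (fterm (\<lambda>n r. c (int p * n) r) t z has_sum ?S) UNIV"
      by (rule has_sum_reindex_bij_witness[where i = "\<lambda>(n, r). (int p * n, r)" and j = "\<lambda>(n, r). (n div int p, r)"])
         (use assms(2) in auto)
    finally show "(fterm (\<lambda>n r. c (int p * n) r) t z has_sum ?S) UNIV" .
  qed
  show ?thesis using expands_add[OF 1 2] unfolding V_fun_def V_coeff_def .
qed

text \<open>This is how the inversion permutes the matrices (1 b; 0 p) with b prime to p: b goes to
  the b' with b b' = -1 mod p.\<close>

lemma neg_inverse_mod_bij:
  assumes "prime (p::nat)"
  shows "\<exists>g. bij_betw g {1..<p} {1..<p} \<and> (\<forall>b\<in>{1..<p}. int p dvd 1 + int b * int (g b))"
proof -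
  have "\<exists>b'\<in>{1..<p}. int p dvd 1 + int b * int b'" if b: "b \<in> {1..<p}" for b
  proof -
    have "\<not> p dvd b" using b nat_dvd_not_less by auto
    hence "coprime p b" using assms prime_imp_coprime by blast
    hence "coprime (int b) (int p)" by (simp add: coprime_commute)
    then obtain x where x: "[int b * x = 1] (mod int p)" using cong_solve_coprime_int by blast
    define b' where "b' = nat ((- x) mod int p)"
    have p: "int p > 0" using assms prime_gt_0_nat by simp
    have ib': "int b' = (- x) mod int p" using p by (simp add: b'_def)
    have "[1 + int b * int b' = 1 + int b * (- x)] (mod int p)" unfolding ib' by (intro cong_add cong_mult) (auto simp: cong_def)
    also have "[1 + int b * (- x) = 0] (mod int p)" using x by (simp add: cong_iff_dvd_diff dvd_diff_commute)
    finally have d: "int p dvd 1 + int b * int b'" by (simp add: cong_0_iff)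
    have "b' \<noteq> 0"
    proof
      assume "b' = 0"
      hence "p = 1" using d by simp
      thus False using assms not_prime_1 by blast
    qed
    moreover have "int b' < int p" unfolding ib' by (rule pos_mod_bound[OF p])
    ultimately show ?thesis using d by (intro bexI[of _ b']) auto
  qed
  hence "\<forall>b\<in>{1..<p}. \<exists>b'. b' \<in> {1..<p} \<and> int p dvd 1 + int b * int b'" by blast
  from bchoice[OF this] obtain g where g: "\<And>b. b \<in> {1..<p} ==> g b \<in> {1..<p} \<and> int p dvd 1 + int b * int (g b)" by blast
  have "inj_on g {1..<p}"
  proof (rule inj_onI)
    fix x y assume xy: "x \<in> {1..<p}" "y \<in> {1..<p}" "g x = g y"
    have "int p dvd (1 + int x * int (g x)) - (1 + int y * int (g y))" using conjunct2[OF g[OF xy(1)]] conjunct2[OF g[OF xy(2)]] by (rule dvd_diff)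
    hence "int p dvd (int x - int y) * int (g x)" unfolding xy(3) by (simp add: algebra_simps)
    hence "int p dvd (int x - int y) \<or> int p dvd int (g x)" using assms by (simp add: prime_dvd_mult_iff)
    moreover have "\<not> int p dvd int (g x)" using conjunct1[OF g[OF xy(1)]] nat_dvd_not_less by auto
    ultimately have "int p dvd (int x - int y)" by simp
    hence "int x - int y = 0" using xy zdvd_not_zless[of "int x - int y" "int p"] zdvd_not_zless[of "int y - int x" "int p"]
      by (cases "int x - int y" "0 :: int" rule: linorder_cases) (auto simp: dvd_diff_commute)
    thus "x = y" by simp
  qed
  moreover have "g ` {1..<p} \<subseteq> {1..<p}" using conjunct1[OF g] by blast
  ultimately have bij: "bij_betw g {1..<p} {1..<p}" unfolding bij_betw_def by (intro conjI endo_inj_surj) simp_all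
  show ?thesis by (intro exI[of _ g] conjI ballI bij conjunct2[OF g])
qed

text \<open>The inversion permutes the p + 1 terms: the dilation and the term b = 0 are exchanged
  (\<open>A\<close> and \<open>B\<close>), the terms with b nonzero are permuted by g
  (\<open>C\<close>).\<close>

lemma jac_V:
  assumes J: "jac m F c" and p: "prime p"
  shows "jac (m * p) (V_fun p F) (V_coeff p c)" unfolding jac_def
proof (intro conjI allI impI)
  have p0: "p > 0" using p prime_gt_0_nat by blast
  show "expands (V_fun p F) (V_coeff p c)" by (rule expands_V[OF jac_expands[OF J] p0])
  fix t z :: complex assume t: "Im t > 0"
  have t0: "t \<noteq> 0" using t by auto
  let ?p = "of_nat p :: complex"
  have p1: "?p \<noteq> 0" using p0 by simp
  have Ip: "Im ((t + of_nat b) / ?p) > 0" for b using t p0 by (simp add: Im_divide_of_nat)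
  have Ip': "Im (?p * t) > 0" using t p0 by simp
  let ?E = "e2pi (of_nat (m * p) * (t + 2 * z))"
  have 1: "?E * F (?p * t) (?p * (z + t)) = F (?p * t) (?p * z)" using jac_elliptic[OF J Ip', of "?p * z"] by (simp add: algebra_simps)
  have 2: "?E * F ((t + of_nat b) / ?p) (z + t) = F ((t + of_nat b) / ?p) z" for b
  proof -
    let ?t = "(t + of_nat b) / ?p"
    have "F ?t z = e2pi (of_nat m * ((of_int (int p))\<^sup>2 * ?t + 2 * of_int (int p) * z)) * F ?t (z + of_int (int p) * ?t)" by (rule jac_elliptic_int[OF J Ip, symmetric])
    also have "of_nat m * ((of_int (int p))\<^sup>2 * ?t + 2 * of_int (int p) * z) = of_nat (m * p) * (t + 2 * z) + of_nat (m * p * b)" using p1 by (simp add: power2_eq_square field_simps)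
    also have "z + of_int (int p) * ?t = (z + t) + of_int (int b)" using p1 by simp
    also have "F ?t ((z + t) + of_int (int b)) = F ?t (z + t)" by (rule jac_z_int[OF J Ip])
    also have "e2pi (of_nat (m * p) * (t + 2 * z) + of_nat (m * p * b)) = ?E" by (simp only: e2pi_add e2pi_of_nat mult_1_right)
    finally show ?thesis by simp
  qed
  have "?E * V_fun p F t (z + t) = ?E * F (?p * t) (?p * (z + t)) + (\<Sum>b<p. ?E * F ((t + of_nat b) / ?p) (z + t)) / ?p" by (simp add: V_fun_def distrib_left sum_distrib_left)
  also have "\<dots> = V_fun p F t z" by (simp only: 1 2 V_fun_def)
  finally show "?E * V_fun p F t (z + t) = V_fun p F t z" .
  let ?D = "e2pi (of_nat (m * p) * z\<^sup>2 / t)"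
  obtain g where g: "bij_betw g {1..<p} {1..<p}" "\<And>b. b \<in> {1..<p} ==> int p dvd 1 + int b * int (g b)" using neg_inverse_mod_bij[OF p] by blast
  have A: "F (?p * (- 1 / t)) (?p * (z / t)) = t / ?p * ?D * F (t / ?p) z"
  proof -
    have "F (- 1 / (t / ?p)) (z / (t / ?p)) = t / ?p * e2pi (of_nat m * z\<^sup>2 / (t / ?p)) * F (t / ?p) z" by (rule jac_S[OF J]) (use Ip[of 0] in simp)
    thus ?thesis by (simp add: mult_ac)
  qed
  have B: "F ((- 1 / t + of_nat 0) / ?p) (z / t) = ?p * t * ?D * F (?p * t) (?p * z)"
  proof -
    have "F (- 1 / (?p * t)) (?p * z / (?p * t)) = ?p * t * e2pi (of_nat m * (?p * z)\<^sup>2 / (?p * t)) * F (?p * t) (?p * z)" by (rule jac_S[OF J Ip'])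
    moreover have "of_nat m * (?p * z)\<^sup>2 / (?p * t) = of_nat (m * p) * z\<^sup>2 / t" using p1 t0 by (simp add: power2_eq_square)
    moreover have "- 1 / (?p * t) = (- 1 / t + of_nat 0) / ?p" by (simp add: mult_ac)
    moreover have "?p * z / (?p * t) = z / t" using p1 by simp
    ultimately show ?thesis by (simp only:)
  qed
  have C: "F ((- 1 / t + of_nat b) / ?p) (z / t) = t * ?D * F ((t + of_nat (g b)) / ?p) z" if b: "b \<in> {1..<p}" for b
  proof -
    obtain k where k: "1 + int b * int (g b) = int p * k" using g(2)[OF b] by blast
    let ?t = "(t + of_nat (g b)) / ?p"
    have w: "of_int (int p) * ?t + of_int (- int (g b)) = t" using p1 by simp
    \<comment> \<open>The matrix (b, -k; p, -g b) has determinant 1 by the choice of k and sends (t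
      + g b)/p to (-1/t + b)/p.\<close>
    have "F ((of_int (int b) * ?t + of_int (- k)) / (of_int (int p) * ?t + of_int (- int (g b)))) (z / (of_int (int p) * ?t + of_int (- int (g b))))
      = (of_int (int p) * ?t + of_int (- int (g b))) * e2pi (of_nat m * of_int (int p) * z\<^sup>2 / (of_int (int p) * ?t + of_int (- int (g b)))) * F ?t z"
      by (rule jac_modular[OF J _ Ip]) (use k in \<open>simp add: algebra_simps\<close>)
    moreover have "(of_int (int b) * ?t + of_int (- k)) / (of_int (int p) * ?t + of_int (- int (g b))) = (- 1 / t + of_nat b) / ?p"
    proof -
      have "?p * of_int k = 1 + of_nat b * of_nat (g b)" using arg_cong[OF k, of "of_int :: int => complex"] by simp
      hence "of_int k = (1 + of_nat b * of_nat (g b)) / ?p" using p1 by (simp add: field_simps)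
      thus ?thesis unfolding w using p1 t0 by (simp add: field_simps)
    qed
    ultimately show ?thesis unfolding w by simp
  qed
  have s0: "(\<Sum>b<p. f b) = f 0 + (\<Sum>b\<in>{1..<p}. f b)" for f :: "nat => complex" using p0 by (simp add: sum.atLeast_Suc_lessThan lessThan_atLeast0)
  have "V_fun p F (- 1 / t) (z / t) = F (?p * (- 1 / t)) (?p * (z / t)) + (F ((- 1 / t + of_nat 0) / ?p) (z / t) + (\<Sum>b\<in>{1..<p}. F ((- 1 / t + of_nat b) / ?p) (z / t))) / ?p"
    unfolding V_fun_def s0 ..
  also have "(\<Sum>b\<in>{1..<p}. F ((- 1 / t + of_nat b) / ?p) (z / t)) = (\<Sum>b\<in>{1..<p}. t * ?D * F ((t + of_nat (g b)) / ?p) z)" by (rule sum.cong[OF refl C])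
  also have "\<dots> = (\<Sum>b\<in>{1..<p}. t * ?D * F ((t + of_nat b) / ?p) z)" by (rule sum.reindex_bij_betw[OF g(1)])
  also have "\<dots> = t * ?D * (\<Sum>b\<in>{1..<p}. F ((t + of_nat b) / ?p) z)" by (simp only: sum_distrib_left)
  also have "F (?p * (- 1 / t)) (?p * (z / t)) + (F ((- 1 / t + of_nat 0) / ?p) (z / t) + t * ?D * (\<Sum>b\<in>{1..<p}. F ((t + of_nat b) / ?p) z)) / ?p
     = t * ?D * V_fun p F t z" unfolding A B V_fun_def s0 using p1 by (simp add: field_simps)
  finally show "V_fun p F (- 1 / t) (z / t) = t * ?D * V_fun p F t z" .
qed

lemma periodic_int_mod:
  fixes f :: "int => 'a"
  assumes "\<And>a. f (a + n) = f a"
  shows "f (a mod n) = f a"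
proof -
  have "f (x + k * n) = f x" for k x
  proof (induction k rule: int_induct[where k = 0])
    case (step1 i)
    thus ?case using assms[of "x + i * n"] by (simp add: algebra_simps)
  next
    case (step2 i)
    thus ?case using assms[of "x + (i - 1) * n"] by (simp add: algebra_simps)
  qed simp
  from this[of "a mod n" "a div n"] show ?thesis by (simp add: add.commute)
qed

lemma sum_neg_mod:
  fixes f :: "int => 'a::comm_monoid_add"
  assumes "n > 0"
  shows "(\<Sum>a\<in>{0..<n}. f ((- a) mod n)) = (\<Sum>a\<in>{0..<n}. f a)" by (rule sum.reindex_bij_witness[where i = "\<lambda>a. (- a) mod n" and j = "\<lambda>a. (- a) mod n"])
     (use assms in \<open>auto simp: mod_minus_eq\<close>)

lemma sum_roots_of_unity_int:
  assumes "p > 0"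
  shows "(\<Sum>b\<in>{0..<int p}. e2pi (of_int n * of_int b / of_nat p)) = (if int p dvd n then of_nat p else 0)"
proof -
  have "(\<Sum>b\<in>{0..<int p}. e2pi (of_int n * of_int b / of_nat p)) = (\<Sum>b<p. e2pi (of_int n * of_nat b / of_nat p))" by (rule sum.reindex_bij_witness[where i = int and j = nat]) auto
  thus ?thesis using sum_roots_of_unity[OF assms] by simp
qed

text \<open>Averaging over \<open>n\<close>-torsion translates: the Eichler--Zagier operators in a form which also
  serves for lowering the index.\<close>

definition W_term :: "nat => nat => (complex => complex => complex) => int => int => complex => complex => complex" where
  "W_term M n F a b t z = e2pi (of_nat M * ((of_int a / of_nat n)\<^sup>2 * t + 2 * (of_int a / of_nat n) * z + of_int a * of_int b / (of_nat n)\<^sup>2)) *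
     F t (z + (of_int a * t + of_int b) / of_nat n)"

definition W_fun :: "nat => nat => (complex => complex => complex) => complex => complex => complex" where
  "W_fun M n F t z = (\<Sum>a\<in>{0..<int n}. \<Sum>b\<in>{0..<int n}. W_term M n F a b t z) / of_nat n"

text \<open>With M = n M', translation by (a t + b)/n sends the exponents (k, r) to R = r + 2M'a and
  N = k + a s/n, where s = r + M'a = R - M'a; summation over b keeps only the terms with n |
  s.\<close>

definition W_coeff :: "nat => nat => (int => int => 'a::comm_ring_1) => int => int => 'a" where
  "W_coeff M n c N R = (\<Sum>a\<in>{0..<int n}. let s = R - int (M div n) * a in
      if int n dvd s then c (N - a * (s div int n)) (R - 2 * int (M div n) * a) else 0)"

context
  fixes M n M' :: nat and F c
  assumes J: "jac M F c" and n: "n > 0" and M: "M = n * M'"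

begin

lemma W_term_period_b:
  assumes t: "Im t > 0"
  shows "W_term M n F a (b + int n) t z = W_term M n F a b t z"
proof -
  let ?n = "of_nat n :: complex"
  have n0: "?n \<noteq> 0" using n by simp
  have "F t (z + (of_int a * t + of_int (b + int n)) / ?n) = F t (z + (of_int a * t + of_int b) / ?n + of_int 1)" using n0 by (simp add: add_divide_distrib add_ac)
  also have "\<dots> = F t (z + (of_int a * t + of_int b) / ?n)" by (rule jac_z_int[OF J t])
  finally have 1: "F t (z + (of_int a * t + of_int (b + int n)) / ?n) = F t (z + (of_int a * t + of_int b) / ?n)" .
  have "of_nat M * ((of_int a / ?n)\<^sup>2 * t + 2 * (of_int a / ?n) * z + of_int a * of_int (b + int n) / ?n\<^sup>2)
    = of_nat M * ((of_int a / ?n)\<^sup>2 * t + 2 * (of_int a / ?n) * z + of_int a * of_int b / ?n\<^sup>2) + of_int (int M' * a)" using n0 by (simp add: M field_simps power2_eq_square)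
  thus ?thesis unfolding W_term_def 1 by (simp only: e2pi_plus_int)
qed

lemma W_term_period_a:
  assumes t: "Im t > 0"
  shows "W_term M n F (a + int n) b t z = W_term M n F a b t z"
proof -
  let ?n = "of_nat n :: complex"
  have n0: "?n \<noteq> 0" using n by simp
  define w where "w = z + (of_int a * t + of_int b) / ?n"
  have w: "z + (of_int (a + int n) * t + of_int b) / ?n = w + t" using n0 by (simp add: w_def field_simps)
  have "of_nat M * ((of_int (a + int n) / ?n)\<^sup>2 * t + 2 * (of_int (a + int n) / ?n) * z + of_int (a + int n) * of_int b / ?n\<^sup>2)
    = of_nat M * ((of_int a / ?n)\<^sup>2 * t + 2 * (of_int a / ?n) * z + of_int a * of_int b / ?n\<^sup>2) + of_nat M * (t + 2 * w) + of_int (- int M' * b)"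
    using n0 by (simp add: M w_def field_simps power2_eq_square)
  hence "W_term M n F (a + int n) b t z = e2pi (of_nat M * ((of_int a / ?n)\<^sup>2 * t + 2 * (of_int a / ?n) * z + of_int a * of_int b / ?n\<^sup>2)) * (e2pi (of_nat M * (t + 2 * w)) * F t (w + t))"
    unfolding W_term_def w by (simp only: e2pi_plus_int) (simp only: e2pi_add mult.assoc)
  thus ?thesis unfolding jac_elliptic[OF J t] by (simp add: W_term_def w_def)
qed

lemma W_term_mod:
  assumes t: "Im t > 0"
  shows "W_term M n F (a mod int n) (b mod int n) t z = W_term M n F a b t z" using periodic_int_mod[of "\<lambda>a. W_term M n F a (b mod int n) t z", OF W_term_period_a[OF t]]
    periodic_int_mod[of "\<lambda>b. W_term M n F a b t z", OF W_term_period_b[OF t]] by simp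

text \<open>The inversion carries the translate by the torsion vector (a, b)/n to the one by (b,
  -a)/n. As the terms depend only on a and b mod n, the average over all vectors is
  preserved.\<close>

lemma W_term_S:
  assumes t: "Im t > 0"
  shows "W_term M n F a b (- 1 / t) (z / t) = t * e2pi (of_nat M * z\<^sup>2 / t) * W_term M n F b (- a) t z"
proof -
  let ?n = "of_nat n :: complex"
  have n0: "?n \<noteq> 0" using n by simp
  have t0: "t \<noteq> 0" using t by auto
  define w where "w = z + (of_int b * t + of_int (- a)) / ?n"
  have w: "z / t + (of_int a * (- 1 / t) + of_int b) / ?n = w / t" using n0 t0 by (simp add: w_def field_simps)
  have "W_term M n F a b (- 1 / t) (z / t) = e2pi (of_nat M * ((of_int a / ?n)\<^sup>2 * (- 1 / t) + 2 * (of_int a / ?n) * (z / t) + of_int a * of_int b / ?n\<^sup>2)) *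
     (t * e2pi (of_nat M * w\<^sup>2 / t) * F t w)" unfolding W_term_def w jac_S[OF J t] ..
  also have "\<dots> = t * e2pi (of_nat M * ((of_int a / ?n)\<^sup>2 * (- 1 / t) + 2 * (of_int a / ?n) * (z / t) + of_int a * of_int b / ?n\<^sup>2) + of_nat M * w\<^sup>2 / t) * F t w"
    by (simp only: e2pi_add mult_ac)
  also have "of_nat M * ((of_int a / ?n)\<^sup>2 * (- 1 / t) + 2 * (of_int a / ?n) * (z / t) + of_int a * of_int b / ?n\<^sup>2) + of_nat M * w\<^sup>2 / t
    = of_nat M * z\<^sup>2 / t + of_nat M * ((of_int b / ?n)\<^sup>2 * t + 2 * (of_int b / ?n) * z + of_int b * of_int (- a) / ?n\<^sup>2)"
    using n0 t0 by (simp add: w_def field_simps power2_eq_square)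
  finally show ?thesis by (simp only: W_term_def w_def e2pi_add mult_ac)
qed

lemma W_term_elliptic:
  assumes t: "Im t > 0"
  shows "e2pi (of_nat M * (t + 2 * z)) * W_term M n F a b t (z + t) = W_term M n F a b t z"
proof -
  let ?n = "of_nat n :: complex"
  have n0: "?n \<noteq> 0" using n by simp
  define w where "w = z + (of_int a * t + of_int b) / ?n"
  have w: "z + t + (of_int a * t + of_int b) / ?n = w + t" by (simp add: w_def)
  have "of_nat M * (t + 2 * z) + of_nat M * ((of_int a / ?n)\<^sup>2 * t + 2 * (of_int a / ?n) * (z + t) + of_int a * of_int b / ?n\<^sup>2)
    = of_nat M * ((of_int a / ?n)\<^sup>2 * t + 2 * (of_int a / ?n) * z + of_int a * of_int b / ?n\<^sup>2) + of_nat M * (t + 2 * w) + of_int (- 2 * int M' * b)"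
    using n0 by (simp add: M w_def field_simps power2_eq_square)
  hence "e2pi (of_nat M * (t + 2 * z)) * W_term M n F a b t (z + t) = e2pi (of_nat M * ((of_int a / ?n)\<^sup>2 * t + 2 * (of_int a / ?n) * z + of_int a * of_int b / ?n\<^sup>2)) * (e2pi (of_nat M * (t + 2 * w)) * F t (w + t))"
    unfolding W_term_def w mult.assoc[symmetric] e2pi_add[symmetric] by (simp only: e2pi_plus_int)
  thus ?thesis unfolding jac_elliptic[OF J t] by (simp add: W_term_def w_def)
qed

lemma expands_W: "expands (W_fun M n F) (W_coeff M n c)"
proof -
  have Mn: "M div n = M'" using n by (simp add: M)
  let ?n = "of_nat n :: complex"
  have n0: "?n \<noteq> 0" using n by simp
  have "expands (\<lambda>t z. (\<Sum>b\<in>{0..<int n}. W_term M n F a b t z) / ?n)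
     (\<lambda>N R. let s = R - int M' * a in if int n dvd s then c (N - a * (s div int n)) (R - 2 * int M' * a) else 0)" (is "expands _ ?d") for a
  proof (rule expandsI)
    fix t z :: complex assume t: "Im t > 0"
    let ?S = "(\<Sum>b\<in>{0..<int n}. W_term M n F a b t z) / ?n"
    let ?e = "\<lambda>b. e2pi (of_nat M * ((of_int a / ?n)\<^sup>2 * t + 2 * (of_int a / ?n) * z + of_int a * of_int b / ?n\<^sup>2))"
    let ?u = "\<lambda>k r. of_nat M' * (of_int a)\<^sup>2 / ?n * t + 2 * of_nat M' * of_int a * z + of_int k * t + of_int r * z + of_int r * of_int a * t / ?n"
    have "((\<lambda>x. (\<Sum>b\<in>{0..<int n}. ?e b * fterm c t (z + (of_int a * t + of_int b) / ?n) x) / ?n) has_sum ?S) UNIV" unfolding W_term_def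
      by (intro has_sum_divide_const has_sum_sum has_sum_cmult_right expandsD[OF jac_expands[OF J] t]) auto
    moreover have "(\<Sum>b\<in>{0..<int n}. ?e b * fterm c t (z + (of_int a * t + of_int b) / ?n) (k, r)) / ?n
        = (if int n dvd r + int M' * a then c k r * e2pi (?u k r) else 0)" for k r
    proof -
      have "(\<Sum>b\<in>{0..<int n}. ?e b * fterm c t (z + (of_int a * t + of_int b) / ?n) (k, r))
        = (\<Sum>b\<in>{0..<int n}. c k r * e2pi (?u k r) * e2pi (of_int (r + int M' * a) * of_int b / ?n))"
      proof (rule sum.cong[OF refl])
        fix b
        have "of_nat M * ((of_int a / ?n)\<^sup>2 * t + 2 * (of_int a / ?n) * z + of_int a * of_int b / ?n\<^sup>2) + (of_int k * t + of_int r * (z + (of_int a * t + of_int b) / ?n))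
          = ?u k r + of_int (r + int M' * a) * of_int b / ?n" using n0 by (simp add: M field_simps power2_eq_square)
        hence "?e b * e2pi (of_int k * t + of_int r * (z + (of_int a * t + of_int b) / ?n)) = e2pi (?u k r) * e2pi (of_int (r + int M' * a) * of_int b / ?n)"
          unfolding e2pi_add[symmetric] by (rule arg_cong)
        thus "?e b * fterm c t (z + (of_int a * t + of_int b) / ?n) (k, r) = c k r * e2pi (?u k r) * e2pi (of_int (r + int M' * a) * of_int b / ?n)" by simp
      qed
      also have "\<dots> = c k r * e2pi (?u k r) * (if int n dvd r + int M' * a then ?n else 0)" by (simp only: sum_distrib_left[symmetric] sum_roots_of_unity_int[OF n])
      finally show ?thesis using n0 by simp
    qed
    ultimately have "((\<lambda>(k, r). if int n dvd r + int M' * a then c k r * e2pi (?u k r) else 0) has_sum ?S) UNIV" by (simp add: case_prod_unfold)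
    also have "?this \<longleftrightarrow> ((\<lambda>(k, r). c k r * e2pi (?u k r)) has_sum ?S) {(k, r). int n dvd r + int M' * a}" by (rule has_sum_cong_neutral) auto
    also have "\<dots> \<longleftrightarrow> (fterm ?d t z has_sum ?S) {(N, R). int n dvd R - int M' * a}"
    proof (rule has_sum_reindex_bij_witness[where j = "\<lambda>(k, r). (k + a * ((r + int M' * a) div int n), r + 2 * int M' * a)"
          and i = "\<lambda>(N, R). (N - a * ((R - int M' * a) div int n), R - 2 * int M' * a)"])
      fix x :: "int \<times> int" assume "x \<in> {(k, r). int n dvd r + int M' * a}"
      then obtain k r where x: "x = (k, r)" "int n dvd r + int M' * a" by auto
      then obtain l where l: "r + int M' * a = int n * l" by blast
      have rr: "r + 2 * int M' * a - int M' * a = int n * l" using l by (simp add: algebra_simps)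
      have l': "of_int r = ?n * of_int l - of_nat M' * of_int a" using arg_cong[OF l, of "of_int :: int => complex"] by (simp add: algebra_simps)
      have e: "of_int (k + a * l) * t + of_int (r + 2 * int M' * a) * z = ?u k r" using n0 by (simp add: l' field_simps power2_eq_square)
      show "fterm ?d t z (case x of (k, r) => (k + a * ((r + int M' * a) div int n), r + 2 * int M' * a)) = (case x of (k, r) => c k r * e2pi (?u k r))"
      proof -
        have "(r + int M' * a) div int n = l" using n by (simp add: l)
        moreover have "?d (k + a * l) (r + 2 * int M' * a) = c k r" using n by (simp add: Let_def rr)
        ultimately show ?thesis by (simp only: x prod.case e)
      qed
    qed (use n in \<open>auto simp: algebra_simps split: prod.splits\<close>)
    also have "\<dots> \<longleftrightarrow> (fterm ?d t z has_sum ?S) UNIV" by (rule has_sum_cong_neutral) (auto simp: Let_def)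
    finally show "(fterm ?d t z has_sum ?S) UNIV" .
  qed
  from expands_sum[of "{0..<int n}", OF _ this] show ?thesis unfolding W_fun_def W_coeff_def Mn sum_divide_distrib by simp
qed

lemma jac_W: "jac M (W_fun M n F) (W_coeff M n c)" unfolding jac_def
proof (intro conjI allI impI)
  show "expands (W_fun M n F) (W_coeff M n c)" by (rule expands_W)
  fix t z :: complex assume t: "Im t > 0"
  show "e2pi (of_nat M * (t + 2 * z)) * W_fun M n F t (z + t) = W_fun M n F t z" unfolding W_fun_def times_divide_eq_right sum_distrib_left W_term_elliptic[OF t] ..
  have n': "int n > 0" using n by simp
  have "(\<Sum>a\<in>{0..<int n}. \<Sum>b\<in>{0..<int n}. W_term M n F b (- a) t z) = (\<Sum>a\<in>{0..<int n}. \<Sum>b\<in>{0..<int n}. W_term M n F (b mod int n) ((- a) mod int n) t z)"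
    unfolding W_term_mod[OF t] ..
  also have "\<dots> = (\<Sum>a\<in>{0..<int n}. \<Sum>b\<in>{0..<int n}. W_term M n F (b mod int n) a t z)"
    by (rule sum_neg_mod[OF n', of "\<lambda>a. \<Sum>b\<in>{0..<int n}. W_term M n F (b mod int n) a t z"])
  also have "\<dots> = (\<Sum>a\<in>{0..<int n}. \<Sum>b\<in>{0..<int n}. W_term M n F b a t z)" by (intro sum.cong refl) auto
  also have "\<dots> = (\<Sum>a\<in>{0..<int n}. \<Sum>b\<in>{0..<int n}. W_term M n F a b t z)" by (rule sum.swap)
  finally show "W_fun M n F (- 1 / t) (z / t) = t * e2pi (of_nat M * z\<^sup>2 / t) * W_fun M n F t z" unfolding W_fun_def W_term_S[OF t] sum_distrib_left[symmetric] by simp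
qed

text \<open>If n^2 divides M, translation by t/n raises a by one and only permutes the terms: the
  average is elliptic for a lattice refined in the direction of t.\<close>

lemma W_fun_shift:
  assumes t: "Im t > 0" and M'': "M' = n * k"
  shows "e2pi (of_nat k * (t + 2 * of_nat n * z)) * W_fun M n F t (z + t / of_nat n) = W_fun M n F t z"
proof -
  let ?n = "of_nat n :: complex"
  have n0: "?n \<noteq> 0" using n by simp
  have n': "int n > 0" using n by simp
  have 1: "e2pi (of_nat k * (t + 2 * ?n * z)) * W_term M n F a b t (z + t / ?n) = W_term M n F (a + 1) b t z" for a b
  proof -
    have w: "z + t / ?n + (of_int a * t + of_int b) / ?n = z + (of_int (a + 1) * t + of_int b) / ?n" using n0 by (simp add: field_simps)
    have "of_nat k * (t + 2 * ?n * z) + of_nat M * ((of_int a / ?n)\<^sup>2 * t + 2 * (of_int a / ?n) * (z + t / ?n) + of_int a * of_int b / ?n\<^sup>2)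
      = of_nat M * ((of_int (a + 1) / ?n)\<^sup>2 * t + 2 * (of_int (a + 1) / ?n) * z + of_int (a + 1) * of_int b / ?n\<^sup>2) + of_int (- int k * b)"
      using n0 by (simp add: M M'' field_simps power2_eq_square)
    thus ?thesis unfolding W_term_def w mult.assoc[symmetric] e2pi_add[symmetric] by (simp only: e2pi_plus_int)
  qed
  have "(\<Sum>a\<in>{0..<int n}. f (a + 1)) = (\<Sum>a\<in>{0..<int n}. f a)" if "\<And>a. f (a + int n) = f a" for f :: "int => complex"
  proof -
    have "(\<Sum>a\<in>{0..<int n}. f (a + 1)) = (\<Sum>a\<in>{0..<int n}. f ((a + 1) mod int n))" by (simp only: periodic_int_mod[of f, OF that])
    also have "\<dots> = (\<Sum>a\<in>{0..<int n}. f a)" by (rule sum.reindex_bij_witness[where i = "\<lambda>a. (a - 1) mod int n" and j = "\<lambda>a. (a + 1) mod int n"])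
         (use n' in \<open>auto simp: mod_diff_left_eq mod_add_left_eq\<close>)
    finally show ?thesis .
  qed
  from this[of "\<lambda>a. \<Sum>b\<in>{0..<int n}. W_term M n F a b t z"]
  have "(\<Sum>a\<in>{0..<int n}. \<Sum>b\<in>{0..<int n}. W_term M n F (a + 1) b t z) = (\<Sum>a\<in>{0..<int n}. \<Sum>b\<in>{0..<int n}. W_term M n F a b t z)" by (simp only: W_term_period_a[OF t])
  thus ?thesis unfolding W_fun_def times_divide_eq_right sum_distrib_left 1 by simp
qed

end

text \<open>Support on multiples of n means invariance under z + 1/n. Together with the shift by
  t/n, all n-torsion translations act elliptically, so passing to z/n divides the index by
  n^2.\<close>

lemma jac_divide:
  assumes J: "jac (m * n * n) G d" and n: "n > 0"
    and d: "\<And>N R. \<not> int n dvd R ==> d N R = 0"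
    and shift: "\<And>t z. Im t > 0 ==> e2pi (of_nat m * (t + 2 * of_nat n * z)) * G t (z + t / of_nat n) = G t z"
  shows "jac m (\<lambda>t z. G t (z / of_nat n)) (\<lambda>N R. d N (int n * R))" unfolding jac_def
proof (intro conjI allI impI)
  let ?n = "of_nat n :: complex"
  have n0: "?n \<noteq> 0" using n by simp
  show "expands (\<lambda>t z. G t (z / ?n)) (\<lambda>N R. d N (int n * R))"
  proof (rule expandsI)
    fix t z :: complex assume t: "Im t > 0"
    have "(fterm d t (z / ?n) has_sum G t (z / ?n)) UNIV" by (rule expandsD[OF jac_expands[OF J] t])
    also have "?this \<longleftrightarrow> (fterm d t (z / ?n) has_sum G t (z / ?n)) {(N, R). int n dvd R}" by (rule has_sum_cong_neutral) (auto simp: d)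
    also have "\<dots> \<longleftrightarrow> (fterm (\<lambda>N R. d N (int n * R)) t z has_sum G t (z / ?n)) UNIV"
      by (rule has_sum_reindex_bij_witness[where j = "\<lambda>(N, R). (N, R div int n)" and i = "\<lambda>(N, R). (N, int n * R)"])
         (use n in auto)
    finally show "(fterm (\<lambda>N R. d N (int n * R)) t z has_sum G t (z / ?n)) UNIV" .
  qed
  fix t z :: complex assume t: "Im t > 0"
  show "e2pi (of_nat m * (t + 2 * z)) * G t ((z + t) / ?n) = G t (z / ?n)" using shift[OF t, of "z / ?n"] n0 by (simp add: add_divide_distrib)
  have e: "of_nat (m * n * n) * (z / ?n)\<^sup>2 / t = of_nat m * z\<^sup>2 / t" using n0 by (simp add: power2_eq_square)
  show "G (- 1 / t) (z / t / ?n) = t * e2pi (of_nat m * z\<^sup>2 / t) * G t (z / ?n)" using jac_S[OF J t, of "z / ?n"] unfolding e by (simp add: mult.commute)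
qed

section \<open>The Hecke operator at a prime\<close>

lemma W_coeff_eq_0:
  assumes "\<not> int n dvd R"
  shows "W_coeff (m * n * n) n c N R = 0"
proof -
  have "\<not> int n dvd R - int (m * n * n div n) * a" for a
  proof
    assume "int n dvd R - int (m * n * n div n) * a"
    moreover have "int n dvd int (m * n * n div n) * a" by (cases "n = 0") auto
    ultimately have "int n dvd (R - int (m * n * n div n) * a) + int (m * n * n div n) * a" by (rule dvd_add)
    thus False using assms by simp
  qed
  thus ?thesis unfolding W_coeff_def Let_def by (simp only: if_False sum.neutral_const)
qed

text \<open>V_p twice raises the index to m p^2; averaging over p-torsion and rescaling z return it
  to m. Subtracting p + 1 copies of F leaves p times the Eichler-Zagier Hecke operator of weight
  one, a multiple whose formula on coefficients is integral.\<close>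

definition T_fun :: "nat => nat => (complex => complex => complex) => complex => complex => complex" where
  "T_fun m p F t z = W_fun (m * p * p) p (V_fun p (V_fun p F)) t (z / of_nat p) - of_nat (p + 1) * F t z"

definition T_coeff :: "nat => nat => (int => int => 'a::comm_ring_1) => int => int => 'a" where
  "T_coeff m p c n r = W_coeff (m * p * p) p (V_coeff p (V_coeff p c)) n (int p * r) - of_nat (p + 1) * c n r"

lemma jac_T:
  assumes J: "jac m F c" and p: "prime p"
  shows "jac m (T_fun m p F) (T_coeff m p c)"
proof -
  have p0: "p > 0" using p prime_gt_0_nat by blast
  have M: "m * p * p = p * (p * m)" by simp
  have J2: "jac (m * p * p) (V_fun p (V_fun p F)) (V_coeff p (V_coeff p c))" by (intro jac_V J p)
  have JW: "jac (m * p * p) (W_fun (m * p * p) p (V_fun p (V_fun p F))) (W_coeff (m * p * p) p (V_coeff p (V_coeff p c)))" by (rule jac_W[OF J2 p0 M])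
  have "jac m (\<lambda>t z. W_fun (m * p * p) p (V_fun p (V_fun p F)) t (z / of_nat p)) (\<lambda>N R. W_coeff (m * p * p) p (V_coeff p (V_coeff p c)) N (int p * R))"
    by (rule jac_divide[OF JW p0 W_coeff_eq_0]) (simp_all add: W_fun_shift[OF J2 p0 M])
  from jac_diff[OF this jac_cmult[OF J, of "of_nat (p + 1)"]]
  show ?thesis unfolding T_fun_def T_coeff_def .
qed

text \<open>Roots mod p of m a^2 - r a + n, with discriminant D = r^2 - 4mn; for p prime to 2m the
  count minus one is the Legendre symbol of D.\<close>

definition nroots :: "nat => nat => int => int => nat" where
  "nroots m p n r = card {a \<in> {0..<int p}. int p dvd n - a * r + int m * a\<^sup>2}"

text \<open>By ellipticity all arguments of the first two kinds reduce to (p^2 n, p r) and (n, r)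
  independently of a (\<open>e1\<close>, \<open>e2\<close>), which gives p copies of each; the
  divisibility condition in \<open>V2\<close> produces the root count.\<close>

lemma T_coeff_eq:
  fixes x :: "int => int => 'a::comm_ring_1"
  assumes p: "p > 0" and ell: "\<And>n r l. x (n + l * r + int m * l\<^sup>2) (r + 2 * int m * l) = x n r"
  shows "T_coeff m p x n r = of_nat p * x ((int p)\<^sup>2 * n) (int p * r) + of_int (int (nroots m p n r) - 1) * x n r
    + (\<Sum>a\<in>{0..<int p}. if (int p)\<^sup>2 dvd n - a * r + int m * a\<^sup>2 \<and> int p dvd r - 2 * int m * a
         then x ((n - a * r + int m * a\<^sup>2) div (int p)\<^sup>2) ((r - 2 * int m * a) div int p) else 0)"
proof -
  let ?p = "int p"
  let ?N = "\<lambda>a. n - a * r + int m * a\<^sup>2" and ?R = "\<lambda>a. r - 2 * int m * a"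
  have p0: "?p \<noteq> 0" using p by simp
  have e1: "x (?N a) (?R a) = x n r" for a using ell[of n "- a" r] by (simp add: algebra_simps)
  have e2: "x (?p\<^sup>2 * ?N a) (?p * ?R a) = x (?p\<^sup>2 * n) (?p * r)" for a using ell[of "?p\<^sup>2 * n" "- a * ?p" "?p * r"] by (simp add: algebra_simps power2_eq_square)
  have V1: "V_coeff p x (?p * k) (?p * s) = x k s + x (?p\<^sup>2 * k) (?p * s)" for k s using p0 by (simp add: V_coeff_def power2_eq_square mult.assoc)
  have V2: "V_coeff p (V_coeff p x) k (?p * s) = x (?p\<^sup>2 * k) (?p * s) + x k s
      + ((if ?p dvd k then x k s else 0) + (if ?p\<^sup>2 dvd k \<and> ?p dvd s then x (k div ?p\<^sup>2) (s div ?p) else 0))" for k s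
  proof -
    have "?p dvd k div ?p \<longleftrightarrow> ?p\<^sup>2 dvd k" "k div ?p div ?p = k div ?p\<^sup>2" "?p * (k div ?p) = k" if "?p dvd k"
      using that p0 by (auto simp: power2_eq_square div_mult2_eq zdiv_zmult2_eq elim!: dvdE)
    moreover have "?p dvd k" if "?p\<^sup>2 dvd k" using that by (auto simp: power2_eq_square elim: dvd_mult_left)
    ultimately show ?thesis using p0 unfolding V_coeff_def[of p "V_coeff p x"] V1 V_coeff_def[of p x "k div ?p"] by auto
  qed
  have s: "?p * r - int (m * p * p div p) * a = ?p * ?R a + int m * ?p * a" for a using p by (simp add: algebra_simps)
  have sd: "(?p * ?R a + int m * ?p * a) div ?p = r - int m * a" for a
  proof -
    have 1: "?p * ?R a + int m * ?p * a = ?p * (r - int m * a)" by (simp add: algebra_simps)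
    show ?thesis unfolding 1 by (rule nonzero_mult_div_cancel_left[OF p0])
  qed
  have "W_coeff (m * p * p) p (V_coeff p (V_coeff p x)) n (?p * r) = (\<Sum>a\<in>{0..<?p}. V_coeff p (V_coeff p x) (?N a) (?p * ?R a))" unfolding W_coeff_def Let_def
  proof (rule sum.cong[OF refl])
    fix a
    have 1: "?p dvd ?p * r - int (m * p * p div p) * a" unfolding s by simp
    have 2: "n - a * ((?p * r - int (m * p * p div p) * a) div ?p) = ?N a" unfolding s sd by (simp add: algebra_simps power2_eq_square)
    have 3: "?p * r - 2 * int (m * p * p div p) * a = ?p * ?R a" using p by (simp add: algebra_simps)
    show "(if ?p dvd ?p * r - int (m * p * p div p) * a
          then V_coeff p (V_coeff p x) (n - a * ((?p * r - int (m * p * p div p) * a) div ?p)) (?p * r - 2 * int (m * p * p div p) * a)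
          else 0) = V_coeff p (V_coeff p x) (?N a) (?p * ?R a)" unfolding 2 3 using 1 by simp
  qed
  also have "\<dots> = (\<Sum>a\<in>{0..<?p}. x (?p\<^sup>2 * n) (?p * r) + x n r
      + ((if ?p dvd ?N a then x n r else 0) + (if ?p\<^sup>2 dvd ?N a \<and> ?p dvd ?R a then x (?N a div ?p\<^sup>2) (?R a div ?p) else 0)))" unfolding V2 e1 e2 ..
  also have "\<dots> = of_nat p * (x (?p\<^sup>2 * n) (?p * r) + x n r) + (of_nat (nroots m p n r) * x n r
      + (\<Sum>a\<in>{0..<?p}. if ?p\<^sup>2 dvd ?N a \<and> ?p dvd ?R a then x (?N a div ?p\<^sup>2) (?R a div ?p) else 0))"
    unfolding sum.distrib by (simp add: nroots_def sum.If_cases Int_def distrib_left)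
  finally show ?thesis unfolding T_coeff_def by (simp add: algebra_simps)
qed

text \<open>Completing the square: y = 2ma - r permutes the residues, and y^2 - (r^2 - 4mn) = 4m (n
  - ar + ma^2).\<close>

lemma nroots_eq:
  assumes p: "prime p" and pm: "\<not> int p dvd 2 * int m"
  shows "nroots m p n r = card {y \<in> {0..<int p}. int p dvd y\<^sup>2 - (r\<^sup>2 - 4 * int m * n)}"
proof -
  let ?p = "int p"
  have p0: "?p > 0" using p prime_gt_0_nat by simp
  have pp: "prime ?p" using p by simp
  define g where "g = (\<lambda>a. (2 * int m * a - r) mod ?p)"
  have gdvd: "?p dvd (g a)\<^sup>2 - (r\<^sup>2 - 4 * int m * n) \<longleftrightarrow> ?p dvd n - a * r + int m * a\<^sup>2" for a
  proof -
    have "[(g a)\<^sup>2 - (r\<^sup>2 - 4 * int m * n) = (2 * int m * a - r)\<^sup>2 - (r\<^sup>2 - 4 * int m * n)] (mod ?p)" unfolding g_def by (intro cong_diff cong_pow) (auto simp: cong_def)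
    hence "?p dvd (g a)\<^sup>2 - (r\<^sup>2 - 4 * int m * n) \<longleftrightarrow> ?p dvd (2 * int m * a - r)\<^sup>2 - (r\<^sup>2 - 4 * int m * n)" by (rule cong_dvd_iff)
    also have "(2 * int m * a - r)\<^sup>2 - (r\<^sup>2 - 4 * int m * n) = 2 * (2 * int m) * (n - a * r + int m * a\<^sup>2)" by (simp add: algebra_simps power2_eq_square)
    also have "?p dvd \<dots> \<longleftrightarrow> ?p dvd n - a * r + int m * a\<^sup>2"
    proof -
      have "\<not> ?p dvd 2" using pm dvd_mult2 by blast
      thus ?thesis using pm unfolding prime_dvd_mult_iff[OF pp] by blast
    qed
    finally show ?thesis .
  qed
  have gin: "g a \<in> {0..<?p}" for a using p0 by (simp add: g_def)
  have inj: "inj_on g {0..<?p}"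
  proof (rule inj_onI)
    fix a b assume ab: "a \<in> {0..<?p}" "b \<in> {0..<?p}" "g a = g b"
    hence "?p dvd (2 * int m * a - r) - (2 * int m * b - r)" by (simp add: g_def mod_eq_dvd_iff)
    also have "(2 * int m * a - r) - (2 * int m * b - r) = 2 * int m * (a - b)" by (simp add: algebra_simps)
    finally have "?p dvd a - b" using pm by (simp add: prime_dvd_mult_iff[OF pp])
    hence "a mod ?p = b mod ?p" by (simp add: mod_eq_dvd_iff)
    thus "a = b" using ab by simp
  qed
  have surj: "g ` {0..<?p} = {0..<?p}" by (rule endo_inj_surj) (use inj gin in auto)
  have "bij_betw g {a \<in> {0..<?p}. ?p dvd n - a * r + int m * a\<^sup>2} {y \<in> {0..<?p}. ?p dvd y\<^sup>2 - (r\<^sup>2 - 4 * int m * n)}" unfolding bij_betw_def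
  proof
    show "inj_on g {a \<in> {0..<?p}. ?p dvd n - a * r + int m * a\<^sup>2}" using inj by (rule inj_on_subset) auto
    show "g ` {a \<in> {0..<?p}. ?p dvd n - a * r + int m * a\<^sup>2} = {y \<in> {0..<?p}. ?p dvd y\<^sup>2 - (r\<^sup>2 - 4 * int m * n)}"
    proof (intro equalityI subsetI)
      fix y assume "y \<in> {y \<in> {0..<?p}. ?p dvd y\<^sup>2 - (r\<^sup>2 - 4 * int m * n)}"
      hence y: "y \<in> {0..<?p}" "?p dvd y\<^sup>2 - (r\<^sup>2 - 4 * int m * n)" by auto
      then obtain a where a: "a \<in> {0..<?p}" "y = g a" using surj by blast
      thus "y \<in> g ` {a \<in> {0..<?p}. ?p dvd n - a * r + int m * a\<^sup>2}" using y gdvd by auto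
    qed (use gdvd gin in auto)
  qed
  thus ?thesis unfolding nroots_def by (rule bij_betw_same_card)
qed

lemma nroots_dvd:
  assumes p: "prime p" and pm: "\<not> int p dvd 2 * int m" and D: "int p dvd r\<^sup>2 - 4 * int m * n"
  shows "nroots m p n r = 1"
proof -
  have p0: "int p > 0" using p prime_gt_0_nat by simp
  have "{y \<in> {0..<int p}. int p dvd y\<^sup>2 - (r\<^sup>2 - 4 * int m * n)} = {0}"
  proof (intro equalityI subsetI)
    fix y assume "y \<in> {y \<in> {0..<int p}. int p dvd y\<^sup>2 - (r\<^sup>2 - 4 * int m * n)}"
    hence y: "y \<in> {0..<int p}" "int p dvd y\<^sup>2 - (r\<^sup>2 - 4 * int m * n)" by auto
    from dvd_add[OF y(2) D] have "int p dvd y\<^sup>2" by simp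
    hence "int p dvd y" using p prime_dvd_power by (metis prime_nat_int_transfer)
    thus "y \<in> {0}" using y(1) zdvd_not_zless[of y "int p"] by force
  qed (use p0 D in \<open>auto simp: dvd_diff_commute\<close>)
  thus ?thesis unfolding nroots_eq[OF p pm] by simp
qed

lemma nroots_nonres:
  assumes p: "prime p" and pm: "\<not> int p dvd 2 * int m" and D: "\<not> QuadRes (int p) (r\<^sup>2 - 4 * int m * n)"
  shows "nroots m p n r = 0"
proof -
  have "{y \<in> {0..<int p}. int p dvd y\<^sup>2 - (r\<^sup>2 - 4 * int m * n)} = {}" using D unfolding QuadRes_def cong_iff_dvd_diff by auto
  thus ?thesis unfolding nroots_eq[OF p pm] by (simp only: card.empty)
qed

lemma nroots_res:
  assumes p: "prime p" and pm: "\<not> int p dvd 2 * int m" and D: "QuadRes (int p) (r\<^sup>2 - 4 * int m * n)"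
    and nd: "\<not> int p dvd r\<^sup>2 - 4 * int m * n"
  shows "nroots m p n r = 2"
proof -
  let ?p = "int p" let ?D = "r\<^sup>2 - 4 * int m * n"
  have p0: "?p > 0" using p prime_gt_0_nat by simp
  have pp: "prime ?p" using p by simp
  have p2: "\<not> ?p dvd 2" using pm dvd_mult2 by blast
  obtain w where w: "?p dvd w\<^sup>2 - ?D" using D unfolding QuadRes_def cong_iff_dvd_diff by auto
  have pw: "\<not> ?p dvd w"
  proof
    assume "?p dvd w"
    hence "?p dvd w\<^sup>2" by (simp add: power2_eq_square)
    from dvd_diff[OF this w] show False using nd by simp
  qed
  have eq: "?p dvd y\<^sup>2 - ?D \<longleftrightarrow> y mod ?p = w mod ?p \<or> y mod ?p = (- w) mod ?p" for y
  proof -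
    have "?p dvd y\<^sup>2 - ?D \<longleftrightarrow> ?p dvd (y\<^sup>2 - ?D) - (w\<^sup>2 - ?D)"
    proof
      assume "?p dvd (y\<^sup>2 - ?D) - (w\<^sup>2 - ?D)"
      from dvd_add[OF this w] show "?p dvd y\<^sup>2 - ?D" by (simp only: diff_add_cancel)
    qed (rule dvd_diff[OF _ w])
    also have "(y\<^sup>2 - ?D) - (w\<^sup>2 - ?D) = (y - w) * (y - - w)" by (simp add: algebra_simps power2_eq_square)
    also have "?p dvd \<dots> \<longleftrightarrow> ?p dvd y - w \<or> ?p dvd y - - w" by (rule prime_dvd_mult_iff[OF pp])
    finally show ?thesis unfolding mod_eq_dvd_iff .
  qed
  have ne: "w mod ?p \<noteq> (- w) mod ?p"
  proof
    assume "w mod ?p = (- w) mod ?p"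
    hence "?p dvd w - - w" by (simp only: mod_eq_dvd_iff)
    hence "?p dvd 2 * w" by simp
    thus False using p2 pw by (simp add: prime_dvd_mult_iff[OF pp])
  qed
  have "{y \<in> {0..<?p}. ?p dvd y\<^sup>2 - ?D} = {w mod ?p, (- w) mod ?p}" unfolding eq using p0 by auto
  thus ?thesis unfolding nroots_eq[OF p pm] using ne by simp
qed

text \<open>At (p^2 n, p r) the discriminant is divisible by p, so the middle term drops out, and
  the condition p | p r - 2ma leaves only a = 0 in the last sum.\<close>

lemma T_coeff_square:
  fixes x :: "int => int => 'a::comm_ring_1"
  assumes p: "prime p" and pm: "\<not> int p dvd 2 * int m"
    and ell: "\<And>n r l. x (n + l * r + int m * l\<^sup>2) (r + 2 * int m * l) = x n r"
  shows "T_coeff m p x ((int p)\<^sup>2 * n) (int p * r) = of_nat p * x ((int p)\<^sup>2 * ((int p)\<^sup>2 * n)) (int p * (int p * r)) + x n r"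
proof -
  let ?p = "int p"
  have p0: "?p > 0" "p > 0" using p prime_gt_0_nat by auto
  have pp: "prime ?p" using p by simp
  have "?p dvd (?p * r)\<^sup>2 - 4 * int m * (?p\<^sup>2 * n)" by (simp add: power2_eq_square)
  hence 1: "nroots m p (?p\<^sup>2 * n) (?p * r) = 1" by (rule nroots_dvd[OF p pm])
  have 2: "(\<Sum>a\<in>{0..<?p}. if ?p\<^sup>2 dvd ?p\<^sup>2 * n - a * (?p * r) + int m * a\<^sup>2 \<and> ?p dvd ?p * r - 2 * int m * a
         then x ((?p\<^sup>2 * n - a * (?p * r) + int m * a\<^sup>2) div ?p\<^sup>2) ((?p * r - 2 * int m * a) div ?p) else 0) =
     (\<Sum>a\<in>{0..<?p}. if a = 0 then x n r else 0)"
  proof (rule sum.cong[OF refl])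
    fix a assume a: "a \<in> {0..<?p}"
    show "(if ?p\<^sup>2 dvd ?p\<^sup>2 * n - a * (?p * r) + int m * a\<^sup>2 \<and> ?p dvd ?p * r - 2 * int m * a
         then x ((?p\<^sup>2 * n - a * (?p * r) + int m * a\<^sup>2) div ?p\<^sup>2) ((?p * r - 2 * int m * a) div ?p) else 0) = (if a = 0 then x n r else 0)"
    proof (cases "a = 0")
      case True
      thus ?thesis using p0 by simp
    next
      case False
      have "\<not> ?p dvd ?p * r - 2 * int m * a"
      proof
        assume "?p dvd ?p * r - 2 * int m * a"
        from dvd_diff[OF dvd_triv_left[of ?p r] this] have "?p dvd 2 * int m * a" by simp
        hence "?p dvd a" using pm by (simp add: prime_dvd_mult_iff[OF pp])
        thus False using a False zdvd_not_zless[of a ?p] by auto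
      qed
      thus ?thesis using False by simp
    qed
  qed
  show ?thesis unfolding T_coeff_eq[OF p0(2) ell] 1 2 using p0 by simp
qed

text \<open>A nonzero term of the last sum would force p^2 to divide the discriminant, which is the
  same at (n - ar + ma^2, r - 2ma) as at (n, r).\<close>

lemma T_coeff_nonsquare:
  fixes x :: "int => int => 'a::comm_ring_1"
  assumes p: "prime p"
    and ell: "\<And>n r l. x (n + l * r + int m * l\<^sup>2) (r + 2 * int m * l) = x n r"
    and nd: "\<not> (int p)\<^sup>2 dvd r\<^sup>2 - 4 * int m * n"
  shows "T_coeff m p x n r = of_nat p * x ((int p)\<^sup>2 * n) (int p * r) + of_int (int (nroots m p n r) - 1) * x n r"
proof -
  let ?p = "int p"
  have p0: "p > 0" using p prime_gt_0_nat by auto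
  have "(\<Sum>a\<in>{0..<?p}. if ?p\<^sup>2 dvd n - a * r + int m * a\<^sup>2 \<and> ?p dvd r - 2 * int m * a
         then x ((n - a * r + int m * a\<^sup>2) div ?p\<^sup>2) ((r - 2 * int m * a) div ?p) else 0) = 0"
  proof (rule sum.neutral, rule ballI)
    fix a
    have "\<not> (?p\<^sup>2 dvd n - a * r + int m * a\<^sup>2 \<and> ?p dvd r - 2 * int m * a)"
    proof
      assume a: "?p\<^sup>2 dvd n - a * r + int m * a\<^sup>2 \<and> ?p dvd r - 2 * int m * a"
      hence "?p\<^sup>2 dvd (r - 2 * int m * a)\<^sup>2 - 4 * int m * (n - a * r + int m * a\<^sup>2)" by (intro dvd_diff) auto
      also have "(r - 2 * int m * a)\<^sup>2 - 4 * int m * (n - a * r + int m * a\<^sup>2) = r\<^sup>2 - 4 * int m * n" by (simp add: algebra_simps power2_eq_square)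
      finally show False using nd by simp
    qed
    thus "(if ?p\<^sup>2 dvd n - a * r + int m * a\<^sup>2 \<and> ?p dvd r - 2 * int m * a
         then x ((n - a * r + int m * a\<^sup>2) div ?p\<^sup>2) ((r - 2 * int m * a) div ?p) else 0) = 0" by (simp only: if_False)
  qed
  thus ?thesis unfolding T_coeff_eq[OF p0 ell] by simp
qed

section \<open>A divisibility argument for integral Hecke modules\<close>

text \<open>A recursion with the
  characteristic polynomial \<open>p X\<^sup>2 - T X + 1\<close> whose solutions stay integral can only run along the
  \<open>p\<close>-adic unit root; this pins down the eigenvalue.\<close>

locale integral_operator =
  fixes L :: "('i => int) set" and T :: "('i => int) => 'i => int" and p :: int and d :: nat
  assumes p: "prime p"
    and lin: "x \<in> L ==> y \<in> L ==> (\<lambda>i. a * x i + b * y i) \<in> L"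
    and T_in: "x \<in> L ==> T x \<in> L"
    and T_lin: "x \<in> L ==> y \<in> L ==> T (\<lambda>i. a * x i + b * y i) = (\<lambda>i. a * T x i + b * T y i)"
    and sat: "x \<in> L ==> (\<And>i. p dvd x i) ==> (\<lambda>i. x i div p) \<in> L"
    and inj: "x \<in> L ==> (\<And>i. p dvd T x i) ==> p dvd x i"
    and rank: "(\<And>j. j \<le> d ==> f j \<in> L) ==> \<exists>n :: nat => int. (\<exists>j\<le>d. \<not> p dvd n j) \<and> (\<forall>i. (\<Sum>j\<le>d. n j * f j i) = 0)"

begin

lemma p_pos: "p > 0" using p by (simp add: prime_gt_0_int)

lemma zero_in: "x \<in> L ==> (\<lambda>i. 0) \<in> L" using lin[of x x 0 0] by simp

lemma T_pow_in: "x \<in> L ==> (T ^^ n) x \<in> L" by (induction n) (auto intro: T_in)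

lemma T_pow_lin: "x \<in> L ==> y \<in> L ==> (T ^^ n) (\<lambda>i. a * x i + b * y i) = (\<lambda>i. a * (T ^^ n) x i + b * (T ^^ n) y i)" by (induction n) (auto simp: T_lin T_pow_in)

lemma sum_in:
  assumes "c \<in> L" "finite A" "\<And>j. j \<in> A ==> f j \<in> L"
  shows "(\<lambda>i. \<Sum>j\<in>A. n j * f j i) \<in> L" using assms(2,3)
proof (induction A rule: finite_induct)
  case empty
  show ?case using zero_in[OF assms(1)] by simp
next
  case (insert j A)
  hence "(\<lambda>i. n j * f j i + 1 * (\<Sum>k\<in>A. n k * f k i)) \<in> L" by (intro lin) auto
  thus ?case using insert by simp
qed

lemma T_sum:
  assumes "c \<in> L" "finite A" "\<And>j. j \<in> A ==> f j \<in> L"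
  shows "(T ^^ k) (\<lambda>i. \<Sum>j\<in>A. n j * f j i) = (\<lambda>i. \<Sum>j\<in>A. n j * (T ^^ k) (f j) i)" using assms(2,3)
proof (induction A rule: finite_induct)
  case empty
  show ?case using T_pow_lin[OF assms(1,1), of k 0 0] by simp
next
  case (insert j A)
  hence "(T ^^ k) (\<lambda>i. n j * f j i + 1 * (\<Sum>k\<in>A. n k * f k i)) = (\<lambda>i. n j * (T ^^ k) (f j) i + 1 * (T ^^ k) (\<lambda>i. \<Sum>j\<in>A. n j * f j i) i)"
    by (intro T_pow_lin sum_in[OF assms(1)]) auto
  thus ?case using insert by simp
qed

lemma inj_pow: "x \<in> L ==> (\<And>i. p dvd (T ^^ n) x i) ==> p dvd x i"
proof (induction n arbitrary: i)
  case (Suc n)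
  have "p dvd (T ^^ n) x i" for i by (rule inj[OF T_pow_in]) (use Suc in auto)
  thus ?case using Suc by blast
qed simp

text \<open>The iterates of c up to T^d satisfy an integral relation that is nontrivial mod p. If
  n_j0 is its first coefficient prime to p, the relation reads T^j0 h = 0 mod p with h = n_j0 c + T
  e. Injectivity mod p cancels T^j0, and n_j0 is inverted mod p.\<close>

lemma T_surj_mod:
  assumes c: "c \<in> L"
  shows "\<exists>c1\<in>L. \<exists>c2\<in>L. \<forall>i. c i = T c1 i + p * c2 i"
proof -
  obtain n where n: "\<exists>j\<le>d. \<not> p dvd n j" "\<And>i. (\<Sum>j\<le>d. n j * (T ^^ j) c i) = 0" using rank[of "\<lambda>j. (T ^^ j) c"] T_pow_in[OF c] by blast
  define j0 where "j0 = (LEAST j. j \<le> d \<and> \<not> p dvd n j)"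
  have j0: "j0 \<le> d" "\<not> p dvd n j0" using LeastI_ex[of "\<lambda>j. j \<le> d \<and> \<not> p dvd n j"] n(1) unfolding j0_def by auto
  have lt: "p dvd n j" if "j < j0" for j using not_less_Least[of j "\<lambda>j. j \<le> d \<and> \<not> p dvd n j"] that j0(1) unfolding j0_def[symmetric] by auto
  define h where "h = (\<lambda>i. \<Sum>k\<le>d - j0. n (j0 + k) * (T ^^ k) c i)"
  have hL: "h \<in> L" unfolding h_def by (intro sum_in[OF c] T_pow_in[OF c]) auto
  have "p dvd h i" for i
  proof (rule inj_pow[OF hL])
    fix i
    have "(T ^^ j0) h i = (\<Sum>k\<le>d - j0. n (j0 + k) * (T ^^ j0) ((T ^^ k) c) i)"
      unfolding h_def using T_sum[OF c, of "{..d - j0}" "\<lambda>k. (T ^^ k) c" j0 "\<lambda>k. n (j0 + k)"] T_pow_in[OF c] by simp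
    also have "\<dots> = (\<Sum>j\<in>{j0..d}. n j * (T ^^ j) c i)" by (rule sum.reindex_bij_witness[where i = "\<lambda>j. j - j0" and j = "\<lambda>k. j0 + k"])
         (use j0 in \<open>auto simp: funpow_add\<close>)
    also have "\<dots> = - (\<Sum>j<j0. n j * (T ^^ j) c i)"
    proof -
      have "{..d} = {..<j0} \<union> {j0..d}" using j0(1) by auto
      hence "(\<Sum>j\<le>d. n j * (T ^^ j) c i) = (\<Sum>j<j0. n j * (T ^^ j) c i) + (\<Sum>j\<in>{j0..d}. n j * (T ^^ j) c i)" by (simp add: sum.union_disjoint ivl_disj_int)
      thus ?thesis using n(2)[of i] by simp
    qed
    finally have e: "(T ^^ j0) h i = - (\<Sum>j<j0. n j * (T ^^ j) c i)" .
    have "p dvd (\<Sum>j<j0. n j * (T ^^ j) c i)" by (intro dvd_sum dvd_mult2 lt) auto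
    thus "p dvd (T ^^ j0) h i" unfolding e by simp
  qed
  hence h': "(\<lambda>i. h i div p) \<in> L" "\<And>i. h i = p * (h i div p)" using sat[OF hL] by auto
  define e where "e = (\<lambda>i. \<Sum>k<d - j0. n (j0 + Suc k) * (T ^^ k) c i)"
  have eL: "e \<in> L" unfolding e_def by (intro sum_in[OF c] T_pow_in[OF c]) auto
  have "T e i = (\<Sum>k<d - j0. n (j0 + Suc k) * (T ^^ Suc k) c i)" for i
    using T_sum[OF c, of "{..<d - j0}" "\<lambda>k. (T ^^ k) c" 1 "\<lambda>k. n (j0 + Suc k)"] T_pow_in[OF c] unfolding e_def by simp
  hence he: "h i = n j0 * c i + T e i" for i unfolding h_def by (subst sum.atMost_shift) simp
  have "coprime (n j0) p" using p j0(2) by (simp add: prime_imp_coprime coprime_commute)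
  then obtain u v where uv: "u * n j0 + v * p = 1" using bezout_int[of "n j0" p] by auto
  have "c i = T (\<lambda>i. (- u) * e i + 0 * e i) i + p * (u * (h i div p) + v * c i)" for i
  proof -
    have "c i = (u * n j0 + v * p) * c i" using uv by simp
    also have "\<dots> = u * (h i - T e i) + p * (v * c i)" unfolding he by (simp add: algebra_simps)
    also have "\<dots> = u * (p * (h i div p) - T e i) + p * (v * c i)" using h'(2)[of i] by simp
    finally show ?thesis using T_lin[OF eL eL, of "- u" 0] by (simp add: algebra_simps)
  qed
  moreover have "(\<lambda>i. (- u) * e i + 0 * e i) \<in> L" by (rule lin[OF eL eL])
  moreover have "(\<lambda>i. u * (h i div p) + v * c i) \<in> L" by (rule lin[OF h'(1) c])
  ultimately show ?thesis by (intro bexI[of _ "\<lambda>i. (- u) * e i + 0 * e i"] bexI[of _ "\<lambda>i. u * (h i div p) + v * c i"] allI)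
qed

lemma T_pow_surj_mod:
  assumes "c \<in> L"
  shows "\<exists>c1\<in>L. \<exists>c2\<in>L. \<forall>i. c i = (T ^^ n) c1 i + p * c2 i" using assms
proof (induction n arbitrary: c)
  case 0
  show ?case using 0 zero_in[OF 0] by (intro bexI[of _ c] bexI[of _ "\<lambda>i. 0"]) auto
next
  case (Suc n)
  obtain c1 c2 where c: "c1 \<in> L" "c2 \<in> L" "\<And>i. c i = (T ^^ n) c1 i + p * c2 i" using Suc by blast
  obtain c3 c4 where c': "c3 \<in> L" "c4 \<in> L" "\<And>i. c1 i = T c3 i + p * c4 i" using T_surj_mod[OF c(1)] by blast
  have "c1 = (\<lambda>i. 1 * T c3 i + p * c4 i)" using c'(3) by auto
  hence "(T ^^ n) c1 i = (T ^^ n) (T c3) i + p * (T ^^ n) c4 i" for i using T_pow_lin[OF T_in[OF c'(1)] c'(2), of n 1 p] by simp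
  hence "c i = (T ^^ Suc n) c3 i + p * (1 * (T ^^ n) c4 i + 1 * c2 i)" for i using c(3)[of i] by (simp add: funpow_swap1 algebra_simps)
  moreover have "(\<lambda>i. 1 * (T ^^ n) c4 i + 1 * c2 i) \<in> L" by (rule lin[OF T_pow_in[OF c'(2)] c(2)])
  ultimately show ?case using c'(1) by (intro bexI[of _ c3] bexI[of _ "\<lambda>i. 1 * (T ^^ n) c4 i + 1 * c2 i"] allI)
qed

text \<open>Write c = T^n c1 + p c2 = Q_n c1 + p g. On the first summand y is divisible by p^n, on
  the second it is p times another value of y. By induction y c is divisible by every power of p,
  hence 0.\<close>

lemma functional_eq_0:
  fixes y :: "('i => int) => int"
  assumes y: "\<And>a b x z. x \<in> L ==> z \<in> L ==> y (\<lambda>i. a * x i + b * z i) = a * y x + b * y z"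
    and Q: "\<And>n x. x \<in> L ==> Q n x \<in> L \<and> (\<exists>e\<in>L. \<forall>i. Q n x i = (T ^^ n) x i + p * e i)"
    and div: "\<And>n x. x \<in> L ==> p ^ n dvd y (Q n x)"
    and c: "c \<in> L"
  shows "y c = 0"
proof -
  have main: "k \<le> n ==> c \<in> L ==> p ^ k dvd y c" for k n c
  proof (induction k arbitrary: c)
    case (Suc k)
    obtain c1 c2 where c: "c1 \<in> L" "c2 \<in> L" "\<And>i. c i = (T ^^ n) c1 i + p * c2 i" using T_pow_surj_mod[OF Suc(3)] by blast
    obtain e where e: "e \<in> L" "\<And>i. Q n c1 i = (T ^^ n) c1 i + p * e i" using Q[OF c(1)] by blast
    have g: "(\<lambda>i. 1 * c2 i + (- 1) * e i) \<in> L" by (rule lin[OF c(2) e(1)])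
    have "c = (\<lambda>i. 1 * Q n c1 i + p * (1 * c2 i + (- 1) * e i))" using c(3) e(2) by (auto simp: algebra_simps)
    hence "y c = 1 * y (Q n c1) + p * y (\<lambda>i. 1 * c2 i + (- 1) * e i)" using y[OF _ g, of "Q n c1" 1 p] Q[OF c(1), of n] by simp
    moreover have "p ^ Suc k dvd y (Q n c1)" using div[OF c(1), of n] Suc(2) by (meson dvd_trans le_imp_power_dvd)
    moreover have "p ^ Suc k dvd p * y (\<lambda>i. 1 * c2 i + (- 1) * e i)" using Suc(1)[OF _ g] Suc(2) by simp
    ultimately show ?case by simp
  qed simp
  show ?thesis
  proof (rule ccontr)
    assume "y c \<noteq> 0"
    moreover have "p ^ nat \<bar>y c\<bar> dvd y c" by (rule main[OF order_refl c])
    ultimately have "p ^ nat \<bar>y c\<bar> \<le> \<bar>y c\<bar>" using dvd_imp_le_int p_pos by force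
    moreover have "p \<ge> 2" using p by (simp add: prime_ge_2_int)
    hence "2 ^ nat \<bar>y c\<bar> \<le> p ^ nat \<bar>y c\<bar>" by (intro power_mono) auto
    moreover have "int (nat \<bar>y c\<bar>) < 2 ^ nat \<bar>y c\<bar>" using less_exp[of "nat \<bar>y c\<bar>"] by (metis of_nat_less_iff of_nat_numeral of_nat_power)
    ultimately show False by simp
  qed
qed

text \<open>The polynomials P_(n+2) = T P_(n+1) - p P_n in T, congruent to T^n mod p. The factors 1
  and - p are spelled out so that closure of L under combinations applies literally.\<close>

fun P_op :: "nat => ('i => int) => 'i => int" where
  "P_op 0 c = c"
| "P_op (Suc 0) c = T c"
| "P_op (Suc (Suc n)) c = (\<lambda>i. 1 * P_op (Suc n) (T c) i + (- p) * P_op n c i)"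

lemma P_op_props: "c \<in> L ==> P_op n c \<in> L \<and> (\<exists>e\<in>L. \<forall>i. P_op n c i = (T ^^ n) c i + p * e i)"
proof (induction n c rule: P_op.induct)
  case (1 c)
  thus ?case using zero_in[OF 1] by (auto intro!: bexI[of _ "\<lambda>i. 0"])
next
  case (2 c)
  thus ?case using zero_in[OF 2] T_in[OF 2] by (auto intro!: bexI[of _ "\<lambda>i. 0"])
next
  case (3 n c)
  have a: "P_op (Suc n) (T c) \<in> L" "P_op n c \<in> L" using 3 T_in by auto
  obtain e where e: "e \<in> L" "\<And>i. P_op (Suc n) (T c) i = (T ^^ Suc n) (T c) i + p * e i" using 3 T_in by blast
  have "P_op (Suc (Suc n)) c \<in> L" unfolding P_op.simps by (rule lin[OF a])
  moreover have "(\<lambda>i. 1 * e i + (- 1) * P_op n c i) \<in> L" by (rule lin[OF e(1) a(2)])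
  moreover have "P_op (Suc (Suc n)) c i = (T ^^ Suc (Suc n)) c i + p * (1 * e i + (- 1) * P_op n c i)" for i using e(2)[of i] by (simp add: funpow_swap1 algebra_simps)
  ultimately show ?case by (intro conjI bexI[of _ "\<lambda>i. 1 * e i + (- 1) * P_op n c i"] allI)
qed

text \<open>Evaluation at s 0 turns P_n c into p^n c(s n): integrality along the tower becomes
  divisibility of one fixed functional.\<close>

theorem recursion_eps_0:
  assumes rec0: "\<And>c. c \<in> L ==> T c (s 0) = p * c (s (Suc 0))"
    and rec: "\<And>c k. c \<in> L ==> T c (s (Suc k)) = p * c (s (Suc (Suc k))) + c (s k)"
    and c: "c \<in> L"
  shows "c (s 0) = 0"
proof (rule functional_eq_0[where y = "\<lambda>c. c (s 0)" and Q = P_op])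
  have "c \<in> L ==> P_op n c (s 0) = p ^ n * c (s n)" for n c
  proof (induction n c rule: P_op.induct)
    case (3 n c)
    thus ?case using rec[OF 3(3), of n] T_in[OF 3(3)] by (simp add: algebra_simps)
  qed (auto simp: rec0)
  thus "x \<in> L ==> p ^ n dvd P_op n x (s 0)" for n x by simp
qed (use P_op_props c in auto)

text \<open>The variant of \<open>P_op\<close> for the defect from the eigenvalue ep (p + 1). The
  added multiples of c are chosen so that the defect of R_n c telescopes to p^(n+1) (c(s(n+1)) -
  ep^(n+1) c(s 0)).\<close>

fun R_op :: "int => nat => ('i => int) => 'i => int" where
  "R_op ep 0 c = c"
| "R_op ep (Suc 0) c = (\<lambda>i. 1 * T c i + (ep * p) * c i)"
| "R_op ep (Suc (Suc n)) c = (\<lambda>i. 1 * R_op ep (Suc n) (T c) i + p * ((- 1) * R_op ep n c i + (ep * (ep * p) ^ Suc n) * c i))"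

lemma R_op_props: "c \<in> L ==> R_op ep n c \<in> L \<and> (\<exists>e\<in>L. \<forall>i. R_op ep n c i = (T ^^ n) c i + p * e i)"
proof (induction ep n c rule: R_op.induct)
  case (1 ep c)
  thus ?case using zero_in[OF 1] by (auto intro!: bexI[of _ "\<lambda>i. 0"])
next
  case (2 ep c)
  have "(\<lambda>i. ep * c i + 0 * c i) \<in> L" by (rule lin[OF 2 2])
  moreover have "R_op ep (Suc 0) c i = (T ^^ Suc 0) c i + p * (ep * c i + 0 * c i)" for i by simp
  moreover have "R_op ep (Suc 0) c \<in> L" unfolding R_op.simps by (rule lin[OF T_in[OF 2] 2])
  ultimately show ?case by (intro conjI bexI[of _ "\<lambda>i. ep * c i + 0 * c i"] allI)
next
  case (3 ep n c)
  have a: "R_op ep (Suc n) (T c) \<in> L" "R_op ep n c \<in> L" using 3 T_in by auto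
  obtain e where e: "e \<in> L" "\<And>i. R_op ep (Suc n) (T c) i = (T ^^ Suc n) (T c) i + p * e i" using 3 T_in by blast
  have g: "(\<lambda>i. (- 1) * R_op ep n c i + (ep * (ep * p) ^ Suc n) * c i) \<in> L" by (rule lin[OF a(2) 3(3)])
  have "R_op ep (Suc (Suc n)) c \<in> L" unfolding R_op.simps by (rule lin[OF a(1) g])
  moreover have "(\<lambda>i. 1 * e i + 1 * ((- 1) * R_op ep n c i + (ep * (ep * p) ^ Suc n) * c i)) \<in> L" by (rule lin[OF e(1) g])
  moreover have "R_op ep (Suc (Suc n)) c i = (T ^^ Suc (Suc n)) c i + p * (1 * e i + 1 * ((- 1) * R_op ep n c i + (ep * (ep * p) ^ Suc n) * c i))" for i
    using e(2)[of i] by (simp add: funpow_swap1 algebra_simps)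
  ultimately show ?case by (intro conjI bexI[of _ "\<lambda>i. 1 * e i + 1 * ((- 1) * R_op ep n c i + (ep * (ep * p) ^ Suc n) * c i)"] allI)
qed

text \<open>The defect T c(s 0) - ep (p + 1) c(s 0) vanishes, and by the starting relation it equals
  p c(s 1) - ep p c(s 0).\<close>

theorem recursion_eps_1:
  assumes eps: "ep * ep = 1"
    and rec0: "\<And>c. c \<in> L ==> T c (s 0) = p * c (s (Suc 0)) + ep * c (s 0)"
    and rec: "\<And>c k. c \<in> L ==> T c (s (Suc k)) = p * c (s (Suc (Suc k))) + c (s k)"
    and c: "c \<in> L"
  shows "c (s (Suc 0)) = ep * c (s 0)"
proof -
  let ?y = "\<lambda>c. T c (s 0) - ep * (p + 1) * c (s 0)"
  have "?y c = 0"
  proof (rule functional_eq_0[where y = ?y and Q = "R_op ep"])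
    have y: "?y (\<lambda>i. a * x i + b * z i) = a * ?y x + b * ?y z" if "x \<in> L" "z \<in> L" for a b x z using T_lin[OF that] by (simp add: algebra_simps)
    thus "\<And>a b x z. x \<in> L ==> z \<in> L ==> ?y (\<lambda>i. a * x i + b * z i) = a * ?y x + b * ?y z" .
    have y1: "?y c = p * c (s (Suc 0)) - ep * p * c (s 0)" if "c \<in> L" for c using rec0[OF that] by (simp add: algebra_simps)
    have "c \<in> L ==> ?y (R_op ep n c) = p ^ Suc n * c (s (Suc n)) - (ep * p) ^ Suc n * c (s 0)" for n c
    proof (induction ep\<equiv>ep n c rule: R_op.induct)
      case (1 c)
      thus ?case using y1 by simp
    next
      case (2 c)
      have "?y (R_op ep (Suc 0) c) = 1 * ?y (T c) + (ep * p) * ?y c" unfolding R_op.simps by (rule y[OF T_in[OF 2] 2])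
      also have "\<dots> = p * (p * c (s (Suc (Suc 0))) + c (s 0)) - ep * p * (p * c (s (Suc 0)) + ep * c (s 0)) + ep * p * (p * c (s (Suc 0)) - ep * p * c (s 0))"
        unfolding y1[OF T_in[OF 2]] by (simp add: rec[OF 2] rec0[OF 2] algebra_simps)
      also have "\<dots> = p ^ Suc (Suc 0) * c (s (Suc (Suc 0))) - (ep * p) ^ Suc (Suc 0) * c (s 0) + (1 - ep * ep) * p * c (s 0)" by (simp add: algebra_simps)
      finally show ?case using eps by simp
    next
      case (3 n c)
      have T: "T c \<in> L" using T_in[OF 3(3)] .
      have "?y (R_op ep (Suc (Suc n)) c) = 1 * ?y (R_op ep (Suc n) (T c)) + p * ?y (\<lambda>i. (- 1) * R_op ep n c i + (ep * (ep * p) ^ Suc n) * c i)"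
        unfolding R_op.simps by (intro y lin) (use R_op_props T 3(3) in auto)
      also have "?y (\<lambda>i. (- 1) * R_op ep n c i + (ep * (ep * p) ^ Suc n) * c i) = (- 1) * ?y (R_op ep n c) + (ep * (ep * p) ^ Suc n) * ?y c" by (intro y) (use R_op_props 3(3) in auto)
      also have "?y (R_op ep (Suc n) (T c)) = p ^ Suc (Suc n) * (p * c (s (Suc (Suc (Suc n)))) + c (s (Suc n))) - (ep * p) ^ Suc (Suc n) * (p * c (s (Suc 0)) + ep * c (s 0))"
        using 3(1)[OF T] rec[OF 3(3)] rec0[OF 3(3)] by simp
      also have "?y (R_op ep n c) = p ^ Suc n * c (s (Suc n)) - (ep * p) ^ Suc n * c (s 0)" using 3(2)[OF 3(3)] by simp
      also have "?y c = p * c (s (Suc 0)) - ep * p * c (s 0)" by (rule y1[OF 3(3)])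
      also have "1 * (p ^ Suc (Suc n) * (p * c (s (Suc (Suc (Suc n)))) + c (s (Suc n))) - (ep * p) ^ Suc (Suc n) * (p * c (s (Suc 0)) + ep * c (s 0)))
          + p * ((- 1) * (p ^ Suc n * c (s (Suc n)) - (ep * p) ^ Suc n * c (s 0)) + (ep * (ep * p) ^ Suc n) * (p * c (s (Suc 0)) - ep * p * c (s 0)))
        = p ^ Suc (Suc (Suc n)) * c (s (Suc (Suc (Suc n)))) - (ep * p) ^ Suc (Suc (Suc n)) * c (s 0) + (1 - ep * ep) * p * (ep * p) ^ Suc n * c (s 0)" by (simp add: algebra_simps)
      finally show ?case using eps by simp
    qed
    thus "x \<in> L ==> p ^ n dvd ?y (R_op ep n x)" for n x by (simp add: power_mult_distrib mult.assoc dvd_diff)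
  qed (use R_op_props c in auto)
  hence "p * c (s (Suc 0)) = p * (ep * c (s 0))" using rec0[OF c] by (simp add: algebra_simps)
  thus ?thesis using p_pos by simp
qed

end

section \<open>Primes with prescribed quadratic character\<close>

lemma Legendre_values: "Legendre a p \<in> {-1, 0, 1}" by (simp add: Legendre_def)

lemma small_cong_eq:
  fixes x y :: int
  assumes "[x = y] (mod int p)" "2 < p" "\<bar>x\<bar> \<le> 1" "\<bar>y\<bar> \<le> 1"
  shows "x = y"
proof -
  have "int p dvd x - y" using assms(1) by (simp add: cong_iff_dvd_diff)
  thus ?thesis using zdvd_not_zless[of "x - y" "int p"] zdvd_not_zless[of "y - x" "int p"] assms by (cases x y rule: linorder_cases) (auto simp: dvd_diff_commute)
qed

lemma Legendre_mult:
  assumes "prime p" "2 < p"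
  shows "Legendre (a * b) (int p) = Legendre a (int p) * Legendre b (int p)"
proof (rule small_cong_eq[OF _ assms(2)])
  have "[Legendre a (int p) * Legendre b (int p) = a ^ ((p - 1) div 2) * b ^ ((p - 1) div 2)] (mod int p)" by (intro cong_mult euler_criterion assms)
  moreover have "[Legendre (a * b) (int p) = (a * b) ^ ((p - 1) div 2)] (mod int p)" by (rule euler_criterion[OF assms])
  ultimately show "[Legendre (a * b) (int p) = Legendre a (int p) * Legendre b (int p)] (mod int p)" by (metis cong_sym cong_trans power_mult_distrib)
qed (auto simp: Legendre_def)

lemma Legendre_cong:
  assumes "[a = b] (mod int p)"
  shows "Legendre a (int p) = Legendre b (int p)"
proof -
  have "[a = 0] (mod int p) \<longleftrightarrow> [b = 0] (mod int p)" using assms cong_sym cong_trans by blast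
  moreover have "QuadRes (int p) a \<longleftrightarrow> QuadRes (int p) b" unfolding QuadRes_def using assms cong_sym cong_trans by blast
  ultimately show ?thesis by (simp add: Legendre_def)
qed

lemma Legendre_1: "2 < p ==> Legendre 1 (int p) = 1"
proof -
  assume p: "2 < p"
  have "\<not> [1 = 0] (mod int p)" using p by (simp add: cong_0_iff)
  moreover have "QuadRes (int p) 1" unfolding QuadRes_def by (intro exI[of _ 1]) simp
  ultimately show ?thesis by (simp add: Legendre_def)
qed

lemma Legendre_prod:
  assumes "prime p" "2 < p" "finite A"
  shows "Legendre (int (\<Prod>A)) (int p) = (\<Prod>r\<in>A. Legendre (int r) (int p))" using assms(3) by (induction A rule: finite_induct) (auto simp: Legendre_1 assms Legendre_mult)

text \<open>Gauss's lemma with p = 2h + 1: among 2x for 1 \<le> x \<le> h, those exceeding h have x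
  > h/2, so their number is h - h div 2. Its parity depends on h mod 4, that is, on p mod 8.\<close>

lemma Legendre_2:
  assumes p: "prime p" "2 < p"
  shows "Legendre 2 (int p) = (if p mod 8 = 1 \<or> p mod 8 = 7 then 1 else -1)"
proof -
  have "\<not> [2 = 0] (mod int p)" using p(2) zdvd_not_zless[of 2 "int p"] by (auto simp: cong_0_iff)
  then interpret GAUSS p 2 using p by unfold_locales auto
  define h where "h = (int p - 1) div 2"
  have ph: "int p = 2 * h + 1" using p_eq2 unfolding h_def .
  have h0: "h > 0" using ph p(2) by linarith
  have C: "C = (\<lambda>x. 2 * x) ` {0<..h}"
  proof -
    have "(\<lambda>x. x * 2 mod int p) ` {0<..h} = (\<lambda>x. 2 * x) ` {0<..h}" by (rule image_cong) (use ph in auto)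
    thus ?thesis unfolding C_def B_def A_def image_image h_def[symmetric] .
  qed
  have E: "E = (\<lambda>x. 2 * x) ` {h div 2<..h}" unfolding E_def C h_def[symmetric] by auto
  have "card E = nat (h - h div 2)" unfolding E by (subst card_image) (auto simp: inj_on_def)
  hence L: "Legendre 2 (int p) = (-1) ^ nat (h - h div 2)" using gauss_lemma by simp
  define k where "k = nat h div 4"
  have "nat h = 4 * k + nat h mod 4" unfolding k_def by simp
  hence hk: "h = 4 * int k + int (nat h mod 4)" using h0 by linarith
  consider "nat h mod 4 = 0" | "nat h mod 4 = 1" | "nat h mod 4 = 2" | "nat h mod 4 = 3" by linarith
  thus ?thesis
  proof cases
    case 1
    hence "h = 4 * int k" using hk by simp
    hence "nat (h - h div 2) = 2 * k" "p = 8 * k + 1" using ph by auto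
    thus ?thesis unfolding L by simp
  next
    case 2
    hence "h = 4 * int k + 1" using hk by simp
    hence "nat (h - h div 2) = 2 * k + 1" "p = 8 * k + 3" using ph by auto
    thus ?thesis unfolding L by simp
  next
    case 3
    hence "h = 4 * int k + 2" using hk by simp
    hence "nat (h - h div 2) = 2 * k + 1" "p = 8 * k + 5" using ph by auto
    thus ?thesis unfolding L by simp
  next
    case 4
    hence "h = 4 * int k + 3" using hk by simp
    hence "nat (h - h div 2) = 2 * (k + 1)" "p = 8 * k + 7" using ph by auto
    thus ?thesis unfolding L by simp
  qed
qed

text \<open>The value of the Jacobi symbol \<open>(r / x)\<close> as predicted by quadratic reciprocity.\<close>

definition recip :: "nat => nat => int" where
  "recip r x = (if r = 2 then (if x mod 8 = 1 \<or> x mod 8 = 7 then 1 else -1)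
     else Legendre (int x) (int r) * (if x mod 4 = 3 \<and> r mod 4 = 3 then -1 else 1))"

lemma odd_mod_cases8: "odd (x::nat) ==> x mod 8 = 1 \<or> x mod 8 = 3 \<or> x mod 8 = 5 \<or> x mod 8 = 7" by presburger

lemma odd_mod_cases4: "odd (x::nat) ==> x mod 4 = 1 \<or> x mod 4 = 3" by presburger

lemma recip_mult:
  assumes r: "prime r" and xy: "odd x" "odd y"
  shows "recip r (x * y) = recip r x * recip r y"
proof (cases "r = 2")
  case True
  define X Y where "X = x mod 8" and "Y = y mod 8"
  have e: "(x * y) mod 8 = (X * Y) mod 8" unfolding X_def Y_def by (simp only: mod_mult_eq)
  show ?thesis using odd_mod_cases8[OF xy(1)] odd_mod_cases8[OF xy(2)] True unfolding recip_def e X_def[symmetric] Y_def[symmetric] by auto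
next
  case False
  hence r2: "2 < r" using r prime_ge_2_nat[OF r] by simp
  define X Y where "X = x mod 4" and "Y = y mod 4"
  have e: "(x * y) mod 4 = (X * Y) mod 4" unfolding X_def Y_def by (simp only: mod_mult_eq)
  show ?thesis using odd_mod_cases4[OF xy(1)] odd_mod_cases4[OF xy(2)] False unfolding recip_def e X_def[symmetric] Y_def[symmetric] by (auto simp: Legendre_mult[OF r r2])
qed

lemma recip_prime:
  assumes r: "prime r" and p: "prime p" "2 < p" "p \<noteq> r"
  shows "recip r p = Legendre (int r) (int p)"
proof (cases "r = 2")
  case True
  thus ?thesis using Legendre_2[OF p(1,2)] by (simp add: recip_def)
next
  case False
  hence r2: "2 < r" using r prime_ge_2_nat[OF r] by simp
  have or: "odd r" and op: "odd p" using r r2 p prime_odd_nat by auto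
  have "\<not> int p dvd int r" using r p primes_dvd_imp_eq by auto
  hence nz: "Legendre (int r) (int p) * Legendre (int r) (int p) = 1" by (auto simp: Legendre_def cong_0_iff)
  have QR: "Legendre (int p) (int r) * Legendre (int r) (int p) = (-1) ^ ((p - 1) div 2 * ((r - 1) div 2))" by (rule Quadratic_Reciprocity) (use p r r2 in auto)
  have m3: "odd ((u - 1) div 2) \<longleftrightarrow> u mod 4 = 3" if "odd u" for u :: nat using that by presburger
  have "(-1) ^ ((p - 1) div 2 * ((r - 1) div 2)) = (if p mod 4 = 3 \<and> r mod 4 = 3 then -1 else (1::int))"
  proof (cases "p mod 4 = 3 \<and> r mod 4 = 3")
    case True
    hence "odd ((p - 1) div 2 * ((r - 1) div 2))" using m3[OF op] m3[OF or] by simp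
    thus ?thesis using True by simp
  next
    case False
    hence "even ((p - 1) div 2 * ((r - 1) div 2))" using m3[OF op] m3[OF or] unfolding even_mult_iff by blast
    thus ?thesis using False by (simp only: if_False) (rule neg_one_even_power)
  qed
  with QR have "Legendre (int p) (int r) * (Legendre (int r) (int p) * Legendre (int r) (int p)) = (if p mod 4 = 3 \<and> r mod 4 = 3 then -1 else 1) * Legendre (int r) (int p)"
    by (simp only: mult.assoc[symmetric])
  hence "Legendre (int p) (int r) = (if p mod 4 = 3 \<and> r mod 4 = 3 then -1 else 1) * Legendre (int r) (int p)" unfolding nz by simp
  thus ?thesis using False by (auto simp: recip_def)
qed

text \<open>A primitive root is a nonresidue, by Euler's criterion.\<close>

lemma exists_nonresidue_mod_prime:
  assumes q: "prime q" "2 < q"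
  shows "\<exists>v. Legendre (int v) (int q) = -1"
proof -
  obtain g where g: "residue_primroot q g" using prime_primitive_root_exists[of q] q by auto
  hence o: "ord q g = q - 1" and c: "coprime q g" using totient_prime[OF q(1)] by (auto simp: residue_primroot_def)
  have "\<not> q - 1 dvd (q - 1) div 2" using q(2) by (auto dest: dvd_imp_le)
  hence "\<not> [g ^ ((q - 1) div 2) = 1] (mod q)" unfolding ord_divides o .
  hence "\<not> [int g ^ ((q - 1) div 2) = 1] (mod int q)" using cong_int_iff[of "g ^ ((q - 1) div 2)" 1 q] by simp
  hence "Legendre (int g) (int q) \<noteq> 1" using euler_criterion[OF q, of "int g"] by (metis cong_sym)
  moreover have "\<not> q dvd g" using c q(1) coprime_common_divisor[of q g q] not_prime_unit by auto
  hence "Legendre (int g) (int q) \<noteq> 0" by (simp add: Legendre_def cong_0_iff)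
  ultimately show ?thesis using Legendre_values[of "int g" "int q"] by blast
qed

text \<open>A substitute for Dirichlet's theorem. If (s/p) were 1 at all primes p prime to N, the
  multiplicative \<open>ch\<close>, which is (s/p) at such p by reciprocity, would be 1 at every x
  prime to N. But \<open>ch\<close> depends only on residues of x, so the Chinese remainder theorem
  provides an x with value -1.\<close>

lemma exists_prime_nonresidue:
  assumes s: "squarefree s" "s > 1" and M: "M > 0"
  shows "\<exists>p. prime p \<and> 2 < p \<and> \<not> p dvd M \<and> Legendre (int s) (int p) = -1"
proof (rule ccontr)
  assume contr: "\<not> ?thesis"
  define N where "N = 2 * s * M"
  have N: "N > 0" using s M by (simp add: N_def)
  let ?A = "prime_factors s"
  have s0: "s \<noteq> 0" using s by simp
  have g2: "2 < r" if "r \<in> ?A" "r \<noteq> 2" for r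
  proof -
    have "prime r" using that by auto
    thus ?thesis using prime_ge_2_nat[of r] that(2) by linarith
  qed
  have sprod: "s = \<Prod>?A"
  proof -
    have m: "p ^ multiplicity p s = p" if "p \<in> ?A" for p using that s(1) unfolding squarefree_factorial_semiring'[OF s0] by simp
    have 1: "(\<Prod>p\<in>?A. p ^ multiplicity p s) = s" by (rule trans[OF prod_prime_factors[OF s0]]) simp
    have 2: "(\<Prod>p\<in>?A. p ^ multiplicity p s) = \<Prod>?A" by (rule prod.cong[OF refl m])
    show ?thesis by (rule trans[OF 1[symmetric] 2])
  qed
  define ch where "ch = (\<lambda>x. \<Prod>r\<in>?A. recip r x)"
  have chi_prime: "ch p = 1" if p: "prime p" "coprime p N" for p
  proof -
    have pN: "\<not> p dvd N"
    proof
      assume "p dvd N"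
      from coprime_common_divisor[OF p(2) dvd_refl this] have "p = 1" by simp
      thus False using p(1) not_prime_1 by blast
    qed
    hence p2: "2 < p" using prime_ge_2_nat[OF p(1)] by (cases "p = 2") (auto simp: N_def)
    have ps: "\<not> p dvd s" using pN by (auto simp: N_def)
    have "ch p = (\<Prod>r\<in>?A. Legendre (int r) (int p))" unfolding ch_def
    proof (rule prod.cong[OF refl])
      fix r assume r: "r \<in> ?A"
      hence "p \<noteq> r" using ps by auto
      thus "recip r p = Legendre (int r) (int p)" using r p p2 by (intro recip_prime) auto
    qed
    also have "\<dots> = Legendre (int s) (int p)" using Legendre_prod[OF p(1) p2, of ?A] unfolding sprod[symmetric] by simp
    also have "\<dots> = 1"
    proof -
      have "Legendre (int s) (int p) \<noteq> -1" using contr p p2 pN by (auto simp: N_def)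
      moreover have "Legendre (int s) (int p) \<noteq> 0" using ps by (auto simp: Legendre_def cong_0_iff)
      ultimately show ?thesis using Legendre_values[of "int s" "int p"] by auto
    qed
    finally show ?thesis .
  qed
  have chi: "ch x = 1" if "x > 0" "coprime x N" for x using that
  proof (induction x rule: prime_divisors_induct)
    case zero
    thus ?case by simp
  next
    case (unit x)
    hence x: "x = 1" by simp
    have "recip r 1 = 1" if "r \<in> ?A" for r
    proof (cases "r = 2")
      case False
      hence "2 < r" using g2[OF that] by simp
      thus ?thesis using False by (simp add: recip_def Legendre_1)
    qed (simp add: recip_def)
    thus ?case by (simp add: ch_def x)
  next
    case (factor p x)
    have c: "coprime p N" "coprime x N" using factor by auto
    have "odd p" "odd x" using c by (auto simp: N_def)
    hence "ch (p * x) = ch p * ch x" unfolding ch_def prod.distrib[symmetric] by (intro prod.cong refl recip_mult) auto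
    thus ?case using chi_prime[OF factor(1) c(1)] factor c by simp
  qed
  have "\<exists>x>0. coprime x N \<and> ch x = -1"
  proof (cases "\<exists>q\<in>?A. q \<noteq> 2")
    case True
    then obtain q where q: "q \<in> ?A" "q \<noteq> 2" by blast
    have qp: "prime q" "2 < q" using q g2[OF q] by auto
    obtain v where v: "Legendre (int v) (int q) = -1" using exists_nonresidue_mod_prime[OF qp] by blast
    have "N \<noteq> 0" "\<not> is_unit q" using N qp(1) not_prime_unit by auto
    from multiplicity_decompose'[OF this] obtain k N0 where N0: "N = q ^ k * N0" "\<not> q dvd N0" by blast
    have "coprime q 8" using prime_imp_coprime_nat[OF qp(1), of 2] qp(2) nat_dvd_not_less[of 2 q] coprime_power_right_iff[of q 2 3] by simp
    hence "coprime q (8 * N0)" using prime_imp_coprime_nat[OF qp(1) N0(2)] by simp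
    \<comment> \<open>A nonresidue mod q that is 1 modulo 8 and modulo the other primes of N: only
      the factor at q becomes -1.\<close>
    from binary_chinese_remainder_nat[OF this, of v 1]
    obtain x where x: "[x = v] (mod q)" "[x = 1] (mod 8 * N0)" by blast
    have x8: "[x = 1] (mod 8)" and xN0: "[x = 1] (mod N0)" using x(2) cong_modulus_mult_nat[of x 1 8 N0] cong_modulus_mult_nat[of x 1 N0 8] by (auto simp: mult.commute)
    have xq: "Legendre (int x) (int q) = -1" using Legendre_cong[of "int x" "int v" q] x(1) v by (simp add: cong_int_iff)
    have "\<not> q dvd x" using xq by (auto simp: Legendre_def cong_0_iff split: if_splits)
    hence "coprime x q" using prime_imp_coprime_nat[OF qp(1)] coprime_commute by blast
    moreover have "coprime x N0" using cong_imp_coprime[OF cong_sym[OF xN0]] by simp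
    ultimately have cN: "coprime x N" by (simp add: N0)
    have x4: "x mod 4 = 1"
    proof -
      have "x mod 8 = 1" using x8 by (simp add: cong_def)
      thus ?thesis by presburger
    qed
    have oth: "recip r x = 1" if r: "r \<in> ?A" "r \<noteq> q" for r
    proof (cases "r = 2")
      case True
      thus ?thesis using x8 by (simp add: recip_def cong_def)
    next
      case False
      have rp: "prime r" "2 < r" using r g2[OF r(1) False] by auto
      have "r dvd N" using r by (auto simp: N_def)
      hence "r dvd q ^ k \<or> r dvd N0" using rp(1) by (simp add: N0 prime_dvd_mult_iff)
      hence "r dvd N0" using rp qp r(2) primes_dvd_imp_eq prime_dvd_power by blast
      hence "[x = 1] (mod r)" using xN0 cong_dvd_modulus_nat by blast
      hence "Legendre (int x) (int r) = Legendre 1 (int r)" using Legendre_cong[of "int x" 1 r] cong_int_iff[of x 1 r] by simp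
      thus ?thesis using False x4 Legendre_1[OF rp(2)] by (simp add: recip_def)
    qed
    have "ch x = recip q x * (\<Prod>r\<in>?A - {q}. recip r x)" unfolding ch_def by (rule prod.remove) (use q in auto)
    also have "\<dots> = -1" using oth xq q x4 by (simp add: recip_def)
    finally have "ch x = -1" .
    moreover have "x > 0" using x4 by (cases x) auto
    ultimately show ?thesis using cN by blast
  next
    case False
    have "?A \<noteq> {}" using s by (simp add: prime_factorization_empty_iff)
    hence A: "?A = {2}" using False by auto
    have "N \<noteq> 0" "\<not> is_unit (2::nat)" using N by auto
    from multiplicity_decompose'[OF this] obtain k N0 where N0: "N = 2 ^ k * N0" "\<not> 2 dvd N0" by blast
    have "coprime 8 N0" using prime_imp_coprime_nat[OF two_is_prime_nat N0(2)] coprime_power_left_iff[of 2 3 N0] by simp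
    \<comment> \<open>Here s = 2, and the only factor is the character mod 8, which is -1 at
      5.\<close>
    from binary_chinese_remainder_nat[OF this, of 5 1]
    obtain x where x: "[x = 5] (mod 8)" "[x = 1] (mod N0)" by blast
    have x8: "x mod 8 = 5" using x(1) by (simp add: cong_def)
    hence "odd x" by presburger
    moreover have "coprime x N0" using cong_imp_coprime[OF cong_sym[OF x(2)]] by simp
    ultimately have "coprime x N" by (simp add: N0)
    moreover have "ch x = -1" unfolding ch_def A by (simp add: recip_def x8)
    moreover have "x > 0" using x8 by (cases x) auto
    ultimately show ?thesis by blast
  qed
  thus False using chi by force
qed

text \<open>With g = gcd(t1, t2) the product t1 t2 is g^2 a b, where a b > 1 is squarefree; a prime
  modulo which a b is a nonresidue separates the two symbols.\<close>

lemma exists_separating_prime: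
  assumes t: "squarefree t1" "squarefree t2" "t1 \<noteq> t2" and M: "M > 0"
  shows "\<exists>p. prime p \<and> 2 < p \<and> \<not> p dvd M \<and> \<not> p dvd t1 \<and> \<not> p dvd t2 \<and>
    Legendre (- int t1) (int p) \<noteq> Legendre (- int t2) (int p)"
proof -
  have t0: "t1 > 0" "t2 > 0" using t(1,2) not_squarefree_0 by (auto intro!: gr0I)
  define g where "g = gcd t1 t2"
  have g0: "g > 0" using t0 by (simp add: g_def)
  obtain a b where ab: "t1 = g * a" "t2 = g * b" "coprime a b" using gcd_coprime_exists[of t1 t2] t0 unfolding g_def by (auto simp: mult.commute)
  have sf: "squarefree (a * b)" using t ab squarefree_mult_coprime[OF ab(3)] squarefree_mono[of a t1] squarefree_mono[of b t2] by simp
  have "a * b \<noteq> 1" using t(3) ab by auto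
  moreover have "a * b \<noteq> 0" using t0 ab by auto
  ultimately have "a * b > 1" by linarith
  from exists_prime_nonresidue[OF sf this, of "M * t1 * t2"] M t0
  obtain p where p: "prime p" "2 < p" "\<not> p dvd M * t1 * t2" "Legendre (int (a * b)) (int p) = -1" by auto
  have pn: "\<not> p dvd M" "\<not> p dvd t1" "\<not> p dvd t2" using p(3) by auto
  have "Legendre (- int t1) (int p) * Legendre (- int t2) (int p) = Legendre (int g * int g * int (a * b)) (int p)" unfolding Legendre_mult[OF p(1,2), symmetric] by (simp add: ab algebra_simps)
  also have "\<dots> = Legendre (int g) (int p) * Legendre (int g) (int p) * -1" by (simp only: Legendre_mult[OF p(1,2)] p(4))
  also have "Legendre (int g) (int p) * Legendre (int g) (int p) = 1"
  proof -
    have "\<not> int p dvd int g" using pn(2) ab by auto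
    thus ?thesis by (auto simp: Legendre_def cong_0_iff)
  qed
  finally have "Legendre (- int t1) (int p) \<noteq> Legendre (- int t2) (int p)" using Legendre_values[of "- int t2" "int p"] by auto
  thus ?thesis using p pn by blast
qed

section \<open>Theta series and the prime form\<close>

lemma exp_minus_abs_summable: "(\<lambda>k::int. exp (- real_of_int \<bar>k\<bar>)) summable_on UNIV"
proof -
  have nat: "(\<lambda>n::nat. exp (- real n)) summable_on UNIV"
  proof -
    have "summable (\<lambda>n. exp (- 1 :: real) ^ n)" by (rule summable_geometric) simp
    hence "summable (\<lambda>n. exp (- real n))" by (simp add: exp_of_nat_mult[symmetric] flip: exp_of_nat_mult)
    thus ?thesis by (simp add: summable_on_UNIV_nonneg_real_iff)
  qed
  have 1: "(\<lambda>k::int. exp (- real_of_int \<bar>k\<bar>)) summable_on {0..}"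
  proof -
    have "bij_betw int UNIV {0..}" by (rule bij_betwI[where g = nat]) auto
    from summable_on_reindex_bij_betw[OF this, of "\<lambda>k. exp (- real_of_int \<bar>k\<bar>)"] nat show ?thesis by simp
  qed
  have 2: "(\<lambda>k::int. exp (- real_of_int \<bar>k\<bar>)) summable_on {..0}"
  proof -
    have "bij_betw (\<lambda>n. - int n) UNIV {..0}" by (rule bij_betwI[where g = "\<lambda>k. nat (- k)"]) auto
    from summable_on_reindex_bij_betw[OF this, of "\<lambda>k. exp (- real_of_int \<bar>k\<bar>)"] nat show ?thesis by simp
  qed
  have "(\<lambda>k::int. exp (- real_of_int \<bar>k\<bar>)) summable_on {..<0}" by (rule summable_on_subset_banach[OF 2]) auto
  with 1 have "(\<lambda>k::int. exp (- real_of_int \<bar>k\<bar>)) summable_on {0..} \<union> {..<0}" by (rule summable_on_Un_disjoint) auto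
  moreover have "{0..} \<union> {..<0} = (UNIV :: int set)" by auto
  ultimately show ?thesis by simp
qed

text \<open>Completing the square bounds the exponent by a constant minus |k|.\<close>

lemma gauss_summable:
  assumes "\<alpha> > 0"
  shows "(\<lambda>k::int. exp (- \<alpha> * (real_of_int k)\<^sup>2 + \<beta> * \<bar>real_of_int k\<bar>)) summable_on UNIV"
proof (rule summable_on_comparison_test)
  let ?C = "exp ((\<beta> + 1)\<^sup>2 / (4 * \<alpha>))"
  show "(\<lambda>k::int. ?C * exp (- real_of_int \<bar>k\<bar>)) summable_on UNIV" by (intro summable_on_cmult_right exp_minus_abs_summable)
  fix k :: int
  have "0 \<le> (2 * \<alpha> * \<bar>real_of_int k\<bar> - (\<beta> + 1))\<^sup>2 / (4 * \<alpha>)" using assms by simp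
  also have "\<dots> = \<alpha> * (real_of_int k)\<^sup>2 - (\<beta> + 1) * \<bar>real_of_int k\<bar> + (\<beta> + 1)\<^sup>2 / (4 * \<alpha>)" using assms by (simp add: field_simps power2_eq_square)
  finally have "- \<alpha> * (real_of_int k)\<^sup>2 + \<beta> * \<bar>real_of_int k\<bar> \<le> (\<beta> + 1)\<^sup>2 / (4 * \<alpha>) + - real_of_int \<bar>k\<bar>" by (simp add: algebra_simps)
  thus "exp (- \<alpha> * (real_of_int k)\<^sup>2 + \<beta> * \<bar>real_of_int k\<bar>) \<le> ?C * exp (- real_of_int \<bar>k\<bar>)" by (simp flip: exp_add)
qed auto

text \<open>A double Fourier series supported on the graph n = N r. One convergence proof then
  serves the odd theta series \<open>th\<close> and the index m series \<open>vt\<close>.\<close>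

definition curve_series :: "(int => int) => (int => complex) => complex => complex => complex" where
  "curve_series N s t z = (\<Sum>\<^sub>\<infinity>r. s r * e2pi (of_int (N r) * t + of_int r * z))"

definition quad_growth :: "(int => int) => bool" where
  "quad_growth N \<longleftrightarrow> (\<exists>a>0. \<exists>b. \<forall>r. a * (real_of_int r)\<^sup>2 - b * \<bar>real_of_int r\<bar> - b \<le> real_of_int (N r))"

lemma curve_series_has_sum:
  assumes N: "quad_growth N" and s: "\<And>r. norm (s r) \<le> B" and t: "Im t > 0"
  shows "((\<lambda>r. s r * e2pi (of_int (N r) * t + of_int r * z)) has_sum curve_series N s t z) UNIV"
proof -
  obtain a b where ab: "a > 0" "\<And>r. a * (real_of_int r)\<^sup>2 - b * \<bar>real_of_int r\<bar> - b \<le> real_of_int (N r)" using N unfolding quad_growth_def by blast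
  let ?y = "2 * pi * Im t"
  let ?e = "\<lambda>r. - (?y * a) * (real_of_int r)\<^sup>2 + (?y * b + 2 * pi * \<bar>Im z\<bar>) * \<bar>real_of_int r\<bar>"
  have "(\<lambda>r. norm (s r * e2pi (of_int (N r) * t + of_int r * z))) summable_on UNIV"
  proof (rule summable_on_comparison_test)
    show "(\<lambda>r. (B * exp (?y * b)) * exp (?e r)) summable_on UNIV" by (intro summable_on_cmult_right gauss_summable) (use t ab(1) in simp)
    fix r
    have B: "B \<ge> 0" using s[of r] norm_ge_zero[of "s r"] by linarith
    have "?y * (a * (real_of_int r)\<^sup>2 - b * \<bar>real_of_int r\<bar> - b) \<le> ?y * real_of_int (N r)" using t ab(2) by (intro mult_left_mono) auto
    moreover have "- (real_of_int r * Im z) \<le> \<bar>real_of_int r\<bar> * \<bar>Im z\<bar>" using abs_ge_minus_self[of "real_of_int r * Im z"] by (simp add: abs_mult)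
    hence "2 * pi * - (real_of_int r * Im z) \<le> 2 * pi * (\<bar>real_of_int r\<bar> * \<bar>Im z\<bar>)" by (intro mult_left_mono) auto
    ultimately have "norm (e2pi (of_int (N r) * t + of_int r * z)) \<le> exp (?y * b) * exp (?e r)" unfolding norm_e2pi exp_add[symmetric] by (simp add: algebra_simps)
    thus "norm (s r * e2pi (of_int (N r) * t + of_int r * z)) \<le> (B * exp (?y * b)) * exp (?e r)" unfolding norm_mult mult.assoc by (intro mult_mono s B) auto
  qed auto
  thus ?thesis unfolding curve_series_def by (rule has_sum_infsum[OF abs_summable_summable])
qed

lemma curve_series_expands:
  assumes N: "quad_growth N" and s: "\<And>r. norm (s r) \<le> B"
  shows "expands (curve_series N s) (\<lambda>n r. if n = N r then s r else 0)"
proof (rule expandsI)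
  fix t z :: complex assume t: "Im t > 0"
  let ?c = "\<lambda>n r. if n = N r then s r else 0"
  have "((\<lambda>r. s r * e2pi (of_int (N r) * t + of_int r * z)) has_sum curve_series N s t z) UNIV" by (rule curve_series_has_sum[OF N s t])
  also have "?this \<longleftrightarrow> (fterm ?c t z has_sum curve_series N s t z) {(n, r). n = N r}" by (rule has_sum_reindex_bij_witness[where j = "\<lambda>r. (N r, r)" and i = snd]) auto
  also have "\<dots> \<longleftrightarrow> (fterm ?c t z has_sum curve_series N s t z) UNIV" by (rule has_sum_cong_neutral) (auto split: if_splits)
  finally show "(fterm ?c t z has_sum curve_series N s t z) UNIV" .
qed

lemma curve_series_int_expansion:
  assumes N: "quad_growth N" and N0: "\<And>r. \<bar>r\<bar> \<le> N r + 1" "\<And>r. 0 \<le> N r"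
    and s: "\<And>r. norm (s r) \<le> B" "\<And>r. s r \<in> \<int>"
  shows "int_expansion (curve_series N s)"
proof -
  have "finite {r. (if n = N r then s r else 0) \<noteq> 0}" for n
  proof (rule finite_subset)
    show "{r. (if n = N r then s r else 0) \<noteq> 0} \<subseteq> {- (n + 1)..n + 1}" using N0(1) by (auto simp: abs_le_iff split: if_splits) (smt (verit))+
  qed auto
  hence "fourier_nice (\<lambda>n r. if n = N r then s r else 0)" unfolding fourier_nice_def using N0(2) by auto
  thus ?thesis unfolding int_expansion_def using curve_series_expands[OF N s(1)] s(2) by (intro exI[of _ "\<lambda>n r. if n = N r then s r else 0"]) auto
qed

section \<open>Entire functions with the quasi-periods of theta functions\<close>

lemma entire_quotient:
  fixes f g :: "complex => complex"
  assumes f: "f holomorphic_on UNIV" and g: "g holomorphic_on UNIV"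
    and z: "\<And>z. g z = 0 ==> f z = 0 \<and> deriv g z \<noteq> 0"
  shows "\<exists>h. h holomorphic_on UNIV \<and> (\<forall>z. f z = h z * g z)"
proof -
  define h where "h = (\<lambda>z. if g z = 0 then deriv f z / deriv g z else f z / g z)"
  have "h field_differentiable at a" for a
  proof (cases "g a = 0")
    case False
    have "open {z. g z \<noteq> 0}" using g holomorphic_on_imp_continuous_on by (intro open_Collect_neq) auto
    moreover have "(\<lambda>z. f z / g z) holomorphic_on {z. g z \<noteq> 0}" by (intro holomorphic_intros holomorphic_on_subset[OF f] holomorphic_on_subset[OF g]) auto
    hence "h holomorphic_on {z. g z \<noteq> 0}" by (rule holomorphic_transform) (auto simp: h_def)
    ultimately show ?thesis using False holomorphic_on_imp_differentiable_at by blast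
  next
    case True
    define F where "F = (\<lambda>z. if z = a then deriv f a else (f z - f a) / (z - a))"
    define G where "G = (\<lambda>z. if z = a then deriv g a else (g z - g a) / (z - a))"
    have F: "F holomorphic_on UNIV" unfolding F_def by (rule pole_lemma_open[OF f]) simp
    have G: "G holomorphic_on UNIV" unfolding G_def by (rule pole_lemma_open[OF g]) simp
    have fa: "f a = 0" "deriv g a \<noteq> 0" using z[OF True] by auto
    have "open {z. G z \<noteq> 0}" using G holomorphic_on_imp_continuous_on by (intro open_Collect_neq) auto
    moreover have "a \<in> {z. G z \<noteq> 0}" using fa by (simp add: G_def)
    moreover have "(\<lambda>z. F z / G z) holomorphic_on {z. G z \<noteq> 0}" by (intro holomorphic_intros holomorphic_on_subset[OF F] holomorphic_on_subset[OF G]) auto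
    hence "h holomorphic_on {z. G z \<noteq> 0}" by (rule holomorphic_transform) (auto simp: h_def F_def G_def True fa split: if_splits)
    ultimately show ?thesis using holomorphic_on_imp_differentiable_at by blast
  qed
  hence "h holomorphic_on UNIV" by (simp add: holomorphic_on_def field_differentiable_at_within)
  moreover have "f z = h z * g z" for z using z[of z] by (simp add: h_def)
  ultimately show ?thesis by blast
qed

lemma entire_cancel:
  fixes u v g :: "complex => complex"
  assumes "u holomorphic_on UNIV" "v holomorphic_on UNIV" "g holomorphic_on UNIV"
    and "\<And>z. u z * g z = v z * g z" and "g w \<noteq> 0"
  shows "u z = v z"
proof -
  have "open {z. g z \<noteq> 0}" using assms(3) holomorphic_on_imp_continuous_on by (intro open_Collect_neq) auto
  thus ?thesis by (rule analytic_continuation_open[of "{z. g z \<noteq> 0}" UNIV u v]) (use assms in auto)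
qed

lemma lattice_reduce:
  assumes "Im t > 0"
  shows "\<exists>w m n. z = w + of_int m * t + of_int n \<and> norm w \<le> norm t + 1"
proof -
  define b where "b = Im z / Im t"
  define a where "a = Re z - b * Re t"
  have z: "z = of_real a + of_real b * t" using assms by (simp add: complex_eq_iff a_def b_def)
  define w where "w = of_real (frac a) + of_real (frac b) * t"
  have "z = w + of_int \<lfloor>b\<rfloor> * t + of_int \<lfloor>a\<rfloor>" unfolding z w_def by (simp add: frac_def algebra_simps)
  moreover have "norm w \<le> norm (of_real (frac a) :: complex) + norm (of_real (frac b) * t)" unfolding w_def by (rule norm_triangle_ineq)
  hence "norm w \<le> \<bar>frac a\<bar> + \<bar>frac b\<bar> * norm t" by (simp add: norm_mult)
  moreover have "\<bar>frac a\<bar> \<le> 1" "\<bar>frac b\<bar> \<le> 1" using frac_lt_1[of a] frac_lt_1[of b] by (simp_all add: frac_ge_0 less_imp_le)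
  hence "\<bar>frac a\<bar> + \<bar>frac b\<bar> * norm t \<le> 1 + 1 * norm t" by (intro add_mono mult_right_mono) auto
  ultimately show ?thesis by (intro exI[of _ w] exI[of _ "\<lfloor>b\<rfloor>"] exI[of _ "\<lfloor>a\<rfloor>"]) simp
qed

text \<open>Periodicity is asked of the modulus only, which admits multipliers of modulus one. A
  bound on a compact set containing a period cell is then global, and Liouville's theorem
  applies.\<close>

lemma doubly_periodic_norm_constant:
  fixes h :: "complex => complex"
  assumes t: "Im t > 0" and h: "h holomorphic_on UNIV"
    and p1: "\<And>z. norm (h (z + 1)) = norm (h z)" and p2: "\<And>z. norm (h (z + t)) = norm (h z)"
  shows "\<exists>C. \<forall>z. h z = C"
proof -
  have 1: "norm (h (z + of_int n)) = norm (h z)" for n z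
  proof (induction n rule: int_induct[where k = 0])
    case (step1 i)
    thus ?case using p1[of "z + of_int i"] by (simp add: add_ac)
  next
    case (step2 i)
    thus ?case using p1[of "z + of_int (i - 1)"] by (simp add: add_ac)
  qed simp
  have 2: "norm (h (z + of_int n * t)) = norm (h z)" for n z
  proof (induction n rule: int_induct[where k = 0])
    case (step1 i)
    thus ?case using p2[of "z + of_int i * t"] by (simp add: algebra_simps)
  next
    case (step2 i)
    thus ?case using p2[of "z + of_int (i - 1) * t"] by (simp add: algebra_simps)
  qed simp
  have "continuous_on (cball 0 (norm t + 1)) h" by (rule holomorphic_on_imp_continuous_on, rule holomorphic_on_subset[OF h]) auto
  hence "bounded (h ` cball 0 (norm t + 1))" by (intro compact_imp_bounded compact_continuous_image) auto
  then obtain B where "\<forall>x\<in>h ` cball 0 (norm t + 1). norm x \<le> B" unfolding bounded_iff by blast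
  hence B: "norm (h w) \<le> B" if "norm w \<le> norm t + 1" for w using that by simp
  have "norm (h z) \<le> B" for z
  proof -
    obtain w m n where w: "z = w + of_int m * t + of_int n" "norm w \<le> norm t + 1" using lattice_reduce[OF t, of z] by blast
    have "norm (h z) = norm (h w)" unfolding w(1) 1 2 ..
    thus ?thesis using B[OF w(2)] by simp
  qed
  hence "bounded (range h)" unfolding bounded_iff by blast
  thus ?thesis using Liouville_theorem[OF h] unfolding constant_on_def by blast
qed

text \<open>f/g is entire because the zeros of g are simple and shared by f. It is doubly periodic
  up to the unitary factors c and d, hence constant, and a factor different from 1 forces that
  constant to be 0.\<close>

lemma theta_quotient_constant:
  fixes f g :: "complex => complex"
  assumes t: "Im t > 0" and f: "f holomorphic_on UNIV" and g: "g holomorphic_on UNIV"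
    and z: "\<And>z. g z = 0 ==> f z = 0 \<and> deriv g z \<noteq> 0"
    and g1: "\<And>z. g (z + 1) = a z * g z" and f1: "\<And>z. f (z + 1) = c * a z * f z"
    and g2: "\<And>z. g (z + t) = b z * g z" and f2: "\<And>z. f (z + t) = d * b z * f z"
    and nz: "\<And>z. a z \<noteq> 0" "\<And>z. b z \<noteq> 0" and cd: "norm c = 1" "norm d = 1"
  shows "\<exists>C. (\<forall>z. f z = C * g z) \<and> (c \<noteq> 1 \<or> d \<noteq> 1 --> C = 0)"
proof -
  obtain w where w: "g w \<noteq> 0"
  proof -
    have "\<exists>w. g w \<noteq> 0"
    proof (rule ccontr)
      assume "\<not> ?thesis"
      hence "g = (\<lambda>_. 0)" by auto
      thus False using z[of 0] by simp
    qed
    thus ?thesis using that by blast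
  qed
  obtain h where h: "h holomorphic_on UNIV" "\<And>z. f z = h z * g z" using entire_quotient[OF f g z] by blast
  have sh: "(\<lambda>z. h (z + u)) holomorphic_on UNIV" for u by (rule holomorphic_on_compose_gen[of "\<lambda>z. z + u" UNIV h UNIV, unfolded o_def])
       (auto intro!: holomorphic_intros h(1))
  have ch: "(\<lambda>z. k * h z) holomorphic_on UNIV" for k by (intro holomorphic_intros h(1))
  have "h (x + 1) * g x = (c * h x) * g x" for x using f1[of x] nz(1)[of x] by (simp add: h(2) g1)
  from entire_cancel[OF sh ch g this w] have e1: "h (z + 1) = c * h z" for z .
  have "h (x + t) * g x = (d * h x) * g x" for x using f2[of x] nz(2)[of x] by (simp add: h(2) g2)
  from entire_cancel[OF sh ch g this w] have e2: "h (z + t) = d * h z" for z .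
  obtain C where C: "\<And>z. h z = C" using doubly_periodic_norm_constant[OF t h(1)] e1 e2 cd by (auto simp: norm_mult)
  have "C = c * C" "C = d * C" using e1[of 0] e2[of 0] by (simp_all add: C)
  thus ?thesis using h(2) by (intro exI[of _ C]) (auto simp: C)
qed

definition lattice :: "complex => complex set" where
  "lattice t = {of_int m * t + of_int n | m n. True}"

text \<open>The classical product, used for fixed \<open>\<tau>\<close> only, to locate the zeros of the theta series.\<close>

definition theta_factor :: "complex => nat => complex => complex" where
  "theta_factor t n z = (1 - e2pi (z + of_nat (Suc n) * t)) * (1 - e2pi (of_nat (Suc n) * t - z))"

lemma theta_factor_bound:
  assumes t: "Im t > 0" and z: "\<bar>Im z\<bar> \<le> v"
  shows "norm (theta_factor t n z - 1) \<le> 3 * exp (2 * pi * v) * exp (- 2 * pi * Im t) ^ n"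
proof -
  let ?x = "e2pi (z + of_nat (Suc n) * t)" and ?y = "e2pi (of_nat (Suc n) * t - z)"
  let ?Q = "exp (- 2 * pi * Im t)"
  have Q: "?Q ^ Suc n = exp (- 2 * pi * (real (Suc n) * Im t))" unfolding exp_of_nat_mult[symmetric] by (simp add: mult_ac del: of_nat_Suc)
  have e: "theta_factor t n z - 1 = ?x * ?y - ?x - ?y" by (simp add: theta_factor_def algebra_simps)
  have Qn: "?Q ^ Suc n \<le> ?Q ^ n" using t by (intro power_decreasing) auto
  have v0: "v \<ge> 0" using z by simp
  have pz: "pi * - Im z \<le> pi * v" "pi * Im z \<le> pi * v" using z by (intro mult_left_mono; simp)+
  have x: "norm ?x \<le> exp (2 * pi * v) * ?Q ^ n"
  proof -
    have "norm ?x = exp (- 2 * pi * Im z) * ?Q ^ Suc n" unfolding Q by (simp add: norm_e2pi exp_add[symmetric] algebra_simps)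
    also have "\<dots> \<le> exp (2 * pi * v) * ?Q ^ n" using pz Qn by (intro mult_mono) auto
    finally show ?thesis .
  qed
  have y: "norm ?y \<le> exp (2 * pi * v) * ?Q ^ n"
  proof -
    have "norm ?y = exp (2 * pi * Im z) * ?Q ^ Suc n" unfolding Q by (simp add: norm_e2pi exp_add[symmetric] algebra_simps)
    also have "\<dots> \<le> exp (2 * pi * v) * ?Q ^ n" using pz Qn by (intro mult_mono) auto
    finally show ?thesis .
  qed
  have xy: "norm (?x * ?y) \<le> exp (2 * pi * v) * ?Q ^ n"
  proof -
    have "norm (?x * ?y) = ?Q ^ Suc n * ?Q ^ Suc n" unfolding Q by (simp add: norm_mult norm_e2pi exp_add[symmetric] algebra_simps)
    also have "\<dots> \<le> 1 * ?Q ^ n" using Qn t by (intro mult_mono) (auto intro: power_le_one simp del: power_Suc)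
    also have "\<dots> \<le> exp (2 * pi * v) * ?Q ^ n" using v0 by (intro mult_right_mono) auto
    finally show ?thesis .
  qed
  have "norm (?x * ?y - ?x - ?y) \<le> norm (?x * ?y) + norm ?x + norm ?y" by (meson add_right_mono norm_triangle_ineq4 order_trans)
  thus ?thesis unfolding e using x y xy by simp
qed

lemma theta_factor_summable:
  assumes t: "Im t > 0"
  shows "summable (\<lambda>n. 3 * exp (2 * pi * v) * exp (- 2 * pi * Im t) ^ n)" using t by (intro summable_mult summable_geometric) auto

definition theta_prod :: "complex => complex => complex" where
  "theta_prod t z = (\<Prod>n. theta_factor t n z)"

lemma theta_factor_convergent:
  assumes t: "Im t > 0"
  shows "convergent_prod (\<lambda>n. theta_factor t n z)"
proof (rule abs_convergent_prod_imp_convergent_prod, rule summable_imp_abs_convergent_prod)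
  show "summable (\<lambda>n. norm (theta_factor t n z - 1))" by (rule summable_comparison_test'[OF theta_factor_summable[OF t, of "\<bar>Im z\<bar>"]])
       (use theta_factor_bound[OF t, of z "\<bar>Im z\<bar>"] in auto)
qed

lemma theta_prod_tendsto:
  assumes t: "Im t > 0"
  shows "(\<lambda>N. \<Prod>n<N. theta_factor t n z) \<longlonglongrightarrow> theta_prod t z" using convergent_prod_LIMSEQ[OF theta_factor_convergent[OF t]] LIMSEQ_lessThan_iff_atMost
  unfolding theta_prod_def by blast

lemma theta_prod_holomorphic:
  assumes t: "Im t > 0"
  shows "theta_prod t holomorphic_on UNIV"
proof -
  have hol: "(\<lambda>z. \<Prod>n<N. theta_factor t n z) holomorphic_on UNIV" for N unfolding theta_factor_def by (intro holomorphic_intros)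
  have "theta_prod t field_differentiable at x" for x
  proof -
    let ?v = "\<bar>Im x\<bar> + 1"
    have I: "\<bar>Im w\<bar> \<le> ?v" if "w \<in> cball x 1" for w using that abs_Im_le_cmod[of "w - x"] by (simp add: dist_norm norm_minus_commute)
    have "uniformly_convergent_on (cball x 1) (\<lambda>N z. \<Prod>n<N. theta_factor t n z)"
    proof (rule uniformly_convergent_on_prod')
      show "continuous_on (cball x 1) (theta_factor t n)" for n unfolding theta_factor_def by (intro continuous_intros)
      show "uniformly_convergent_on (cball x 1) (\<lambda>N z. \<Sum>n<N. norm (theta_factor t n z - 1))" by (rule Weierstrass_m_test'[OF _ theta_factor_summable[OF t, of ?v]])
           (use theta_factor_bound[OF t I] in auto)
    qed auto
    then obtain l where l: "uniform_limit (cball x 1) (\<lambda>N z. \<Prod>n<N. theta_factor t n z) l sequentially" unfolding uniformly_convergent_on_def by blast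
    have eq: "l z = theta_prod t z" if "z \<in> cball x 1" for z using LIMSEQ_unique[OF tendsto_uniform_limitI[OF l that] theta_prod_tendsto[OF t]] .
    have ul: "uniform_limit (cball x 1) (\<lambda>N z. \<Prod>n<N. theta_factor t n z) (theta_prod t) sequentially" by (rule uniform_limit_cong'[THEN iffD1, OF refl eq l])
    have "theta_prod t holomorphic_on ball x 1" by (rule holomorphic_uniform_limit[OF _ ul])
         (auto intro!: always_eventually holomorphic_on_imp_continuous_on holomorphic_on_subset[OF hol])
    thus ?thesis by (meson centre_in_ball holomorphic_on_imp_differentiable_at open_ball zero_less_one)
  qed
  thus ?thesis by (simp add: holomorphic_on_def field_differentiable_at_within)
qed

lemma theta_prod_zero:
  assumes t: "Im t > 0" and z: "theta_prod t z = 0"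
  shows "z \<in> lattice t" "\<exists>n m. n \<noteq> 0 \<and> z = of_int n * t + of_int m"
proof -
  obtain n where "theta_factor t n z = 0" using prodinf_nonzero[OF theta_factor_convergent[OF t, of z]] z unfolding theta_prod_def by blast
  then consider "e2pi (z + of_nat (Suc n) * t) = 1" | "e2pi (of_nat (Suc n) * t - z) = 1" by (auto simp: theta_factor_def)
  hence "\<exists>n m. n \<noteq> 0 \<and> z = of_int n * t + of_int m"
  proof cases
    case 1
    then obtain k where "z + of_nat (Suc n) * t = of_int k" unfolding e2pi_eq_1_iff by blast
    hence "z = of_int (- int (Suc n)) * t + of_int k" by (simp add: algebra_simps)
    thus ?thesis by (intro exI[of _ "- int (Suc n)"] exI[of _ k]) simp
  next
    case 2
    then obtain k where "of_nat (Suc n) * t - z = of_int k" unfolding e2pi_eq_1_iff by blast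
    hence "z = of_int (int (Suc n)) * t + of_int (- k)" by (simp add: algebra_simps)
    thus ?thesis by (intro exI[of _ "int (Suc n)"] exI[of _ "- k"]) simp
  qed
  thus "\<exists>n m. n \<noteq> 0 \<and> z = of_int n * t + of_int m" "z \<in> lattice t" unfolding lattice_def by blast+
qed

definition theta_P :: "complex => complex => complex" where
  "theta_P t z = (1 - e2pi z) * theta_prod t z"

text \<open>The truncated product satisfies the functional equation exactly, up to the boundary
  factors 1 - e(Nt - z) and 1 - e((N + 1)t + z), which tend to 1.\<close>

lemma theta_P_shift:
  assumes t: "Im t > 0"
  shows "theta_P t (z + t) = - e2pi (- z) * theta_P t z"
proof -
  let ?S = "\<lambda>N z. (1 - e2pi z) * (\<Prod>n<N. theta_factor t n z)"
  have tf: "(\<lambda>N. ?S N z) \<longlonglongrightarrow> theta_P t z" for z unfolding theta_P_def by (intro tendsto_mult tendsto_const theta_prod_tendsto[OF t])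
  have q: "(\<lambda>N. e2pi (of_nat N * t + w)) \<longlonglongrightarrow> 0" for w
  proof -
    have "(\<lambda>N. e2pi t ^ N) \<longlonglongrightarrow> 0" using t by (intro LIMSEQ_power_zero) (simp add: norm_e2pi)
    hence "(\<lambda>N. e2pi t ^ N * e2pi w) \<longlonglongrightarrow> 0 * e2pi w" by (intro tendsto_mult tendsto_const)
    thus ?thesis by (simp add: e2pi_pow e2pi_add)
  qed
  have id: "?S N (z + t) * (1 - e2pi (of_nat N * t + - z)) = - e2pi (- z) * ?S N z * (1 - e2pi (of_nat N * t + (z + t)))" for N
  proof (induction N)
    case 0
    have "- e2pi (- z) * (1 - e2pi z) = 1 - e2pi (- z)" by (simp add: algebra_simps e2pi_add[symmetric])
    thus ?case by simp
  next
    case (Suc N)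
    have f1: "theta_factor t N (z + t) = (1 - e2pi (of_nat (Suc N) * t + (z + t))) * (1 - e2pi (of_nat N * t + - z))" by (simp add: theta_factor_def algebra_simps)
    have f2: "theta_factor t N z = (1 - e2pi (of_nat N * t + (z + t))) * (1 - e2pi (of_nat (Suc N) * t + - z))" by (simp add: theta_factor_def algebra_simps)
    have "?S (Suc N) (z + t) * (1 - e2pi (of_nat (Suc N) * t + - z)) = (?S N (z + t) * (1 - e2pi (of_nat N * t + - z))) *
        ((1 - e2pi (of_nat (Suc N) * t + (z + t))) * (1 - e2pi (of_nat (Suc N) * t + - z)))" unfolding prod.lessThan_Suc f1 by (simp only: mult_ac)
    also have "\<dots> = - e2pi (- z) * ?S (Suc N) z * (1 - e2pi (of_nat (Suc N) * t + (z + t)))" unfolding Suc prod.lessThan_Suc f2 by (simp only: mult_ac)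
    finally show ?case .
  qed
  have "(\<lambda>N. ?S N (z + t) * (1 - e2pi (of_nat N * t + - z))) \<longlonglongrightarrow> theta_P t (z + t) * (1 - 0)" by (intro tendsto_intros tf q)
  moreover have "(\<lambda>N. - e2pi (- z) * ?S N z * (1 - e2pi (of_nat N * t + (z + t)))) \<longlonglongrightarrow> - e2pi (- z) * theta_P t z * (1 - 0)"
    by (intro tendsto_mult tendsto_diff tendsto_const tf q)
  ultimately show ?thesis unfolding id using LIMSEQ_unique by fastforce
qed

lemma int_translation_iff:
  fixes u z :: "'a::ring_1"
  assumes "\<And>z. P (z + u) \<longleftrightarrow> P z"
  shows "P (z + of_int n * u) \<longleftrightarrow> P z"
proof (induction n rule: int_induct[where k = 0])
  case (step1 i)
  thus ?case using assms[of "z + of_int i * u"] by (simp add: algebra_simps)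
next
  case (step2 i)
  thus ?case using assms[of "z + of_int (i - 1) * u"] by (simp add: algebra_simps)
qed simp

lemma simple_zero_shift:
  fixes g b :: "complex => complex"
  assumes g: "g holomorphic_on UNIV" and b: "b holomorphic_on UNIV" "\<And>z. b z \<noteq> 0"
    and s: "\<And>z. g (z + u) = b z * g z"
  shows "g (z + u) = 0 \<and> deriv g (z + u) \<noteq> 0 \<longleftrightarrow> g z = 0 \<and> deriv g z \<noteq> 0"
proof -
  have "deriv g (z + u) = b z * deriv g z" if "g z = 0"
  proof -
    have "DERIV g (z + u) :> deriv g (z + u)" using holomorphic_derivI[OF g] by simp
    hence "DERIV (\<lambda>x. g (x + u)) z :> deriv g (z + u)" by (simp add: DERIV_shift)
    moreover have "DERIV (\<lambda>x. b x * g x) z :> deriv b z * g z + deriv g z * b z" by (rule DERIV_mult) (use holomorphic_derivI[OF g] holomorphic_derivI[OF b(1)] in simp_all)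
    ultimately show ?thesis using that unfolding s by (auto dest: DERIV_unique simp: mult.commute)
  qed
  thus ?thesis using b(2)[of z] by (auto simp: s)
qed

lemma theta_P_z1: "theta_P t (z + 1) = theta_P t z"
proof -
  have "theta_factor t n (z + 1) = theta_factor t n z" for n
  proof -
    have "e2pi (z + 1 + of_nat (Suc n) * t) = e2pi (z + of_nat (Suc n) * t)" using e2pi_plus_1[of "z + of_nat (Suc n) * t"] by (simp add: add_ac)
    moreover have "e2pi (of_nat (Suc n) * t - (z + 1)) = e2pi (of_nat (Suc n) * t - z)" using e2pi_plus_1[of "of_nat (Suc n) * t - (z + 1)"] by (simp add: algebra_simps)
    ultimately show ?thesis by (simp only: theta_factor_def)
  qed
  thus ?thesis by (simp add: theta_P_def theta_prod_def)
qed

lemma theta_P_holomorphic: "Im t > 0 ==> theta_P t holomorphic_on UNIV" unfolding theta_P_def by (intro holomorphic_intros theta_prod_holomorphic)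

lemma lattice_independent:
  assumes "Im t > 0" "of_int n * t + of_int m = 0"
  shows "n = 0"
proof -
  have "Im (of_int n * t + of_int m) = 0" unfolding assms(2) by simp
  thus ?thesis using assms(1) by simp
qed

text \<open>At 0 the factor 1 - e(z) has a simple zero and the remaining product is nonzero. The
  functional equations carry this to the lattice, and a convergent product vanishes only where a
  factor does.\<close>

lemma theta_P_simple_zeros:
  assumes t: "Im t > 0"
  shows "theta_P t z = 0 \<longleftrightarrow> z \<in> lattice t" "theta_P t z = 0 ==> deriv (theta_P t) z \<noteq> 0"
proof -
  let ?P = "\<lambda>z. theta_P t z = 0 \<and> deriv (theta_P t) z \<noteq> 0"
  have 0: "?P 0"
  proof -
    have G: "theta_prod t 0 \<noteq> 0"
    proof
      assume "theta_prod t 0 = 0"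
      from theta_prod_zero(2)[OF t this] obtain n m where nm: "n \<noteq> 0" "0 = of_int n * t + of_int m" by blast
      from lattice_independent[OF t nm(2)[symmetric]] nm(1) show False by simp
    qed
    have "DERIV (theta_prod t) 0 :> deriv (theta_prod t) 0" using holomorphic_derivI[OF theta_prod_holomorphic[OF t]] by simp
    hence "DERIV (theta_P t) 0 :> - tpi * theta_prod t 0" unfolding theta_P_def by (auto intro!: derivative_eq_intros)
    thus ?thesis using G by (auto simp: theta_P_def dest!: DERIV_imp_deriv)
  qed
  have s1: "?P (w + 1) \<longleftrightarrow> ?P w" for w by (rule simple_zero_shift[OF theta_P_holomorphic[OF t], of "\<lambda>_. 1"]) (auto simp: theta_P_z1)
  have s2: "?P (w + t) \<longleftrightarrow> ?P w" for w by (rule simple_zero_shift[OF theta_P_holomorphic[OF t], of "\<lambda>z. - e2pi (- z)"])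
       (auto simp: theta_P_shift[OF t] intro!: holomorphic_intros)
  have L: "?P w" if wl: "w \<in> lattice t" for w
  proof -
    obtain m n where w: "w = of_int m * t + of_int n" using wl unfolding lattice_def by blast
    have "?P (0 + of_int n * 1 + of_int m * t) \<longleftrightarrow> ?P (0 + of_int n * 1)" by (rule int_translation_iff[where P = ?P, OF s2])
    moreover have "?P (0 + of_int n * 1) \<longleftrightarrow> ?P 0" by (rule int_translation_iff[where P = ?P, OF s1])
    ultimately show ?thesis using 0 unfolding w by (simp add: add_ac)
  qed
  have Z: "w \<in> lattice t" if "theta_P t w = 0" for w
  proof -
    from that have "e2pi w = 1 \<or> theta_prod t w = 0" by (auto simp: theta_P_def)
    thus ?thesis
    proof
      assume "e2pi w = 1"
      then obtain n where "w = of_int n" unfolding e2pi_eq_1_iff by blast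
      thus ?thesis unfolding lattice_def by (intro CollectI exI[of _ 0] exI[of _ n], simp)
    qed (rule theta_prod_zero(1)[OF t])
  qed
  show "theta_P t z = 0 \<longleftrightarrow> z \<in> lattice t" using L Z by blast
  show "theta_P t z = 0 ==> deriv (theta_P t) z \<noteq> 0" using L Z by blast
qed

section \<open>The odd theta series\<close>

definition tri :: "int => int" where "tri r = r * (r - 1) div 2"

definition alt :: "int => complex" where "alt r = (if even r then 1 else - 1)"

abbreviation tha where "tha n r == (if n = tri r then alt r else 0)"

text \<open>Jacobi's odd theta series with the factor q^(1/8) y^(-1/2) removed: all exponents are
  integers and the coefficients are 1 and -1.\<close>

definition th :: "complex => complex => complex" where "th = curve_series tri alt"

lemma tri_eq: "2 * tri r = r * (r - 1)" unfolding tri_def by simp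

lemma tri_Suc: "tri (r + 1) = tri r + r" using tri_eq[of r] tri_eq[of "r + 1"] by (simp add: algebra_simps)

lemma tri_refl: "tri (1 - r) = tri r" using tri_eq[of r] tri_eq[of "1 - r"] by (simp add: algebra_simps)

lemma quad_growth_tri: "quad_growth tri"
proof -
  have "1 / 2 * (real_of_int r)\<^sup>2 - 1 / 2 * \<bar>real_of_int r\<bar> - 1 / 2 \<le> real_of_int (tri r)" for r
    using arg_cong[OF tri_eq[of r], of real_of_int] by (simp add: power2_eq_square abs_if algebra_simps)
  thus ?thesis unfolding quad_growth_def by (intro exI[of _ "1 / 2"] conjI allI) simp_all
qed

lemma tri_nonneg: "0 \<le> tri r"
proof -
  have "0 \<le> r * (r - 1)" by (cases "r \<le> 0") (auto intro: mult_nonpos_nonpos)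
  thus ?thesis using tri_eq[of r] by simp
qed

lemma tri_abs: "\<bar>r\<bar> \<le> tri r + 1"
proof -
  have "0 \<le> tri (r - 1)" "0 \<le> tri (r + 1)" by (rule tri_nonneg)+
  moreover have "tri r = tri (r - 1) + (r - 1)" using tri_Suc[of "r - 1"] by simp
  ultimately show ?thesis using tri_Suc[of r] by auto
qed

lemma norm_alt: "norm (alt r) \<le> 1" by (simp add: alt_def)

lemma alt_Suc: "alt (r + 1) = - alt r" by (simp add: alt_def)

lemma alt_refl: "alt (1 - r) = - alt r" by (simp add: alt_def)

lemma th_has_sum: "Im t > 0 ==> ((\<lambda>r. alt r * e2pi (of_int (tri r) * t + of_int r * z)) has_sum th t z) UNIV" unfolding th_def by (rule curve_series_has_sum[OF quad_growth_tri norm_alt])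

lemma th_expands: "expands th (\<lambda>n r. if n = tri r then alt r else 0)" unfolding th_def by (rule curve_series_expands[OF quad_growth_tri norm_alt])

lemma int_expansion_th: "int_expansion th" unfolding th_def by (rule curve_series_int_expansion[OF quad_growth_tri tri_abs tri_nonneg norm_alt]) (simp add: alt_def)

lemma th_z1: "Im t > 0 ==> th t (z + 1) = th t z" by (rule expands_z1[OF th_expands])

lemma th_holomorphic: "Im t > 0 ==> th t holomorphic_on A" by (rule expands_holomorphic_z[OF th_expands])

lemma th_shift:
  assumes t: "Im t > 0"
  shows "th t (z + t) = - e2pi (- z) * th t z"
proof -
  have e: "alt r * e2pi (of_int (tri r) * t + of_int r * (z + t)) =
      - e2pi (- z) * (alt (r + 1) * e2pi (of_int (tri (r + 1)) * t + of_int (r + 1) * z))" for r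
  proof -
    have "of_int (tri r) * t + of_int r * (z + t) = - z + (of_int (tri (r + 1)) * t + of_int (r + 1) * z)" unfolding tri_Suc by (simp add: algebra_simps)
    thus ?thesis by (simp only: e2pi_add alt_Suc mult_minus_left mult_minus_right minus_minus mult_ac)
  qed
  have "((\<lambda>r. - e2pi (- z) * (alt r * e2pi (of_int (tri r) * t + of_int r * z))) has_sum - e2pi (- z) * th t z) UNIV"
    by (rule has_sum_cmult_right[OF th_has_sum[OF t], where c = "- e2pi (- z)"])
  also have "?this \<longleftrightarrow> ((\<lambda>r. alt r * e2pi (of_int (tri r) * t + of_int r * (z + t))) has_sum - e2pi (- z) * th t z) UNIV"
    by (rule has_sum_reindex_bij_witness[where i = "\<lambda>r. r + 1" and j = "\<lambda>r. r - 1"])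
       (simp_all only: e diff_add_cancel add_diff_cancel UNIV_I)
  finally show ?thesis using has_sum_unique[OF th_has_sum[OF t, of "z + t"]] by blast
qed

lemma th_neg:
  assumes t: "Im t > 0"
  shows "th t (- z) = - e2pi (- z) * th t z"
proof -
  have e: "alt r * e2pi (of_int (tri r) * t + of_int r * (- z)) =
      - e2pi (- z) * (alt (1 - r) * e2pi (of_int (tri (1 - r)) * t + of_int (1 - r) * z))" for r
  proof -
    have "of_int (tri r) * t + of_int r * (- z) = - z + (of_int (tri (1 - r)) * t + of_int (1 - r) * z)" by (simp add: tri_refl algebra_simps)
    thus ?thesis by (simp only: e2pi_add alt_refl mult_minus_left mult_minus_right minus_minus mult_ac)
  qed
  have "((\<lambda>r. - e2pi (- z) * (alt r * e2pi (of_int (tri r) * t + of_int r * z))) has_sum - e2pi (- z) * th t z) UNIV"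
    by (rule has_sum_cmult_right[OF th_has_sum[OF t], where c = "- e2pi (- z)"])
  also have "?this \<longleftrightarrow> ((\<lambda>r. alt r * e2pi (of_int (tri r) * t + of_int r * (- z))) has_sum - e2pi (- z) * th t z) UNIV"
    by (rule has_sum_reindex_bij_witness[where i = "\<lambda>r. 1 - r" and j = "\<lambda>r. 1 - r"])
       (simp_all only: e diff_diff_eq2 add_diff_cancel_left' UNIV_I)
  finally show ?thesis using has_sum_unique[OF th_has_sum[OF t, of "- z"]] by blast
qed

lemma th_not_identically_zero:
  assumes t: "Im t > 0"
  shows "\<exists>z. th t z \<noteq> 0"
proof (rule ccontr)
  assume "\<not> ?thesis"
  hence z: "th t z = 0" for z by blast
  have "((\<lambda>r. (alt r * e2pi (of_int (tri r) * t)) * e2pi (of_int r * of_real x)) has_sum 0) UNIV" for x using th_has_sum[OF t, of "of_real x"] unfolding z e2pi_add mult.assoc .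
  hence "alt 0 * e2pi (of_int (tri 0) * t) = 0" by (rule fourier_coeff_unique)
  thus False by (simp add: alt_def)
qed

lemma th_lattice:
  assumes t: "Im t > 0" and "z \<in> lattice t"
  shows "th t z = 0"
proof -
  let ?P = "\<lambda>z. th t z = 0"
  obtain m n where z: "z = of_int m * t + of_int n" using assms(2) unfolding lattice_def by blast
  have "?P (0 + of_int n * 1 + of_int m * t) \<longleftrightarrow> ?P (0 + of_int n * 1)" by (rule int_translation_iff[where P = ?P]) (simp add: th_shift[OF t])
  moreover have "?P (0 + of_int n * 1) \<longleftrightarrow> ?P 0" by (rule int_translation_iff[where P = ?P]) (simp add: th_z1[OF t])
  moreover have "th t 0 = 0" using th_neg[OF t, of 0] by simp
  ultimately show ?thesis unfolding z by (simp add: add_ac)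
qed

text \<open>Series and product have the same quasi-periods, so they differ by a factor depending on
  t only; it is nonzero because the series has a nonzero Fourier coefficient.\<close>

lemma th_simple_zeros:
  assumes t: "Im t > 0"
  shows "th t z = 0 \<longleftrightarrow> z \<in> lattice t" "th t z = 0 ==> deriv (th t) z \<noteq> 0"
proof -
  have "\<exists>C. (\<forall>z. th t z = C * theta_P t z) \<and> ((1::complex) \<noteq> 1 \<or> (1::complex) \<noteq> 1 --> C = 0)"
    by (rule theta_quotient_constant[OF t th_holomorphic[OF t] theta_P_holomorphic[OF t], where a = "\<lambda>_. 1" and b = "\<lambda>z. - e2pi (- z)"])
       (use theta_P_simple_zeros[OF t] th_lattice[OF t] theta_P_z1 th_z1[OF t] theta_P_shift[OF t] th_shift[OF t] in auto)
  then obtain C where C: "\<And>z. th t z = C * theta_P t z" by blast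
  have C0: "C \<noteq> 0" using th_not_identically_zero[OF t] by (auto simp: C)
  show "th t z = 0 \<longleftrightarrow> z \<in> lattice t" using theta_P_simple_zeros(1)[OF t] C0 by (simp add: C)
  have "th t = (\<lambda>z. C * theta_P t z)" by (rule ext) (rule C)
  moreover have "(\<lambda>z. C * theta_P t z) = (\<lambda>z. C * theta_P t z)" ..
  moreover have "theta_P t field_differentiable at z" using theta_P_holomorphic[OF t] by (simp add: holomorphic_on_def)
  ultimately have "deriv (th t) z = C * deriv (theta_P t) z" by (simp add: deriv_cmult)
  thus "th t z = 0 ==> deriv (th t) z \<noteq> 0" using C0 theta_P_simple_zeros(2)[OF t, of z] by (simp add: C)
qed

section \<open>Integral q-series\<close>

lemma fourier_nice_finite_row: "fourier_nice c ==> finite {r. c n r \<noteq> 0}" by (simp add: fourier_nice_def)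

lemma fourier_nice_neg: "fourier_nice c ==> n < 0 ==> c n r = 0" unfolding fourier_nice_def by force

text \<open>One-variable q-series as arrays supported on r = 0, so that \<open>expands\<close>,
  \<open>conv\<close> and \<open>fourier_nice\<close> serve modular forms as well.\<close>

definition col :: "(int => 'a::zero) => int => int => 'a" where
  "col v n r = (if r = 0 then v n else 0)"

lemma has_sum_col:
  fixes v :: "int => complex"
  shows "(fterm (col v) t z has_sum s) UNIV \<longleftrightarrow> ((\<lambda>n. v n * e2pi (of_int n * t)) has_sum s) UNIV"
proof -
  have "((\<lambda>n. v n * e2pi (of_int n * t)) has_sum s) UNIV \<longleftrightarrow> (fterm (col v) t z has_sum s) {(n, r). r = 0}"
    by (rule has_sum_reindex_bij_witness[where j = "\<lambda>n. (n, 0)" and i = fst]) (auto simp: col_def)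
  also have "\<dots> \<longleftrightarrow> (fterm (col v) t z has_sum s) UNIV" by (rule has_sum_cong_neutral) (auto simp: col_def split: if_splits)
  finally show ?thesis ..
qed

lemma expands_at_0:
  assumes e: "expands F c" and n: "fourier_nice c"
  shows "expands (\<lambda>t z. F t 0) (col (\<lambda>n. \<Sum>s | c n s \<noteq> 0. c n s))"
proof (rule expandsI)
  fix t z :: complex assume t: "Im t > 0"
  have "(fterm c t 0 has_sum F t 0) (SIGMA x:UNIV. UNIV)" unfolding UNIV_Times_UNIV by (rule expandsD[OF e t])
  hence "((\<lambda>n. (\<Sum>s | c n s \<noteq> 0. c n s) * e2pi (of_int n * t)) has_sum F t 0) UNIV"
  proof (rule has_sum_SigmaD)
    fix n :: int
    have "((\<lambda>s. c n s * e2pi (of_int n * t)) has_sum (\<Sum>s | c n s \<noteq> 0. c n s * e2pi (of_int n * t))) {s. c n s \<noteq> 0}"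
      by (rule has_sum_finite[OF fourier_nice_finite_row[OF n]])
    also have "?this \<longleftrightarrow> ((\<lambda>s. c n s * e2pi (of_int n * t)) has_sum (\<Sum>s | c n s \<noteq> 0. c n s * e2pi (of_int n * t))) UNIV" by (rule has_sum_cong_neutral) auto
    finally show "((\<lambda>s. fterm c t 0 (n, s)) has_sum (\<Sum>s | c n s \<noteq> 0. c n s) * e2pi (of_int n * t)) UNIV" by (simp add: sum_distrib_right)
  qed
  thus "(fterm (col (\<lambda>n. \<Sum>s | c n s \<noteq> 0. c n s)) t z has_sum F t 0) UNIV" unfolding has_sum_col .
qed

lemma fourier_nice_col: "(\<And>n. n < 0 ==> v n = 0) ==> fourier_nice (col v)"
proof -
  assume v: "\<And>n. n < 0 ==> v n = 0"
  have "finite {r. col v n r \<noteq> 0}" for n by (rule finite_subset[of _ "{0}"]) (auto simp: col_def)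
  moreover have "0 \<le> n" if "col v n r \<noteq> 0" for n r using that v[of n] unfolding col_def by (cases "n < 0") (auto split: if_splits)
  ultimately show ?thesis unfolding fourier_nice_def by simp
qed

lemma fourier_nice_at_0: "fourier_nice c ==> fourier_nice (col (\<lambda>n. \<Sum>s | c n s \<noteq> 0. c n s))" by (intro fourier_nice_col sum.neutral) (auto simp: fourier_nice_neg)

lemma int_expansion_at_0:
  assumes "int_expansion F" shows "int_expansion (\<lambda>t z. F t 0)"
proof -
  obtain c where c: "expands F c" "fourier_nice c" "\<And>n r. c n r \<in> \<int>" using assms unfolding int_expansion_def by blast
  show ?thesis unfolding int_expansion_def by (intro exI[of _ "col (\<lambda>n. \<Sum>s | c n s \<noteq> 0. c n s)"] conjI allI
          expands_at_0[OF c(1,2)] fourier_nice_at_0[OF c(2)])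
       (auto simp: col_def intro!: Ints_sum c(3))
qed

lemma expands_const_col:
  assumes e: "expands (\<lambda>t z. f t) c" and n: "fourier_nice c"
  shows "c = col (\<lambda>n. c n 0)"
proof -
  have "\<exists>V. c = col V" using expands_coeff_unique[OF e expands_at_0[OF e n]] by (intro exI) simp
  then obtain V where V: "c = col V" ..
  show ?thesis unfolding V by (auto simp: col_def fun_eq_iff)
qed

lemma expands_monomial:
  "expands (\<lambda>t z. e2pi (of_int k * t + of_int l * z)) (\<lambda>n r. if n = k \<and> r = l then 1 else 0)"
proof (rule expandsI)
  fix t z :: complex
  let ?d = "\<lambda>n r. if n = k \<and> r = l then 1 else 0 :: complex"
  let ?s = "e2pi (of_int k * t + of_int l * z)"
  have "(fterm ?d t z has_sum sum (fterm ?d t z) {(k, l)}) {(k, l)}" by (rule has_sum_finite) simp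
  hence "(fterm ?d t z has_sum ?s) {(k, l)}" by simp
  moreover have "(fterm ?d t z has_sum ?s) {(k, l)} \<longleftrightarrow> (fterm ?d t z has_sum ?s) UNIV" by (rule has_sum_cong_neutral) (auto split: if_splits)
  ultimately show "(fterm ?d t z has_sum ?s) UNIV" by blast
qed

lemma e2pi_surj:
  assumes "q \<noteq> 0" "norm q < 1"
  obtains t where "Im t > 0" "e2pi t = q"
proof
  let ?t = "Ln q / tpi"
  show "e2pi ?t = q" using assms by (simp add: e2pi_def)
  have "Im ?t = - ln (norm q) / (2 * pi)" using assms by (simp add: Im_divide power2_eq_square)
  thus "Im ?t > 0" using assms by (simp add: divide_neg_pos)
qed

lemma q_series_has_sum:
  fixes v :: "nat => complex"
  assumes s: "\<And>q. norm q < 1 ==> (\<lambda>n. v n * q ^ n) sums W q" and t: "Im t > 0"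
  shows "((\<lambda>n. (if n < 0 then 0 else v (nat n)) * e2pi (of_int n * t)) has_sum W (e2pi t)) UNIV"
proof -
  define y where "y = complex_of_real ((1 + norm (e2pi t)) / 2)"
  have q: "norm (e2pi t) < 1" using t by (simp add: norm_e2pi)
  have "norm y = (1 + norm (e2pi t)) / 2" unfolding y_def norm_of_real by (rule abs_of_nonneg) simp
  with q have y: "norm y < 1" "norm (e2pi t) < norm y" by simp_all
  have "summable (\<lambda>n. norm (v n * e2pi t ^ n))" by (rule powser_insidea[OF sums_summable[OF s[OF y(1)]] y(2)])
  hence "((\<lambda>n. v n * e2pi t ^ n) has_sum W (e2pi t)) UNIV" by (rule norm_summable_imp_has_sum[OF _ s[OF q]])
  also have "?this \<longleftrightarrow> ((\<lambda>n. (if n < 0 then 0 else v (nat n)) * e2pi (of_int n * t)) has_sum W (e2pi t)) {n. n \<ge> 0}"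
    by (rule has_sum_reindex_bij_witness[where j = int and i = nat]) (auto simp: e2pi_pow)
  also have "\<dots> \<longleftrightarrow> ((\<lambda>n. (if n < 0 then 0 else v (nat n)) * e2pi (of_int n * t)) has_sum W (e2pi t)) UNIV" by (rule has_sum_cong_neutral) auto
  finally show ?thesis .
qed

lemma q_series_expands:
  assumes "\<And>q. norm q < 1 ==> (\<lambda>n. v n * q ^ n) sums W q"
  shows "expands (\<lambda>t z. W (e2pi t)) (col (\<lambda>n. if n < 0 then 0 else v (nat n)))" by (rule expandsI) (unfold has_sum_col, rule q_series_has_sum[OF assms])

lemma holomorphic_disc_expands:
  assumes W: "W holomorphic_on ball 0 1" and f: "\<And>t. Im t > 0 ==> f t = W (e2pi t)"
  shows "\<exists>v. (\<forall>n<0. v n = 0) \<and> v 0 = W 0 \<and> expands (\<lambda>t z. f t) (col v)"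
proof -
  define v where "v = (\<lambda>n. (deriv ^^ n) W 0 / fact n)"
  have "(\<lambda>n. v n * q ^ n) sums W q" if "norm q < 1" for q using holomorphic_power_series[OF W, of q] that by (simp add: v_def)
  hence "expands (\<lambda>t z. W (e2pi t)) (col (\<lambda>n. if n < 0 then 0 else v (nat n)))" by (rule q_series_expands)
  hence "expands (\<lambda>t z. f t) (col (\<lambda>n. if n < 0 then 0 else v (nat n)))" by (rule expands_cong[rotated]) (simp add: f)
  thus ?thesis by (intro exI[of _ "\<lambda>n. if n < 0 then 0 else v (nat n)"]) (auto simp: v_def)
qed

text \<open>In the variable q the behaviour at the cusp becomes the value of a power series at
  0.\<close>

lemma expands_holomorphic_disc:
  assumes e: "expands (\<lambda>t z. f t) c" and n: "fourier_nice c"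
  shows "\<exists>W. W holomorphic_on ball 0 1 \<and> (\<forall>t. Im t > 0 --> f t = W (e2pi t)) \<and> W 0 = c 0 0"
proof -
  define W where "W = (\<lambda>q. \<Sum>n. c (int n) 0 * q ^ n)"
  have s: "((\<lambda>n. c (int n) 0 * e2pi t ^ n) has_sum f t) UNIV" if t: "Im t > 0" for t
  proof -
    have "(fterm (col (\<lambda>n. c n 0)) t 0 has_sum f t) UNIV" using expandsD[OF e t, of 0] expands_const_col[OF e n] by simp
    hence "((\<lambda>n. c n 0 * e2pi (of_int n * t)) has_sum f t) UNIV" unfolding has_sum_col .
    also have "?this \<longleftrightarrow> ((\<lambda>n. c n 0 * e2pi (of_int n * t)) has_sum f t) {n. n \<ge> 0}" by (rule has_sum_cong_neutral) (auto simp: fourier_nice_neg[OF n] not_le)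
    also have "\<dots> \<longleftrightarrow> ((\<lambda>n. c (int n) 0 * e2pi t ^ n) has_sum f t) UNIV" by (rule has_sum_reindex_bij_witness[where i = int and j = nat]) (auto simp: e2pi_pow)
    finally show ?thesis .
  qed
  have "(\<lambda>n. c (int n) 0 * (q - 0) ^ n) sums W q" if "q \<in> ball 0 1" for q
  proof (cases "q = 0")
    case True
    thus ?thesis using powser_sums_zero[of "\<lambda>n. c (int n) 0"] by (simp add: W_def powser_zero)
  next
    case False
    have qn: "norm q < 1" using that by simp
    obtain t where t: "Im t > 0" "e2pi t = q" by (rule e2pi_surj[OF False qn])
    hence "(\<lambda>n. c (int n) 0 * q ^ n) sums f t" using has_sum_imp_sums[OF s[OF t(1)]] by simp
    thus ?thesis unfolding W_def by (simp add: sums_iff)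
  qed
  hence "W holomorphic_on ball 0 1" by (rule power_series_holomorphic)
  moreover have "f t = W (e2pi t)" if "Im t > 0" for t using has_sum_imp_sums[OF s[OF that]] unfolding W_def by (simp add: sums_iff)
  moreover have "W 0 = c 0 0" by (simp add: W_def powser_zero)
  ultimately show ?thesis by blast
qed

lemma at_cusp_e2pi: "(e2pi \<longlongrightarrow> 0) at_cusp"
proof -
  have "((\<lambda>y. exp (- 2 * pi * y)) \<longlongrightarrow> 0) at_top" by real_asymp
  hence "((\<lambda>t. exp (- 2 * pi * Im t)) \<longlongrightarrow> 0) at_cusp" unfolding at_cusp_def by (rule filterlim_compose) (rule filterlim_filtercomap)
  thus ?thesis by (subst tendsto_norm_zero_iff[symmetric]) (simp add: norm_e2pi)
qed

lemma at_cusp_not_bot: "at_cusp \<noteq> bot" unfolding at_cusp_def by (rule filtercomap_neq_bot_surj) (auto intro!: surjI[of _ "\<lambda>y. \<i> * of_real y"])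

lemma eventually_at_cusp_upper: "eventually (\<lambda>t. Im t > 0) at_cusp" unfolding at_cusp_def by (rule eventually_filtercomapI[OF eventually_gt_at_top])

lemma expands_at_cusp:
  assumes e: "expands (\<lambda>t z. f t) c" and n: "fourier_nice c"
  shows "(f \<longlongrightarrow> c 0 0) at_cusp"
proof -
  obtain W where W: "W holomorphic_on ball 0 1" "\<And>t. Im t > 0 ==> f t = W (e2pi t)" "W 0 = c 0 0" using expands_holomorphic_disc[OF e n] by blast
  have "isCont W 0" using holomorphic_on_imp_continuous_on[OF W(1)] by (simp add: continuous_on_eq_continuous_at)
  hence "((\<lambda>t. W (e2pi t)) \<longlongrightarrow> W 0) at_cusp" by (rule isCont_tendsto_compose[OF _ at_cusp_e2pi])
  thus ?thesis unfolding W(3) by (rule Lim_transform_eventually) (rule eventually_mono[OF eventually_at_cusp_upper], simp add: W(2))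
qed

text \<open>The limit at the cusp makes the leading coefficient 1, and as a function of q the series
  has no zero in the unit disc, so its inverse is again a power series. Comparing coefficients in f
  times 1/f gives each coefficient of 1/f integrally in terms of earlier ones.\<close>

lemma int_expansion_inverse:
  assumes i: "int_expansion (\<lambda>t z. f t)" and nz: "\<And>t. Im t > 0 ==> f t \<noteq> 0" and l: "(f \<longlongrightarrow> 1) at_cusp"
  shows "int_expansion (\<lambda>t z. inverse (f t))"
proof -
  obtain c where c: "expands (\<lambda>t z. f t) c" "fourier_nice c" "\<And>n r. c n r \<in> \<int>" using i unfolding int_expansion_def by blast
  have c0: "c 0 0 = 1" using tendsto_unique[OF at_cusp_not_bot expands_at_cusp[OF c(1,2)] l] .
  have cc: "c n r = 0" if "r \<noteq> 0" for n r
  proof -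
    have "c n r = col (\<lambda>n. c n 0) n r" by (rule fun_cong[OF fun_cong[OF expands_const_col[OF c(1,2)]]])
    thus ?thesis by (simp add: col_def that)
  qed
  obtain W where W: "W holomorphic_on ball 0 1" "\<And>t. Im t > 0 ==> f t = W (e2pi t)" "W 0 = 1" using expands_holomorphic_disc[OF c(1,2)] unfolding c0 by blast
  have "W q \<noteq> 0" if "q \<in> ball 0 1" for q
  proof (cases "q = 0")
    case False
    have qn: "norm q < 1" using that by simp
    obtain t where t: "Im t > 0" "e2pi t = q" by (rule e2pi_surj[OF False qn])
    thus ?thesis using nz[OF t(1)] W(2)[OF t(1)] by simp
  qed (simp add: W(3))
  hence "(\<lambda>q. inverse (W q)) holomorphic_on ball 0 1" by (intro holomorphic_intros W(1))
  then obtain v where v: "\<forall>n<0. v n = 0" "expands (\<lambda>t z. inverse (f t)) (col v)" using holomorphic_disc_expands[of "\<lambda>q. inverse (W q)" "\<lambda>t. inverse (f t)"] W(2) by auto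
  have nv: "fourier_nice (col v)" using v(1) by (intro fourier_nice_col) simp
  have "expands (\<lambda>t z. f t * inverse (f t)) (conv c (col v))" by (rule expands_mult[OF c(1) v(2) c(2) nv])
  hence "expands (\<lambda>t z. 1) (conv c (col v))" by (rule expands_cong[rotated]) (simp add: nz)
  moreover have "expands (\<lambda>t z. 1) (\<lambda>n r. if n = 0 \<and> r = 0 then 1 else 0)" using expands_monomial[of 0 0] by simp
  ultimately have cv: "conv c (col v) = (\<lambda>n r. if n = 0 \<and> r = 0 then 1 else 0)" by (rule expands_coeff_unique) simp
  have vi: "v (int n) \<in> \<int>" for n
  proof (induction n rule: less_induct)
    case (less n)
    let ?S = "{(k, s). 0 \<le> k \<and> k \<le> int n \<and> c k s \<noteq> 0}"
    have fin: "finite ?S" by (rule fourier_nice_finite[OF c(2)])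
    have "(if n = 0 then 1 else 0) = conv c (col v) (int n) 0" unfolding cv by simp
    also have "\<dots> = (\<Sum>(k, s)\<in>?S. c k s * col v (int n - k) (0 - s))" unfolding conv_def ..
    also have "\<dots> = c 0 0 * v (int n) + (\<Sum>(k, s)\<in>?S - {(0, 0)}. c k s * col v (int n - k) (0 - s))" by (subst sum.remove[OF fin, of "(0, 0)"]) (auto simp: c0 col_def)
    finally have "v (int n) = (if n = 0 then 1 else 0) - (\<Sum>(k, s)\<in>?S - {(0, 0)}. c k s * col v (int n - k) (0 - s))" by (simp add: c0)
    moreover have "(\<Sum>(k, s)\<in>?S - {(0, 0)}. c k s * col v (int n - k) (0 - s)) \<in> \<int>"
    proof (rule Ints_sum)
      fix x assume x: "x \<in> ?S - {(0, 0)}"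
      obtain k s where ks: "x = (k, s)" by (cases x)
      have k: "s = 0" "0 < k" "k \<le> int n" using x cc[of s k] unfolding ks by (auto simp: le_less)
      have "v (int (nat (int n - k))) \<in> \<int>" by (rule less) (use k in auto)
      thus "(case x of (k, s) => c k s * col v (int n - k) (0 - s)) \<in> \<int>" using k c(3) by (simp add: ks col_def)
    qed
    ultimately show ?case by simp
  qed
  have "v n \<in> \<int>" for n
  proof (cases "n < 0")
    case False
    thus ?thesis using vi[of "nat n"] by simp
  qed (use v(1) in simp)
  thus ?thesis unfolding int_expansion_def using v(2) nv by (intro exI[of _ "col v"]) (simp add: col_def)
qed

text \<open>Division by 2 pi i makes differentiation multiply c n r by r or, for \<open>Dt\<close>,
  by n, so integral expansions stay integral.\<close>

definition Dz :: "(complex => complex => complex) => complex => complex => complex" where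
  "Dz F t z = deriv (F t) z / tpi"

definition Dt :: "(complex => complex) => complex => complex" where
  "Dt f t = deriv f t / tpi"

lemma expands_Dz:
  assumes "expands F c" shows "expands (Dz F) (\<lambda>n r. of_int r * c n r)"
proof -
  have "expands (\<lambda>t z. inverse tpi * (deriv ^^ 1) (F t) z) (\<lambda>n r. inverse tpi * ((tpi * of_int r) ^ 1 * c n r))" by (intro expands_cmult expands_higher_deriv assms)
  thus ?thesis by (simp add: Dz_def[abs_def] field_simps)
qed

lemma int_expansion_Dz:
  assumes "int_expansion F" shows "int_expansion (Dz F)"
proof -
  obtain c where c: "expands F c" "fourier_nice c" "\<And>n r. c n r \<in> \<int>" using assms unfolding int_expansion_def by blast
  have "fourier_nice (\<lambda>n r. of_int r * c n r)" unfolding fourier_nice_def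
  proof (intro conjI allI impI)
    show "0 \<le> n" if "of_int r * c n r \<noteq> 0" for n r using that fourier_nice_neg[OF c(2), of n r] by (auto simp: not_le[symmetric])
    show "finite {r. of_int r * c n r \<noteq> 0}" for n by (rule finite_subset[OF _ fourier_nice_finite_row[OF c(2), of n]]) auto
  qed
  thus ?thesis unfolding int_expansion_def using expands_Dz[OF c(1)] c(3) by (intro exI[of _ "\<lambda>n r. of_int r * c n r"]) auto
qed

lemma expands_Dt:
  assumes e: "expands F c"
  shows "expands (\<lambda>t z. Dt (\<lambda>t. F t z) t) (\<lambda>n r. of_int n * c n r)"
proof (rule expandsI)
  fix t z :: complex assume t: "Im t > 0"
  have "((\<lambda>x. (deriv ^^ 1) (\<lambda>t. fterm c t z x) t) has_sum (deriv ^^ 1) (\<lambda>t. F t z) t) UNIV"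
  proof (rule higher_deriv_has_sum[of upper])
    show "(\<lambda>t. fterm c t z x) holomorphic_on upper" for x by (cases x) (auto intro!: holomorphic_intros)
    show "((\<lambda>x. fterm c t z x) has_sum F t z) UNIV" if "t \<in> upper" for t using expandsD[OF e] that by simp
    fix x assume x: "x \<in> upper"
    obtain d M where "d > 0" "M summable_on UNIV" "cball x d \<subseteq> upper"
        "\<forall>t\<in>cball x d. \<forall>z'\<in>cball z d. \<forall>k. norm (fterm c t z' k) \<le> M k" using expands_bound_cball[OF e x[unfolded upper_iff], of z] by blast
    thus "\<exists>r>0. \<exists>M. M summable_on UNIV \<and> cball x r \<subseteq> upper \<and> (\<forall>k. \<forall>y\<in>cball x r. norm (fterm c y z k) \<le> M k)"
      by (intro exI[of _ d] conjI exI[of _ M]) simp_all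
  qed (use t in auto)
  moreover have "deriv (\<lambda>t. fterm c t z x) t = tpi * fterm (\<lambda>n r. of_int n * c n r) t z x" for x by (cases x) (auto intro!: DERIV_imp_deriv derivative_eq_intros)
  ultimately have "((\<lambda>x. tpi * fterm (\<lambda>n r. of_int n * c n r) t z x) has_sum deriv (\<lambda>t. F t z) t) UNIV" by simp
  from has_sum_cmult_right[OF this, where c = "inverse tpi"]
  show "(fterm (\<lambda>n r. of_int n * c n r) t z has_sum Dt (\<lambda>t. F t z) t) UNIV" unfolding mult.assoc[symmetric] Dt_def by (simp add: field_simps)
qed

lemma int_expansion_Dt:
  assumes "int_expansion (\<lambda>t z. f t)"
  shows "int_expansion (\<lambda>t z. Dt f t)" "(Dt f \<longlongrightarrow> 0) at_cusp"
proof -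
  obtain c where c: "expands (\<lambda>t z. f t) c" "fourier_nice c" "\<And>n r. c n r \<in> \<int>" using assms unfolding int_expansion_def by blast
  have n: "fourier_nice (\<lambda>n r. of_int n * c n r)" unfolding fourier_nice_def
  proof (intro conjI allI impI)
    show "0 \<le> n" if "of_int n * c n r \<noteq> 0" for n r using that fourier_nice_neg[OF c(2), of n r] by (auto simp: not_le[symmetric])
    show "finite {r. of_int n * c n r \<noteq> 0}" for n by (rule finite_subset[OF _ fourier_nice_finite_row[OF c(2), of n]]) auto
  qed
  thus "int_expansion (\<lambda>t z. Dt f t)" unfolding int_expansion_def using expands_Dt[OF c(1)] c(3) by (intro exI[of _ "\<lambda>n r. of_int n * c n r"]) auto
  show "(Dt f \<longlongrightarrow> 0) at_cusp" using expands_at_cusp[OF expands_Dt[OF c(1)] n] by simp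
qed

lemma int_expansion_double:
  assumes "int_expansion F" shows "int_expansion (\<lambda>t z. F t (2 * z))"
proof -
  obtain c where c: "expands F c" "fourier_nice c" "\<And>n r. c n r \<in> \<int>" using assms unfolding int_expansion_def by blast
  define d where "d = (\<lambda>n r::int. if even r then c n (r div 2) else 0)"
  have "expands (\<lambda>t z. F t (2 * z)) d"
  proof (rule expandsI)
    fix t z :: complex assume t: "Im t > 0"
    have "(fterm c t (2 * z) has_sum F t (2 * z)) UNIV" by (rule expandsD[OF c(1) t])
    also have "?this \<longleftrightarrow> (fterm d t z has_sum F t (2 * z)) {(n, r). even r}"
      by (rule has_sum_reindex_bij_witness[where j = "\<lambda>(n, r). (n, 2 * r)" and i = "\<lambda>(n, r). (n, r div 2)"])
         (auto simp: d_def mult_ac)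
    also have "\<dots> \<longleftrightarrow> (fterm d t z has_sum F t (2 * z)) UNIV" by (rule has_sum_cong_neutral) (auto simp: d_def split: if_splits)
    finally show "(fterm d t z has_sum F t (2 * z)) UNIV" .
  qed
  moreover have "fourier_nice d" unfolding fourier_nice_def
  proof (intro conjI allI impI)
    show "0 \<le> n" if "d n r \<noteq> 0" for n r using that fourier_nice_neg[OF c(2), of n "r div 2"] by (auto simp: d_def not_le[symmetric] split: if_splits)
    have "{r. d n r \<noteq> 0} \<subseteq> (\<lambda>r. 2 * r) ` {r. c n r \<noteq> 0}" for n
    proof (rule subsetI)
      fix x assume "x \<in> {r. d n r \<noteq> 0}"
      hence "even x" "c n (x div 2) \<noteq> 0" by (auto simp: d_def split: if_splits)
      thus "x \<in> (\<lambda>r. 2 * r) ` {r. c n r \<noteq> 0}" by (intro image_eqI[of _ _ "x div 2"]) auto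
    qed
    thus "finite {r. d n r \<noteq> 0}" for n by (rule finite_subset[OF _ finite_imageI[OF fourier_nice_finite_row[OF c(2), of n]]])
  qed
  ultimately show ?thesis unfolding int_expansion_def using c(3) by (intro exI[of _ d]) (auto simp: d_def)
qed

lemma int_expansion_e2pi: "int_expansion (\<lambda>t z. e2pi (of_int k * z))"
proof -
  define d where "d = (\<lambda>n r::int. if n = (0::int) \<and> r = k then 1 else 0 :: complex)"
  have "expands (\<lambda>t z. e2pi (of_int k * z)) d" unfolding d_def using expands_monomial[of 0 k] by simp
  moreover have "finite {r. d n r \<noteq> 0}" for n by (rule finite_subset[of _ "{k}"]) (auto simp: d_def)
  hence "fourier_nice d" unfolding fourier_nice_def by (simp add: d_def)
  ultimately show ?thesis unfolding int_expansion_def by (intro exI[of _ d]) (auto simp: d_def)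
qed

section \<open>Modular transformation of the theta series\<close>

lemma DERIV_Dz: "expands F c ==> Im t > 0 ==> (DERIV (F t) z :> tpi * Dz F t z)" unfolding Dz_def using holomorphic_derivI[OF expands_holomorphic_z[of F c t UNIV], of z] by simp

lemma DERIV_Dt: "f holomorphic_on upper ==> Im t > 0 ==> (DERIV f t :> tpi * Dt f t)" unfolding Dt_def using holomorphic_derivI[of f upper t] by simp

lemma Dt_eqI: "DERIV f t :> tpi * d ==> Dt f t = d" unfolding Dt_def by (drule DERIV_imp_deriv) simp

lemma DERIV_const_unique:
  assumes "DERIV f z :> tpi * a" "DERIV f z :> tpi * b"
  shows "a = (b :: complex)" using DERIV_unique[OF assms] by simp

section \<open>Theta derivatives, the heat equation and the discriminant\<close>

definition th1 where "th1 = Dz th"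

definition th2 where "th2 = Dz th1"

definition th3 where "th3 = Dz th2"

lemma th1_expands: "expands th1 (\<lambda>n r. of_int r * tha n r)" unfolding th1_def by (rule expands_Dz[OF th_expands])

lemma th2_expands: "expands th2 (\<lambda>n r. of_int r * (of_int r * tha n r))" unfolding th2_def by (rule expands_Dz[OF th1_expands])

lemma th3_expands: "expands th3 (\<lambda>n r. of_int r * (of_int r * (of_int r * tha n r)))" unfolding th3_def by (rule expands_Dz[OF th2_expands])

lemma int_expansion_th12: "int_expansion th1" "int_expansion th2" unfolding th2_def th1_def by (intro int_expansion_Dz int_expansion_th)+

lemma th_DERIV:
  assumes "Im t > 0"
  shows "DERIV (th t) z :> tpi * th1 t z"
    "DERIV (th1 t) z :> tpi * th2 t z"
    "DERIV (th2 t) z :> tpi * th3 t z" unfolding th3_def using DERIV_Dz[OF th_expands assms, of z] DERIV_Dz[OF th1_expands assms, of z] DERIV_Dz[OF th2_expands assms, of z]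
  by (simp_all add: th1_def th2_def)

text \<open>On the support 2n = r^2 - r, so n r = (r^3 - r^2)/2: the heat equation, differentiated
  once in z.\<close>

lemma th1_heat:
  assumes t: "Im t > 0"
  shows "Dt (\<lambda>t. th1 t z) t = (th3 t z - th2 t z) / 2"
proof -
  have "expands (\<lambda>t z. 1/2 * (th3 t z - th2 t z)) (\<lambda>n r. 1/2 * (of_int r * (of_int r * (of_int r * tha n r)) - of_int r * (of_int r * tha n r)))"
    by (intro expands_cmult expands_diff th3_expands th2_expands)
  also have "(\<lambda>n r. 1/2 * (of_int r * (of_int r * (of_int r * tha n r)) - of_int r * (of_int r * tha n r)))
      = (\<lambda>n r. of_int n * (of_int r * tha n r))"
  proof (intro ext)
    fix n r
    have "2 * complex_of_int (tri r) = of_int r * (of_int r - 1)" using arg_cong[OF tri_eq[of r], of complex_of_int] by simp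
    hence e: "complex_of_int (tri r) = of_int r * (of_int r - 1) / 2" by (subst eq_divide_eq) (simp add: mult.commute)
    show "1/2 * (of_int r * (of_int r * (of_int r * tha n r)) - of_int r * (of_int r * tha n r))
      = of_int n * (of_int r * tha n r)" by (simp add: e field_simps)
  qed
  finally have "expands (\<lambda>t z. 1/2 * (th3 t z - th2 t z)) (\<lambda>n r. of_int n * (of_int r * tha n r))" .
  from expands_fun_unique[OF expands_Dt[OF th1_expands] this t] show ?thesis by simp
qed

text \<open>By Jacobi's identity this is the q-series of the product of all (1 - q^n)^3. As a theta
  constant it becomes accessible to the heat equation.\<close>

definition varpi :: "complex => complex" where "varpi t = - th1 t 0"

lemma int_expansion_varpi: "int_expansion (\<lambda>t z. varpi t)"
proof -
  have "int_expansion (\<lambda>t z. (- 1) * th1 t 0)" by (intro int_expansion_mult int_expansion_const int_expansion_at_0 int_expansion_th12) simp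
  thus ?thesis by (rule int_expansion_cong[rotated]) (simp add: varpi_def)
qed

lemma varpi_nonzero: "Im t > 0 ==> varpi t \<noteq> 0"
proof -
  assume t: "Im t > 0"
  have "th t 0 = 0" using th_neg[OF t, of 0] by simp
  from th_simple_zeros(2)[OF t this] show ?thesis by (simp add: varpi_def th1_def Dz_def)
qed

lemma fourier_nice_tri: "fourier_nice (\<lambda>n r. g r * tha n r)"
proof -
  have "finite {r. g r * tha n r \<noteq> 0}" for n
  proof (rule finite_subset[of _ "{- (n + 1)..n + 1}"], rule subsetI)
    fix r assume "r \<in> {r. g r * tha n r \<noteq> 0}"
    hence "n = tri r" by (auto split: if_splits)
    thus "r \<in> {- (n + 1)..n + 1}" using tri_abs[of r] by (auto simp: abs_le_iff)
  qed simp
  thus ?thesis unfolding fourier_nice_def using tri_nonneg by (auto split: if_splits)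
qed

lemma varpi_at_cusp: "(varpi \<longlongrightarrow> 1) at_cusp"
proof -
  let ?c = "\<lambda>n r. of_int r * tha n r :: complex"
  have "{s. ?c 0 s \<noteq> 0} = {1}"
  proof -
    have "tri s = 0 \<longleftrightarrow> s = 0 \<or> s = 1" for s using tri_eq[of s] by auto
    thus ?thesis by (auto simp: alt_def split: if_splits)
  qed
  hence e: "(\<Sum>s | ?c 0 s \<noteq> 0. ?c 0 s) = - 1" by (simp add: tri_def alt_def)
  have "((\<lambda>t. th1 t 0) \<longlongrightarrow> col (\<lambda>n. \<Sum>s | ?c n s \<noteq> 0. ?c n s) 0 0) at_cusp"
    by (rule expands_at_cusp[OF expands_at_0[OF th1_expands fourier_nice_tri] fourier_nice_at_0[OF fourier_nice_tri]])
  hence "((\<lambda>t. th1 t 0) \<longlongrightarrow> - 1) at_cusp" by (simp only: col_def e refl if_True)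
  hence "((\<lambda>t. - th1 t 0) \<longlongrightarrow> - (- 1)) at_cusp" by (rule tendsto_minus)
  thus ?thesis by (simp add: varpi_def[abs_def])
qed

definition theta11 :: "complex => complex => complex" where
  "theta11 t z = e2pi (t / 8 - z / 2) * th t z"

lemma theta11_neg: "Im t > 0 ==> theta11 t (- z) = - theta11 t z"
proof -
  assume t: "Im t > 0"
  have "t / 8 - - z / 2 + - z = t / 8 - z / 2" by (simp add: field_simps)
  hence "e2pi (t / 8 - - z / 2) * e2pi (- z) = e2pi (t / 8 - z / 2)" unfolding e2pi_add[symmetric] by (rule arg_cong)
  thus ?thesis by (simp add: theta11_def th_neg[OF t] mult.assoc[symmetric])
qed

lemma theta11_z1: "Im t > 0 ==> theta11 t (z + 1) = - theta11 t z"
proof -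
  assume t: "Im t > 0"
  have "t / 8 - (z + 1) / 2 + 1 / 2 = t / 8 - z / 2" by (simp add: field_simps)
  hence "e2pi (t / 8 - (z + 1) / 2) * e2pi (1 / 2) = e2pi (t / 8 - z / 2)" unfolding e2pi_add[symmetric] by (rule arg_cong)
  hence "e2pi (t / 8 - z / 2) = - e2pi (t / 8 - (z + 1) / 2)" by (simp add: e2pi_half)
  thus ?thesis by (simp add: theta11_def th_z1[OF t])
qed

lemma theta11_shift: "Im t > 0 ==> theta11 t (z + t) = - e2pi (- t / 2 - z) * theta11 t z"
proof -
  assume t: "Im t > 0"
  have "t / 8 - (z + t) / 2 + - z = - t / 2 - z + (t / 8 - z / 2)" by (simp add: field_simps)
  hence "e2pi (t / 8 - (z + t) / 2) * e2pi (- z) = e2pi (- t / 2 - z) * e2pi (t / 8 - z / 2)" unfolding e2pi_add[symmetric] by (rule arg_cong)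
  thus ?thesis by (simp add: theta11_def th_shift[OF t] mult.assoc[symmetric])
qed

lemma theta11_DERIV:
  assumes t: "Im t > 0"
  shows "DERIV (theta11 t) z :> tpi * (e2pi (t / 8 - z / 2) * (th1 t z - th t z / 2))"
    "DERIV (\<lambda>z. e2pi (t / 8 - z / 2) * (th1 t z - th t z / 2)) z :> tpi * (e2pi (t / 8 - z / 2) * (th2 t z - th1 t z + th t z / 4))"
    "DERIV (\<lambda>z. e2pi (t / 8 - z / 2) * (th2 t z - th1 t z + th t z / 4)) z :> tpi * (e2pi (t / 8 - z / 2) * (th3 t z - 3/2 * th2 t z + 3/4 * th1 t z - th t z / 8))"
  unfolding theta11_def[abs_def] by (rule derivative_eq_intros th_DERIV[OF t] refl | simp add: algebra_simps)+

lemma theta11_holomorphic: "Im t > 0 ==> theta11 t holomorphic_on A" unfolding theta11_def by (intro holomorphic_intros th_holomorphic) auto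

lemma theta11_zero: "Im t > 0 ==> theta11 t z = 0 \<longleftrightarrow> z \<in> lattice t" by (simp add: theta11_def th_simple_zeros(1))

lemma theta11_simple: "Im t > 0 ==> theta11 t z = 0 ==> deriv (theta11 t) z \<noteq> 0"
  using DERIV_imp_deriv[OF theta11_DERIV(1), of t z] th_simple_zeros(2)[of t z] DERIV_imp_deriv[OF th_DERIV(1), of t z] by (auto simp: theta11_def)

text \<open>\<open>theta11\<close> is odd, so its second derivative vanishes at 0.\<close>

lemma th2_0: "Im t > 0 ==> th2 t 0 = th1 t 0"
proof -
  assume t: "Im t > 0"
  let ?f1 = "\<lambda>z. e2pi (t / 8 - z / 2) * (th1 t z - th t z / 2)"
  let ?f2 = "\<lambda>z. e2pi (t / 8 - z / 2) * (th2 t z - th1 t z + th t z / 4)"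
  have "DERIV (\<lambda>z. - theta11 t (- z)) z :> tpi * ?f1 (- z)" for z
  proof -
    have "DERIV (\<lambda>z. theta11 t (- z)) z :> tpi * ?f1 (- z) * (- 1)" by (rule DERIV_chain2[OF theta11_DERIV(1)[OF t]]) (auto intro!: derivative_eq_intros)
    from DERIV_minus[OF this] show ?thesis by simp
  qed
  hence "DERIV (theta11 t) z :> tpi * ?f1 (- z)" for z by (simp add: theta11_neg[OF t])
  hence e: "?f1 (- z) = ?f1 z" for z by (rule DERIV_const_unique[OF _ theta11_DERIV(1)[OF t]])
  have "DERIV (\<lambda>z. ?f1 (- z)) 0 :> tpi * ?f2 (- 0) * (- 1)" by (rule DERIV_chain2[OF theta11_DERIV(2)[OF t]]) (auto intro!: derivative_eq_intros)
  hence "DERIV ?f1 0 :> tpi * - ?f2 0" unfolding e by simp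
  from DERIV_const_unique[OF this theta11_DERIV(2)[OF t]] have "?f2 0 = 0" by simp
  moreover have "th t 0 = 0" using th_neg[OF t, of 0] by simp
  ultimately show ?thesis by simp
qed

lemma lattice_S:
  assumes t: "Im t > 0" and "z \<in> lattice t"
  shows "z / t \<in> lattice (- 1 / t)"
proof -
  obtain m n where z: "z = of_int m * t + of_int n" using assms(2) unfolding lattice_def by blast
  have "z / t = of_int (- n) * (- 1 / t) + of_int m" using upper_nonzero[OF t] unfolding z by (simp add: add_divide_distrib)
  thus ?thesis unfolding lattice_def by blast
qed

text \<open>Both sides have the same quasi-periods in z, and the left vanishes at the simple zeros
  of \<open>theta11 t\<close>, so they agree up to a factor C depending on t. Information on C comes
  later, from a differential equation.\<close>

lemma theta11_S:
  assumes t: "Im t > 0"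
  shows "\<exists>C. \<forall>z. theta11 (- 1 / t) (z / t) = C * e2pi (z\<^sup>2 / (2 * t)) * theta11 t z"
proof -
  let ?s = "- 1 / t"
  have s: "Im ?s > 0" and t0: "t \<noteq> 0" using t by auto
  let ?f = "\<lambda>z. e2pi (- z\<^sup>2 / (2 * t)) * theta11 ?s (z / t)"
  have "(\<lambda>z. z / t) holomorphic_on UNIV" using t0 by (intro holomorphic_intros)
  hence "(\<lambda>z. theta11 ?s (z / t)) holomorphic_on UNIV" using holomorphic_on_compose_gen[OF _ theta11_holomorphic[OF s, of UNIV], of "\<lambda>z. z / t" UNIV] unfolding o_def by simp
  moreover have "(\<lambda>z. e2pi (- z\<^sup>2 / (2 * t))) holomorphic_on UNIV" using t0 by (intro holomorphic_intros) auto
  ultimately have fh: "?f holomorphic_on UNIV" by (rule holomorphic_on_mult[rotated])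
  have f1: "?f (z + 1) = 1 * - 1 * ?f z" for z
  proof -
    have a1: "(z + 1) / t + ?s = z / t" using t0 by (simp add: field_simps)
    have 1: "theta11 ?s (z / t) = - e2pi (- ?s / 2 - (z + 1) / t) * theta11 ?s ((z + 1) / t)" using theta11_shift[OF s, of "(z + 1) / t"] unfolding a1 .
    have "- z\<^sup>2 / (2 * t) + (- ?s / 2 - (z + 1) / t) = - (z + 1)\<^sup>2 / (2 * t)" using t0 by (simp add: field_simps power2_eq_square)
    hence "e2pi (- z\<^sup>2 / (2 * t)) * e2pi (- ?s / 2 - (z + 1) / t) = e2pi (- (z + 1)\<^sup>2 / (2 * t))" unfolding e2pi_add[symmetric] by (rule arg_cong)
    thus ?thesis unfolding 1 by simp
  qed
  have f2: "?f (z + t) = 1 * - e2pi (- t / 2 - z) * ?f z" for z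
  proof -
    have "(z + t) / t = z / t + 1" using t0 by (simp add: field_simps)
    moreover have "- (z + t)\<^sup>2 / (2 * t) = - t / 2 - z + - z\<^sup>2 / (2 * t)" using t0 by (simp add: field_simps power2_eq_square)
    ultimately show ?thesis using theta11_z1[OF s, of "z / t"] by (simp only: e2pi_add mult_1_left) simp
  qed
  have "\<exists>C. (\<forall>z. ?f z = C * theta11 t z) \<and> ((1::complex) \<noteq> 1 \<or> (1::complex) \<noteq> 1 --> C = 0)"
  proof (rule theta_quotient_constant[OF t fh theta11_holomorphic[OF t] _ _ f1 _ f2])
    show "?f z = 0 \<and> deriv (theta11 t) z \<noteq> 0" if z: "theta11 t z = 0" for z
      using z theta11_simple[OF t z] lattice_S[OF t, of z] theta11_zero[OF t, of z] theta11_zero[OF s, of "z / t"] by simp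
  qed (use theta11_z1[OF t] theta11_shift[OF t] in auto)
  then obtain C where C: "\<And>z. ?f z = C * theta11 t z" by blast
  have "theta11 ?s (z / t) = C * e2pi (z\<^sup>2 / (2 * t)) * theta11 t z" for z
  proof -
    have "theta11 ?s (z / t) = e2pi (z\<^sup>2 / (2 * t)) * ?f z" by (simp add: mult.assoc[symmetric] e2pi_add[symmetric])
    thus ?thesis unfolding C by simp
  qed
  thus ?thesis by blast
qed

text \<open>\<open>aa\<close> and \<open>bb\<close> are the first and third z-derivatives of
  \<open>theta11\<close> at 0, divided by the matching powers of 2 pi i; \<open>aa\<close> is -
  \<eta>^3.\<close>

definition aa :: "complex => complex" where "aa t = - e2pi (t / 8) * varpi t"

definition bb :: "complex => complex" where "bb t = e2pi (t / 8) * (th3 t 0 - 3/4 * th1 t 0)"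

lemma aa_nonzero: "Im t > 0 ==> aa t \<noteq> 0" by (simp add: aa_def varpi_nonzero)

lemma th1_0_holomorphic: "(\<lambda>t. th1 t 0) holomorphic_on upper" by (rule expands_holomorphic_tau[OF th1_expands])

lemma aa_holomorphic: "aa holomorphic_on upper" unfolding aa_def varpi_def by (intro holomorphic_intros th1_0_holomorphic) auto

lemma Dt_aa:
  assumes t: "Im t > 0"
  shows "Dt aa t = bb t / 2"
proof (rule Dt_eqI)
  have "DERIV (\<lambda>t. - e2pi (t / 8)) t :> - (tpi * (1 / 8) * e2pi (t / 8))" by (auto intro!: derivative_eq_intros)
  from DERIV_mult[OF this DERIV_minus[OF DERIV_Dt[OF th1_0_holomorphic t]]]
  show "DERIV aa t :> tpi * (bb t / 2)" unfolding aa_def[abs_def] varpi_def by (rule DERIV_cong) (simp add: th1_heat[OF t] th2_0[OF t] bb_def field_simps)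
qed

text \<open>The inversion formula differentiated once and three times at z = 0, where even
  derivatives of \<open>theta11\<close> vanish. The same unknown C enters both results; the term
  with 3 aa comes from the Gaussian factor.\<close>

lemma aa_bb_S:
  assumes t: "Im t > 0"
  shows "\<exists>C. C \<noteq> 0 \<and> aa (- 1 / t) = t * C * aa t \<and> bb (- 1 / t) = t ^ 3 * C * (bb t + 3 * aa t / (tpi * t)) \<and>
    (\<forall>z. theta11 (- 1 / t) (z / t) = C * e2pi (z\<^sup>2 / (2 * t)) * theta11 t z)"
proof -
  obtain C where C: "\<And>z. theta11 (- 1 / t) (z / t) = C * e2pi (z\<^sup>2 / (2 * t)) * theta11 t z" using theta11_S[OF t] by blast
  let ?s = "- 1 / t"
  define P :: complex where "P = tpi"
  have P0: "P \<noteq> 0" by (simp add: P_def)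
  have s: "Im ?s > 0" and t0: "t \<noteq> 0" using t by auto
  define f1 where "f1 = (\<lambda>t z. e2pi (t / 8 - z / 2) * (th1 t z - th t z / 2))"
  define f2 where "f2 = (\<lambda>t z. e2pi (t / 8 - z / 2) * (th2 t z - th1 t z + th t z / 4))"
  define f3 where "f3 = (\<lambda>t z. e2pi (t / 8 - z / 2) * (th3 t z - 3/2 * th2 t z + 3/4 * th1 t z - th t z / 8))"
  have D: "DERIV (theta11 t) z :> P * f1 t z" "DERIV (f1 t) z :> P * f2 t z"
    "DERIV (f2 t) z :> P * f3 t z" if "Im t > 0" for t z unfolding P_def f1_def f2_def f3_def using theta11_DERIV[OF that] by blast+
  have q: "DERIV (\<lambda>z. z / t) z :> 1 / t" for z using t0 by (auto intro!: derivative_eq_intros)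
  let ?E = "\<lambda>z. e2pi (z\<^sup>2 / (2 * t))"
  have E: "DERIV (\<lambda>z. C * ?E z) z :> P * (C * (z / t * ?E z))" for z unfolding P_def using t0 by (auto intro!: derivative_eq_intros)
  note uniq = DERIV_const_unique[folded P_def]
  have 1: "f1 ?s (z / t) / t = C * ?E z * (z / t * theta11 t z + f1 t z)" for z
  proof (rule uniq)
    show "DERIV (\<lambda>z. theta11 ?s (z / t)) z :> P * (f1 ?s (z / t) / t)" using DERIV_chain2[OF D(1)[OF s] q] by simp
    show "DERIV (\<lambda>z. theta11 ?s (z / t)) z :> P * (C * ?E z * (z / t * theta11 t z + f1 t z))" unfolding C by (rule DERIV_cong[OF DERIV_mult[OF E D(1)[OF t]]]) (simp add: algebra_simps)
  qed
  have 2: "f2 ?s (z / t) / t\<^sup>2 = C * ?E z * (z / t * (z / t * theta11 t z) + 2 * (z / t * f1 t z) + 1 / (P * t) * theta11 t z + f2 t z)" for z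
  proof (rule uniq)
    show "DERIV (\<lambda>z. f1 ?s (z / t) / t) z :> P * (f2 ?s (z / t) / t\<^sup>2)" using DERIV_cdivide[OF DERIV_chain2[OF D(2)[OF s] q], of t] by (simp add: power2_eq_square)
    show "DERIV (\<lambda>z. f1 ?s (z / t) / t) z :> P * (C * ?E z * (z / t * (z / t * theta11 t z) + 2 * (z / t * f1 t z) + 1 / (P * t) * theta11 t z + f2 t z))" unfolding 1
      by (rule DERIV_cong[OF DERIV_mult[OF E DERIV_add[OF DERIV_mult[OF q D(1)[OF t]] D(2)[OF t]]]])
         (use t0 P0 in \<open>simp add: field_simps\<close>)
  qed
  have 3: "f3 ?s (0 / t) / t ^ 3 = C * (3 * f1 t 0 / (P * t) + f3 t 0)"
  proof (rule uniq)
    show "DERIV (\<lambda>z. f2 ?s (z / t) / t\<^sup>2) 0 :> P * (f3 ?s (0 / t) / t ^ 3)" by (rule DERIV_cong[OF DERIV_cdivide[OF DERIV_chain2[OF D(3)[OF s] q, of 0], of "t\<^sup>2"]])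
         (simp add: power2_eq_square power3_eq_cube)
    have "((\<lambda>z. z / t * (z / t * theta11 t z) + 2 * (z / t * f1 t z) + 1 / (P * t) * theta11 t z + f2 t z) has_field_derivative
        3 * f1 t 0 / t + P * f3 t 0) (at 0)" by (rule DERIV_cong[OF DERIV_add[OF DERIV_add[OF DERIV_add[OF
            DERIV_mult[OF q DERIV_mult[OF q D(1)[OF t]]] DERIV_cmult[OF DERIV_mult[OF q D(2)[OF t]]]] DERIV_cmult[OF D(1)[OF t]]] D(3)[OF t]]])
         (use t0 P0 in \<open>simp \<close>)
    from DERIV_mult[OF E this]
    show "DERIV (\<lambda>z. f2 ?s (z / t) / t\<^sup>2) 0 :> P * (C * (3 * f1 t 0 / (P * t) + f3 t 0))" unfolding 2 by (rule DERIV_cong) (use t0 P0 in \<open>simp add: field_simps\<close>)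
  qed
  have th0: "th t 0 = 0" if "Im t > 0" for t using th_neg[OF that, of 0] by simp
  have a: "f1 t 0 = aa t" and b: "f3 t 0 = bb t" if "Im t > 0" for t using th0[OF that] th2_0[OF that] by (simp_all add: f1_def f3_def aa_def bb_def varpi_def algebra_simps)
  have A: "aa ?s = t * C * aa t" using 1[of 0] a[OF t] a[OF s] t0 by (simp add: field_simps)
  moreover have "bb ?s = t ^ 3 * C * (bb t + 3 * aa t / (tpi * t))" unfolding P_def[symmetric] using P0 3 a[OF t] b[OF t] b[OF s] t0 by (simp add: field_simps)
  moreover have "C \<noteq> 0" using aa_nonzero[OF s] unfolding A by auto
  ultimately show ?thesis using C by blast
qed

lemma DERIV_S: "t \<noteq> 0 ==> (DERIV (\<lambda>t. - 1 / t) (t::complex) :> 1 / t\<^sup>2)" by (auto intro!: derivative_eq_intros simp: power2_eq_square)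

lemma Dt_S:
  assumes f: "f holomorphic_on upper" and t: "Im t > 0"
  shows "DERIV (\<lambda>t. f (- 1 / t)) t :> tpi * (Dt f (- 1 / t) / t\<^sup>2)"
  by (rule DERIV_cong[OF DERIV_chain2[OF DERIV_Dt[OF f Im_minus_inverse_pos[OF t]] DERIV_S[OF upper_nonzero[OF t]]]]) simp

lemma holomorphic_on_S:
  assumes "f holomorphic_on upper" shows "(\<lambda>t. f (- 1 / t)) holomorphic_on upper"
proof -
  have "(\<lambda>t::complex. - 1 / t) holomorphic_on upper" by (intro holomorphic_intros) auto
  from holomorphic_on_compose_gen[OF this assms] show ?thesis unfolding o_def by fastforce
qed

definition WW :: "complex => complex" where "WW t = aa (- 1 / t) / aa t"

lemma WW_holomorphic: "WW holomorphic_on upper" unfolding WW_def by (intro holomorphic_intros holomorphic_on_S aa_holomorphic) (simp add: aa_nonzero)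

lemma aa_S: "Im t > 0 ==> aa (- 1 / t) = WW t * aa t" by (simp add: WW_def aa_nonzero)

text \<open>By the heat equation bb = 2 Dt aa. Hence the two formulas of \<open>aa_bb_S\<close>
  combine into a differential equation for the multiplier, solved by the constant multiples of
  t^(3/2).\<close>

lemma Dt_WW:
  assumes t: "Im t > 0"
  shows "Dt WW t = 3 / (2 * tpi * t) * WW t"
proof -
  define P :: complex where "P = tpi"
  have P0: "P \<noteq> 0" by (simp add: P_def)
  have t0: "t \<noteq> 0" using t by auto
  have s: "Im (- 1 / t) > 0" using t by simp
  obtain C where C: "aa (- 1 / t) = t * C * aa t" "bb (- 1 / t) = t ^ 3 * C * (bb t + 3 * aa t / (P * t))" using aa_bb_S[OF t] unfolding P_def by blast
  have W: "WW t = t * C" using C(1) aa_nonzero[OF t] by (simp add: WW_def)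
  have 1: "DERIV (\<lambda>t. aa (- 1 / t)) t :> P * (Dt aa (- 1 / t) / t\<^sup>2)" unfolding P_def by (rule Dt_S[OF aa_holomorphic t])
  have "DERIV (\<lambda>t. WW t * aa t) t :> P * (Dt WW t * aa t + WW t * Dt aa t)"
    unfolding P_def by (rule DERIV_cong[OF DERIV_mult[OF DERIV_Dt[OF WW_holomorphic t] DERIV_Dt[OF aa_holomorphic t]]]) (simp add: algebra_simps)
  hence 2: "DERIV (\<lambda>t. aa (- 1 / t)) t :> P * (Dt WW t * aa t + WW t * Dt aa t)"
    by (rule has_field_derivative_transform_within_open[of _ _ _ upper]) (use t in \<open>simp_all add: aa_S[simplified]\<close>)
  have "Dt aa (- 1 / t) / t\<^sup>2 = Dt WW t * aa t + WW t * Dt aa t" by (rule DERIV_const_unique[folded P_def, OF 1 2])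
  hence "t ^ 3 * C * (bb t + 3 * aa t / (P * t)) / 2 / t\<^sup>2 = Dt WW t * aa t + WW t * (bb t / 2)" unfolding Dt_aa[OF t] Dt_aa[OF s] C(2) .
  hence "Dt WW t * aa t = 3 / (2 * P * t) * WW t * aa t" unfolding W using t0 P0 by (auto simp: field_simps power2_eq_square power3_eq_cube)
  thus ?thesis unfolding P_def mult_right_cancel[OF aa_nonzero[OF t]] .
qed

text \<open>The eighth power clears the branch of t^(3/2); the constant is read off at the fixed
  point i of the inversion, where WW = 1 and i^12 = 1.\<close>

lemma WW_pow8:
  assumes t: "Im t > 0"
  shows "WW t ^ 8 = t ^ 12"
proof -
  let ?h = "\<lambda>t. WW t ^ 8 / t ^ 12"
  have "\<exists>c. \<forall>x\<in>upper. ?h x = c"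
  proof (rule has_field_derivative_zero_constant[OF convex_upper])
    fix x assume x: "x \<in> upper"
    hence x0: "x \<noteq> 0" and xi: "Im x > 0" by auto
    have d: "DERIV WW x :> 3 / (2 * x) * WW x" by (rule DERIV_cong[OF DERIV_Dt[OF WW_holomorphic xi]]) (simp add: Dt_WW[OF xi] field_simps)
    have "DERIV ?h x :> 0" by (rule DERIV_cong[OF DERIV_divide[OF DERIV_power[OF d, of 8] DERIV_power[OF DERIV_ident, of 12]]])
         (use x0 in \<open>simp_all add: field_simps eval_nat_numeral\<close>)
    thus "(?h has_field_derivative 0) (at x within upper)" by (rule has_field_derivative_at_within)
  qed
  then obtain c where c: "\<And>x. Im x > 0 ==> ?h x = c" by auto
  have "- 1 / \<i> = \<i>" by (simp add: field_simps)
  hence "WW \<i> = 1" using aa_nonzero[of \<i>] by (simp add: WW_def)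
  moreover have "\<i> ^ 12 = (1::complex)" by (simp add: eval_nat_numeral)
  ultimately have "c = 1" using c[of \<i>] by simp
  thus ?thesis using c[OF t] t by (auto simp: field_simps)
qed

definition Delta :: "complex => complex" where "Delta t = aa t ^ 8"

lemma Delta_S: "Im t > 0 ==> Delta (- 1 / t) = t ^ 12 * Delta t" unfolding Delta_def aa_S power_mult_distrib by (simp add: WW_pow8)

lemma Delta_eq: "Delta t = e2pi t * varpi t ^ 8" by (simp add: Delta_def aa_def power_mult_distrib e2pi_pow)

subsection \<open>Eisenstein series\<close>

text \<open>E2 is the logarithmic derivative of \<open>Delta\<close>, and Ramanujan's identities
  serve as definitions of E4 and E6. Their transformation laws and integral coefficients are thereby
  inherited from E2.\<close>

definition E2 :: "complex => complex" where "E2 t = 8 * Dt aa t / aa t"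

definition E4 :: "complex => complex" where "E4 t = E2 t ^ 2 - 12 * Dt E2 t"

definition E6 :: "complex => complex" where "E6 t = E2 t * E4 t - 3 * Dt E4 t"

lemma Dt_holomorphic: "f holomorphic_on upper ==> Dt f holomorphic_on upper" unfolding Dt_def by (intro holomorphic_intros holomorphic_deriv) auto

lemma E2_holomorphic: "E2 holomorphic_on upper" unfolding E2_def by (intro holomorphic_intros Dt_holomorphic aa_holomorphic) (simp add: aa_nonzero)

lemma E4_holomorphic: "E4 holomorphic_on upper" unfolding E4_def by (intro holomorphic_intros Dt_holomorphic E2_holomorphic)

lemma E2_S:
  assumes t: "Im t > 0"
  shows "E2 (- 1 / t) = t\<^sup>2 * E2 t + 12 * t / tpi"
proof -
  define P :: complex where "P = tpi"
  have P0: "P \<noteq> 0" by (simp add: P_def)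
  have t0: "t \<noteq> 0" using t by auto
  have W0: "WW t \<noteq> 0" using t aa_nonzero[of "- 1 / t"] by (simp add: WW_def aa_nonzero del: minus_divide_left)
  have 1: "DERIV (\<lambda>t. aa (- 1 / t)) t :> P * (Dt aa (- 1 / t) / t\<^sup>2)" unfolding P_def by (rule Dt_S[OF aa_holomorphic t])
  have "DERIV (\<lambda>t. WW t * aa t) t :> P * (Dt WW t * aa t + WW t * Dt aa t)"
    unfolding P_def by (rule DERIV_cong[OF DERIV_mult[OF DERIV_Dt[OF WW_holomorphic t] DERIV_Dt[OF aa_holomorphic t]]]) (simp add: algebra_simps)
  hence 2: "DERIV (\<lambda>t. aa (- 1 / t)) t :> P * (Dt WW t * aa t + WW t * Dt aa t)"
    by (rule has_field_derivative_transform_within_open[of _ _ _ upper]) (use t in \<open>simp_all add: aa_S[simplified]\<close>)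
  have "Dt aa (- 1 / t) / t\<^sup>2 = Dt WW t * aa t + WW t * Dt aa t" by (rule DERIV_const_unique[folded P_def, OF 1 2])
  hence D: "Dt aa (- 1 / t) = t\<^sup>2 * (3 / (2 * P * t) * WW t * aa t + WW t * Dt aa t)" unfolding Dt_WW[OF t, folded P_def] using t0 by (simp add: field_simps)
  show ?thesis unfolding E2_def aa_S[OF t] P_def[symmetric] D using P0 t0 W0 aa_nonzero[OF t] by (simp add: field_simps power2_eq_square)
qed

lemma Dt_S_unique:
  assumes f: "f holomorphic_on upper" and t: "Im t > 0"
    and e: "\<And>t. Im t > 0 ==> f (- 1 / t) = g t"
    and g: "DERIV g t :> tpi * d"
  shows "Dt f (- 1 / t) = t\<^sup>2 * d"
proof -
  have "DERIV (\<lambda>t. f (- 1 / t)) t :> tpi * d" by (rule has_field_derivative_transform_within_open[OF g, of upper]) (use t e in auto)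
  from DERIV_const_unique[OF Dt_S[OF f t] this] have "Dt f (- 1 / t) / t\<^sup>2 = d" .
  thus ?thesis using t by (auto simp: field_simps)
qed

lemma E4_S:
  assumes t: "Im t > 0"
  shows "E4 (- 1 / t) = t ^ 4 * E4 t"
proof -
  define P :: complex where "P = tpi"
  have P0: "P \<noteq> 0" by (simp add: P_def)
  note d2 = DERIV_Dt[OF E2_holomorphic t, folded P_def]
  have "DERIV (\<lambda>t. t\<^sup>2 * E2 t + 12 * t / P) t :> P * (2 * t * E2 t / P + t\<^sup>2 * Dt E2 t + 12 / P\<^sup>2)"
    by (rule DERIV_cong[OF DERIV_add[OF DERIV_mult[OF DERIV_power[OF DERIV_ident, of 2] d2] DERIV_cdivide[OF DERIV_cmult[OF DERIV_ident, of 12], of P]]])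
       (use P0 in \<open>simp add: field_simps power2_eq_square\<close>)
  from Dt_S_unique[folded P_def, OF E2_holomorphic t E2_S[folded P_def] this]
  have D: "Dt E2 (- 1 / t) = t\<^sup>2 * (2 * t * E2 t / P + t\<^sup>2 * Dt E2 t + 12 / P\<^sup>2)" .
  show ?thesis unfolding E4_def E2_S[OF t, folded P_def] D using P0 by (simp add: field_simps power2_eq_square power4_eq_xxxx)
qed

lemma E6_S:
  assumes t: "Im t > 0"
  shows "E6 (- 1 / t) = t ^ 6 * E6 t"
proof -
  define P :: complex where "P = tpi"
  have P0: "P \<noteq> 0" by (simp add: P_def)
  note d4 = DERIV_Dt[OF E4_holomorphic t, folded P_def]
  have "DERIV (\<lambda>t. t ^ 4 * E4 t) t :> P * (4 * t ^ 3 * E4 t / P + t ^ 4 * Dt E4 t)" by (rule DERIV_cong[OF DERIV_mult[OF DERIV_power[OF DERIV_ident, of 4] d4]])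
       (use P0 in \<open>simp add: field_simps eval_nat_numeral\<close>)
  from Dt_S_unique[folded P_def, OF E4_holomorphic t E4_S this]
  have D: "Dt E4 (- 1 / t) = t\<^sup>2 * (4 * t ^ 3 * E4 t / P + t ^ 4 * Dt E4 t)" .
  show ?thesis unfolding E6_def E2_S[OF t, folded P_def] E4_S[OF t] D using P0 by (simp add: field_simps eval_nat_numeral)
qed

lemma varpi_holomorphic: "varpi holomorphic_on upper" unfolding varpi_def by (intro holomorphic_intros th1_0_holomorphic)

lemma E2_eq: "Im t > 0 ==> E2 t = 1 + 8 * (Dt varpi t * inverse (varpi t))"
proof -
  assume t: "Im t > 0"
  have "DERIV (\<lambda>t. - e2pi (t / 8)) t :> - (tpi * (1 / 8) * e2pi (t / 8))" by (auto intro!: derivative_eq_intros)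
  from DERIV_mult[OF this DERIV_Dt[OF varpi_holomorphic t]]
  have "DERIV aa t :> tpi * (- e2pi (t / 8) * (varpi t / 8 + Dt varpi t))" unfolding aa_def[abs_def] by (rule DERIV_cong) (simp add: algebra_simps)
  hence D: "Dt aa t = - e2pi (t / 8) * (varpi t / 8 + Dt varpi t)" by (rule Dt_eqI)
  show ?thesis unfolding E2_def D aa_def using varpi_nonzero[OF t] by (simp add: field_simps)
qed

lemma int_expansion_varpi_inverse: "int_expansion (\<lambda>t z. inverse (varpi t))" by (rule int_expansion_inverse[OF int_expansion_varpi varpi_nonzero varpi_at_cusp])

lemma int_expansion_minus: "int_expansion F ==> int_expansion G ==> int_expansion (\<lambda>t z. F t z - G t z)"
proof -
  assume "int_expansion F" "int_expansion G"
  hence "int_expansion (\<lambda>t z. F t z + (- 1) * G t z)" by (intro int_expansion_add int_expansion_mult int_expansion_const) auto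
  thus ?thesis by simp
qed

lemma tendsto_inverse_varpi: "((\<lambda>t. inverse (varpi t)) \<longlongrightarrow> 1) at_cusp" using tendsto_inverse[OF varpi_at_cusp] by simp

lemma int_expansion_E2: "int_expansion (\<lambda>t z. E2 t)" "(E2 \<longlongrightarrow> 1) at_cusp"
proof -
  have "int_expansion (\<lambda>t z. 1 + 8 * (Dt varpi t * inverse (varpi t)))"
    by (intro int_expansion_add int_expansion_mult int_expansion_const int_expansion_Dt int_expansion_varpi int_expansion_varpi_inverse) auto
  thus "int_expansion (\<lambda>t z. E2 t)" by (rule int_expansion_cong[rotated]) (simp add: E2_eq)
  have "((\<lambda>t. 1 + 8 * (Dt varpi t * inverse (varpi t))) \<longlongrightarrow> 1 + 8 * (0 * 1)) at_cusp" by (intro tendsto_intros int_expansion_Dt int_expansion_varpi tendsto_inverse_varpi)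
  thus "(E2 \<longlongrightarrow> 1) at_cusp" by (rule Lim_transform_eventually[THEN back_subst[where P = "\<lambda>x. (E2 \<longlongrightarrow> x) at_cusp"]])
       (rule eventually_mono[OF eventually_at_cusp_upper], simp_all add: E2_eq)
qed

lemma int_expansion_E4: "int_expansion (\<lambda>t z. E4 t)" "(E4 \<longlongrightarrow> 1) at_cusp"
proof -
  show "int_expansion (\<lambda>t z. E4 t)" unfolding E4_def by (intro int_expansion_minus int_expansion_mult int_expansion_power int_expansion_const int_expansion_Dt int_expansion_E2) auto
  have "((\<lambda>t. E2 t ^ 2 - 12 * Dt E2 t) \<longlongrightarrow> 1 ^ 2 - 12 * 0) at_cusp" by (intro tendsto_intros int_expansion_Dt int_expansion_E2)
  thus "(E4 \<longlongrightarrow> 1) at_cusp" by (simp add: E4_def[abs_def])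
qed

lemma int_expansion_E6: "int_expansion (\<lambda>t z. E6 t)" "(E6 \<longlongrightarrow> 1) at_cusp"
proof -
  show "int_expansion (\<lambda>t z. E6 t)" unfolding E6_def
    by (intro int_expansion_minus int_expansion_mult int_expansion_power int_expansion_const int_expansion_Dt int_expansion_E2 int_expansion_E4) auto
  have "((\<lambda>t. E2 t * E4 t - 3 * Dt E4 t) \<longlongrightarrow> 1 * 1 - 3 * 0) at_cusp" by (intro tendsto_intros int_expansion_Dt int_expansion_E2 int_expansion_E4)
  thus "(E6 \<longlongrightarrow> 1) at_cusp" by (simp add: E6_def[abs_def])
qed

section \<open>Modular forms of positive weight\<close>

lemma rho_S: "- 1 / (- 1 / 2 + \<i> * of_real (sqrt 3) / 2) = (- 1 / 2 + \<i> * of_real (sqrt 3) / 2) + (1 :: complex)"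
proof -
  let ?r = "- 1 / 2 + \<i> * of_real (sqrt 3) / 2 :: complex"
  have "(of_real (sqrt 3) :: complex) * of_real (sqrt 3) = 3" by (simp flip: of_real_mult)
  hence 1: "(?r + 1) * ?r = - 1" by (simp add: field_simps)
  have 2: "?r \<noteq> 0" by (simp add: complex_eq_iff)
  show ?thesis by (rule sym, rule eq_divide_imp[OF 2 1])
qed

text \<open>An elementary residue theorem for q^(-N) f. The form q^(-N) f dt is invariant under the
  inversion, so a primitive F changes by a constant under it, and the fixed point i shows that this
  constant is 0. At the cube root of unity \<rho> the inversion equals translation by 1, so F(\<rho>
  + 1) = F(\<rho>); but F(t + 1) - F(t) is 2 pi i times the constant term.\<close>

lemma weight_2_constant_term:
  assumes e: "expands (\<lambda>t z. f t) c" and n: "fourier_nice c"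
    and S: "\<And>t. Im t > 0 ==> e2pi (- of_int N * (- 1 / t)) * f (- 1 / t) = t\<^sup>2 * (e2pi (- of_int N * t) * f t)"
  shows "c N 0 = 0"
proof -
  define P :: complex where "P = tpi"
  have P0: "P \<noteq> 0" by (simp add: P_def)
  \<comment> \<open>Coefficients for the periodic part of a primitive of q^(-N) f: division by n -
    N, with the term n = N left out.\<close>
  define d where "d = (\<lambda>n r. if n = N then 0 else c n r / of_int (n - N))"
  define g where "g = (\<lambda>t. infsum (fterm d t 0) UNIV)"
  have cc: "c n r = 0" if "r \<noteq> 0" for n r
  proof -
    have "c n r = col (\<lambda>n. c n 0) n r" by (rule fun_cong[OF fun_cong[OF expands_const_col[OF e n]]])
    thus ?thesis by (simp add: col_def that)
  qed
  have g: "expands (\<lambda>t z. g t) d"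
  proof (rule expandsI)
    fix t z :: complex assume t: "Im t > 0"
    have "(\<lambda>x. norm (fterm d t 0 x)) summable_on UNIV"
    proof (rule summable_on_comparison_test[OF expands_summable[OF e t, of 0]])
      fix x :: "int \<times> int"
      obtain n r where x: "x = (n, r)" by (cases x)
      have "norm (d n r) \<le> norm (c n r)"
      proof (cases "n = N")
        case False
        hence "1 \<le> norm (of_int (n - N) :: complex)" by (simp flip: of_int_diff)
        hence "norm (c n r) / norm (of_int (n - N) :: complex) \<le> norm (c n r) / 1" by (intro divide_left_mono) auto
        thus ?thesis using False by (simp add: d_def norm_divide)
      qed (simp add: d_def)
      thus "norm (fterm d t 0 x) \<le> norm (fterm c t 0 x)" by (simp add: x norm_mult mult_right_mono)
    qed auto
    hence "(fterm d t 0 has_sum g t) UNIV" unfolding g_def by (rule has_sum_infsum[OF abs_summable_summable])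
    moreover have "fterm d t 0 = fterm d t z"
    proof (rule ext)
      fix x :: "int \<times> int"
      obtain n r where x: "x = (n, r)" by (cases x)
      show "fterm d t 0 x = fterm d t z x" by (cases "r = 0") (simp_all add: x d_def cc)
    qed
    ultimately show "(fterm d t z has_sum g t) UNIV" by simp
  qed
  have gh: "g holomorphic_on upper" using expands_holomorphic_tau[OF g] .
  have Dg: "Dt g t = f t - c N 0 * e2pi (of_int N * t) + of_int N * g t" if t: "Im t > 0" for t
  proof -
    have "expands (\<lambda>t z. f t - c N 0 * e2pi (of_int N * t + of_int 0 * z) + of_int N * g t)
       (\<lambda>n r. c n r - c N 0 * (if n = N \<and> r = 0 then 1 else 0) + of_int N * d n r)" by (intro expands_add expands_diff expands_cmult e g expands_monomial)
    also have "(\<lambda>n r. c n r - c N 0 * (if n = N \<and> r = 0 then 1 else 0) + of_int N * d n r) = (\<lambda>n r. of_int n * d n r)"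
    proof (intro ext)
      fix n r
      show "c n r - c N 0 * (if n = N \<and> r = 0 then 1 else 0) + of_int N * d n r = of_int n * d n r"
      proof (cases "n = N")
        case False
        hence "(of_int n :: complex) - of_int N \<noteq> 0" by simp
        thus ?thesis using False by (simp add: d_def field_simps)
      qed (use cc[of r N] in \<open>auto simp: d_def\<close>)
    qed
    finally show ?thesis using expands_fun_unique[OF expands_Dt[OF g] _ t, of "\<lambda>t z. f t - c N 0 * e2pi (of_int N * t + of_int 0 * z) + of_int N * g t"] by simp
  qed
  \<comment> \<open>The omitted term n = N integrates to the linear summand.\<close>
  define F where "F = (\<lambda>t. P * c N 0 * t + e2pi (- of_int N * t) * g t)"
  have F: "DERIV F t :> P * (e2pi (- of_int N * t) * f t)" if t: "Im t > 0" for t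
  proof -
    have "DERIV (\<lambda>t. e2pi (- of_int N * t)) t :> P * (- of_int N) * e2pi (- of_int N * t)" unfolding P_def by (auto intro!: derivative_eq_intros)
    from DERIV_add[OF DERIV_cmult[OF DERIV_ident, of "P * c N 0"] DERIV_mult[OF this DERIV_Dt[OF gh t, folded P_def]]]
    have "DERIV F t :> P * c N 0 * 1 + (P * (- of_int N) * e2pi (- of_int N * t) * g t + P * Dt g t * e2pi (- of_int N * t))" unfolding F_def .
    moreover have "e2pi (of_int N * t) * e2pi (- of_int N * t) = 1" by (simp add: e2pi_add[symmetric])
    hence "P * c N 0 * 1 + (P * (- of_int N) * e2pi (- of_int N * t) * g t + P * Dt g t * e2pi (- of_int N * t)) = P * (e2pi (- of_int N * t) * f t)" unfolding Dg[OF t] by (simp add: algebra_simps)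
    ultimately show ?thesis by simp
  qed
  have FS: "DERIV (\<lambda>t. F (- 1 / t)) t :> P * (e2pi (- of_int N * t) * f t)" if t: "Im t > 0" for t
  proof (rule DERIV_cong[OF DERIV_chain2[OF F[OF Im_minus_inverse_pos[OF t]] DERIV_S[OF upper_nonzero[OF t]]]])
    have "P * (e2pi (- of_int N * (- 1 / t)) * f (- 1 / t)) * (1 / t\<^sup>2) = P * (t\<^sup>2 * (e2pi (- of_int N * t) * f t)) * (1 / t\<^sup>2)" by (simp only: S[OF t])
    also have "\<dots> = P * (e2pi (- of_int N * t) * f t)" using upper_nonzero[OF t] by simp
    finally show "P * (e2pi (- of_int N * (- 1 / t)) * f (- 1 / t)) * (1 / t\<^sup>2) = P * (e2pi (- of_int N * t) * f t)" .
  qed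
  have "\<exists>k. \<forall>x\<in>upper. F (- 1 / x) - F x = k"
  proof (rule has_field_derivative_zero_constant[OF convex_upper])
    fix x assume "x \<in> upper"
    hence x: "Im x > 0" by simp
    have "DERIV (\<lambda>x. F (- 1 / x) - F x) x :> 0" using DERIV_diff[OF FS[OF x] F[OF x]] by (simp only: diff_self)
    thus "((\<lambda>x. F (- 1 / x) - F x) has_field_derivative 0) (at x within upper)" by (rule has_field_derivative_at_within)
  qed
  then obtain k where k: "\<And>x. Im x > 0 ==> F (- 1 / x) - F x = k" by auto
  have "- 1 / \<i> = \<i>" by (simp add: field_simps)
  hence "k = 0" using k[of \<i>] by simp
  let ?r = "- 1 / 2 + \<i> * of_real (sqrt 3) / 2 :: complex"
  have r: "Im ?r > 0" by simp
  have "F (?r + 1) = F ?r" using k[OF r] unfolding rho_S \<open>k = 0\<close> by simp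
  moreover have "F (?r + 1) = P * c N 0 + F ?r"
  proof -
    have "- of_int N * (?r + 1) = - of_int N * ?r + of_int (- N)" by (simp add: algebra_simps)
    hence "e2pi (- of_int N * (?r + 1)) = e2pi (- of_int N * ?r)" by (simp only: e2pi_plus_int)
    thus ?thesis unfolding F_def using expands_T[OF g r] by (simp add: algebra_simps)
  qed
  ultimately show ?thesis using P0 by simp
qed

definition mform :: "nat => (complex => complex) => (int => complex) => bool" where
  "mform k f v \<longleftrightarrow> expands (\<lambda>t z. f t) (col v) \<and> (\<forall>n<0. v n = 0) \<and>
     (\<forall>t. Im t > 0 --> f (- 1 / t) = t ^ k * f t)"

lemma conv_col:
  assumes "\<And>n. n < 0 ==> w n = 0"
  shows "conv (col w) (col v) n 0 = (\<Sum>k\<in>{0..n}. w k * v (n - k))"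
proof -
  have "conv (col w) (col v) n 0 = (\<Sum>(k, s)\<in>(\<lambda>k. (k, 0)) ` {k\<in>{0..n}. w k \<noteq> 0}. col w k s * col v (n - k) (0 - s))"
    unfolding conv_def by (rule sum.cong) (auto simp: col_def split: if_splits)
  also have "\<dots> = (\<Sum>k\<in>{k\<in>{0..n}. w k \<noteq> 0}. w k * v (n - k))" by (subst sum.reindex) (auto simp: inj_on_def col_def)
  also have "\<dots> = (\<Sum>k\<in>{0..n}. w k * v (n - k))" by (rule sum.mono_neutral_left) auto
  finally show ?thesis .
qed

text \<open>E4^a E6^b / Delta^n has weight 2 - k, integral coefficients and leading term q^(-n). Its
  product with a form of weight k has weight two and hence constant term 0, which expresses v n by
  earlier coefficients with multipliers common to all forms.\<close>

lemma mform_recursion: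
  assumes k: "even k" and n: "k < n"
  shows "\<exists>w. (\<forall>j. w j \<in> \<int>) \<and> (\<forall>f v. mform k f v --> v (int n) = (\<Sum>j\<in>{1..int n}. w j * v (int n - j)))"
proof -
  \<comment> \<open>Solves 2a + 3b = t with b the parity of t; k < n makes t at least 3.\<close>
  obtain a b :: nat where ab: "4 * a + 6 * b + k = 12 * n + 2"
  proof -
    define t where "t = (12 * n + 2 - k) div 2"
    have t: "2 * t + k = 12 * n + 2" using k n unfolding t_def by (auto elim!: evenE)
    hence t2: "t \<ge> 3" using n by simp
    define b where "b = t mod 2"
    define a where "a = (t - 3 * b) div 2"
    have "b = 0 \<or> b = 1" "even (t - b)" unfolding b_def by auto
    hence "2 * a + 3 * b = t" using t2 unfolding a_def by (auto elim!: evenE)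
    hence "4 * a + 6 * b + k = 12 * n + 2" using t by linarith
    thus ?thesis using that by blast
  qed
  \<comment> \<open>The form of weight 2 - k multiplied by q^n, so that its expansion starts with
    1.\<close>
  define h where "h = (\<lambda>t. E4 t ^ a * E6 t ^ b * inverse (varpi t) ^ (8 * n))"
  have h: "int_expansion (\<lambda>t z. h t)" unfolding h_def by (intro int_expansion_mult int_expansion_power int_expansion_E4 int_expansion_E6 int_expansion_varpi_inverse)
  have "((\<lambda>t. E4 t ^ a * E6 t ^ b * inverse (varpi t) ^ (8 * n)) \<longlongrightarrow> 1 ^ a * 1 ^ b * 1 ^ (8 * n)) at_cusp"
    by (intro tendsto_intros int_expansion_E4 int_expansion_E6 tendsto_inverse_varpi)
  hence hl: "(h \<longlongrightarrow> 1) at_cusp" unfolding h_def by simp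
  obtain d where d: "expands (\<lambda>t z. h t) d" "fourier_nice d" "\<And>n r. d n r \<in> \<int>" using h unfolding int_expansion_def by blast
  have d0: "d 0 0 = 1" using tendsto_unique[OF at_cusp_not_bot expands_at_cusp[OF d(1,2)] hl] .
  define w where "w = (\<lambda>j. d j 0)"
  have dw: "d = col w" unfolding w_def by (rule expands_const_col[OF d(1,2)])
  have wn: "w j = 0" if "j < 0" for j using fourier_nice_neg[OF d(2) that] by (simp add: w_def)
  have "v (int n) = (\<Sum>j\<in>{1..int n}. - w j * v (int n - j))" if m: "mform k f v" for f v
  proof -
    have v: "expands (\<lambda>t z. f t) (col v)" "\<And>n. n < 0 ==> v n = 0" "\<And>t. Im t > 0 ==> f (- 1 / t) = t ^ k * f t" using m unfolding mform_def by blast+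
    have vn: "fourier_nice (col v)" by (rule fourier_nice_col[OF v(2)])
    have "conv d (col v) (int n) 0 = 0"
    proof (rule weight_2_constant_term[OF expands_mult[OF d(1) v(1) d(2) vn] fourier_nice_conv[OF d(2) vn]])
      fix t assume t: "Im t > 0"
      have t0: "t \<noteq> 0" using t by auto
      have key: "e2pi (- of_int (int n) * t) * (h t * f t) = E4 t ^ a * E6 t ^ b * inverse (Delta t) ^ n * f t" for t
      proof -
        have "Delta t ^ n = e2pi (of_nat n * t) * varpi t ^ (8 * n)" by (simp add: Delta_eq power_mult_distrib power_mult[symmetric] e2pi_pow)
        hence "inverse (Delta t) ^ n = e2pi (- of_int (int n) * t) * inverse (varpi t) ^ (8 * n)" by (simp add: power_inverse inverse_mult_distrib e2pi_minus)
        thus ?thesis by (simp add: h_def mult_ac)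
      qed
      have "E4 (- 1 / t) ^ a * E6 (- 1 / t) ^ b * inverse (Delta (- 1 / t)) ^ n * f (- 1 / t)
          = t ^ (4 * a + 6 * b + k) * inverse (t ^ (12 * n)) * (E4 t ^ a * E6 t ^ b * inverse (Delta t) ^ n * f t)" unfolding E4_S[OF t] E6_S[OF t] Delta_S[OF t] v(3)[OF t]
        by (simp add: power_mult_distrib power_mult[symmetric] power_add inverse_mult_distrib power_inverse mult_ac)
      also have "t ^ (4 * a + 6 * b + k) * inverse (t ^ (12 * n)) = t\<^sup>2" unfolding ab power_add using t0 by simp
      finally show "e2pi (- of_int (int n) * (- 1 / t)) * (h (- 1 / t) * f (- 1 / t)) = t\<^sup>2 * (e2pi (- of_int (int n) * t) * (h t * f t))" unfolding key .
    qed
    hence "(\<Sum>j\<in>{0..int n}. w j * v (int n - j)) = 0" unfolding dw using conv_col[of w v "int n"] wn by simp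
    also have "{0..int n} = insert 0 {1..int n}" by auto
    finally have "w 0 * v (int n) + (\<Sum>j\<in>{1..int n}. w j * v (int n - j)) = 0" by simp
    thus ?thesis using d0 by (simp add: w_def sum_negf add_eq_0_iff)
  qed
  thus ?thesis using d(3) by (intro exI[of _ "\<lambda>j. - w j"]) (auto simp: w_def)
qed

text \<open>Containment in the complex span of finitely many integer-valued functions; the spanning
  functions may lie outside S and be dependent.\<close>

definition int_span :: "('i => complex) set => bool" where
  "int_span S \<longleftrightarrow> (\<exists>N::nat. \<exists>b :: nat => 'i => complex. (\<forall>j i. b j i \<in> \<int>) \<and>
     (\<forall>x\<in>S. \<exists>a. \<forall>i. x i = (\<Sum>j<N. a j * b j i)))"

text \<open>The recursion expresses every coefficient through the first k + 1 with integer
  multipliers common to all forms; these multipliers are the spanning arrays.\<close>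

lemma mform_int_span:
  assumes k: "even k"
  shows "int_span {v. \<exists>f. mform k f v}"
proof -
  have ex: "\<exists>\<beta>. (\<forall>j. \<beta> j \<in> \<int>) \<and> (\<forall>f v. mform k f v --> v (int n) = (\<Sum>j<Suc k. v (int j) * \<beta> j))" for n
  proof (induction n rule: less_induct)
    case (less n)
    show ?case
    proof (cases "n < Suc k")
      case True
      have "(\<Sum>j<Suc k. x j * (if j = n then 1 else 0)) = x n" for x :: "nat => complex"
      proof -
        have "(\<Sum>j<Suc k. x j * (if j = n then 1 else 0)) = (\<Sum>j<Suc k. if j = n then x j else 0)" by (rule sum.cong) auto
        thus ?thesis using True by (simp only: sum.delta finite_lessThan lessThan_iff if_True)
      qed
      thus ?thesis by (intro exI[of _ "\<lambda>j. if j = n then 1 else 0"]) auto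
    next
      case False
      then obtain w where w: "\<And>j. w j \<in> \<int>" "\<And>f v. mform k f v ==> v (int n) = (\<Sum>j\<in>{1..int n}. w j * v (int n - j))" using mform_recursion[OF k, of n] by auto
      have "\<forall>i. \<exists>\<beta>. i < n --> (\<forall>j. \<beta> j \<in> \<int>) \<and> (\<forall>f v. mform k f v --> v (int i) = (\<Sum>j<Suc k. v (int j) * \<beta> j))" using less by blast
      then obtain B where B: "\<And>i j. i < n ==> B i j \<in> \<int>" "\<And>i f v. i < n ==> mform k f v ==> v (int i) = (\<Sum>j<Suc k. v (int j) * B i j)"
        using choice[of "\<lambda>i \<beta>. i < n --> (\<forall>j. \<beta> j \<in> \<int>) \<and> (\<forall>f v. mform k f v --> v (int i) = (\<Sum>j<Suc k. v (int j) * \<beta> j))"] by blast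
      let ?b = "\<lambda>j. \<Sum>i\<in>{1..int n}. w i * B (nat (int n - i)) j"
      have "?b j \<in> \<int>" for j by (rule Ints_sum) (intro Ints_mult w(1) B(1), auto)
      moreover have "v (int n) = (\<Sum>j<Suc k. v (int j) * ?b j)" if m: "mform k f v" for f v
      proof -
        have "v (int n) = (\<Sum>i\<in>{1..int n}. w i * (\<Sum>j<Suc k. v (int j) * B (nat (int n - i)) j))" unfolding w(2)[OF m]
        proof (rule sum.cong[OF refl])
          fix i assume i: "i \<in> {1..int n}"
          hence "int n - i = int (nat (int n - i))" "nat (int n - i) < n" by auto
          thus "w i * v (int n - i) = w i * (\<Sum>j<Suc k. v (int j) * B (nat (int n - i)) j)" using B(2)[OF _ m, of "nat (int n - i)"] by simp
        qed
        also have "\<dots> = (\<Sum>i\<in>{1..int n}. \<Sum>j<Suc k. v (int j) * (w i * B (nat (int n - i)) j))" unfolding sum_distrib_left by (simp only: mult_ac)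
        also have "\<dots> = (\<Sum>j<Suc k. \<Sum>i\<in>{1..int n}. v (int j) * (w i * B (nat (int n - i)) j))" by (rule sum.swap)
        finally show ?thesis unfolding sum_distrib_left .
      qed
      ultimately show ?thesis by (intro exI[of _ ?b]) blast
    qed
  qed
  have "\<forall>n. \<exists>\<beta>. (\<forall>j. \<beta> j \<in> \<int>) \<and> (\<forall>f v. mform k f v --> v (int n) = (\<Sum>j<Suc k. v (int j) * \<beta> j))" using ex by (rule allI)
  from choice[OF this] obtain b where b: "\<And>n j. b n j \<in> \<int>" "\<And>n f v. mform k f v ==> v (int n) = (\<Sum>j<Suc k. v (int j) * b n j)" by blast
  define c where "c = (\<lambda>j i. if i < 0 then 0 else b (nat i) j)"
  have "v i = (\<Sum>j<Suc k. v (int j) * c j i)" if m: "mform k f v" for f v i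
  proof (cases "i < 0")
    case True
    thus ?thesis using m unfolding mform_def c_def by simp
  next
    case False
    thus ?thesis using b(2)[OF m, of "nat i"] by (simp add: c_def del: sum.lessThan_Suc)
  qed
  note vc = this
  have "\<exists>a. \<forall>i. x i = (\<Sum>j<Suc k. a j * c j i)" if x: "x \<in> {v. \<exists>f. mform k f v}" for x
  proof -
    obtain f where "mform k f x" using x by blast
    thus ?thesis by (intro exI[of _ "\<lambda>j. x (int j)"] allI vc)
  qed
  moreover have "\<forall>j i. c j i \<in> \<int>" using b(1) by (simp add: c_def)
  ultimately show ?thesis unfolding int_span_def by blast
qed

section \<open>The prime form and the index one form\<close>

text \<open>The prime form: weight -1, index 1/2, simple zeros exactly at the lattice points,
  derivative 2 pi i at 0. The unknown multiplier C of \<open>theta11\<close> cancels in this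
  quotient.\<close>

definition Kf :: "complex => complex => complex" where
  "Kf t z = theta11 t z / aa t"

definition Kf1 :: "complex => complex => complex" where
  "Kf1 t z = e2pi (t / 8 - z / 2) * (th1 t z - th t z / 2) / aa t"

definition Kf2 :: "complex => complex => complex" where
  "Kf2 t z = e2pi (t / 8 - z / 2) * (th2 t z - th1 t z + th t z / 4) / aa t"

lemma Kf_DERIV:
  assumes t: "Im t > 0"
  shows "DERIV (Kf t) z :> tpi * Kf1 t z"
    "DERIV (Kf1 t) z :> tpi * Kf2 t z" unfolding Kf_def[abs_def] Kf1_def[abs_def] Kf2_def by (rule DERIV_cong[OF DERIV_cdivide[OF theta11_DERIV(1)[OF t]]], simp)
     (rule DERIV_cong[OF DERIV_cdivide[OF theta11_DERIV(2)[OF t]]], simp)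

lemma Kf_holomorphic: "Im t > 0 ==> Kf t holomorphic_on A" unfolding Kf_def by (intro holomorphic_intros theta11_holomorphic) (auto simp: aa_nonzero)

lemma Kf_neg: "Im t > 0 ==> Kf t (- z) = - Kf t z" by (simp add: Kf_def theta11_neg)

lemma Kf_z1: "Im t > 0 ==> Kf t (z + 1) = - Kf t z" by (simp add: Kf_def theta11_z1)

lemma Kf_shift: "Im t > 0 ==> Kf t (z + t) = - e2pi (- t / 2 - z) * Kf t z" by (simp add: Kf_def theta11_shift)

lemma Kf_zero: "Im t > 0 ==> Kf t z = 0 \<longleftrightarrow> z \<in> lattice t" by (simp add: Kf_def theta11_zero aa_nonzero)

lemma Kf_simple: "Im t > 0 ==> Kf t z = 0 ==> deriv (Kf t) z \<noteq> 0"
proof -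
  assume t: "Im t > 0" and z: "Kf t z = 0"
  hence z': "theta11 t z = 0" by (simp add: Kf_def aa_nonzero)
  have "deriv (Kf t) z = deriv (theta11 t) z / aa t" unfolding DERIV_imp_deriv[OF Kf_DERIV(1)[OF t]] DERIV_imp_deriv[OF theta11_DERIV(1)[OF t]] by (simp add: Kf1_def)
  thus ?thesis using theta11_simple[OF t z'] aa_nonzero[OF t] by simp
qed

lemma Kf_0: "Im t > 0 ==> Kf t 0 = 0" "Im t > 0 ==> Kf1 t 0 = 1" using th_neg[of t 0] aa_nonzero[of t] by (simp_all add: Kf_def Kf1_def theta11_def aa_def varpi_def)

lemma Kf_S:
  assumes t: "Im t > 0"
  shows "Kf (- 1 / t) (z / t) = e2pi (z\<^sup>2 / (2 * t)) * Kf t z / t"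
proof -
  obtain C where C: "C \<noteq> 0" "aa (- 1 / t) = t * C * aa t" "\<And>z. theta11 (- 1 / t) (z / t) = C * e2pi (z\<^sup>2 / (2 * t)) * theta11 t z" using aa_bb_S[OF t] by blast
  show ?thesis unfolding Kf_def C(2,3) using C(1) by simp
qed

text \<open>K^2 times (E2/12 minus the second logarithmic derivative of K), that is, K^2 times a
  normalised Weierstrass function. 12 \<open>Phi\<close> is the standard weak Jacobi form of weight
  0 and index 1.\<close>

definition Phi :: "complex => complex => complex" where
  "Phi t z = Kf1 t z ^ 2 - Kf t z * Kf2 t z + E2 t / 12 * Kf t z ^ 2"

lemma Phi_0: "Im t > 0 ==> Phi t 0 = 1" by (simp add: Phi_def Kf_0)

lemma Phi_holomorphic: "Im t > 0 ==> Phi t holomorphic_on UNIV"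
proof -
  assume t: "Im t > 0"
  have "th1 t holomorphic_on UNIV" "th2 t holomorphic_on UNIV" "th t holomorphic_on UNIV" by (rule expands_holomorphic_z[OF _ t], rule th1_expands th2_expands th_expands)+
  thus ?thesis unfolding Phi_def Kf1_def Kf2_def by (intro holomorphic_intros Kf_holomorphic t) (auto simp: aa_nonzero[OF t])
qed

lemma Phi_shift:
  assumes t: "Im t > 0" shows "Phi t (z + t) = e2pi (- t - 2 * z) * Phi t z"
proof -
  let ?u = "\<lambda>z. - e2pi (- t / 2 - z)"
  have s: "DERIV (\<lambda>z. z + t) z :> 1" for z :: complex by (auto intro!: derivative_eq_intros)
  have u: "DERIV ?u z :> tpi * - ?u z" for z by (auto intro!: derivative_eq_intros)
  have 1: "Kf1 t (z + t) = ?u z * (Kf1 t z - Kf t z)" for z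
  proof (rule DERIV_const_unique)
    show "DERIV (\<lambda>z. Kf t (z + t)) z :> tpi * Kf1 t (z + t)" by (rule DERIV_cong[OF DERIV_chain2[OF Kf_DERIV(1)[OF t] s]]) simp
    show "DERIV (\<lambda>z. Kf t (z + t)) z :> tpi * (?u z * (Kf1 t z - Kf t z))" unfolding Kf_shift[OF t] by (rule DERIV_cong[OF DERIV_mult[OF u Kf_DERIV(1)[OF t]]]) (simp add: algebra_simps)
  qed
  have 2: "Kf2 t (z + t) = ?u z * (Kf2 t z - 2 * Kf1 t z + Kf t z)" for z
  proof (rule DERIV_const_unique)
    show "DERIV (\<lambda>z. Kf1 t (z + t)) z :> tpi * Kf2 t (z + t)" by (rule DERIV_cong[OF DERIV_chain2[OF Kf_DERIV(2)[OF t] s]]) simp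
    show "DERIV (\<lambda>z. Kf1 t (z + t)) z :> tpi * (?u z * (Kf2 t z - 2 * Kf1 t z + Kf t z))"
      unfolding 1 by (rule DERIV_cong[OF DERIV_mult[OF u DERIV_diff[OF Kf_DERIV(2)[OF t] Kf_DERIV(1)[OF t]]]]) (simp add: algebra_simps)
  qed
  have "- t / 2 - z + (- t / 2 - z) = - t - 2 * z" by (simp add: field_simps)
  hence uu: "e2pi (- t - 2 * z) = ?u z * ?u z" by (simp add: e2pi_add[symmetric])
  show ?thesis unfolding uu Phi_def 1 2 Kf_shift[OF t] by (simp add: algebra_simps power2_eq_square)
qed

lemma Phi_S_algebra:
  fixes t P :: complex
  assumes "t \<noteq> 0" "P \<noteq> 0"
  shows "(e * (w * k + k1)) ^ 2 - e * k / t * (t * (e * (w * (w * k) + 2 * (w * k1) + 1 / (P * t) * k + k2))) +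
    (t\<^sup>2 * E + 12 * t / P) / 12 * (e * k / t) ^ 2 = e * e * (k1 ^ 2 - k * k2 + E / 12 * k ^ 2)"
proof -
  have 1: "(t\<^sup>2 * E + 12 * t / P) / 12 * (e * k / t) ^ 2 = (E / 12 + 1 / (P * t)) * (e * k) ^ 2" using assms by (simp add: divide_simps power2_eq_square) (simp add: algebra_simps)
  have 2: "e * k / t * (t * (e * (w * (w * k) + 2 * (w * k1) + 1 / (P * t) * k + k2))) =
      e * k * (e * (w * (w * k) + 2 * (w * k1) + 1 / (P * t) * k + k2))" using assms by simp
  define i where "i = 1 / (P * t)"
  show ?thesis unfolding 1 2 unfolding i_def[symmetric] by (simp add: power2_eq_square algebra_simps)
qed

text \<open>Under the inversion K acquires the Gaussian e(z^2/2t), whose second logarithmic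
  derivative is cancelled by the non-modular term in the transformation of E2.\<close>

lemma Phi_S:
  assumes t: "Im t > 0"
  shows "Phi (- 1 / t) (z / t) = e2pi (z\<^sup>2 / t) * Phi t z"
proof -
  let ?s = "- 1 / t"
  define P :: complex where "P = tpi"
  have P0: "P \<noteq> 0" by (simp add: P_def)
  have s: "Im ?s > 0" and t0: "t \<noteq> 0" using t by auto
  let ?E = "\<lambda>z. e2pi (z\<^sup>2 / (2 * t))"
  have q: "DERIV (\<lambda>z. z / t) z :> 1 / t" for z using t0 by (auto intro!: derivative_eq_intros)
  have E: "DERIV ?E z :> P * (z / t * ?E z)" for z unfolding P_def using t0 by (auto intro!: derivative_eq_intros)
  note D = Kf_DERIV[folded P_def]
  note uniq = DERIV_const_unique[folded P_def]
  have 1: "Kf1 ?s (z / t) = ?E z * (z / t * Kf t z + Kf1 t z)" for z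
  proof -
    have "Kf1 ?s (z / t) / t = ?E z * (z / t * Kf t z + Kf1 t z) / t"
    proof (rule uniq)
      show "DERIV (\<lambda>z. Kf ?s (z / t)) z :> P * (Kf1 ?s (z / t) / t)" by (rule DERIV_cong[OF DERIV_chain2[OF D(1)[OF s] q]]) simp
      show "DERIV (\<lambda>z. Kf ?s (z / t)) z :> P * (?E z * (z / t * Kf t z + Kf1 t z) / t)"
        unfolding Kf_S[OF t] by (rule DERIV_cong[OF DERIV_cdivide[OF DERIV_mult[OF E D(1)[OF t]]]]) (simp add: algebra_simps)
    qed
    thus ?thesis using t0 by simp
  qed
  have 2: "Kf2 ?s (z / t) = t * (?E z * (z / t * (z / t * Kf t z) + 2 * (z / t * Kf1 t z) + 1 / (P * t) * Kf t z + Kf2 t z))" for z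
  proof -
    have "Kf2 ?s (z / t) / t = ?E z * (z / t * (z / t * Kf t z) + 2 * (z / t * Kf1 t z) + 1 / (P * t) * Kf t z + Kf2 t z)"
    proof (rule uniq)
      show "DERIV (\<lambda>z. Kf1 ?s (z / t)) z :> P * (Kf2 ?s (z / t) / t)" by (rule DERIV_cong[OF DERIV_chain2[OF D(2)[OF s] q]]) simp
      show "DERIV (\<lambda>z. Kf1 ?s (z / t)) z :> P * (?E z * (z / t * (z / t * Kf t z) + 2 * (z / t * Kf1 t z) + 1 / (P * t) * Kf t z + Kf2 t z))"
        unfolding 1 by (rule DERIV_cong[OF DERIV_mult[OF E DERIV_add[OF DERIV_mult[OF q D(1)[OF t]] D(2)[OF t]]]])
          (use P0 t0 in \<open>simp add: field_simps\<close>)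
    qed
    thus ?thesis using t0 by (simp add: field_simps)
  qed
  have "z\<^sup>2 / (2 * t) + z\<^sup>2 / (2 * t) = z\<^sup>2 / t" by (simp add: field_simps)
  hence EE: "e2pi (z\<^sup>2 / t) = ?E z * ?E z" by (simp only: e2pi_add[symmetric])
  show ?thesis unfolding EE Phi_def 1 2 Kf_S[OF t] E2_S[OF t, folded P_def] by (rule Phi_S_algebra[OF t0 P0])
qed

lemma Kf_eq:
  assumes t: "Im t > 0"
  shows "Kf t z = - e2pi (- z / 2) * th t z * inverse (varpi t)"
    "Kf1 t z = - e2pi (- z / 2) * (th1 t z - th t z / 2) * inverse (varpi t)"
    "Kf2 t z = - e2pi (- z / 2) * (th2 t z - th1 t z + th t z / 4) * inverse (varpi t)"
proof -
  have e: "e2pi (t / 8 - z / 2) = e2pi (t / 8) * e2pi (- z / 2)" unfolding e2pi_add[symmetric] by simp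
  have a: "e2pi (t / 8 - z / 2) * X / aa t = - e2pi (- z / 2) * X * inverse (varpi t)" for X unfolding e aa_def using varpi_nonzero[OF t] by (simp add: divide_simps)
  show "Kf t z = - e2pi (- z / 2) * th t z * inverse (varpi t)"
    "Kf1 t z = - e2pi (- z / 2) * (th1 t z - th t z / 2) * inverse (varpi t)"
    "Kf2 t z = - e2pi (- z / 2) * (th2 t z - th1 t z + th t z / 4) * inverse (varpi t)" unfolding Kf_def Kf1_def Kf2_def theta11_def by (rule a)+
qed

lemma e2pi_half_square: "e2pi (- z / 2) * e2pi (- z / 2) = e2pi (of_int (- 1) * z)"
proof -
  have "- z / 2 + - z / 2 = of_int (- 1) * z" by (simp add: field_simps)
  thus ?thesis unfolding e2pi_add[symmetric] by (rule arg_cong)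
qed

text \<open>K itself carries the power y^(-1/2). Its square and K(t, 2z) have integral exponents, so
  the spanning forms are built from these and \<open>Phi\<close>.\<close>

lemma int_expansion_Kf_square: "int_expansion (\<lambda>t z. Kf t z ^ 2)"
proof -
  have "int_expansion (\<lambda>t z. e2pi (of_int (- 1) * z) * (th t z ^ 2 * inverse (varpi t) ^ 2))"
    by (intro int_expansion_mult int_expansion_power int_expansion_e2pi int_expansion_th int_expansion_varpi_inverse)
  thus ?thesis
  proof (rule int_expansion_cong[rotated])
    fix t z :: complex assume t: "Im t > 0"
    show "e2pi (of_int (- 1) * z) * (th t z ^ 2 * inverse (varpi t) ^ 2) = Kf t z ^ 2" unfolding Kf_eq[OF t] e2pi_half_square[symmetric] by (simp add: power2_eq_square)
  qed
qed

lemma int_expansion_Kf_double: "int_expansion (\<lambda>t z. Kf t (2 * z))"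
proof -
  have d: "int_expansion (\<lambda>t z. th t (2 * z))" by (rule int_expansion_double[OF int_expansion_th])
  have "int_expansion (\<lambda>t z. (- 1) * (e2pi (of_int (- 1) * z) * (th t (2 * z) * inverse (varpi t))))"
    by (intro int_expansion_mult int_expansion_const int_expansion_e2pi d int_expansion_varpi_inverse) simp
  thus ?thesis by (rule int_expansion_cong[rotated]) (simp add: Kf_eq)
qed

lemma Phi_expansion_algebra:
  fixes e :: complex
  shows "e * e * (12 * t1 ^ 2 - 12 * (t0 * t2) + E * t0 ^ 2) * w ^ 2 =
    12 * ((- e * (t1 - t0 / 2) * w) ^ 2 - - e * t0 * w * (- e * (t2 - t1 + t0 / 4) * w) + E / 12 * (- e * t0 * w) ^ 2)" by (simp add: power2_eq_square algebra_simps)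

lemma int_expansion_Phi: "int_expansion (\<lambda>t z. 12 * Phi t z)"
proof -
  have "int_expansion (\<lambda>t z. e2pi (of_int (- 1) * z) * (12 * th1 t z ^ 2 - 12 * (th t z * th2 t z) + E2 t * th t z ^ 2) * inverse (varpi t) ^ 2)"
    by (intro int_expansion_mult int_expansion_add int_expansion_minus int_expansion_const int_expansion_e2pi int_expansion_power
        int_expansion_th int_expansion_th12 int_expansion_E2 int_expansion_varpi_inverse) auto
  thus ?thesis
  proof (rule int_expansion_cong[rotated])
    fix t z :: complex assume t: "Im t > 0"
    show "e2pi (of_int (- 1) * z) * (12 * th1 t z ^ 2 - 12 * (th t z * th2 t z) + E2 t * th t z ^ 2) * inverse (varpi t) ^ 2 = 12 * Phi t z"
      unfolding Phi_def Kf_eq[OF t] e2pi_half_square[symmetric] by (rule Phi_expansion_algebra)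
  qed
qed

section \<open>Integral bases of spaces of Jacobi forms\<close>

lemma int_span_combine:
  fixes A B C :: "('i => complex) set"
  assumes A: "int_span A" and B: "int_span B"
    and C: "\<And>x. x \<in> C ==> \<exists>s\<in>A. \<exists>t\<in>B. \<exists>k. \<forall>i. x i = s i + k * t i"
  shows "int_span C"
proof -
  obtain N b where b: "\<And>j i. b j i \<in> \<int>" "\<And>x. x \<in> A ==> \<exists>a. \<forall>i. x i = (\<Sum>j<(N::nat). a j * b j i)" using A unfolding int_span_def by blast
  obtain M d where d: "\<And>j i. d j i \<in> \<int>" "\<And>x. x \<in> B ==> \<exists>a. \<forall>i. x i = (\<Sum>j<(M::nat). a j * d j i)" using B unfolding int_span_def by blast
  define e where "e = (\<lambda>j. if j < N then b j else d (j - N))"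
  have "\<exists>a. \<forall>i. x i = (\<Sum>j<N + M. a j * e j i)" if x: "x \<in> C" for x
  proof -
    obtain s t k where st: "s \<in> A" "t \<in> B" "\<And>i. x i = s i + k * t i" using C[OF x] by blast
    obtain a1 where a1: "\<And>i. s i = (\<Sum>j<N. a1 j * b j i)" using b(2)[OF st(1)] by blast
    obtain a2 where a2: "\<And>i. t i = (\<Sum>j<M. a2 j * d j i)" using d(2)[OF st(2)] by blast
    define a where "a = (\<lambda>j. if j < N then a1 j else k * a2 (j - N))"
    have "x i = (\<Sum>j<N + M. a j * e j i)" for i
    proof -
      have "(\<Sum>j<N + M. a j * e j i) = (\<Sum>j<N. a j * e j i) + (\<Sum>j\<in>{N..<N + M}. a j * e j i)" by (simp add: lessThan_atLeast0 sum.atLeastLessThan_concat)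
      also have "(\<Sum>j\<in>{N..<N + M}. a j * e j i) = (\<Sum>j<M. a (j + N) * e (j + N) i)"
        using sum.shift_bounds_nat_ivl[of "\<lambda>j. a j * e j i" 0 N M] by (simp add: lessThan_atLeast0 add.commute)
      also have "(\<Sum>j<N. a j * e j i) = s i" unfolding a1 by (rule sum.cong) (auto simp: a_def e_def)
      also have "(\<Sum>j<M. a (j + N) * e (j + N) i) = k * t i" unfolding a2 sum_distrib_left by (rule sum.cong) (auto simp: a_def e_def)
      finally show ?thesis using st(3) by simp
    qed
    thus ?thesis by blast
  qed
  moreover have "e j i \<in> \<int>" for j i using b(1) d(1) by (simp add: e_def)
  ultimately show ?thesis unfolding int_span_def by blast
qed

lemma conv_col_left: "conv (col w) d n r = (\<Sum>k\<in>{0..n}. w k * d (n - k) r)"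
proof -
  have "conv (col w) d n r = (\<Sum>(k, s)\<in>(\<lambda>k. (k, 0)) ` {k\<in>{0..n}. w k \<noteq> 0}. col w k s * d (n - k) (r - s))"
    unfolding conv_def by (rule sum.cong) (auto simp: col_def split: if_splits)
  also have "\<dots> = (\<Sum>k\<in>{k\<in>{0..n}. w k \<noteq> 0}. w k * d (n - k) r)" by (subst sum.reindex) (auto simp: inj_on_def col_def)
  also have "\<dots> = (\<Sum>k\<in>{0..n}. w k * d (n - k) r)" by (rule sum.mono_neutral_left) auto
  finally show ?thesis .
qed

lemma int_span_conv:
  assumes V: "int_span V" and d: "\<And>n r. d n r \<in> \<int>"
  shows "int_span ((\<lambda>v. \<lambda>(n, r). conv (col v) d n r) ` V)"
proof -
  obtain N b where b: "\<And>j i. b j i \<in> \<int>" "\<And>x. x \<in> V ==> \<exists>a. \<forall>i. x i = (\<Sum>j<(N::nat). a j * b j i)" using V unfolding int_span_def by blast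
  define e where "e = (\<lambda>j (n, r). conv (col (b j)) d n r)"
  have "e j x \<in> \<int>" for j x by (cases x) (auto simp: e_def conv_col_left intro!: Ints_sum Ints_mult b d)
  moreover have "\<exists>a. \<forall>x. (\<lambda>(n, r). conv (col v) d n r) x = (\<Sum>j<N. a j * e j x)" if v: "v \<in> V" for v
  proof -
    obtain a where a: "\<And>i. v i = (\<Sum>j<N. a j * b j i)" using b(2)[OF v] by blast
    have "conv (col v) d n r = (\<Sum>j<N. a j * conv (col (b j)) d n r)" for n r
    proof -
      have "conv (col v) d n r = (\<Sum>k\<in>{0..n}. \<Sum>j<N. a j * (b j k * d (n - k) r))" unfolding conv_col_left a sum_distrib_right by (simp only: mult_ac)
      also have "\<dots> = (\<Sum>j<N. \<Sum>k\<in>{0..n}. a j * (b j k * d (n - k) r))" by (rule sum.swap)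
      finally show ?thesis unfolding conv_col_left sum_distrib_left .
    qed
    thus ?thesis by (intro exI[of _ a]) (auto simp: e_def)
  qed
  ultimately show ?thesis unfolding int_span_def by blast
qed

lemma higher_deriv_power_mult:
  assumes "w holomorphic_on UNIV"
  shows "(deriv ^^ k) (\<lambda>z. z ^ k * w z) 0 = fact k * w (0::complex)"
proof -
  have hp: "(deriv ^^ j) (\<lambda>z::complex. z ^ k) 0 = pochhammer (of_nat (Suc k - j)) j * 0 ^ (k - j)" for j using higher_deriv_power[of j 0 k 0] by simp
  have "(deriv ^^ k) (\<lambda>z. z ^ k * w z) 0 =
      (\<Sum>i = 0..k. of_nat (k choose i) * (deriv ^^ i) (\<lambda>z. z ^ k) 0 * (deriv ^^ (k - i)) w 0)"
    by (rule higher_deriv_mult[of _ UNIV]) (use assms in \<open>auto intro!: holomorphic_intros\<close>)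
  also have "\<dots> = (\<Sum>i\<in>{k}. of_nat (k choose i) * (deriv ^^ i) (\<lambda>z. z ^ k) 0 * (deriv ^^ (k - i)) w 0)"
  proof (rule sum.mono_neutral_right)
    show "\<forall>i\<in>{0..k} - {k}. of_nat (k choose i) * (deriv ^^ i) (\<lambda>z. z ^ k) 0 * (deriv ^^ (k - i)) w 0 = 0" by (auto simp: hp)
  qed auto
  also have "\<dots> = fact k * w 0" by (simp add: hp pochhammer_fact)
  finally show ?thesis .
qed

lemma entire_shift:
  fixes h :: "complex => complex"
  assumes "h holomorphic_on UNIV" shows "(\<lambda>z. h (z + s)) holomorphic_on UNIV" by (rule holomorphic_on_compose_gen[of "\<lambda>z. z + s" UNIV h UNIV, unfolded o_def])
     (auto intro!: holomorphic_intros assms)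

lemma entire_scale:
  fixes h :: "complex => complex"
  assumes "h holomorphic_on UNIV" shows "(\<lambda>z. h (s * z)) holomorphic_on UNIV" by (rule holomorphic_on_compose_gen[of "\<lambda>z. s * z" UNIV h UNIV, unfolded o_def])
     (auto intro!: holomorphic_intros assms)

lemma quotient_shift:
  fixes g h :: "complex => complex"
  assumes h: "h holomorphic_on UNIV" and g: "g holomorphic_on UNIV" "g w \<noteq> 0"
    and b: "b holomorphic_on UNIV" "\<And>z. b z \<noteq> 0" and B: "B holomorphic_on UNIV"
    and gs: "\<And>z. g (z + s) = b z * g z" and Gs: "\<And>z. g (z + s) * h (z + s) = B z * (g z * h z)"
  shows "h (z + s) = B z / b z * h z"
proof -
  have "h (x + s) * b x * g x = (B x * h x) * g x" for x using Gs[of x] unfolding gs by (simp add: mult_ac)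
  note eq = this
  have "(\<lambda>z. h (z + s) * b z) holomorphic_on UNIV" "(\<lambda>z. B z * h z) holomorphic_on UNIV" by (intro holomorphic_intros entire_shift h b(1) B)+
  from entire_cancel[OF this g(1) eq g(2)] have "h (z + s) * b z = B z * h z" .
  thus ?thesis using b(2)[of z] by (simp add: field_simps)
qed

lemma Kf_nonzero_point: "Im t > 0 ==> \<exists>w. Kf t w \<noteq> 0" using th_not_identically_zero[of t] aa_nonzero[of t] by (auto simp: Kf_def theta11_def)

lemma lattice_zeros:
  assumes "\<And>z. (h :: complex => complex) (z + 1) = 0 \<longleftrightarrow> h z = 0" "\<And>z. h (z + t) = 0 \<longleftrightarrow> h z = 0"
    and "h w = 0" and z: "z - w \<in> lattice t"
  shows "h z = 0"
proof -
  obtain m n where z: "z = w + of_int n * 1 + of_int m * t" using z unfolding lattice_def by (auto simp: algebra_simps)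
  have "h (w + of_int n * 1 + of_int m * t) = 0 \<longleftrightarrow> h (w + of_int n * 1) = 0" by (rule int_translation_iff[where P = "\<lambda>z. h z = 0", OF assms(2)])
  moreover have "h (w + of_int n * 1) = 0 \<longleftrightarrow> h w = 0" by (rule int_translation_iff[where P = "\<lambda>z. h z = 0", OF assms(1)])
  ultimately show ?thesis using assms(3) unfolding z by simp
qed

lemma Kf_power_shift:
  "Im t > 0 ==> Kf t (z + 1) ^ k = (- 1) ^ k * Kf t z ^ k"
  "Im t > 0 ==> Kf t (z + t) ^ k = (- e2pi (- t / 2 - z)) ^ k * Kf t z ^ k" by (simp_all only: Kf_z1 Kf_shift power_mult_distrib[symmetric] mult_minus1)

lemma jac_shift: "jac m F c ==> Im t > 0 ==> F t (z + t) = e2pi (- of_nat m * (t + 2 * z)) * F t z"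
proof -
  assume F: "jac m F c" and t: "Im t > 0"
  have "e2pi (- of_nat m * (t + 2 * z)) * (e2pi (of_nat m * (t + 2 * z)) * F t (z + t)) = F t (z + t)" unfolding mult.assoc[symmetric] e2pi_add[symmetric] by simp
  thus ?thesis unfolding jac_elliptic[OF F t] by simp
qed

lemma jac_quotient_shift:
  assumes F: "jac m F c" and t: "Im t > 0" and h: "h holomorphic_on UNIV"
    and Fh: "\<And>z. F t z = Kf t z ^ k * h z"
  shows "h (z + 1) = (- 1) ^ k * h z"
    "h (z + t) = e2pi (- of_nat m * (t + 2 * z)) / (- e2pi (- t / 2 - z)) ^ k * h z"
    "h (- z) = - ((- 1) ^ k * h z)"
proof -
  obtain w where w: "Kf t w ^ k \<noteq> 0" using Kf_nonzero_point[OF t] by (auto simp: power_eq_0_iff)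
  have g: "(\<lambda>z. Kf t z ^ k) holomorphic_on UNIV" by (intro holomorphic_intros Kf_holomorphic[OF t])
  have one: "(\<lambda>z::complex. 1 :: complex) holomorphic_on UNIV" "(\<lambda>z::complex. (- 1) ^ k :: complex) holomorphic_on UNIV" by (intro holomorphic_intros)+
  have "h (z + 1) = 1 / (- 1) ^ k * h z"
  proof (rule quotient_shift[OF h g w one(2) _ one(1)])
    show "Kf t (z + 1) ^ k * h (z + 1) = 1 * (Kf t z ^ k * h z)" for z using jac_z_int[OF F t, of z 1] by (simp add: Fh)
  qed (use Kf_power_shift[OF t] in auto)
  thus "h (z + 1) = (- 1) ^ k * h z" by (cases "even k") auto
  show "h (z + t) = e2pi (- of_nat m * (t + 2 * z)) / (- e2pi (- t / 2 - z)) ^ k * h z"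
  proof (rule quotient_shift[OF h g w])
    show "Kf t (z + t) ^ k * h (z + t) = e2pi (- of_nat m * (t + 2 * z)) * (Kf t z ^ k * h z)" for z using jac_shift[OF F t, of z] by (simp only: Fh)
  qed (use Kf_power_shift[OF t] in \<open>auto intro!: holomorphic_intros\<close>)
  have "Kf t (- x) ^ k = (- 1) ^ k * Kf t x ^ k" for x unfolding Kf_neg[OF t] power_mult_distrib[symmetric] by simp
  hence "h (- x) * Kf t x ^ k = (- ((- 1) ^ k * h x)) * Kf t x ^ k" for x using jac_odd[OF F t, of x] unfolding Fh by (cases "even k") (auto simp: mult.commute)
  note eq = this
  have h': "(\<lambda>z. h (- z)) holomorphic_on UNIV" using entire_scale[OF h, of "- 1"] by simp
  have h'': "(\<lambda>z. - ((- 1) ^ k * h z)) holomorphic_on UNIV" by (intro holomorphic_intros h)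
  show "h (- z) = - ((- 1) ^ k * h z)" by (rule entire_cancel[OF h' h'' g eq w])
qed

section \<open>Filtration by the order of vanishing at the lattice points\<close>

lemma jac_quotient_zero:
  assumes F: "jac m F c" and t: "Im t > 0" and h: "h holomorphic_on UNIV"
    and Fh: "\<And>z. F t z = Kf t z ^ k * h z" and w: "h w = 0" and z: "z - w \<in> lattice t"
  shows "h z = 0"
proof (rule lattice_zeros[of h t w z])
  show "h (x + 1) = 0 \<longleftrightarrow> h x = 0" for x using jac_quotient_shift(1)[OF F t h Fh, of x] by simp
  show "h (x + t) = 0 \<longleftrightarrow> h x = 0" for x using jac_quotient_shift(2)[OF F t h Fh, of x] by simp
qed (rule w z)+

text \<open>h is quasi-periodic, so its zero at 0 propagates to all lattice points, which are
  exactly the simple zeros of K.\<close>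

lemma jac_divide_Kf:
  assumes F: "jac m F c" and t: "Im t > 0" and h: "h holomorphic_on UNIV"
    and Fh: "\<And>z. F t z = Kf t z ^ k * h z" and h0: "h 0 = 0"
  shows "\<exists>h'. h' holomorphic_on UNIV \<and> (\<forall>z. h z = h' z * Kf t z) \<and> (\<forall>z. F t z = Kf t z ^ Suc k * h' z)"
proof -
  have "\<exists>h'. h' holomorphic_on UNIV \<and> (\<forall>z. h z = h' z * Kf t z)"
  proof (rule entire_quotient[OF h Kf_holomorphic[OF t]])
    fix z assume z: "Kf t z = 0"
    hence "z - 0 \<in> lattice t" using Kf_zero[OF t] by simp
    from jac_quotient_zero[OF F t h Fh h0 this] show "h z = 0 \<and> deriv (Kf t) z \<noteq> 0" using Kf_simple[OF t z] by simp
  qed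
  then obtain h' where h': "h' holomorphic_on UNIV" "\<And>z. h z = h' z * Kf t z" by blast
  thus ?thesis by (intro exI[of _ h']) (simp add: Fh mult_ac)
qed

text \<open>Vanishing to order at least k along the lattice, phrased as divisibility by K^k for each
  t separately.\<close>

definition vanishes :: "(complex => complex => complex) => nat => bool" where
  "vanishes F k \<longleftrightarrow> (\<forall>t. Im t > 0 --> (\<exists>h. h holomorphic_on UNIV \<and> (\<forall>z. F t z = Kf t z ^ k * h z)))"

lemma vanishes_1: "jac m F c ==> vanishes F 1" unfolding vanishes_def
proof (intro allI impI)
  fix t assume F: "jac m F c" and t: "Im t > 0"
  have "F t 0 = 0" using jac_odd[OF F t, of 0] by simp
  from jac_divide_Kf[OF F t expands_holomorphic_z[OF jac_expands[OF F] t] _ this, of 0]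
  show "\<exists>h. h holomorphic_on UNIV \<and> (\<forall>z. F t z = Kf t z ^ 1 * h z)" by auto
qed

text \<open>A form of index m has room for 2m zeros modulo the lattice. After 2m - 1 of them at 0,
  the quotient h is even with h(z + 1) = - h(z), so the last one is at 1/2. Then h is comparable
  with K(z - 1/2), but the multipliers along t differ by a sign, and h = 0.\<close>

lemma jac_top_order:
  assumes F: "jac m F c" and m: "m > 0" and v: "vanishes F (2 * m - 1)" and t: "Im t > 0"
  shows "F t z = 0"
proof -
  obtain h where h: "h holomorphic_on UNIV" "\<And>z. F t z = Kf t z ^ (2 * m - 1) * h z" using v t unfolding vanishes_def by blast
  have od: "odd (2 * m - 1)" using m by simp
  note hs = jac_quotient_shift[OF F t h]
  have h1: "h (z + 1) = - 1 * h z" for z using hs(1)[of z] od by simp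
  have he: "h (- z) = h z" for z using hs(3)[of z] od by simp
  have h2: "h (z + t) = - 1 * e2pi (- t / 2 - z) * h z" for z
  proof -
    have "of_nat (2 * m - 1) = 2 * of_nat m - (1::complex)"
    proof -
      have "of_nat (2 * m - 1) + (1::complex) = of_nat (2 * m - 1 + 1)" by (simp only: of_nat_add of_nat_1)
      also have "2 * m - 1 + 1 = 2 * m" using m by simp
      finally show ?thesis by (simp add: eq_diff_eq)
    qed
    note on = this
    have "- of_nat m * (t + 2 * z) = of_nat (2 * m - 1) * (- t / 2 - z) + (- t / 2 - z)" unfolding on by (simp add: field_simps)
    hence e: "e2pi (- of_nat m * (t + 2 * z)) = e2pi (- t / 2 - z) ^ (2 * m - 1) * e2pi (- t / 2 - z)" by (simp only: e2pi_add e2pi_pow)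
    have "(- e2pi (- t / 2 - z)) ^ (2 * m - 1) = - (e2pi (- t / 2 - z) ^ (2 * m - 1))" using od by simp
    thus ?thesis unfolding hs(2) e by simp
  qed
  have h0: "h (1 / 2) = 0" using h1[of "- (1 / 2)"] he[of "1 / 2"] by simp
  let ?g = "\<lambda>z. Kf t (z + - (1 / 2))"
  have g: "?g holomorphic_on UNIV" by (rule entire_shift[OF Kf_holomorphic[OF t]])
  have "\<exists>C. (\<forall>z. h z = C * ?g z) \<and> ((1::complex) \<noteq> 1 \<or> (- 1 :: complex) \<noteq> 1 --> C = 0)"
  proof (rule theta_quotient_constant[OF t h(1) g])
    fix z
    show "?g (z + 1) = - 1 * ?g z" using Kf_z1[OF t, of "z + - (1 / 2)"] by (simp add: add_ac)
    show "h (z + 1) = 1 * - 1 * h z" using h1[of z] by simp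
    show "h (z + t) = - 1 * e2pi (- t / 2 - z) * h z" by (rule h2)
    have e: "- t / 2 - (z + - (1 / 2)) = (- t / 2 - z) + 1 / 2" by simp
    have e': "z + - (1 / 2) + t = z + t + - (1 / 2)" by simp
    show "?g (z + t) = e2pi (- t / 2 - z) * ?g z" using Kf_shift[OF t, of "z + - (1 / 2)"] unfolding e e' e2pi_add e2pi_half by (simp only: mult_minus1_right minus_minus)
    assume z: "?g z = 0"
    hence "z - 1 / 2 \<in> lattice t" using Kf_zero[OF t, of "z + - (1 / 2)"] by simp
    from jac_quotient_zero[OF F t h h0 this] have "h z = 0" .
    moreover have "(Kf t has_field_derivative deriv (Kf t) (z + - (1 / 2))) (at (z + - (1 / 2)))" by (rule holomorphic_derivI[OF Kf_holomorphic[OF t, of UNIV]]) auto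
    hence "DERIV ?g z :> deriv (Kf t) (z + - (1 / 2))" by (simp only: DERIV_shift)
    hence "deriv ?g z = deriv (Kf t) (z + - (1 / 2))" by (rule DERIV_imp_deriv)
    ultimately show "h z = 0 \<and> deriv ?g z \<noteq> 0" using Kf_simple[OF t z] by simp
  qed auto
  hence "h z = 0" for z by auto
  thus ?thesis by (simp add: h(2))
qed

lemma fourier_nice_times: "fourier_nice c ==> fourier_nice (\<lambda>n r. g n r * c n r :: complex)"
proof -
  assume c: "fourier_nice c"
  have "finite {r. g n r * c n r \<noteq> 0}" for n by (rule finite_subset[OF _ fourier_nice_finite_row[OF c, of n]]) auto
  thus ?thesis using fourier_nice_neg[OF c] unfolding fourier_nice_def by (auto simp: not_le[symmetric])
qed

lemma fourier_nice_diff: "fourier_nice c ==> fourier_nice d ==> fourier_nice (\<lambda>n r. c n r - d n r :: complex)"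
proof -
  assume c: "fourier_nice c" and d: "fourier_nice d"
  have "finite {r. c n r - d n r \<noteq> 0}" for n by (rule finite_subset[OF _ finite_UnI[OF fourier_nice_finite_row[OF c, of n] fourier_nice_finite_row[OF d, of n]]]) auto
  thus ?thesis using fourier_nice_neg[OF c] fourier_nice_neg[OF d] unfolding fourier_nice_def by (metis diff_self linorder_not_less)
qed

text \<open>The leading coefficient h(0) is the k-th z-derivative at 0 divided by k! (2 pi i)^k, so
  it has a q-expansion; the inversion formulas of F and K give it weight 1 + k.\<close>

lemma jac_leading_mform:
  assumes F: "jac m F c" and n: "fourier_nice c" and v: "vanishes F k"
  shows "\<exists>f u. mform (k + 1) f u \<and> (\<forall>t h. Im t > 0 --> h holomorphic_on UNIV -->
    (\<forall>z. F t z = Kf t z ^ k * h z) --> f t = h 0)"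
proof -
  define P :: complex where "P = tpi"
  have P0: "P \<noteq> 0" by (simp add: P_def)
  define \<alpha> :: complex where "\<alpha> = 1 / (fact k * P ^ k)"
  define f where "f = (\<lambda>t. \<alpha> * (deriv ^^ k) (F t) 0)"
  have f: "f t = h 0" if t: "Im t > 0" and h: "h holomorphic_on UNIV" "\<And>z. F t z = Kf t z ^ k * h z" for t h
  proof -
    define w where "w = (\<lambda>z. if z = 0 then deriv (Kf t) 0 else (Kf t z - Kf t 0) / (z - 0))"
    have w: "w holomorphic_on UNIV" unfolding w_def by (rule pole_lemma_open[OF Kf_holomorphic[OF t]]) simp
    have Kw: "Kf t z = z * w z" for z using Kf_0(1)[OF t] by (simp add: w_def)
    have w0: "w 0 = P" using DERIV_imp_deriv[OF Kf_DERIV(1)[OF t, of 0]] Kf_0(2)[OF t] by (simp add: w_def P_def)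
    have "F t = (\<lambda>z. z ^ k * (w z ^ k * h z))" by (rule ext) (simp add: h(2) Kw power_mult_distrib)
    moreover have "(deriv ^^ k) (\<lambda>z. z ^ k * (w z ^ k * h z)) 0 = fact k * (w 0 ^ k * h 0)" by (rule higher_deriv_power_mult) (intro holomorphic_intros w h(1))
    ultimately show ?thesis using P0 by (simp add: f_def w0 \<alpha>_def)
  qed
  define u where "u = (\<lambda>n. \<alpha> * (\<Sum>s | (P * of_int s) ^ k * c n s \<noteq> 0. (P * of_int s) ^ k * c n s))"
  have nice: "fourier_nice (\<lambda>n r. (P * of_int r) ^ k * c n r)" by (rule fourier_nice_times[OF n])
  have "expands (\<lambda>t z. \<alpha> * (deriv ^^ k) (F t) 0) (\<lambda>n r. \<alpha> * col (\<lambda>n. \<Sum>s | (P * of_int s) ^ k * c n s \<noteq> 0. (P * of_int s) ^ k * c n s) n r)"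
    unfolding P_def by (rule expands_cmult[OF expands_at_0[OF expands_higher_deriv[OF jac_expands[OF F]] nice[unfolded P_def]]])
  also have "(\<lambda>n r. \<alpha> * col (\<lambda>n. \<Sum>s | (P * of_int s) ^ k * c n s \<noteq> 0. (P * of_int s) ^ k * c n s) n r) = col u" by (intro ext) (simp add: col_def u_def)
  finally have e: "expands (\<lambda>t z. f t) (col u)" unfolding f_def .
  have un: "u n = 0" if "n < 0" for n using fourier_nice_neg[OF n that] by (simp add: u_def)
  have S: "f (- 1 / t) = t ^ (k + 1) * f t" if t: "Im t > 0" for t
  proof -
    let ?s = "- 1 / t"
    have s: "Im ?s > 0" and t0: "t \<noteq> 0" using t by auto
    obtain h where h: "h holomorphic_on UNIV" "\<And>z. F t z = Kf t z ^ k * h z" using v t unfolding vanishes_def by blast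
    obtain g where g: "g holomorphic_on UNIV" "\<And>z. F ?s z = Kf ?s z ^ k * g z" using v s unfolding vanishes_def by blast
    obtain w where w: "Kf t w ^ k \<noteq> 0" using Kf_nonzero_point[OF t] by (auto simp: power_eq_0_iff)
    have g': "(\<lambda>z. g (1 / t * z)) holomorphic_on UNIV" by (rule entire_scale[OF g(1)])
    have "(e2pi (x\<^sup>2 / (2 * t)) ^ k * g (1 / t * x)) * Kf t x ^ k = (t ^ (k + 1) * e2pi (of_nat m * x\<^sup>2 / t) * h x) * Kf t x ^ k" for x
    proof -
      have "(e2pi (x\<^sup>2 / (2 * t)) * Kf t x / t) ^ k * g (x / t) = t * e2pi (of_nat m * x\<^sup>2 / t) * (Kf t x ^ k * h x)" using jac_S[OF F t, of x] unfolding g(2) h(2) Kf_S[OF t] .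
      hence "t ^ k * ((e2pi (x\<^sup>2 / (2 * t)) * Kf t x / t) ^ k * g (x / t)) = t ^ k * (t * e2pi (of_nat m * x\<^sup>2 / t) * (Kf t x ^ k * h x))" by (rule arg_cong)
      thus ?thesis using t0 by (simp add: power_mult_distrib power_divide mult_ac)
    qed
    note eq = this
    have "(\<lambda>x. e2pi (x\<^sup>2 / (2 * t)) ^ k * g (1 / t * x)) holomorphic_on UNIV"
      "(\<lambda>x. t ^ (k + 1) * e2pi (of_nat m * x\<^sup>2 / t) * h x) holomorphic_on UNIV"
      "(\<lambda>x. Kf t x ^ k) holomorphic_on UNIV" using t0 by (intro holomorphic_intros g' h(1) Kf_holomorphic[OF t]; simp)+
    from entire_cancel[OF this eq w, of 0] have "g 0 = t ^ (k + 1) * h 0" by simp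
    thus ?thesis using f[OF t h] f[OF s g] by simp
  qed
  have "mform (k + 1) f u" unfolding mform_def using e un S by blast
  thus ?thesis using f by blast
qed

text \<open>Weight -1 - 2i, index i + e + 2, order of vanishing 2i + 1 with leading coefficient 2
  times 12^e, and integral expansion. Multiplied by a modular form of weight 2i + 2 it gives weight
  one.\<close>

definition RR :: "nat => nat => complex => complex => complex" where
  "RR i e t z = Kf t (2 * z) * (Kf t z ^ 2) ^ i * (12 * Phi t z) ^ e"

lemma int_expansion_RR: "int_expansion (RR i e)" unfolding RR_def[abs_def] by (rule int_expansion_mult[OF int_expansion_mult[OF int_expansion_Kf_double int_expansion_power[OF int_expansion_Kf_square]]
        int_expansion_power[OF int_expansion_Phi]])

lemma RR_shift:
  assumes t: "Im t > 0"
  shows "RR i e t (z + t) = e2pi (- of_nat (i + e + 2) * (t + 2 * z)) * RR i e t z"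
proof -
  have z2: "2 * (z + t) = 2 * z + t + t" by simp
  have "Kf t (2 * (z + t)) = (e2pi (- t / 2 - (2 * z + t)) * e2pi (- t / 2 - 2 * z)) * Kf t (2 * z)" unfolding z2 Kf_shift[OF t] by simp
  also have "e2pi (- t / 2 - (2 * z + t)) * e2pi (- t / 2 - 2 * z) = e2pi (of_nat 2 * - (t + 2 * z))" unfolding e2pi_add[symmetric] by (rule arg_cong) (simp add: field_simps)
  finally have 1: "Kf t (2 * (z + t)) = e2pi (of_nat 2 * - (t + 2 * z)) * Kf t (2 * z)" .
  have 2: "Kf t (z + t) ^ 2 = e2pi (- (t + 2 * z)) * Kf t z ^ 2"
  proof -
    have "e2pi (- (t + 2 * z)) = e2pi (- t / 2 - z) * e2pi (- t / 2 - z)" unfolding e2pi_add[symmetric] by (rule arg_cong) (simp add: field_simps)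
    thus ?thesis unfolding Kf_shift[OF t] by (simp add: power2_eq_square)
  qed
  have "- t - 2 * z = - (t + 2 * z)" by simp
  hence 3: "12 * Phi t (z + t) = e2pi (- (t + 2 * z)) * (12 * Phi t z)" using Phi_shift[OF t, of z] by simp
  have 4: "e2pi (- of_nat (i + e + 2) * (t + 2 * z)) = e2pi (of_nat 2 * - (t + 2 * z)) * e2pi (- (t + 2 * z)) ^ i * e2pi (- (t + 2 * z)) ^ e"
    unfolding e2pi_pow e2pi_add[symmetric] by (rule arg_cong) (simp add: algebra_simps)
  show ?thesis unfolding RR_def 1 2 3 4 power_mult_distrib by (simp only: mult_ac)
qed

lemma RR_S:
  assumes t: "Im t > 0"
  shows "t ^ (2 * i + 1) * RR i e (- 1 / t) (z / t) = e2pi (of_nat (i + e + 2) * z\<^sup>2 / t) * RR i e t z"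
proof -
  have t0: "t \<noteq> 0" using t by auto
  have z2: "2 * (z / t) = (2 * z) / t" by simp
  have 1: "Kf (- 1 / t) (2 * (z / t)) = e2pi (of_nat 2 * (z\<^sup>2 / t)) * Kf t (2 * z) / t"
  proof -
    have "(2 * z)\<^sup>2 / (2 * t) = of_nat 2 * (z\<^sup>2 / t)" using t0 by (simp add: field_simps power2_eq_square)
    thus ?thesis unfolding z2 Kf_S[OF t] by (simp only:)
  qed
  have 2: "Kf (- 1 / t) (z / t) ^ 2 = e2pi (z\<^sup>2 / t) * Kf t z ^ 2 / t\<^sup>2"
  proof -
    have "e2pi (z\<^sup>2 / t) = e2pi (z\<^sup>2 / (2 * t)) * e2pi (z\<^sup>2 / (2 * t))" unfolding e2pi_add[symmetric] by (rule arg_cong) (simp add: field_simps)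
    thus ?thesis unfolding Kf_S[OF t] by (simp add: power2_eq_square)
  qed
  have 3: "12 * Phi (- 1 / t) (z / t) = e2pi (z\<^sup>2 / t) * (12 * Phi t z)" unfolding Phi_S[OF t] by simp
  have 4: "e2pi (of_nat (i + e + 2) * z\<^sup>2 / t) = e2pi (of_nat 2 * (z\<^sup>2 / t)) * e2pi (z\<^sup>2 / t) ^ i * e2pi (z\<^sup>2 / t) ^ e"
    unfolding e2pi_pow e2pi_add[symmetric] by (rule arg_cong) (simp add: add_divide_distrib algebra_simps)
  have 5: "t ^ (2 * i + 1) = t * t\<^sup>2 ^ i" by (simp add: power_mult)
  show ?thesis unfolding RR_def 1 2 3 4 5 power_mult_distrib power_divide using t0 by simp
qed

lemma RR_quotient:
  assumes t: "Im t > 0"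
  shows "\<exists>g. g holomorphic_on UNIV \<and> (\<forall>z. RR i e t z = Kf t z ^ (2 * i + 1) * g z) \<and> g 0 = 2 * 12 ^ e"
proof -
  have dbl: "(\<lambda>z. Kf t (2 * z)) holomorphic_on UNIV" by (rule entire_scale[OF Kf_holomorphic[OF t]])
  have "\<exists>q. q holomorphic_on UNIV \<and> (\<forall>z. Kf t (2 * z) = q z * Kf t z)"
  proof (rule entire_quotient[OF dbl Kf_holomorphic[OF t]])
    fix z assume z: "Kf t z = 0"
    then obtain a b where "z = of_int a * t + of_int b" using Kf_zero[OF t] unfolding lattice_def by blast
    hence "2 * z = of_int (2 * a) * t + of_int (2 * b)" by (simp add: algebra_simps)
    hence "2 * z \<in> lattice t" unfolding lattice_def by blast
    thus "Kf t (2 * z) = 0 \<and> deriv (Kf t) z \<noteq> 0" using Kf_zero[OF t] Kf_simple[OF t z] by simp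
  qed
  then obtain q where q: "q holomorphic_on UNIV" "\<And>z. Kf t (2 * z) = q z * Kf t z" by blast
  define P :: complex where "P = tpi"
  have P0: "P \<noteq> 0" by (simp add: P_def)
  have "DERIV (\<lambda>z. Kf t (2 * z)) 0 :> P * Kf1 t (2 * 0) * 2" unfolding P_def by (rule DERIV_chain2[OF Kf_DERIV(1)[OF t]]) (auto intro!: derivative_eq_intros)
  moreover have "DERIV q 0 :> deriv q 0" using holomorphic_derivI[OF q(1)] by simp
  hence "DERIV (\<lambda>z. q z * Kf t z) 0 :> deriv q 0 * Kf t 0 + P * Kf1 t 0 * q 0" unfolding P_def by (rule DERIV_mult[OF _ Kf_DERIV(1)[OF t]])
  ultimately have "P * Kf1 t (2 * 0) * 2 = deriv q 0 * Kf t 0 + P * Kf1 t 0 * q 0" unfolding q(2) by (rule DERIV_unique)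
  hence q0: "q 0 = 2" using P0 Kf_0[OF t] by simp
  have "(\<lambda>z. q z * (12 * Phi t z) ^ e) holomorphic_on UNIV" by (intro holomorphic_intros q(1) Phi_holomorphic[OF t])
  thus ?thesis
  proof (intro exI[of _ "\<lambda>z. q z * (12 * Phi t z) ^ e"] conjI allI)
    fix z
    have "(Kf t z ^ 2) ^ i * Kf t z = Kf t z ^ (2 * i + 1)" by (simp add: power_mult)
    thus "RR i e t z = Kf t z ^ (2 * i + 1) * (q z * (12 * Phi t z) ^ e)" unfolding RR_def q(2) by (simp only: mult_ac)
  qed (simp_all add: q0 Phi_0[OF t])
qed

lemma mform_times_RR:
  assumes f: "mform (2 * i + 2) f u" and \<rho>: "expands (RR i e) \<rho>" "fourier_nice \<rho>"
  shows "jac (i + e + 2) (\<lambda>t z. f t * RR i e t z) (conv (col u) \<rho>)" unfolding jac_def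
proof (intro conjI allI impI)
  have u: "expands (\<lambda>t z. f t) (col u)" "\<And>n. n < 0 ==> u n = 0" "\<And>t. Im t > 0 ==> f (- 1 / t) = t ^ (2 * i + 2) * f t" using f unfolding mform_def by blast+
  show "expands (\<lambda>t z. f t * RR i e t z) (conv (col u) \<rho>)" by (rule expands_mult[OF u(1) \<rho>(1) fourier_nice_col[OF u(2)] \<rho>(2)])
  fix t z :: complex assume t: "Im t > 0"
  have "of_nat (i + e + 2) * (t + 2 * z) + - of_nat (i + e + 2) * (t + 2 * z) = 0" by (simp add: algebra_simps)
  hence "e2pi (of_nat (i + e + 2) * (t + 2 * z)) * e2pi (- of_nat (i + e + 2) * (t + 2 * z)) = 1" unfolding e2pi_add[symmetric] by (simp only: e2pi_0)
  thus "e2pi (of_nat (i + e + 2) * (t + 2 * z)) * (f t * RR i e t (z + t)) = f t * RR i e t z" unfolding RR_shift[OF t] by (simp only: mult_ac) (simp only: mult.assoc[symmetric] mult_1_left)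
  have "f (- 1 / t) * RR i e (- 1 / t) (z / t) = t * f t * (t ^ (2 * i + 1) * RR i e (- 1 / t) (z / t))" unfolding u(3)[OF t] by simp
  also have "\<dots> = t * e2pi (of_nat (i + e + 2) * z\<^sup>2 / t) * (f t * RR i e t z)" unfolding RR_S[OF t] by (simp only: mult_ac)
  finally show "f (- 1 / t) * RR i e (- 1 / t) (z / t) = t * e2pi (of_nat (i + e + 2) * z\<^sup>2 / t) * (f t * RR i e t z)" .
qed

text \<open>The subtracted multiple of \<open>RR\<close> cancels the leading coefficient at order 2i
  + 1. The quotient by K^(2i + 2) is odd by parity, hence vanishes at 0, and a further order is
  gained.\<close>

lemma taylor_step:
  assumes F: "jac (i + e + 2) F c" and n: "fourier_nice c" and v: "vanishes F (2 * i + 1)"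
    and \<rho>: "expands (RR i e) \<rho>" "fourier_nice \<rho>"
  shows "\<exists>f u G. mform (2 * i + 2) f u \<and>
    jac (i + e + 2) G (\<lambda>n r. c n r - 1 / (2 * 12 ^ e) * conv (col u) \<rho> n r) \<and>
    fourier_nice (\<lambda>n r. c n r - 1 / (2 * 12 ^ e) * conv (col u) \<rho> n r) \<and> vanishes G (2 * i + 3)"
proof -
  let ?k = "2 * i + 1"
  obtain f u where f: "mform (?k + 1) f u" and fh: "\<And>t h. Im t > 0 ==> h holomorphic_on UNIV ==> (\<forall>z. F t z = Kf t z ^ ?k * h z) ==> f t = h 0" using jac_leading_mform[OF F n v] by blast
  have f': "mform (2 * i + 2) f u" using f by simp
  have un: "\<And>n. n < 0 ==> u n = 0" using f unfolding mform_def by blast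
  let ?\<alpha> = "1 / (2 * 12 ^ e) :: complex"
  define G where "G = (\<lambda>t z. F t z - ?\<alpha> * (f t * RR i e t z))"
  have G: "jac (i + e + 2) G (\<lambda>n r. c n r - ?\<alpha> * conv (col u) \<rho> n r)" unfolding G_def by (rule jac_diff[OF F jac_cmult[OF mform_times_RR[OF f' \<rho>]]])
  have nG: "fourier_nice (\<lambda>n r. c n r - ?\<alpha> * conv (col u) \<rho> n r)" by (rule fourier_nice_diff[OF n fourier_nice_times[OF fourier_nice_conv[OF fourier_nice_col[OF un] \<rho>(2)]]])
  have "vanishes G (2 * i + 3)" unfolding vanishes_def
  proof (intro allI impI)
    fix t assume t: "Im t > 0"
    obtain h where h: "h holomorphic_on UNIV" "\<forall>z. F t z = Kf t z ^ ?k * h z" using v t unfolding vanishes_def by blast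
    obtain g where g: "g holomorphic_on UNIV" "\<forall>z. RR i e t z = Kf t z ^ ?k * g z" "g 0 = 2 * 12 ^ e" using RR_quotient[OF t, of i e] by blast
    have f0: "f t = h 0" by (rule fh[OF t h])
    define h1 where "h1 = (\<lambda>z. h z - ?\<alpha> * (f t * g z))"
    have h1: "h1 holomorphic_on UNIV" unfolding h1_def by (intro holomorphic_intros h(1) g(1))
    have e1: "G t z = Kf t z ^ ?k * h1 z" for z unfolding G_def h1_def using h(2) g(2) by (simp add: algebra_simps)
    have h10: "h1 0 = 0" unfolding h1_def g(3) f0 by simp
    obtain h2 where h2: "h2 holomorphic_on UNIV" "\<forall>z. G t z = Kf t z ^ Suc ?k * h2 z" using jac_divide_Kf[OF G t h1 e1 h10] by blast
    have e2: "G t z = Kf t z ^ Suc ?k * h2 z" for z using h2(2) by blast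
    have "h2 (- 0) = - ((- 1) ^ Suc ?k * h2 0)" by (rule jac_quotient_shift(3)[OF G t h2(1) e2])
    hence h20: "h2 0 = 0" by simp
    obtain h3 where h3: "h3 holomorphic_on UNIV" "\<forall>z. G t z = Kf t z ^ Suc (Suc ?k) * h3 z" using jac_divide_Kf[OF G t h2(1) e2 h20] by blast
    have "Suc (Suc ?k) = 2 * i + 3" by simp
    thus "\<exists>h. h holomorphic_on UNIV \<and> (\<forall>z. G t z = Kf t z ^ (2 * i + 3) * h z)" using h3 by metis
  qed
  thus ?thesis using f' G nG by blast
qed

definition jac_arrays :: "nat => nat => (int \<times> int => complex) set" where
  "jac_arrays m i = {\<lambda>(n, r). c n r | c. \<exists>F. jac m F c \<and> fourier_nice c \<and> vanishes F (2 * i + 1)}"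

lemma int_span_zero: "(\<And>x i. x \<in> S ==> x i = 0) ==> int_span S" unfolding int_span_def by (intro exI[of _ 0] exI[of _ "\<lambda>_ _. 0"]) auto

text \<open>Downward induction on the order of vanishing: at order 2m - 1 only 0 remains, and each
  step adds products of one fixed integral series with modular forms of one weight, whose arrays
  have an integral span.\<close>

lemma int_span_jac_arrays:
  assumes m: "m > 0" and i: "i \<le> m - 1"
  shows "int_span (jac_arrays m i)" using i
proof (induction rule: inc_induct)
  case base
  have e: "2 * (m - 1) + 1 = 2 * m - 1" using m by simp
  show ?case
  proof (rule int_span_zero)
    fix x j assume "x \<in> jac_arrays m (m - 1)"
    then obtain c F where x: "x = (\<lambda>(n, r). c n r)" and F: "jac m F c" "vanishes F (2 * m - 1)" unfolding jac_arrays_def e by blast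
    have "c n r = 0" for n r by (rule expands_coeff_eq_0[OF jac_expands[OF F(1)] jac_top_order[OF F(1) m F(2)]])
    thus "x j = 0" by (simp add: x split: prod.split)
  qed
next
  case (step i)
  \<comment> \<open>The exponent of \<open>Phi\<close> that gives \<open>RR i e\<close> the index
    m.\<close>
  define e where "e = m - 2 - i"
  have me: "i + e + 2 = m" using step unfolding e_def by linarith
  obtain \<rho> where \<rho>: "expands (RR i e) \<rho>" "fourier_nice \<rho>" "\<And>n r. \<rho> n r \<in> \<int>" using int_expansion_RR[of i e] unfolding int_expansion_def by blast
  have ev: "even (2 * i + 2)" by simp
  show ?case
  proof (rule int_span_combine[OF step.IH int_span_conv[OF mform_int_span[OF ev] \<rho>(3)]])
    fix x assume "x \<in> jac_arrays m i"
    then obtain c F where x: "x = (\<lambda>(n, r). c n r)" and F: "jac m F c" "fourier_nice c" "vanishes F (2 * i + 1)" unfolding jac_arrays_def by blast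
    obtain f u G where u: "mform (2 * i + 2) f u" and G: "jac m G (\<lambda>n r. c n r - 1 / (2 * 12 ^ e) * conv (col u) \<rho> n r)"
      "fourier_nice (\<lambda>n r. c n r - 1 / (2 * 12 ^ e) * conv (col u) \<rho> n r)" "vanishes G (2 * i + 3)" using taylor_step[OF F(1)[folded me] F(2,3) \<rho>(1,2)] unfolding me by blast
    let ?d = "\<lambda>n r. c n r - 1 / (2 * 12 ^ e) * conv (col u) \<rho> n r"
    have i3: "2 * i + 3 = 2 * Suc i + 1" by simp
    have "(\<lambda>(n, r). ?d n r) \<in> jac_arrays m (Suc i)" unfolding jac_arrays_def using G(1,2) G(3)[unfolded i3] by blast
    moreover have "(\<lambda>(n, r). conv (col u) \<rho> n r) \<in> (\<lambda>v. \<lambda>(n, r). conv (col v) \<rho> n r) ` {v. \<exists>f. mform (2 * i + 2) f v}" using u by blast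
    moreover have "x j = (\<lambda>(n, r). ?d n r) j + 1 / (2 * 12 ^ e) * (\<lambda>(n, r). conv (col u) \<rho> n r) j" for j by (cases j) (simp add: x)
    ultimately show "\<exists>s\<in>jac_arrays m (Suc i). \<exists>t\<in>(\<lambda>v. \<lambda>(n, r). conv (col v) \<rho> n r) ` {v. \<exists>f. mform (2 * i + 2) f v}. \<exists>k. \<forall>j. x j = s j + k * t j"
      by blast
  qed
qed

theorem jac_int_span:
  assumes "m > 0"
  shows "int_span {\<lambda>(n, r). c n r | c. \<exists>F. jac m F c \<and> fourier_nice c}"
proof -
  have "{\<lambda>(n, r). c n r | c. \<exists>F. jac m F c \<and> fourier_nice c} \<subseteq> jac_arrays m 0"
  proof
    fix x assume "x \<in> {\<lambda>(n, r). c n r | c. \<exists>F. jac m F c \<and> fourier_nice c}"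
    then obtain c F where x: "x = (\<lambda>(n, r). c n r)" "jac m F c" "fourier_nice c" by blast
    thus "x \<in> jac_arrays m 0" unfolding jac_arrays_def using vanishes_1[OF x(2)] by auto
  qed
  thus ?thesis using int_span_jac_arrays[OF assms, of 0] unfolding int_span_def by blast
qed

section \<open>Hecke operators on integral coefficient arrays\<close>

lemma homogeneous_system:
  fixes q :: "nat => nat => 'a::field"
  assumes "finite J" "card J > N"
  shows "\<exists>n. (\<exists>j\<in>J. n j \<noteq> 0) \<and> (\<forall>k<N. (\<Sum>j\<in>J. n j * q j k) = 0)" using assms
proof (induction N arbitrary: J q)
  case 0
  then obtain j where "j \<in> J" by (metis card_gt_0_iff ex_in_conv)
  thus ?case by (intro exI[of _ "\<lambda>_. 1"]) auto
next
  case (Suc N)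
  show ?case
  proof (cases "\<forall>j\<in>J. q j N = 0")
    case True
    from Suc.prems have "card J > N" by simp
    from Suc.IH[OF Suc.prems(1) this, of q] obtain n where n: "\<exists>j\<in>J. n j \<noteq> 0" "\<forall>k<N. (\<Sum>j\<in>J. n j * q j k) = 0" by blast
    have "(\<Sum>j\<in>J. n j * q j k) = 0" if k: "k < Suc N" for k
    proof (cases "k = N")
      case True
      thus ?thesis using \<open>\<forall>j\<in>J. q j N = 0\<close> by (intro sum.neutral) auto
    next
      case False
      thus ?thesis using n(2) k by simp
    qed
    thus ?thesis using n(1) by blast
  next
    case False
    then obtain a where a: "a \<in> J" "q a N \<noteq> 0" by blast
    define q' where "q' = (\<lambda>j k. q j k - q j N / q a N * q a k)"
    have "card (J - {a}) > N" using Suc.prems a by simp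
    from Suc.IH[OF _ this, of q'] Suc.prems obtain n where n: "\<exists>j\<in>J - {a}. n j \<noteq> 0" "\<forall>k<N. (\<Sum>j\<in>J - {a}. n j * q' j k) = 0" by blast
    have n2: "(\<Sum>j\<in>J - {a}. n j * q' j k) = 0" if "k < Suc N" for k
    proof (cases "k = N")
      case True
      thus ?thesis using a by (intro sum.neutral) (auto simp: q'_def)
    qed (use n(2) that in simp)
    define n' where "n' = (\<lambda>j. if j = a then - (\<Sum>j\<in>J - {a}. n j * (q j N / q a N)) else n j)"
    have "(\<Sum>j\<in>J. n' j * q j k) = 0" if k: "k < Suc N" for k
    proof -
      have "(\<Sum>j\<in>J. n' j * q j k) = n' a * q a k + (\<Sum>j\<in>J - {a}. n j * q j k)" by (subst sum.remove[OF Suc.prems(1) a(1)]) (auto simp: n'_def intro!: sum.cong)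
      also have "n' a * q a k = - (\<Sum>j\<in>J - {a}. n j * (q j N / q a N) * q a k)" by (simp add: n'_def sum_distrib_right)
      also have "- (\<Sum>j\<in>J - {a}. n j * (q j N / q a N) * q a k) + (\<Sum>j\<in>J - {a}. n j * q j k) = (\<Sum>j\<in>J - {a}. n j * q' j k)" by (simp add: q'_def algebra_simps sum_subtractf)
      finally show ?thesis using n2[OF k] by simp
    qed
    moreover have "\<exists>j\<in>J. n' j \<noteq> 0" using n(1) by (auto simp: n'_def)
    ultimately show ?thesis by blast
  qed
qed

lemma rat_common_denominator:
  fixes q :: "'a => rat"
  assumes "finite J"
  shows "\<exists>d::int. d > 0 \<and> (\<forall>j\<in>J. \<exists>n::int. of_int d * q j = of_int n)" using assms
proof (induction rule: finite_induct)
  case empty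
  thus ?case by (intro exI[of _ 1]) simp
next
  case (insert j J)
  then obtain d where d: "d > 0" "\<forall>j\<in>J. \<exists>n::int. of_int d * q j = of_int n" by blast
  obtain a b :: int where ab: "q j = of_int a / of_int b" "b > 0" by (metis Fract_of_int_quotient quotient_of_denom_pos quotient_of_div surj_pair)
  show ?case
  proof (rule exI[of _ "d * b"], intro conjI ballI)
    show "d * b > 0" using d ab by simp
    fix i assume "i \<in> insert j J"
    then consider "i = j" | "i \<in> J" by blast
    thus "\<exists>n. of_int (d * b) * q i = of_int n"
    proof cases
      case 1
      thus ?thesis using ab by (intro exI[of _ "d * a"]) simp
    next
      case 2
      then obtain n where "of_int d * q i = of_int n" using d(2) by blast
      thus ?thesis by (intro exI[of _ "b * n"]) (simp add: mult_ac)
    qed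
  qed
qed

text \<open>A rational relation exists because there is one vector more than coordinates; clearing
  denominators and dividing by the gcd leaves a coefficient not divisible by p.\<close>

lemma primitive_relation:
  fixes q :: "nat => nat => rat" and p :: int
  assumes p: "\<not> is_unit p"
  shows "\<exists>n :: nat => int. (\<exists>j\<le>N. \<not> p dvd n j) \<and> (\<forall>k<N. (\<Sum>j\<le>N. of_int (n j) * q j k) = 0)"
proof -
  obtain n where n: "\<exists>j\<in>{..N}. n j \<noteq> 0" "\<forall>k<N. (\<Sum>j\<in>{..N}. n j * q j k) = 0" using homogeneous_system[of "{..N}" N q] by auto
  obtain d where d: "d > 0" "\<forall>j\<in>{..N}. \<exists>i::int. of_int d * n j = of_int i" using rat_common_denominator[of "{..N}" n] by auto
  define i where "i = (\<lambda>j. SOME k. of_int d * n j = of_int k)"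
  have i: "of_int d * n j = of_int (i j)" if "j \<le> N" for j unfolding i_def by (rule someI_ex) (use d(2) that in simp)
  define g where "g = Gcd (i ` {..N})"
  have gd: "g dvd i j" if "j \<le> N" for j unfolding g_def using that by (intro Gcd_dvd) auto
  obtain j0 where j0: "j0 \<le> N" "n j0 \<noteq> 0" using n(1) by auto
  have "i j0 \<noteq> 0" using i[OF j0(1)] j0(2) d(1) by auto
  hence g0: "g \<noteq> 0" using gd[OF j0(1)] by auto
  have nd: "\<exists>j\<le>N. \<not> p dvd i j div g"
  proof (rule ccontr)
    assume "\<not> ?thesis"
    hence a: "p dvd i j div g" if "j \<le> N" for j using that by blast
    have "p * g dvd i j" if "j \<le> N" for j using mult_dvd_mono[OF a[OF that] dvd_refl[of g]] gd[OF that] by simp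
    hence "p * g dvd g" unfolding g_def by (intro Gcd_greatest) auto
    thus False using p g0 by simp
  qed
  have "(\<Sum>j\<le>N. of_int (i j div g) * q j k) = 0" if k: "k < N" for k
  proof -
    have "of_int g * (\<Sum>j\<le>N. of_int (i j div g) * q j k) = (\<Sum>j\<le>N. of_int d * (n j * q j k))" unfolding sum_distrib_left
    proof (rule sum.cong[OF refl])
      fix j assume "j \<in> {..N}"
      hence j: "j \<le> N" by simp
      have "of_int g * of_int (i j div g) = (of_int (i j) :: rat)" using gd[OF j] by (simp flip: of_int_mult)
      thus "of_int g * (of_int (i j div g) * q j k) = of_int d * (n j * q j k)" unfolding mult.assoc[symmetric] i[OF j] by simp
    qed
    also have "\<dots> = 0" using n(2) k by (simp add: sum_distrib_left[symmetric])
    finally show ?thesis using g0 by simp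
  qed
  thus ?thesis using nd by (intro exI[of _ "\<lambda>j. i j div g"]) blast
qed

text \<open>The coordinate along z in a basis of the complex numbers over the rationals that
  contains z.\<close>

lemma exists_additive_rat:
  assumes "z \<noteq> 0"
  shows "\<exists>l :: complex => rat. (\<forall>x y. l (x + y) = l x + l y) \<and> l z \<noteq> 0"
proof -
  interpret Q: vector_space "\<lambda>(q::rat) (z::complex). of_rat q * z" by unfold_locales (simp_all add: of_rat_add of_rat_mult algebra_simps)
  define B where "B = Q.extend_basis {z}"
  have ind: "Q.independent {z}" using assms by (simp add: Q.independent_insert Q.span_empty)
  have B: "Q.independent B" "Q.span B = UNIV" "z \<in> B" unfolding B_def using Q.independent_extend_basis[OF ind] Q.span_extend_basis[OF ind] Q.extend_basis_superset[OF ind] by auto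
  define l where "l = (\<lambda>x. Q.representation B x z)"
  have "l (x + y) = l x + l y" for x y unfolding l_def by (subst Q.representation_add[OF B(1)]) (simp_all add: B(2))
  moreover have "l z = 1" unfolding l_def by (simp add: Q.representation_basis[OF B(1) B(3)])
  ultimately show ?thesis by (intro exI[of _ l]) auto
qed

subsection \<open>Compatibility of the Hecke operator with additive maps\<close>

lemma additive_0: "(\<And>x y. l (x + y) = l x + l y) ==> l (0 :: 'a::comm_ring_1) = (0 :: 'b::comm_ring_1)" by (metis add_cancel_right_right)

lemma additive_sum:
  fixes l :: "'a::comm_ring_1 => 'b::comm_ring_1"
  assumes l: "\<And>x y. l (x + y) = l x + l y"
  shows "l (\<Sum>i\<in>A. f i) = (\<Sum>i\<in>A. l (f i))" by (induction A rule: infinite_finite_induct) (simp_all add: l additive_0[of l, OF l])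

lemma additive_of_nat:
  fixes l :: "'a::comm_ring_1 => 'b::comm_ring_1"
  assumes l: "\<And>x y. l (x + y) = l x + l y"
  shows "l (of_nat n * x) = of_nat n * l x" by (induction n) (simp_all add: l additive_0[of l, OF l] distrib_right)

lemma additive_diff:
  fixes l :: "'a::comm_ring_1 => 'b::comm_ring_1"
  assumes l: "\<And>x y. l (x + y) = l x + l y"
  shows "l (x - y) = l x - l y" using l[of "x - y" y] by simp

lemma V_coeff_additive:
  fixes l :: "'a::comm_ring_1 => 'b::comm_ring_1"
  assumes l: "\<And>x y. l (x + y) = l x + l y"
  shows "V_coeff p (\<lambda>n r. l (c n r)) = (\<lambda>n r. l (V_coeff p c n r))" by (intro ext) (simp add: V_coeff_def l additive_0[of l, OF l])

lemma W_coeff_additive: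
  fixes l :: "'a::comm_ring_1 => 'b::comm_ring_1"
  assumes l: "\<And>x y. l (x + y) = l x + l y"
  shows "W_coeff M n (\<lambda>n r. l (c n r)) N R = l (W_coeff M n c N R)" unfolding W_coeff_def additive_sum[of l, OF l] by (rule sum.cong) (simp_all add: Let_def additive_0[of l, OF l])

text \<open>The operator has integer coefficients, so it commutes with additive maps, in particular
  with functionals to the rationals and with the inclusion of the integers.\<close>

lemma T_coeff_additive:
  fixes l :: "'a::comm_ring_1 => 'b::comm_ring_1"
  assumes l: "\<And>x y. l (x + y) = l x + l y"
  shows "T_coeff m p (\<lambda>n r. l (c n r)) n r = l (T_coeff m p c n r)"
  unfolding T_coeff_def V_coeff_additive[of l, OF l] W_coeff_additive[of l, OF l] additive_diff[of l, OF l] additive_of_nat[of l, OF l] ..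

lemma V_coeff_linear:
  "V_coeff p (\<lambda>n r. a * c n r + b * d n r) = (\<lambda>n r. a * V_coeff p c n r + b * V_coeff p d n r)" by (intro ext) (simp add: V_coeff_def algebra_simps)

lemma W_coeff_linear:
  "W_coeff M n (\<lambda>n r. a * c n r + b * d n r) N R = a * W_coeff M n c N R + b * W_coeff M n d N R" unfolding W_coeff_def sum_distrib_left sum.distrib[symmetric]
  by (rule sum.cong) (simp_all add: Let_def)

lemma T_coeff_linear:
  "T_coeff m p (\<lambda>n r. a * c n r + b * d n r) n r = a * T_coeff m p c n r + b * T_coeff m p d n r" unfolding T_coeff_def V_coeff_linear W_coeff_linear by (simp add: algebra_simps)

subsection \<open>Holomorphic Jacobi forms of weight one\<close>

definition JJ :: "nat => (int => int => complex) set" where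
  "JJ m = {c. (\<exists>F. jac m F c) \<and> (\<forall>n r. c n r \<noteq> 0 --> r\<^sup>2 \<le> 4 * int m * n)}"

lemma JJ_elliptic: "c \<in> JJ m ==> c (n + l * r + int m * l\<^sup>2) (r + 2 * int m * l) = c n r" unfolding JJ_def using jac_coeff by blast

lemma JJ_nice:
  assumes m: "m > 0" and c: "c \<in> JJ m"
  shows "fourier_nice c" unfolding fourier_nice_def
proof (intro conjI allI impI)
  have s: "r\<^sup>2 \<le> 4 * int m * n" if "c n r \<noteq> 0" for n r using c that unfolding JJ_def by blast
  show "0 \<le> n" if "c n r \<noteq> 0" for n r
  proof -
    have "0 \<le> 4 * int m * n" using s[OF that] zero_le_power2[of r] by linarith
    thus ?thesis using m by (simp add: zero_le_mult_iff)
  qed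
  fix n
  have "{r. c n r \<noteq> 0} \<subseteq> {- \<bar>4 * int m * n\<bar>..\<bar>4 * int m * n\<bar>}"
  proof
    fix r assume "r \<in> {r. c n r \<noteq> 0}"
    hence "r\<^sup>2 \<le> \<bar>4 * int m * n\<bar>" using s[of n r] by simp
    moreover have "\<bar>r\<bar> \<le> r\<^sup>2" using mult_mono[of 1 "\<bar>r\<bar>" "\<bar>r\<bar>" "\<bar>r\<bar>"] by (cases "r = 0") (auto simp: power2_eq_square)
    ultimately show "r \<in> {- \<bar>4 * int m * n\<bar>..\<bar>4 * int m * n\<bar>}" by auto
  qed
  thus "finite {r. c n r \<noteq> 0}" by (rule finite_subset) simp
qed

lemma JJ_linear:
  assumes "c \<in> JJ m" "d \<in> JJ m"
  shows "(\<lambda>n r. a * c n r + b * d n r) \<in> JJ m"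
proof -
  obtain F G where F: "jac m F c" and G: "jac m G d" using assms unfolding JJ_def by blast
  have "jac m (\<lambda>t z. a * F t z + b * G t z) (\<lambda>n r. a * c n r + b * d n r)" by (intro jac_add jac_cmult F G)
  moreover have "r\<^sup>2 \<le> 4 * int m * n" if "a * c n r + b * d n r \<noteq> 0" for n r using assms that unfolding JJ_def by (cases "c n r = 0") auto
  ultimately show ?thesis unfolding JJ_def by blast
qed

text \<open>All arguments in the coefficient formula have discriminant p^2 D, D or D/p^2, so the
  sign condition on the support is preserved.\<close>

lemma JJ_T:
  assumes c: "c \<in> JJ m" and p: "prime p"
  shows "T_coeff m p c \<in> JJ m"
proof -
  obtain F where F: "jac m F c" using c unfolding JJ_def by blast
  have s: "r\<^sup>2 \<le> 4 * int m * n" if "c n r \<noteq> 0" for n r using c that unfolding JJ_def by blast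
  have p0: "p > 0" using p prime_gt_0_nat by blast
  have "r\<^sup>2 \<le> 4 * int m * n" if T: "T_coeff m p c n r \<noteq> 0" for n r
  proof (rule ccontr)
    assume D: "\<not> r\<^sup>2 \<le> 4 * int m * n"
    have "c n r = 0" using s D by blast
    moreover have "c ((int p)\<^sup>2 * n) (int p * r) = 0"
    proof (rule ccontr)
      assume "c ((int p)\<^sup>2 * n) (int p * r) \<noteq> 0"
      from s[OF this] have "(int p)\<^sup>2 * r\<^sup>2 \<le> (int p)\<^sup>2 * (4 * int m * n)" by (simp add: power_mult_distrib mult_ac)
      thus False using D p0 by simp
    qed
    moreover have "(\<Sum>a\<in>{0..<int p}. if (int p)\<^sup>2 dvd n - a * r + int m * a\<^sup>2 \<and> int p dvd r - 2 * int m * a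
         then c ((n - a * r + int m * a\<^sup>2) div (int p)\<^sup>2) ((r - 2 * int m * a) div int p) else 0) = 0"
    proof (rule sum.neutral, rule ballI)
      fix a
      have "c ((n - a * r + int m * a\<^sup>2) div (int p)\<^sup>2) ((r - 2 * int m * a) div int p) = 0"
        if d: "(int p)\<^sup>2 dvd n - a * r + int m * a\<^sup>2" "int p dvd r - 2 * int m * a"
      proof (rule ccontr)
        assume nz: "c ((n - a * r + int m * a\<^sup>2) div (int p)\<^sup>2) ((r - 2 * int m * a) div int p) \<noteq> 0"
        obtain x where x: "n - a * r + int m * a\<^sup>2 = (int p)\<^sup>2 * x" using d(1) by blast
        obtain y where y: "r - 2 * int m * a = int p * y" using d(2) by blast
        have "y\<^sup>2 \<le> 4 * int m * x" using s[OF nz] p0 unfolding x y by simp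
        hence "(int p)\<^sup>2 * y\<^sup>2 \<le> (int p)\<^sup>2 * (4 * int m * x)" by (intro mult_left_mono) auto
        hence "(int p * y)\<^sup>2 \<le> 4 * int m * ((int p)\<^sup>2 * x)" by (simp add: power_mult_distrib mult_ac)
        hence "(r - 2 * int m * a)\<^sup>2 \<le> 4 * int m * (n - a * r + int m * a\<^sup>2)" unfolding x y .
        thus False using D by (simp add: power2_eq_square algebra_simps)
      qed
      thus "(if (int p)\<^sup>2 dvd n - a * r + int m * a\<^sup>2 \<and> int p dvd r - 2 * int m * a
         then c ((n - a * r + int m * a\<^sup>2) div (int p)\<^sup>2) ((r - 2 * int m * a) div int p) else 0) = 0" by simp
    qed
    ultimately have "T_coeff m p c n r = 0" unfolding T_coeff_eq[of p c m, OF p0 JJ_elliptic[OF c]] by simp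
    thus False using T by simp
  qed
  thus ?thesis using jac_T[OF F p] unfolding JJ_def by blast
qed

subsection \<open>The lattice of rational linear functionals\<close>

text \<open>\<open>JJ m\<close> has no evident rational structure. Additive functionals applied to
  the coefficients of forms give rational arrays on which T still acts; their rational span is taken
  over all forms and all functionals at once.\<close>

inductive_set Lq :: "nat => (int \<times> int => rat) set" for m where
  base: "c \<in> JJ m ==> (\<And>x y. l (x + y) = l x + l y) ==> (\<lambda>(n, r). l (c n r)) \<in> Lq m"
| comb: "x \<in> Lq m ==> y \<in> Lq m ==> (\<lambda>i. a * x i + b * y i) \<in> Lq m"

definition Tp :: "nat => nat => (int \<times> int => 'a::comm_ring_1) => int \<times> int => 'a" where
  "Tp m p x = (\<lambda>(n, r). T_coeff m p (\<lambda>n r. x (n, r)) n r)"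

lemma Lq_elliptic: "x \<in> Lq m ==> x (n + l * r + int m * l\<^sup>2, r + 2 * int m * l) = x (n, r)" by (induction rule: Lq.induct) (simp_all add: JJ_elliptic)

lemma Lq_T:
  assumes "x \<in> Lq m" "prime p" shows "Tp m p x \<in> Lq m" using assms(1)
proof (induction rule: Lq.induct)
  case (base c l)
  have "Tp m p (\<lambda>(n, r). l (c n r)) = (\<lambda>(n, r). l (T_coeff m p c n r))" unfolding Tp_def using T_coeff_additive[of l m p c, OF base(2)] by (simp add: fun_eq_iff)
  thus ?case using Lq.base[OF JJ_T[OF base(1) assms(2)] base(2)] by simp
next
  case (comb x y a b)
  have "Tp m p (\<lambda>i. a * x i + b * y i) = (\<lambda>i. a * Tp m p x i + b * Tp m p y i)" unfolding Tp_def by (simp add: fun_eq_iff T_coeff_linear)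
  thus ?case using Lq.comb[OF comb.IH] by simp
qed

lemma additive_of_int:
  fixes l :: "complex => rat"
  assumes l: "\<And>x y. l (x + y) = l x + l y"
  shows "l (x * of_int k) = l x * of_int k"
proof (cases "k \<ge> 0")
  case True
  thus ?thesis using additive_of_nat[of l "nat k" x, OF l] by (simp add: mult.commute)
next
  case False
  hence "l (0 - of_nat (nat (- k)) * x) = 0 - of_nat (nat (- k)) * l x"
    using additive_diff[of l 0 "of_nat (nat (- k)) * x", OF l] additive_of_nat[of l "nat (- k)" x, OF l] additive_0[of l, OF l] by simp
  thus ?thesis using False by (simp add: mult.commute)
qed

text \<open>Since the spanning arrays are integral, an additive l acts only on the complex weights a
  j, and the same arrays span rationally.\<close>

lemma Lq_span:
  assumes m: "m > 0"
  shows "\<exists>N. \<exists>b :: nat => int \<times> int => int. \<forall>x\<in>Lq m. \<exists>q :: nat => rat. \<forall>i. x i = (\<Sum>j<N. q j * of_int (b j i))"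
proof -
  define S where "S = {\<lambda>(n, r). c n r | c. \<exists>F. jac m F c \<and> fourier_nice c}"
  have "int_span S" unfolding S_def by (rule jac_int_span[OF m])
  then obtain N B where B: "\<And>j i. B j i \<in> (\<int> :: complex set)"
    "\<And>x. x \<in> S ==> \<exists>a. \<forall>i. x i = (\<Sum>j<(N::nat). a j * B j i)" unfolding int_span_def by blast
  define b where "b = (\<lambda>j i. SOME k. B j i = of_int k)"
  have b: "B j i = of_int (b j i)" for j i unfolding b_def by (rule someI_ex, rule Ints_cases[OF B(1)[of j i]]) blast
  have "\<exists>q :: nat => rat. \<forall>i. x i = (\<Sum>j<N. q j * of_int (b j i))" if x: "x \<in> Lq m" for x using x
  proof (induction rule: Lq.induct)
    case (base c l)
    have "(\<lambda>(n, r). c n r) \<in> S" using base(1) JJ_nice[OF m base(1)] unfolding JJ_def S_def by blast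
    from B(2)[OF this] obtain a where a: "\<And>i. (\<lambda>(n, r). c n r) i = (\<Sum>j<N. a j * B j i)" by blast
    have "l (c n r) = (\<Sum>j<N. l (a j) * of_int (b j (n, r)))" for n r using a[of "(n, r)"] by (simp add: b additive_sum[of l, OF base(2)] additive_of_int[of l, OF base(2)])
    thus ?case by (intro exI[of _ "\<lambda>j. l (a j)"]) auto
  next
    case (comb x y a c)
    obtain q where q: "\<And>i. x i = (\<Sum>j<N. q j * of_int (b j i))" using comb.IH by blast
    obtain s where s: "\<And>i. y i = (\<Sum>j<N. s j * of_int (b j i))" using comb.IH by blast
    show ?case by (intro exI[of _ "\<lambda>j. a * q j + c * s j"]) (simp add: q s sum_distrib_left sum.distrib algebra_simps)
  qed
  thus ?thesis by blast
qed

text \<open>All integer points of the rational space \<open>Lq m\<close>; hence dividing an array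
  whose values are multiples of p by p stays inside.\<close>

definition Lz :: "nat => (int \<times> int => int) set" where
  "Lz m = {x. (\<lambda>i. of_int (x i)) \<in> Lq m}"

lemma Lz_elliptic: "x \<in> Lz m ==> x (n + l * r + int m * l\<^sup>2, r + 2 * int m * l) = x (n, r)" unfolding Lz_def mem_Collect_eq using Lq_elliptic[of "\<lambda>i. of_int (x i)" m n l r] by simp

text \<open>Injectivity mod p holds because the value of T x at (p^2 n, p r) is congruent to x(n,
  r). For the rank condition, N + 1 arrays in the span of N satisfy a relation that can be taken
  primitive at p.\<close>

lemma Lz_integral_operator:
  assumes m: "m > 0" and p: "prime p" and pm: "\<not> int p dvd 2 * int m"
  shows "\<exists>N. integral_operator (Lz m) (Tp m p) (int p) N"
proof -
  obtain N and b :: "nat => int \<times> int => int" where b: "\<And>x. x \<in> Lq m ==> \<exists>q :: nat => rat. \<forall>i. x i = (\<Sum>j<N. q j * of_int (b j i))" using Lq_span[OF m] by blast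
  have pp: "prime (int p)" using p by simp
  have p0: "int p > 0" using p prime_gt_0_nat by simp
  have Tof: "(\<lambda>i. of_int (Tp m p x i)) = Tp m p (\<lambda>i. of_int (x i) :: rat)" for x
    unfolding Tp_def using T_coeff_additive[of "of_int :: int => rat" m p "\<lambda>n r. x (n, r)"] by (simp add: fun_eq_iff)
  have "integral_operator (Lz m) (Tp m p) (int p) N"
  proof
    fix x y :: "int \<times> int => int" and a c
    assume x: "x \<in> Lz m" and y: "y \<in> Lz m"
    show "(\<lambda>i. a * x i + c * y i) \<in> Lz m" using Lq.comb[of "\<lambda>i. of_int (x i)" m "\<lambda>i. of_int (y i)" "of_int a" "of_int c"] x y unfolding Lz_def by simp
    show "Tp m p (\<lambda>i. a * x i + c * y i) = (\<lambda>i. a * Tp m p x i + c * Tp m p y i)" unfolding Tp_def by (simp add: fun_eq_iff T_coeff_linear)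
  next
    fix x assume x: "x \<in> Lz m"
    show "Tp m p x \<in> Lz m" using Lq_T[OF _ p, of "\<lambda>i. of_int (x i)" m] x unfolding Lz_def by (simp add: Tof)
    show "(\<lambda>i. x i div int p) \<in> Lz m" if d: "\<And>i. int p dvd x i"
    proof -
      have "of_int (x i div int p) = 1 / of_int (int p) * of_int (x i) + 0 * (of_int (x i) :: rat)" for i using d[of i] p0 by (auto elim!: dvdE)
      thus ?thesis using Lq.comb[of "\<lambda>i. of_int (x i)" m "\<lambda>i. of_int (x i)" "1 / of_int (int p)" 0] x unfolding Lz_def by simp
    qed
    show "int p dvd x i" if d: "\<And>i. int p dvd Tp m p x i" for i
    proof -
      obtain n r where i: "i = (n, r)" by (cases i)
      have "Tp m p x ((int p)\<^sup>2 * n, int p * r) = int p * x ((int p)\<^sup>2 * ((int p)\<^sup>2 * n), int p * (int p * r)) + x (n, r)"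
        unfolding Tp_def using T_coeff_square[OF p pm, of "\<lambda>n r. x (n, r)" n r] Lz_elliptic[OF x] by simp
      hence "int p dvd int p * x ((int p)\<^sup>2 * ((int p)\<^sup>2 * n), int p * (int p * r)) + x (n, r)" using d[of "((int p)\<^sup>2 * n, int p * r)"] by simp
      thus ?thesis unfolding i by (simp add: dvd_add_right_iff)
    qed
  next
    fix f :: "nat => int \<times> int => int" assume f: "\<And>j. j \<le> N ==> f j \<in> Lz m"
    define q where "q = (\<lambda>j. SOME q :: nat => rat. \<forall>i. of_int (f j i) = (\<Sum>k<N. q k * of_int (b k i)))"
    have q: "of_int (f j i) = (\<Sum>k<N. q j k * (of_int (b k i) :: rat))" if j: "j \<le> N" for j i
    proof -
      have "(\<lambda>i. of_int (f j i)) \<in> Lq m" using f[OF j] unfolding Lz_def by simp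
      from someI_ex[OF b[OF this]] show ?thesis unfolding q_def by blast
    qed
    have "\<not> is_unit (int p)" using pp not_prime_unit by blast
    from primitive_relation[OF this, of N q] obtain n where n: "\<exists>j\<le>N. \<not> int p dvd n j" "\<And>k. k < N ==> (\<Sum>j\<le>N. of_int (n j) * q j k) = 0" by blast
    have "(\<Sum>j\<le>N. n j * f j i) = 0" for i
    proof -
      have "(of_int (\<Sum>j\<le>N. n j * f j i) :: rat) = (\<Sum>j\<le>N. of_int (n j) * of_int (f j i))" by simp
      also have "\<dots> = (\<Sum>j\<le>N. \<Sum>k<N. of_int (n j) * q j k * of_int (b k i))" by (rule sum.cong) (auto simp: q sum_distrib_left mult.assoc)
      also have "\<dots> = (\<Sum>k<N. \<Sum>j\<le>N. of_int (n j) * q j k * of_int (b k i))" by (rule sum.swap)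
      also have "\<dots> = (\<Sum>k<N. (\<Sum>j\<le>N. of_int (n j) * q j k) * of_int (b k i))" by (simp only: sum_distrib_right)
      also have "\<dots> = 0" by (rule sum.neutral) (auto simp: n(2))
      finally show ?thesis by (simp only: of_int_eq_0_iff)
    qed
    thus "\<exists>n :: nat => int. (\<exists>j\<le>N. \<not> int p dvd n j) \<and> (\<forall>i. (\<Sum>j\<le>N. n j * f j i) = 0)" using n(1) by blast
  qed (rule pp)
  thus ?thesis by blast
qed

text \<open>Linear relations with integral coefficients transfer from the lattice to the forms, since
  additive maps to the rationals separate complex numbers.\<close>

lemma JJ_relation:
  assumes m: "m > 0" and c: "c \<in> JJ m"
    and rel: "\<And>x. x \<in> Lz m ==> x (n1, r1) = e * x (n2, r2)"
  shows "c n1 r1 = of_int e * c n2 r2"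
proof (rule ccontr)
  assume "\<not> ?thesis"
  hence "c n1 r1 - c n2 r2 * of_int e \<noteq> 0" by (simp add: mult.commute)
  \<comment> \<open>A functional that detects the failure of the relation. After clearing
    denominators its array lies in the lattice, where the relation holds.\<close>
  from exists_additive_rat[OF this] obtain l :: "complex => rat" where l: "\<And>x y. l (x + y) = l x + l y"
    "l (c n1 r1 - c n2 r2 * of_int e) \<noteq> 0" by blast
  let ?x = "\<lambda>(n, r). l (c n r)"
  have x: "?x \<in> Lq m" by (rule Lq.base[OF c l(1)])
  obtain N and b :: "nat => int \<times> int => int" where b: "\<And>x. x \<in> Lq m ==> \<exists>q :: nat => rat. \<forall>i. x i = (\<Sum>j<N. q j * of_int (b j i))" using Lq_span[OF m] by blast
  obtain q where q: "\<And>i. ?x i = (\<Sum>j<N. q j * (of_int (b j i) :: rat))" using b[OF x] by blast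
  obtain d where d: "d > 0" "\<forall>j\<in>{..<N}. \<exists>n::int. of_int d * q j = of_int n" using rat_common_denominator[of "{..<N}" q] by auto
  define k where "k = (\<lambda>j. SOME n. of_int d * q j = of_int n)"
  have k: "of_int d * q j = of_int (k j)" if "j < N" for j unfolding k_def by (rule someI_ex) (use d(2) that in simp)
  define y where "y = (\<lambda>i. \<Sum>j<N. k j * b j i)"
  have y: "of_int (y i) = of_int d * ?x i + 0 * ?x i" for i unfolding q by (simp add: y_def sum_distrib_left mult.assoc[symmetric] k)
  have "y \<in> Lz m" unfolding Lz_def mem_Collect_eq y by (rule Lq.comb[OF x x])
  from rel[OF this] have "of_int (y (n1, r1)) = of_int e * (of_int (y (n2, r2)) :: rat)" by (simp flip: of_int_mult)
  hence "l (c n1 r1) = of_int e * l (c n2 r2)" unfolding y using d(1) by simp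
  thus False using l(2) unfolding additive_diff[of l, OF l(1)] additive_of_int[of l, OF l(1)] by (simp add: mult.commute)
qed

section \<open>Hecke recursions along p-towers\<close>

lemma Tp_recursion:
  fixes n r :: int
  assumes p: "prime p" and pm: "\<not> int p dvd 2 * int m" and x: "x \<in> Lz m"
  defines "s \<equiv> \<lambda>k::nat. (int p ^ (2 * k) * n, int p ^ k * r)"
  shows "Tp m p x (s (Suc k)) = int p * x (s (Suc (Suc k))) + x (s k)"
proof -
  have e: "int p ^ (2 * Suc k) * n = (int p)\<^sup>2 * (int p ^ (2 * k) * n)" for k by (simp add: power2_eq_square)
  have e': "int p ^ Suc k * r = int p * (int p ^ k * r)" for k by simp
  show ?thesis unfolding s_def Tp_def prod.case e e' using T_coeff_square[OF p pm, of "\<lambda>n r. x (n, r)" "int p ^ (2 * k) * n" "int p ^ k * r"] Lz_elliptic[OF x] by simp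
qed

lemma Tp_start:
  assumes p: "prime p" and x: "x \<in> Lz m" and nd: "\<not> (int p)\<^sup>2 dvd r\<^sup>2 - 4 * int m * n"
  shows "Tp m p x (n, r) = int p * x ((int p)\<^sup>2 * n, int p * r) + (int (nroots m p n r) - 1) * x (n, r)"
  unfolding Tp_def prod.case using T_coeff_nonsquare[OF p _ nd, of "\<lambda>n r. x (n, r)"] Lz_elliptic[OF x] by simp

text \<open>As p divides D exactly once, the starting relation of the tower has \<epsilon> = 0.
  Vanishing on the lattice transfers to the forms as the relation with factor 0.\<close>

lemma JJ_exact_prime_divisor:
  assumes m: "m > 0" and c: "c \<in> JJ m" and pr: "prime p" and pm: "\<not> int p dvd 2 * int m"
    and d: "int p dvd r\<^sup>2 - 4 * int m * n" and nd: "\<not> (int p)\<^sup>2 dvd r\<^sup>2 - 4 * int m * n"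
  shows "c n r = 0"
proof -
  obtain N where "integral_operator (Lz m) (Tp m p) (int p) N" using Lz_integral_operator[OF m pr pm] by blast
  then interpret integral_operator "Lz m" "Tp m p" "int p" N .
  define s where "s = (\<lambda>k::nat. (int p ^ (2 * k) * n, int p ^ k * r))"
  have "x (n, r) = 0 * x (n, r)" if x: "x \<in> Lz m" for x
  proof -
    have "x (s 0) = 0"
    proof (rule recursion_eps_0[OF _ _ x])
      show "Tp m p y (s 0) = int p * y (s (Suc 0))" if "y \<in> Lz m" for y using Tp_start[OF pr that nd] nroots_dvd[OF pr pm d] by (simp add: s_def)
      show "Tp m p y (s (Suc k)) = int p * y (s (Suc (Suc k))) + y (s k)" if "y \<in> Lz m" for y k unfolding s_def by (rule Tp_recursion[OF pr pm that])
    qed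
    thus ?thesis by (simp add: s_def)
  qed
  note rel = this
  have "c n r = of_int 0 * c n r" by (rule JJ_relation[OF m c]) (rule rel)
  thus ?thesis by simp
qed

text \<open>Here \<epsilon> is the root count minus one, which is the Legendre symbol of D.\<close>

lemma JJ_unit_prime:
  assumes m: "m > 0" and c: "c \<in> JJ m" and pr: "prime p" and pm: "\<not> int p dvd 2 * int m"
    and nd: "\<not> int p dvd r\<^sup>2 - 4 * int m * n"
  shows "c ((int p)\<^sup>2 * n) (int p * r) = of_int (Legendre (r\<^sup>2 - 4 * int m * n) (int p)) * c n r"
    "T_coeff m p c n r = of_int (Legendre (r\<^sup>2 - 4 * int m * n) (int p)) * of_nat (p + 1) * c n r"
proof -
  let ?D = "r\<^sup>2 - 4 * int m * n"
  let ?e = "Legendre ?D (int p)"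
  have D0: "\<not> [?D = 0] (mod int p)" using nd by (simp add: cong_0_iff)
  have nd2: "\<not> (int p)\<^sup>2 dvd ?D" using nd dvd_trans[of "int p" "(int p)\<^sup>2" ?D] by (auto simp: power2_eq_square)
  have nr: "int (nroots m p n r) - 1 = ?e" using nroots_res[OF pr pm _ nd] nroots_nonres[OF pr pm, of r n] D0 unfolding Legendre_def by auto
  have ee: "?e * ?e = 1" using D0 unfolding Legendre_def by auto
  obtain N where "integral_operator (Lz m) (Tp m p) (int p) N" using Lz_integral_operator[OF m pr pm] by blast
  then interpret integral_operator "Lz m" "Tp m p" "int p" N .
  define s where "s = (\<lambda>k::nat. (int p ^ (2 * k) * n, int p ^ k * r))"
  have "x ((int p)\<^sup>2 * n, int p * r) = ?e * x (n, r)" if x: "x \<in> Lz m" for x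
  proof -
    have "x (s (Suc 0)) = ?e * x (s 0)"
    proof (rule recursion_eps_1[OF ee _ _ x])
      show "Tp m p y (s 0) = int p * y (s (Suc 0)) + ?e * y (s 0)" if "y \<in> Lz m" for y using Tp_start[OF pr that nd2] nr by (simp add: s_def)
      show "Tp m p y (s (Suc k)) = int p * y (s (Suc (Suc k))) + y (s k)" if "y \<in> Lz m" for y k unfolding s_def by (rule Tp_recursion[OF pr pm that])
    qed
    thus ?thesis by (simp add: s_def power2_eq_square)
  qed
  note rel = this
  show 1: "c ((int p)\<^sup>2 * n) (int p * r) = of_int ?e * c n r" by (rule JJ_relation[OF m c]) (rule rel)
  show "T_coeff m p c n r = of_int ?e * of_nat (p + 1) * c n r" using T_coeff_nonsquare[OF pr JJ_elliptic[OF c] nd2] unfolding nr 1 by (simp add: algebra_simps)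
qed

text \<open>The recursion p x_(k+1) = (T x)_k - x_(k-1) carries vanishing upwards, because T c again
  belongs to the family X; hence a whole T-stable family is treated at once.\<close>

lemma vanish_tower:
  assumes p: "prime p" and pm: "\<not> int p dvd 2 * int m" and nd: "\<not> (int p)\<^sup>2 dvd r\<^sup>2 - 4 * int m * n"
    and X: "\<And>c. c \<in> X ==> c \<in> JJ m" "\<And>c. c \<in> X ==> T_coeff m p c \<in> X" "\<And>c. c \<in> X ==> c n r = 0"
    and c: "c \<in> X"
  shows "c (int p ^ (2 * k) * n) (int p ^ k * r) = 0" using c
proof (induction k arbitrary: c rule: less_induct)
  case (less k)
  have p0: "of_nat p \<noteq> (0 :: complex)" using p by auto
  show ?case
  proof (cases k)
    case 0
    thus ?thesis using X(3)[OF less.prems] by simp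
  next
    case (Suc j)
    note ell = JJ_elliptic[OF X(1)[OF less.prems]]
    have e: "int p ^ (2 * Suc i) * n = (int p)\<^sup>2 * (int p ^ (2 * i) * n)" "int p ^ Suc i * r = int p * (int p ^ i * r)" for i by (simp_all add: power2_eq_square)
    have T: "T_coeff m p c (int p ^ (2 * j) * n) (int p ^ j * r) = 0" "c (int p ^ (2 * j) * n) (int p ^ j * r) = 0" using less.IH[of j] X(2)[OF less.prems] less.prems Suc by auto
    show ?thesis
    proof (cases j)
      case 0
      thus ?thesis using T T_coeff_nonsquare[OF p ell nd] p0 Suc by (simp add: power2_eq_square)
    next
      case (Suc i)
      have "c (int p ^ (2 * i) * n) (int p ^ i * r) = 0" using less.IH[of i] less.prems Suc \<open>k = _\<close> by auto
      hence "of_nat p * c ((int p)\<^sup>2 * ((int p)\<^sup>2 * (int p ^ (2 * i) * n))) (int p * (int p * (int p ^ i * r))) = 0"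
        using T(1) T_coeff_square[OF p pm ell, of "int p ^ (2 * i) * n" "int p ^ i * r"] unfolding Suc e by simp
      thus ?thesis unfolding \<open>k = _\<close> Suc e using p0 by simp
    qed
  qed
qed

section \<open>Vanishing of holomorphic Jacobi forms of weight one\<close>

definition cls :: "nat => nat => int => int => bool" where
  "cls m t n r \<longleftrightarrow> (\<exists>s::nat. s > 0 \<and> 4 * int m * n - r\<^sup>2 = int t * (int s)\<^sup>2)"

lemma cls_exists:
  assumes "r\<^sup>2 < 4 * int m * n"
  shows "\<exists>t. squarefree t \<and> cls m t n r"
proof -
  define x where "x = nat (4 * int m * n - r\<^sup>2)"
  have x: "int x = 4 * int m * n - r\<^sup>2" "x > 0" using assms by (auto simp: x_def)
  have "x \<noteq> 0" using x(2) by simp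
  hence "square_part x \<noteq> 0" by (simp only: square_part_0_iff not_False_eq_True)
  hence "square_part x > 0" by (simp only: neq0_conv)
  moreover have "int (squarefree_part x * (square_part x)\<^sup>2) = int (squarefree_part x) * (int (square_part x))\<^sup>2" by (simp only: of_nat_mult of_nat_power)
  hence "int x = int (squarefree_part x) * (int (square_part x))\<^sup>2" unfolding squarefree_decompose[of x, symmetric] .
  moreover have "squarefree (squarefree_part x)" by (rule squarefree_squarefree_part)
  ultimately show ?thesis unfolding cls_def x(1)[symmetric] by (intro exI[of _ "squarefree_part x"]) blast
qed

lemma disc_translate:
  "(r + 2 * int m * l)\<^sup>2 - 4 * int m * (n + l * r + int m * l\<^sup>2) = r\<^sup>2 - 4 * int m * n" by (simp add: power2_eq_square algebra_simps)

text \<open>As p is prime to 2m, r can be translated by a multiple of 2m to become divisible by p^k;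
  then p^(2k) | D forces p^(2k) to divide the translated n as well.\<close>

lemma tower_representative:
  assumes p: "prime p" and pm: "\<not> int p dvd 2 * int m" and d: "int p ^ (2 * k) dvd r\<^sup>2 - 4 * int m * n"
  shows "\<exists>n0 r0. int p ^ (2 * k) * (r0\<^sup>2 - 4 * int m * n0) = r\<^sup>2 - 4 * int m * n \<and>
    (\<forall>c\<in>JJ m. c n r = c (int p ^ (2 * k) * n0) (int p ^ k * r0))"
proof -
  have pp: "prime (int p)" using p by simp
  have cop: "coprime (2 * int m) (int p)" using prime_imp_coprime[OF pp pm] by (rule coprime_commute[THEN iffD1])
  hence "coprime (2 * int m) (int p ^ k)" by simp
  then obtain x where x: "[2 * int m * x = 1] (mod int p ^ k)" using cong_solve_coprime_int by blast
  define l where "l = - r * x"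
  have "int p ^ k dvd 2 * int m * x - 1" using x by (simp add: cong_iff_dvd_diff)
  hence "int p ^ k dvd - r * (2 * int m * x - 1)" by (rule dvd_mult)
  also have "- r * (2 * int m * x - 1) = r + 2 * int m * l" by (simp add: l_def algebra_simps)
  finally obtain r0 where r0: "r + 2 * int m * l = int p ^ k * r0" by blast
  define n' where "n' = n + l * r + int m * l\<^sup>2"
  have D: "(int p ^ k * r0)\<^sup>2 - 4 * int m * n' = r\<^sup>2 - 4 * int m * n" using disc_translate[of r m l n] unfolding r0 n'_def .
  have sq: "(int p ^ k * r0)\<^sup>2 = int p ^ (2 * k) * r0\<^sup>2" by (simp add: power_mult_distrib power_mult[symmetric] mult.commute)
  have "int p ^ (2 * k) dvd int p ^ (2 * k) * r0\<^sup>2 - (r\<^sup>2 - 4 * int m * n)" using d by simp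
  also have "int p ^ (2 * k) * r0\<^sup>2 - (r\<^sup>2 - 4 * int m * n) = 4 * int m * n'" using D unfolding sq by simp
  finally have dv: "int p ^ (2 * k) dvd 4 * int m * n'" .
  have "coprime (2 * (2 * int m)) (int p)" using cop by (simp only: coprime_mult_left_iff)
  hence "coprime (2 * (2 * int m)) (int p ^ (2 * k))" by (simp only: coprime_power_right_iff simp_thms)
  moreover have "2 * (2 * int m) = 4 * int m" by simp
  ultimately have "coprime (int p ^ (2 * k)) (4 * int m)" using coprime_commute by metis
  with dv have "int p ^ (2 * k) dvd n'" using coprime_dvd_mult_right_iff by blast
  then obtain n0 where n0: "n' = int p ^ (2 * k) * n0" by blast
  have "c n r = c (int p ^ (2 * k) * n0) (int p ^ k * r0)" if "c \<in> JJ m" for c using JJ_elliptic[OF that, of n l r] unfolding r0 n'_def[symmetric] n0 by simp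
  moreover have "int p ^ (2 * k) * (r0\<^sup>2 - 4 * int m * n0) = r\<^sup>2 - 4 * int m * n" using D unfolding sq n0 by (simp add: algebra_simps)
  ultimately show ?thesis by blast
qed

text \<open>All factors p are removed from s, which leads to the bottom of the p-tower.\<close>

lemma class_representative:
  assumes p: "prime p" and pm: "\<not> int p dvd 2 * int m" and c: "cls m t n r"
  shows "\<exists>k n0 r0 s0. int t * (int s0)\<^sup>2 = 4 * int m * n0 - r0\<^sup>2 \<and> \<not> p dvd s0 \<and>
    (\<forall>c\<in>JJ m. c n r = c (int p ^ (2 * k) * n0) (int p ^ k * r0))"
proof -
  obtain s :: nat where s: "s > 0" "4 * int m * n - r\<^sup>2 = int t * (int s)\<^sup>2" using c unfolding cls_def by blast
  have "s \<noteq> 0" "\<not> is_unit p" using s(1) p not_prime_unit by auto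
  then obtain s0 where "s = p ^ multiplicity p s * s0" "\<not> p dvd s0" by (rule multiplicity_decompose')
  then obtain k where s0: "s = p ^ k * s0" "\<not> p dvd s0" by blast
  have q: "(int s)\<^sup>2 = int p ^ (2 * k) * (int s0)\<^sup>2" unfolding s0(1) by (simp add: power_mult_distrib power_mult[symmetric] mult.commute)
  have D: "r\<^sup>2 - 4 * int m * n = int p ^ (2 * k) * - (int t * (int s0)\<^sup>2)" using s(2) unfolding q by (simp add: algebra_simps)
  have "int p ^ (2 * k) dvd r\<^sup>2 - 4 * int m * n" unfolding D by simp
  from tower_representative[OF p pm this] obtain n0 r0 where n0: "int p ^ (2 * k) * (r0\<^sup>2 - 4 * int m * n0) = r\<^sup>2 - 4 * int m * n"
    "\<forall>c\<in>JJ m. c n r = c (int p ^ (2 * k) * n0) (int p ^ k * r0)" by blast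
  have "int p ^ (2 * k) \<noteq> 0" using p by auto
  hence "r0\<^sup>2 - 4 * int m * n0 = - (int t * (int s0)\<^sup>2)" using n0(1) unfolding D mult_cancel_left by blast
  hence "int t * (int s0)\<^sup>2 = 4 * int m * n0 - r0\<^sup>2" by simp
  thus ?thesis using s0(2) n0(2) by blast
qed

text \<open>At the bottom of the tower p divides D = - t s0^2 exactly once, since t is squarefree
  and s0 is prime to p. All forms vanish there, hence along the tower.\<close>

lemma JJ_class_prime:
  assumes m: "m > 0" and c: "c \<in> JJ m" and t: "squarefree t" "cls m t n r" and p: "prime p" and pm: "\<not> int p dvd 2 * int m" and pt: "p dvd t"
  shows "c n r = 0"
proof -
  obtain k n0 r0 s0 where a: "int t * (int s0)\<^sup>2 = 4 * int m * n0 - r0\<^sup>2" "\<not> p dvd s0"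
    "\<forall>c\<in>JJ m. c n r = c (int p ^ (2 * k) * n0) (int p ^ k * r0)" using class_representative[OF p pm t(2)] by blast
  have D: "r0\<^sup>2 - 4 * int m * n0 = - int (t * s0\<^sup>2)" using a(1) by simp
  have d: "int p dvd r0\<^sup>2 - 4 * int m * n0" unfolding D using pt by (simp del: of_nat_mult)
  have nd: "\<not> (int p)\<^sup>2 dvd r0\<^sup>2 - 4 * int m * n0"
  proof
    assume "(int p)\<^sup>2 dvd r0\<^sup>2 - 4 * int m * n0"
    hence "int (p\<^sup>2) dvd int (t * s0\<^sup>2)" unfolding D by simp
    hence "p\<^sup>2 dvd t * s0\<^sup>2" by (simp only: int_dvd_int_iff)
    moreover have "coprime (p\<^sup>2) (s0\<^sup>2)" using p a(2) by (simp add: prime_imp_coprime)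
    ultimately have "p\<^sup>2 dvd t" by (simp add: coprime_dvd_mult_left_iff)
    hence "p dvd 1" using squarefreeD[OF t(1)] by blast
    thus False using p not_prime_unit by blast
  qed
  have "c (int p ^ (2 * k) * n0) (int p ^ k * r0) = 0" by (rule vanish_tower[OF p pm nd, of "JJ m"]) (use c JJ_T[OF _ p] JJ_exact_prime_divisor[OF m _ p pm d nd] in auto)
  thus ?thesis using bspec[OF a(3) c] by simp
qed

text \<open>At the bottom of the tower D = - t s0^2 is prime to p with the Legendre symbol of - t.
  There T acts by a scalar depending on the class only, and vanishing at the bottom implies
  vanishing at the original point.\<close>

lemma JJ_class_reduce:
  assumes m: "m > 0" and p: "prime p" and p2: "2 < p" and pm: "\<not> int p dvd 2 * int m" and pt: "\<not> p dvd t" and t: "cls m t n r"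
  shows "\<exists>n0 r0. cls m t n0 r0 \<and> (\<forall>c\<in>JJ m. c n0 r0 = 0 --> c n r = 0) \<and>
    (\<forall>c\<in>JJ m. T_coeff m p c n0 r0 = of_int (Legendre (- int t) (int p)) * of_nat (p + 1) * c n0 r0)"
proof -
  obtain k n0 r0 s0 where a: "int t * (int s0)\<^sup>2 = 4 * int m * n0 - r0\<^sup>2" "\<not> p dvd s0"
    "\<forall>c\<in>JJ m. c n r = c (int p ^ (2 * k) * n0) (int p ^ k * r0)" using class_representative[OF p pm t] by blast
  have D: "r0\<^sup>2 - 4 * int m * n0 = - int (t * s0\<^sup>2)" using a(1) by simp
  have D': "r0\<^sup>2 - 4 * int m * n0 = - int t * (int s0 * int s0)" using a(1) by (simp add: power2_eq_square)
  have nd: "\<not> int p dvd r0\<^sup>2 - 4 * int m * n0"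
  proof
    assume "int p dvd r0\<^sup>2 - 4 * int m * n0"
    hence "int p dvd int (t * s0\<^sup>2)" unfolding D by simp
    hence "p dvd t * s0\<^sup>2" by (simp only: int_dvd_int_iff)
    thus False using p pt a(2) by (simp add: prime_dvd_mult_iff prime_dvd_power_iff)
  qed
  have nd2: "\<not> (int p)\<^sup>2 dvd r0\<^sup>2 - 4 * int m * n0" using nd dvd_trans[of "int p" "(int p)\<^sup>2" "r0\<^sup>2 - 4 * int m * n0"] by (auto simp: power2_eq_square)
  have "Legendre (int s0) (int p) * Legendre (int s0) (int p) = 1" using a(2) unfolding Legendre_def by (auto simp: cong_0_iff)
  hence L: "Legendre (r0\<^sup>2 - 4 * int m * n0) (int p) = Legendre (- int t) (int p)" unfolding D' Legendre_mult[OF p p2] by simp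
  have T: "T_coeff m p c n0 r0 = of_int (Legendre (- int t) (int p)) * of_nat (p + 1) * c n0 r0" if "c \<in> JJ m" for c using JJ_unit_prime(2)[OF m that p pm nd] unfolding L .
  have "c n r = 0" if c: "c \<in> JJ m" "c n0 r0 = 0" for c
  proof -
    have "c (int p ^ (2 * k) * n0) (int p ^ k * r0) = 0" by (rule vanish_tower[OF p pm nd2, of "{c \<in> JJ m. c n0 r0 = 0}"]) (use c JJ_T[OF _ p] T in auto)
    thus ?thesis using bspec[OF a(3) c(1)] by simp
  qed
  moreover have "s0 > 0" using a(2) by (auto intro: gr0I)
  hence "cls m t n0 r0" unfolding cls_def using a(1) by (intro exI[of _ s0]) simp
  ultimately show ?thesis using T by blast
qed

text \<open>A form whose indices \<open>r\<close> are all divisible by a prime \<open>q\<close> is invariant under \<open>z \<mapsto> z + 1/q\<close>;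
  by the inversion it is then elliptic for the lattice shrunk by \<open>q\<close>, hence comes from index \<open>m/q\<^sup>2\<close>.\<close>

lemma JJ_oldform:
  assumes m: "m > 0" and c: "c \<in> JJ m" and q: "prime q" and supp: "\<forall>n r. c n r \<noteq> 0 --> int q dvd r"
    and IH: "\<forall>m' c n r. 0 < m' --> m' < m --> c \<in> JJ m' --> c n r = 0"
  shows "c n r = 0"
proof -
  obtain F where F: "jac m F c" using c unfolding JJ_def by blast
  have e: "expands F c" by (rule jac_expands[OF F])
  have q0: "q > 0" "q > 1" using q prime_gt_0_nat prime_gt_1_nat by auto
  let ?q = "of_nat q :: complex"
  have q0c: "?q \<noteq> 0" using q0 by simp
  have F1: "F t (z + 1 / ?q) = F t z" if t: "Im t > 0" for t z
  proof -
    have "fterm c t (z + 1 / ?q) = fterm c t z"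
    proof (rule ext)
      fix x :: "int \<times> int"
      obtain n r where x: "x = (n, r)" by (cases x)
      show "fterm c t (z + 1 / ?q) x = fterm c t z x"
      proof (cases "c n r = 0")
        case False
        then obtain k where k: "r = int q * k" using supp by blast
        have "of_int n * t + of_int r * (z + 1 / ?q) = of_int n * t + of_int r * z + of_int k" using q0c unfolding k by (simp add: field_simps)
        thus ?thesis unfolding x by (simp only: prod.case e2pi_plus_int)
      qed (simp add: x)
    qed
    note E = this
    show ?thesis by (rule has_sum_unique[OF expandsD[OF e t, of "z + 1 / ?q", unfolded E] expandsD[OF e t, of z]])
  qed
  \<comment> \<open>Conjugating the translation by 1/q with the inversion gives the translation by
    t/q.\<close>
  have F2: "F t z = e2pi (of_nat m * (2 * z / ?q + t / ?q\<^sup>2)) * F t (z + t / ?q)" if t: "Im t > 0" for t z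
  proof -
    have t0: "t \<noteq> 0" using t by auto
    have s: "Im (- 1 / t) > 0" using t by simp
    have "t * e2pi (of_nat m * z\<^sup>2 / t) * F t z = F (- 1 / t) (z / t)" by (rule jac_S[OF F t, symmetric])
    also have "\<dots> = F (- 1 / t) (z / t + 1 / ?q)" by (rule F1[OF s, symmetric])
    also have "z / t + 1 / ?q = (z + t / ?q) / t" using t0 q0c by (simp add: field_simps)
    also have "F (- 1 / t) ((z + t / ?q) / t) = t * e2pi (of_nat m * (z + t / ?q)\<^sup>2 / t) * F t (z + t / ?q)" by (rule jac_S[OF F t])
    also have "of_nat m * (z + t / ?q)\<^sup>2 / t = of_nat m * z\<^sup>2 / t + of_nat m * (2 * z / ?q + t / ?q\<^sup>2)" using t0 q0c by (simp add: field_simps power2_eq_square)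
    finally show ?thesis using t0 by (simp add: e2pi_add)
  qed
  show ?thesis
  proof (cases "q\<^sup>2 dvd m")
    case False
    have ne: "e2pi (of_nat m / ?q\<^sup>2) \<noteq> 1"
    proof
      assume "e2pi (of_nat m / ?q\<^sup>2) = 1"
      then obtain k where "of_nat m / ?q\<^sup>2 = of_int k" unfolding e2pi_eq_1_iff by blast
      hence "of_int (int m) = (of_int (k * (int q)\<^sup>2) :: complex)" using q0c by (simp add: field_simps)
      hence "int m = k * (int q)\<^sup>2" by (simp only: of_int_eq_iff)
      hence "int (q\<^sup>2) dvd int m" by simp
      hence "q\<^sup>2 dvd m" by (simp only: int_dvd_int_iff)
      thus False using False by simp
    qed
    \<comment> \<open>Comparing the translations by t/q and (t + 1)/q yields F = e(m/q^2) F, and the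
      factor is not 1 when q^2 does not divide m.\<close>
    have "F t z = 0" if t: "Im t > 0" for t z
    proof -
      have t1: "Im (t + 1) > 0" using t by simp
      have "F t z = F (t + 1) z" by (rule expands_T[OF e t, symmetric])
      also have "\<dots> = e2pi (of_nat m * (2 * z / ?q + (t + 1) / ?q\<^sup>2)) * F (t + 1) (z + (t + 1) / ?q)" by (rule F2[OF t1])
      also have "F (t + 1) (z + (t + 1) / ?q) = F t (z + t / ?q + 1 / ?q)" unfolding expands_T[OF e t] by (simp add: add_divide_distrib add_ac)
      also have "\<dots> = F t (z + t / ?q)" by (rule F1[OF t])
      also have "of_nat m * (2 * z / ?q + (t + 1) / ?q\<^sup>2) = of_nat m / ?q\<^sup>2 + of_nat m * (2 * z / ?q + t / ?q\<^sup>2)" by (simp add: add_divide_distrib algebra_simps)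
      finally have "F t z = e2pi (of_nat m / ?q\<^sup>2) * (e2pi (of_nat m * (2 * z / ?q + t / ?q\<^sup>2)) * F t (z + t / ?q))" by (simp only: e2pi_add mult.assoc)
      hence "F t z = e2pi (of_nat m / ?q\<^sup>2) * F t z" unfolding F2[OF t, symmetric] .
      thus ?thesis using ne by simp
    qed
    thus ?thesis by (rule expands_coeff_eq_0[OF e])
  next
    case True
    then obtain m' where m': "m = q\<^sup>2 * m'" by blast
    have q2: "1 < q\<^sup>2" by (rule one_less_power[OF q0(2)]) simp
    have m'0: "0 < m'" using m unfolding m' by simp
    have "m' < m" unfolding m' using n_less_m_mult_n[of m' "q\<^sup>2"] m'0 q2 by simp
    note m'0 = m'0 this
    have mc: "of_nat m = ?q\<^sup>2 * of_nat m'" unfolding m' by simp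
    have sz: "c n r = 0" if "\<not> int q dvd r" for n r using supp that by blast
    define d where "d = (\<lambda>n r. c n (int q * r))"
    have "jac m' (\<lambda>t z. F t (z / ?q)) d" unfolding jac_def
    proof (intro conjI allI impI)
      show "expands (\<lambda>t z. F t (z / ?q)) d"
      proof (rule expandsI)
        fix t z :: complex assume t: "Im t > 0"
        have "(fterm c t (z / ?q) has_sum F t (z / ?q)) UNIV" by (rule expandsD[OF e t])
        also have "?this \<longleftrightarrow> (fterm c t (z / ?q) has_sum F t (z / ?q)) {(n, r). int q dvd r}" by (rule has_sum_cong_neutral) (auto simp: sz)
        also have "\<dots> \<longleftrightarrow> (fterm d t z has_sum F t (z / ?q)) UNIV"
          by (rule has_sum_reindex_bij_witness[where i = "\<lambda>(n, r). (n, int q * r)" and j = "\<lambda>(n, r). (n, r div int q)"])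
             (use q0 q0c in \<open>auto simp: d_def\<close>)
        finally show "(fterm d t z has_sum F t (z / ?q)) UNIV" .
      qed
      fix t z :: complex assume t: "Im t > 0"
      have t0: "t \<noteq> 0" using t by auto
      have "(z + t) / ?q = z / ?q + t / ?q" by (simp add: add_divide_distrib)
      moreover have "of_nat m * (2 * (z / ?q) / ?q + t / ?q\<^sup>2) = of_nat m' * (t + 2 * z)" unfolding mc using q0c by (simp add: field_simps power2_eq_square)
      ultimately show "e2pi (of_nat m' * (t + 2 * z)) * F t ((z + t) / ?q) = F t (z / ?q)" using F2[OF t, of "z / ?q"] by simp
      have A: "z / t / ?q = z / ?q / t" by simp
      have B: "of_nat m' * z\<^sup>2 / t = of_nat m * (z / ?q)\<^sup>2 / t" unfolding mc using q0c by (simp add: power_divide)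
      show "F (- 1 / t) (z / t / ?q) = t * e2pi (of_nat m' * z\<^sup>2 / t) * F t (z / ?q)" unfolding A B by (rule jac_S[OF F t])
    qed
    moreover have "r\<^sup>2 \<le> 4 * int m' * n" if nz: "d n r \<noteq> 0" for n r
    proof -
      have "(int q * r)\<^sup>2 \<le> 4 * int m * n" using c nz unfolding JJ_def d_def by blast
      hence "(int q)\<^sup>2 * r\<^sup>2 \<le> (int q)\<^sup>2 * (4 * int m' * n)" unfolding m' by (simp add: power_mult_distrib mult_ac)
      thus ?thesis using q0 by simp
    qed
    ultimately have "d \<in> JJ m'" unfolding JJ_def by blast
    hence dz: "d n r = 0" for n r using IH m'0 by blast
    show ?thesis
    proof (rule ccontr)
      assume nz: "c n r \<noteq> 0"
      then obtain k where "r = int q * k" using supp by blast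
      thus False using dz[of n k] nz by (simp add: d_def)
    qed
  qed
qed

text \<open>Squares are 0 or 1 mod 4, so an odd r would give r^2 + t s^2 = 1, 2 or 3 mod 4.\<close>

lemma even_if_sum_squares:
  fixes r s :: int
  assumes "4 dvd r\<^sup>2 + t * s\<^sup>2" and t: "t = 1 \<or> t = 2"
  shows "even r"
proof (rule ccontr)
  assume "odd r"
  then obtain a where "r = 2 * a + 1" by (elim oddE)
  hence r: "r\<^sup>2 = 4 * (a\<^sup>2 + a) + 1" by (simp add: power2_eq_square algebra_simps)
  obtain b where "s = 2 * b \<or> s = 2 * b + 1" by (metis evenE oddE)
  hence "s\<^sup>2 = 4 * b\<^sup>2 \<or> s\<^sup>2 = 4 * (b\<^sup>2 + b) + 1" by (auto simp: power2_eq_square algebra_simps)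
  thus False using assms unfolding r by (elim disjE; simp; presburger)
qed

text \<open>If an odd prime q divides t and m, then r^2 = 4mn - t s^2 is divisible by q, also when D
  = 0. Otherwise \<open>JJ_class_prime\<close> excludes all odd prime factors of an occurring t, so
  t is 1 or 2 and all r are even by reduction mod 4. Either way \<open>JJ_oldform\<close>
  applies.\<close>

lemma JJ_single_class:
  assumes m: "m > 0" and c: "c \<in> JJ m" and t: "squarefree t"
    and cl: "\<forall>n r. c n r \<noteq> 0 --> r\<^sup>2 = 4 * int m * n \<or> cls m t n r"
    and IH: "\<forall>m' c n r. 0 < m' --> m' < m --> c \<in> JJ m' --> c n r = 0"
  shows "c n r = 0"
proof (cases "\<exists>q. prime q \<and> 2 < q \<and> q dvd t \<and> q dvd m")
  case True
  then obtain q where q: "prime q" "q dvd t" "q dvd m" by blast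
  show ?thesis
  proof (rule JJ_oldform[OF m c q(1) _ IH], intro allI impI)
    fix n r assume nz: "c n r \<noteq> 0"
    have "r\<^sup>2 = 4 * int m * n \<or> cls m t n r" using cl nz by blast
    hence "int q dvd r\<^sup>2"
    proof
      assume r: "r\<^sup>2 = 4 * int m * n"
      show ?thesis unfolding r using q(3) by simp
    next
      assume "cls m t n r"
      then obtain s :: nat where "4 * int m * n - r\<^sup>2 = int t * (int s)\<^sup>2" unfolding cls_def by blast
      hence r: "r\<^sup>2 = 4 * int m * n - int t * (int s)\<^sup>2" by simp
      show ?thesis unfolding r using q(2,3) by simp
    qed
    thus "int q dvd r" using q(1) by (simp add: prime_dvd_power_iff)
  qed
next
  case False
  have par: "even r" if nz: "c n r \<noteq> 0" for n r
  proof (cases "r\<^sup>2 = 4 * int m * n")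
    case True
    hence "even (r\<^sup>2)" by simp
    thus ?thesis by simp
  next
    case nD: False
    hence ct: "cls m t n r" using cl nz by blast
    have no: "\<not> (prime q \<and> 2 < q \<and> q dvd t)" for q
    proof
      assume q: "prime q \<and> 2 < q \<and> q dvd t"
      hence "\<not> q dvd m" using False by blast
      moreover have "\<not> q dvd 2" using q by (auto dest: dvd_imp_le)
      ultimately have "\<not> q dvd 2 * m" using q by (simp add: prime_dvd_mult_iff)
      hence "\<not> int q dvd int (2 * m)" by (simp only: int_dvd_int_iff not_False_eq_True)
      hence "\<not> int q dvd 2 * int m" by simp
      from JJ_class_prime[OF m c t ct _ this] q nz show False by blast
    qed
    have t0: "t \<noteq> 0" using t by (intro notI) simp
    have "\<forall>q. prime q --> multiplicity q t \<le> multiplicity q 2"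
    proof (intro allI impI)
      fix q :: nat assume q: "prime q"
      show "multiplicity q t \<le> multiplicity q 2"
      proof (cases "q dvd t")
        case True
        hence "q = 2" using no[of q] q prime_ge_2_nat[OF q] by auto
        moreover have "multiplicity q t \<le> 1" using t q squarefree_factorial_semiring''[OF t0] by blast
        moreover have "multiplicity (2::nat) 2 = 1" by (rule multiplicity_prime) simp
        ultimately show ?thesis by simp
      qed (simp add: not_dvd_imp_multiplicity_0)
    qed
    hence "t dvd 2" using prime_multiplicity_le_imp_dvd[OF t0, of 2] by simp
    hence "t \<le> 2" by (rule dvd_imp_le) simp
    hence "t = 1 \<or> t = 2" using t0 by linarith
    obtain s :: nat where "4 * int m * n - r\<^sup>2 = int t * (int s)\<^sup>2" using ct unfolding cls_def by blast
    hence "r\<^sup>2 + int t * (int s)\<^sup>2 = 4 * (int m * n)" by simp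
    hence "4 dvd r\<^sup>2 + int t * (int s)\<^sup>2" by simp
    thus ?thesis by (rule even_if_sum_squares) (use \<open>t = 1 \<or> t = 2\<close> in auto)
  qed
  show ?thesis by (rule JJ_oldform[OF m c two_is_prime_nat _ IH]) (use par in auto)
qed

definition jclasses :: "nat => (int => int => complex) => nat set" where
  "jclasses m c = {t. squarefree t \<and> (\<exists>n r. c n r \<noteq> 0 \<and> cls m t n r)}"

text \<open>A prime dividing t but not 2m would kill the class, and t is squarefree; so t divides
  2m.\<close>

lemma finite_jclasses:
  assumes m: "m > 0" and c: "c \<in> JJ m"
  shows "finite (jclasses m c)"
proof (rule finite_subset)
  show "jclasses m c \<subseteq> {t. t dvd 2 * m}"
  proof
    fix t assume "t \<in> jclasses m c"
    then obtain n r where t: "squarefree t" "c n r \<noteq> 0" "cls m t n r" unfolding jclasses_def by blast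
    have t0: "t \<noteq> 0" using t(1) by (intro notI) simp
    have m0: "2 * m \<noteq> 0" using m by simp
    have "\<forall>q. prime q --> multiplicity q t \<le> multiplicity q (2 * m)"
    proof (intro allI impI)
      fix q :: nat assume q: "prime q"
      show "multiplicity q t \<le> multiplicity q (2 * m)"
      proof (cases "q dvd t")
        case True
        have "q dvd 2 * m"
        proof (rule ccontr)
          assume "\<not> q dvd 2 * m"
          hence "\<not> int q dvd int (2 * m)" by (simp only: int_dvd_int_iff not_False_eq_True)
          hence "\<not> int q dvd 2 * int m" by simp
          from JJ_class_prime[OF m c t(1,3) q this True] t(2) show False by blast
        qed
        hence "1 \<le> multiplicity q (2 * m)" using m0 q by (simp add: multiplicity_geI prime_gt_1_nat Suc_leI prime_multiplicity_gt_zero_iff)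
        moreover have "multiplicity q t \<le> 1" using t(1) q squarefree_factorial_semiring''[OF t0] by blast
        ultimately show ?thesis by simp
      qed (simp add: not_dvd_imp_multiplicity_0)
    qed
    thus "t \<in> {t. t dvd 2 * m}" using prime_multiplicity_le_imp_dvd[OF t0 m0] by simp
  qed
  show "finite {t. t dvd 2 * m}" using m by (intro finite_divisors_nat) simp
qed

text \<open>Induction on the number of square classes. If two occur, T - L t2 at a separating prime
  kills the class t2, so the resulting form has fewer classes and is 0; but it scales the class t1
  by L t1 - L t2, which is nonzero.\<close>

lemma JJ_zero_step:
  assumes m: "m > 0" and IH: "\<forall>m' c n r. 0 < m' --> m' < m --> c \<in> JJ m' --> c n r = 0"
  shows "c \<in> JJ m ==> c n r = 0"
proof (induction "card (jclasses m c)" arbitrary: c n r rule: less_induct)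
  case less
  note c = less.prems
  have fin: "finite (jclasses m c)" by (rule finite_jclasses[OF m c])
  have cl: "r\<^sup>2 = 4 * int m * n \<or> (\<exists>t\<in>jclasses m c. cls m t n r)" if nz: "c n r \<noteq> 0" for n r
  proof (cases "r\<^sup>2 = 4 * int m * n")
    case False
    have "r\<^sup>2 \<le> 4 * int m * n" using c nz unfolding JJ_def by blast
    hence "r\<^sup>2 < 4 * int m * n" using False by simp
    from cls_exists[OF this] show ?thesis unfolding jclasses_def using nz by blast
  qed simp
  show ?case
  proof (cases "\<exists>t1\<in>jclasses m c. \<exists>t2\<in>jclasses m c. t1 \<noteq> t2")
    case False
    show ?thesis
    proof (cases "jclasses m c = {}")
      case True
      \<comment> \<open>Only D = 0 occurs here; t = 1 is an arbitrary squarefree value.\<close>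
      have "\<forall>n r. c n r \<noteq> 0 --> r\<^sup>2 = 4 * int m * n \<or> cls m 1 n r"
      proof (intro allI impI)
        fix n r assume "c n r \<noteq> 0"
        from cl[OF this] show "r\<^sup>2 = 4 * int m * n \<or> cls m 1 n r" unfolding True by blast
      qed
      from JJ_single_class[OF m c squarefree_1 this IH] show ?thesis .
    next
      case nonempty: False
      then obtain t where t: "t \<in> jclasses m c" by blast
      hence sq: "squarefree t" unfolding jclasses_def by blast
      have only: "t' = t" if "t' \<in> jclasses m c" for t' using False t that by blast
      have "\<forall>n r. c n r \<noteq> 0 --> r\<^sup>2 = 4 * int m * n \<or> cls m t n r"
      proof (intro allI impI)
        fix n r assume nz: "c n r \<noteq> 0"
        from cl[OF nz] show "r\<^sup>2 = 4 * int m * n \<or> cls m t n r"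
        proof
          assume "\<exists>t\<in>jclasses m c. cls m t n r"
          then obtain t' where "t' \<in> jclasses m c" "cls m t' n r" by blast
          thus ?thesis using only[of t'] by simp
        qed simp
      qed
      from JJ_single_class[OF m c sq this IH] show ?thesis .
    qed
  next
    case True
    then obtain t1 t2 where t: "t1 \<in> jclasses m c" "t2 \<in> jclasses m c" "t1 \<noteq> t2" by blast
    have sf: "squarefree t1" "squarefree t2" using t unfolding jclasses_def by blast+
    have m2: "0 < 2 * m" using m by simp
    obtain p where p: "prime p" "2 < p" "\<not> p dvd 2 * m" "\<not> p dvd t1" "\<not> p dvd t2"
      "Legendre (- int t1) (int p) \<noteq> Legendre (- int t2) (int p)" using exists_separating_prime[OF sf t(3) m2] by blast
    have "\<not> int p dvd int (2 * m)" using p(3) by (simp only: int_dvd_int_iff not_False_eq_True)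
    hence pm: "\<not> int p dvd 2 * int m" by simp
    define L where "L = (\<lambda>t. of_int (Legendre (- int t) (int p)) * of_nat (p + 1) :: complex)"
    have "of_nat (p + 1) \<noteq> (0 :: complex)" by (simp only: of_nat_eq_0_iff)
    hence L12: "L t1 \<noteq> L t2" using p(6) unfolding L_def by simp
    define d where "d = (\<lambda>n r. 1 * T_coeff m p c n r + (- L t2) * c n r)"
    have d: "d \<in> JJ m" unfolding d_def by (rule JJ_linear[OF JJ_T[OF c p(1)] c])
    \<comment> \<open>The scalar action of T is available only at the bottom of the p-tower, so
      every point is traded for its representative there.\<close>
    have red: "\<exists>n0 r0. cls m t n0 r0 \<and> (\<forall>c\<in>JJ m. c n0 r0 = 0 --> c n r = 0) \<and> d n0 r0 = (L t - L t2) * c n0 r0"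
      if pt: "\<not> p dvd t" and ct: "cls m t n r" for t n r
    proof -
      obtain n0 r0 where a: "cls m t n0 r0" "\<forall>c\<in>JJ m. c n0 r0 = 0 --> c n r = 0" "\<forall>c\<in>JJ m. T_coeff m p c n0 r0 = L t * c n0 r0"
        using JJ_class_reduce[OF m p(1,2) pm pt ct] unfolding L_def by blast
      have "d n0 r0 = (L t - L t2) * c n0 r0" using a(3) c by (simp add: d_def left_diff_distrib)
      thus ?thesis using a(1,2) by blast
    qed
    have sub: "jclasses m d \<subseteq> jclasses m c - {t2}"
    proof
      fix t assume td: "t \<in> jclasses m d"
      then obtain n r where nr: "squarefree t" "d n r \<noteq> 0" "cls m t n r" unfolding jclasses_def by blast
      have pt: "\<not> p dvd t" using JJ_class_prime[OF m d nr(1,3) p(1) pm] nr(2) by blast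
      obtain n0 r0 where a: "cls m t n0 r0" "\<forall>c\<in>JJ m. c n0 r0 = 0 --> c n r = 0" "d n0 r0 = (L t - L t2) * c n0 r0" using red[OF pt nr(3)] by blast
      have "d n0 r0 \<noteq> 0" using a(2) d nr(2) by blast
      hence "c n0 r0 \<noteq> 0" "t \<noteq> t2" unfolding a(3) by auto
      thus "t \<in> jclasses m c - {t2}" unfolding jclasses_def using nr(1) a(1) by blast
    qed
    have "card (jclasses m d) < card (jclasses m c)" by (rule psubset_card_mono[OF fin]) (use sub t(2) in blast)
    hence dz: "d n r = 0" for n r by (rule less.hyps[OF _ d])
    obtain n1 r1 where n1: "c n1 r1 \<noteq> 0" "cls m t1 n1 r1" using t(1) unfolding jclasses_def by blast
    obtain n0 r0 where a: "\<forall>c\<in>JJ m. c n0 r0 = 0 --> c n1 r1 = 0" "d n0 r0 = (L t1 - L t2) * c n0 r0" using red[OF p(4) n1(2)] by blast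
    have "c n0 r0 = 0" using a(2) dz L12 by simp
    hence "c n1 r1 = 0" using a(1) c by blast
    thus ?thesis using n1(1) by simp
  qed
qed

theorem JJ_zero: "m > 0 ==> c \<in> JJ m ==> c n r = 0"
proof (induction m arbitrary: c n r rule: less_induct)
  case (less m)
  show ?case by (rule JJ_zero_step[OF less.prems(1) _ less.prems(2)]) (use less.IH in blast)
qed

section \<open>Weak Jacobi forms with optimal growth\<close>

lemma jac_coeff_odd:
  assumes F: "jac m F c"
  shows "c n (- r) = - c n r"
proof -
  note e = jac_expands[OF F]
  have "expands (\<lambda>t z. F t (- z)) (\<lambda>n r. c n (- r))"
  proof (rule expandsI)
    fix t z :: complex assume t: "Im t > 0"
    have "(fterm c t (- z) has_sum F t (- z)) UNIV" by (rule expandsD[OF e t])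
    also have "?this \<longleftrightarrow> (fterm (\<lambda>n r. c n (- r)) t z has_sum F t (- z)) UNIV"
      by (rule has_sum_reindex_bij_witness[where i = "\<lambda>(n, r). (n, - r)" and j = "\<lambda>(n, r). (n, - r)"]) auto
    finally show "(fterm (\<lambda>n r. c n (- r)) t z has_sum F t (- z)) UNIV" .
  qed
  moreover have "expands (\<lambda>t z. - 1 * F t z) (\<lambda>n r. - 1 * c n r)" by (rule expands_cmult[OF e])
  ultimately have "(\<lambda>n r. c n (- r)) = (\<lambda>n r. - 1 * c n r)" by (rule expands_coeff_unique) (simp add: jac_odd[OF F])
  from fun_cong[OF fun_cong[OF this, of n], of r] show ?thesis by simp
qed

lemma weak_nice:
  fixes c :: "int => int => complex"
  assumes m: "m > 0" and s: "\<And>n r. c n r \<noteq> 0 ==> r\<^sup>2 \<le> 4 * int m * n + 1"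
  shows "fourier_nice c" unfolding fourier_nice_def
proof (intro conjI allI impI)
  show "0 \<le> n" if "c n r \<noteq> 0" for n r
  proof (rule ccontr)
    assume "\<not> 0 \<le> n"
    hence "int m * n \<le> int m * (- 1)" by (intro mult_left_mono) auto
    moreover have "0 \<le> 4 * (int m * n) + 1" using order_trans[OF zero_le_power2[of r] s[OF that]] by (simp add: mult.assoc)
    ultimately show False using m by simp
  qed
  fix n
  have "{r. c n r \<noteq> 0} \<subseteq> {- \<bar>4 * int m * n + 1\<bar>..\<bar>4 * int m * n + 1\<bar>}"
  proof
    fix r assume "r \<in> {r. c n r \<noteq> 0}"
    hence "r\<^sup>2 \<le> \<bar>4 * int m * n + 1\<bar>" using s[of n r] by simp
    moreover have "\<bar>r\<bar> \<le> r\<^sup>2" using mult_mono[of 1 "\<bar>r\<bar>" "\<bar>r\<bar>" "\<bar>r\<bar>"] by (cases "r = 0") (auto simp: power2_eq_square)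
    ultimately show "r \<in> {- \<bar>4 * int m * n + 1\<bar>..\<bar>4 * int m * n + 1\<bar>}" by auto
  qed
  thus "finite {r. c n r \<noteq> 0}" by (rule finite_subset) simp
qed

text \<open>The \<open>z\<close>-derivative at \<open>0\<close> has weight two, so its constant term vanishes.\<close>

lemma weak_jac_constant_term:
  assumes m: "m > 0" and F: "jac m F c" and s: "\<And>n r. c n r \<noteq> 0 ==> r\<^sup>2 \<le> 4 * int m * n + 1"
  shows "c 0 1 = 0"
proof -
  note e = jac_expands[OF F]
  have nice: "fourier_nice c" by (rule weak_nice[OF m s])
  let ?d = "\<lambda>n r. of_int r * c n r"
  have nd: "fourier_nice ?d" by (rule fourier_nice_times[OF nice])
  let ?v = "\<lambda>n. \<Sum>s | ?d n s \<noteq> 0. ?d n s"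
  have "col ?v 0 0 = 0"
  proof (rule weight_2_constant_term[OF expands_at_0[OF expands_Dz[OF e] nd] fourier_nice_at_0[OF nd]])
    fix t assume t: "Im t > 0"
    have s: "Im (- 1 / t) > 0" and t0: "t \<noteq> 0" using t by auto
    have F0: "F t 0 = 0" using jac_odd[OF F t, of 0] by simp
    define P :: complex where "P = tpi"
    have P0: "P \<noteq> 0" by (simp add: P_def)
    have q: "DERIV (\<lambda>z. z / t) 0 :> 1 / t" using t0 by (auto intro!: derivative_eq_intros)
    have 1: "DERIV (\<lambda>z. F (- 1 / t) (z / t)) 0 :> P * Dz F (- 1 / t) (0 / t) * (1 / t)" unfolding P_def by (rule DERIV_chain2[OF DERIV_Dz[OF e s] q])
    have "DERIV (\<lambda>z. t * e2pi (of_nat m * z\<^sup>2 / t)) 0 :> 0" using t0 by (auto intro!: derivative_eq_intros)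
    from DERIV_mult[OF this DERIV_Dz[OF e t]]
    have 2: "DERIV (\<lambda>z. F (- 1 / t) (z / t)) 0 :> P * Dz F t 0 * t" unfolding jac_S[OF F t] P_def by (simp add: F0)
    have "P * Dz F (- 1 / t) 0 * (1 / t) = P * Dz F t 0 * t" using DERIV_unique[OF 1 2] by simp
    hence "Dz F (- 1 / t) 0 = t\<^sup>2 * Dz F t 0" using P0 t0 by (simp add: field_simps power2_eq_square)
    thus "e2pi (- of_int 0 * (- 1 / t)) * Dz F (- 1 / t) 0 = t\<^sup>2 * (e2pi (- of_int 0 * t) * Dz F t 0)" by simp
  qed
  hence "?v 0 = 0" by (simp add: col_def)
  moreover have "?v 0 = (\<Sum>s\<in>{1, - 1}. ?d 0 s)"
  proof (rule sum.mono_neutral_left)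
    show "{s. ?d 0 s \<noteq> 0} \<subseteq> {1, - 1}"
    proof
      fix x assume "x \<in> {s. ?d 0 s \<noteq> 0}"
      hence "x \<noteq> 0" "c 0 x \<noteq> 0" by auto
      hence "x\<^sup>2 \<le> 1" using s[of 0 x] by simp
      hence "\<bar>x\<bar> \<le> 1" by (simp add: abs_square_le_1)
      thus "x \<in> {1, - 1}" using \<open>x \<noteq> 0\<close> by auto
    qed
  qed auto
  moreover have "(\<Sum>s\<in>{1, - 1}. ?d 0 s) = 2 * c 0 1" using jac_coeff_odd[OF F, of 0 1] by simp
  ultimately show ?thesis by simp
qed

lemma same_orbit:
  assumes F: "jac m F c" and m: "m > 0" and D: "r\<^sup>2 - 4 * int m * n = r'\<^sup>2 - 4 * int m * n'" and d: "2 * int m dvd r' - r"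
  shows "c n r = c n' r'"
proof -
  obtain l where "r' - r = 2 * int m * l" using d by blast
  hence r': "r' = r + 2 * int m * l" by simp
  have "4 * int m * n' = 4 * int m * (n + l * r + int m * l\<^sup>2)" using D unfolding r' by (simp add: power2_eq_square algebra_simps)
  hence "n' = n + l * r + int m * l\<^sup>2" using m by simp
  thus ?thesis using jac_coeff[OF F, of n l r] by (simp add: r')
qed

text \<open>For D = 1 write r0 = 2a + 1; then a (a + 1) = m n0, and m = k k' with coprime k | a + 1
  and k' | a. The average over k-torsion acts like an Atkin-Lehner involution: its coefficient at
  (0, 1) is the value of c at D = 1, r = -1 mod 2k, r = 1 mod 2k', which is the orbit of (n0,
  r0).\<close>

theorem weak_jac_zero:
  assumes m: "m > 0" and F: "jac m F c" and s: "\<And>n r. c n r \<noteq> 0 ==> r\<^sup>2 \<le> 4 * int m * n + 1"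
  shows "c n r = 0"
proof -
  have polar: "c n0 r0 = 0" if D: "r0\<^sup>2 = 4 * int m * n0 + 1" for n0 r0
  proof -
    have "odd (r0\<^sup>2)" unfolding D by simp
    hence "odd r0" by simp
    then obtain a where a: "r0 = 2 * a + 1" by (elim oddE)
    define b where "b = a + 1"
    have "(2 * a + 1)\<^sup>2 = 4 * (a * b) + 1" by (simp add: b_def power2_eq_square algebra_simps)
    hence ab: "a * b = int m * n0" using D unfolding a by simp
    have cab: "coprime a b" unfolding b_def by simp
    define k where "k = nat (gcd b (int m))"
    have k: "int k = gcd b (int m)" by (simp add: k_def)
    have "gcd b (int m) \<noteq> 0" using m by simp
    hence k0: "k > 0" using k by (metis gr0I of_nat_0)
    have "int k dvd int m" unfolding k by simp
    hence km: "k dvd m" by (simp only: int_dvd_int_iff)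
    then obtain k' where k': "m = k * k'" by blast
    have kb: "int k dvd b" unfolding k by simp
    have k'a: "int k' dvd a"
    proof -
      obtain b' where b': "b = int k * b'" using kb by blast
      have "gcd (int k * b') (int k * int k') = int k * gcd b' (int k')" by (simp add: gcd_mult_distrib_int[symmetric])
      moreover have "gcd (int k * b') (int k * int k') = int k" using k unfolding b' k' by simp
      ultimately have "gcd b' (int k') = 1" using k0 by simp
      hence cop: "coprime (int k') b'" by (simp add: coprime_iff_gcd_eq_1 gcd.commute)
      have "int k * (a * b') = int k * (int k' * n0)" using ab unfolding b' k' by (simp add: mult_ac)
      hence "a * b' = int k' * n0" using k0 by simp
      hence "int k' dvd a * b'" by simp
      thus ?thesis using cop by (simp add: coprime_dvd_mult_left_iff)
    qed
    have ckk': "coprime (int k) (int k')" using coprime_divisors[OF kb k'a] cab by (simp add: coprime_commute)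
    have md: "m div k = k'" using k0 unfolding k' by simp
    let ?W = "W_coeff m k c"
    have J: "jac m (W_fun m k F) ?W" by (rule jac_W[OF F k0 k'])
    \<comment> \<open>The index change in \<open>W_coeff\<close> preserves the discriminant, so the
      average obeys the same support bound.\<close>
    have shift: "(R - 2 * int k' * a)\<^sup>2 - 4 * int m * (N - a * x) = R\<^sup>2 - 4 * int m * N" if "R - int k' * a = int k * x" for R N a x
    proof -
      have "4 * int m * (a * x) = 4 * int k' * a * (int k * x)" unfolding k' by simp
      also have "\<dots> = 4 * int k' * a * (R - int k' * a)" unfolding that ..
      finally show ?thesis by (simp add: power2_eq_square algebra_simps)
    qed
    have Wterm: "(let s = R - int (m div k) * a in if int k dvd s then c (N - a * (s div int k)) (R - 2 * int (m div k) * a) else 0)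
       = (if int k dvd R - int k' * a then c (N - a * ((R - int k' * a) div int k)) (R - 2 * int k' * a) else 0)" for R N a unfolding md Let_def ..
    have sW: "R\<^sup>2 \<le> 4 * int m * N + 1" if nz: "?W N R \<noteq> 0" for N R
    proof -
      have "\<exists>a\<in>{0..<int k}. (if int k dvd R - int k' * a then c (N - a * ((R - int k' * a) div int k)) (R - 2 * int k' * a) else 0) \<noteq> 0"
        using nz unfolding W_coeff_def Wterm by (rule sum.not_neutral_contains_not_neutral) (rule bexI)
      then obtain a where a: "int k dvd R - int k' * a" "c (N - a * ((R - int k' * a) div int k)) (R - 2 * int k' * a) \<noteq> 0" by (metis (no_types, lifting))
      then obtain x where x: "R - int k' * a = int k * x" by blast
      have "c (N - a * x) (R - 2 * int k' * a) \<noteq> 0" using a(2) k0 unfolding x by simp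
      from s[OF this] shift[OF x, of N] show ?thesis by simp
    qed
    have "?W 0 1 = 0" by (rule weak_jac_constant_term[OF m J sW])
    moreover have "?W 0 1 = c n0 r0"
    proof -
      obtain y where y: "[int k' * y = 1] (mod int k)" using cong_solve_coprime_int[of "int k'" "int k"] ckk' coprime_commute by blast
      \<comment> \<open>The only a in the range with k | 1 - k' a, so a single term of the sum at
        (0, 1) survives.\<close>
      define a0 where "a0 = y mod int k"
      have kp: "int k > 0" using k0 by simp
      have a0: "a0 \<in> {0..<int k}" using kp by (simp add: a0_def)
      have "[int k' * a0 = 1] (mod int k)" using y unfolding a0_def cong_def by (simp add: mod_mult_right_eq)
      hence d0: "int k dvd 1 - int k' * a0" by (simp add: cong_iff_dvd_diff dvd_diff_commute)
      have uniq: "a = a0" if "a \<in> {0..<int k}" "int k dvd 1 - int k' * a" for a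
      proof -
        have "int k dvd (1 - int k' * a0) - (1 - int k' * a)" using d0 that(2) by (rule dvd_diff)
        hence "int k dvd int k' * (a - a0)" by (simp add: algebra_simps)
        hence "int k dvd a - a0" using ckk' by (simp add: coprime_dvd_mult_right_iff)
        thus ?thesis using that(1) a0 by (metis atLeastLessThan_iff mod_eq_dvd_iff mod_pos_pos_trivial)
      qed
      have "?W 0 1 = (\<Sum>a\<in>{0..<int k}. if int k dvd 1 - int k' * a then c (0 - a * ((1 - int k' * a) div int k)) (1 - 2 * int k' * a) else 0)" unfolding W_coeff_def Wterm ..
      also have "\<dots> = (\<Sum>a\<in>{a0}. if int k dvd 1 - int k' * a then c (0 - a * ((1 - int k' * a) div int k)) (1 - 2 * int k' * a) else 0)"
        by (rule sum.mono_neutral_right) (use a0 uniq in auto)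
      also have "\<dots> = c (0 - a0 * ((1 - int k' * a0) div int k)) (1 - 2 * int k' * a0)" using d0 by simp
      finally have W: "?W 0 1 = c (0 - a0 * ((1 - int k' * a0) div int k)) (1 - 2 * int k' * a0)" .
      obtain x where x: "1 - int k' * a0 = int k * x" using d0 by blast
      have "2 * int m dvd (1 - 2 * int k' * a0) - r0"
      proof -
        have e: "(1 - 2 * int k' * a0) - r0 = 2 * (- (int k' * a0) - a)" unfolding a by simp
        have "int k' dvd - (int k' * a0) - a" using k'a by simp
        moreover have "- (int k' * a0) - a = int k * x - b" using x by (simp add: b_def)
        hence "int k dvd - (int k' * a0) - a" using kb by simp
        ultimately have "int k * int k' dvd - (int k' * a0) - a" using ckk' by (intro divides_mult)
        hence "2 * (int k * int k') dvd 2 * (- (int k' * a0) - a)" by (intro mult_dvd_mono) auto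
        thus ?thesis unfolding e k' by simp
      qed
      moreover have "r0\<^sup>2 - 4 * int m * n0 = (1 - 2 * int k' * a0)\<^sup>2 - 4 * int m * (0 - a0 * x)" using shift[OF x, of 0] D by simp
      ultimately have "c n0 r0 = c (0 - a0 * x) (1 - 2 * int k' * a0)" by (intro same_orbit[OF F m])
      thus ?thesis unfolding W x using k0 by simp
    qed
    ultimately show ?thesis by simp
  qed
  have "c \<in> JJ m" unfolding JJ_def
  proof (intro CollectI conjI allI impI)
    show "\<exists>F. jac m F c" using F by blast
    fix n r assume nz: "c n r \<noteq> 0"
    hence "r\<^sup>2 \<le> 4 * int m * n + 1" "r\<^sup>2 \<noteq> 4 * int m * n + 1" using s polar by blast+
    thus "r\<^sup>2 \<le> 4 * int m * n" by simp
  qed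
  thus ?thesis by (rule JJ_zero[OF m])
qed

section \<open>Analytic properties of the polar part\<close>

text \<open>Exhibits the torsion points as the zeros of an entire function of z, which gives the
  open complement and the identity principle off these points.\<close>

lemma torsion_points_iff:
  assumes m: "m > 0" and t: "Im t > 0"
  shows "z \<in> torsion_points m t \<longleftrightarrow> th t (of_nat m * z) = 0"
proof -
  have m0: "of_nat m \<noteq> (0 :: complex)" using m by simp
  have "z \<in> torsion_points m t \<longleftrightarrow> of_nat m * z \<in> lattice t"
  proof
    assume "z \<in> torsion_points m t"
    then obtain a b where "z = (of_int a * t + of_int b) / of_nat m" unfolding torsion_points_def by blast
    hence "of_nat m * z = of_int a * t + of_int b" using m0 by simp
    thus "of_nat m * z \<in> lattice t" unfolding lattice_def by blast
  next
    assume "of_nat m * z \<in> lattice t"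
    then obtain a b where "of_nat m * z = of_int a * t + of_int b" unfolding lattice_def by blast
    hence "z = (of_int a * t + of_int b) / of_nat m" using m0 by (simp add: field_simps)
    thus "z \<in> torsion_points m t" unfolding torsion_points_def by blast
  qed
  thus ?thesis using th_simple_zeros(1)[OF t] by simp
qed

lemma th_scaled_holomorphic: "Im t > 0 ==> (\<lambda>z. th t (of_nat m * z)) holomorphic_on UNIV" by (rule entire_scale[OF th_holomorphic])

lemma open_non_torsion:
  assumes m: "m > 0" and t: "Im t > 0"
  shows "open (- torsion_points m t)"
proof -
  have "- torsion_points m t = {z. th t (of_nat m * z) \<noteq> 0}" using torsion_points_iff[OF m t] by auto
  moreover have "open {z. th t (of_nat m * z) \<noteq> 0}" using holomorphic_on_imp_continuous_on[OF th_scaled_holomorphic[OF t]] by (intro open_Collect_neq) auto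
  ultimately show ?thesis by simp
qed

text \<open>The function is a multiple of the cotangent. For |Im w| \<le> 1 periodicity reduces to a
  compact rectangle without discs around 0 and 1; for larger |Im w| the modulus of e(w) is at most
  1/2 or at least 2.\<close>

lemma cot_bounded:
  assumes d: "\<delta> > 0"
  shows "\<exists>B. \<forall>w. (\<forall>n::int. norm (w - of_int n) \<ge> \<delta>) --> norm ((e2pi w + 1) / (e2pi w - 1)) \<le> B"
proof -
  let ?g = "\<lambda>w. inverse (e2pi w - 1)"
  let ?K = "cbox (Complex 0 (- 1)) (Complex 1 1) - ball 0 \<delta> - ball 1 \<delta>"
  have K: "compact ?K" by (intro compact_diff compact_cbox open_ball)
  have nz: "e2pi w - 1 \<noteq> 0" if "w \<in> ?K" for w
  proof
    assume "e2pi w - 1 = 0"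
    then obtain n where n: "w = of_int n" using e2pi_eq_1_iff[of w] by auto
    have "0 \<le> Re w" "Re w \<le> 1" using that by (auto simp: in_cbox_complex_iff)
    hence "n = 0 \<or> n = 1" unfolding n by auto
    thus False using that d unfolding n by auto
  qed
  have "continuous_on ?K ?g" using nz by (intro continuous_intros) auto
  hence "bounded (?g ` ?K)" using compact_continuous_image[OF _ K] compact_imp_bounded by blast
  then obtain B where B: "\<forall>u\<in>?g ` ?K. norm u \<le> B" unfolding bounded_iff by blast
  have "norm ((e2pi w + 1) / (e2pi w - 1)) \<le> 1 + 2 * max 2 B" if w: "\<forall>n::int. norm (w - of_int n) \<ge> \<delta>" for w
  proof -
    have "norm (?g w) \<le> max 2 B"
    proof (cases "\<bar>Im w\<bar> \<le> 1")
      case True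
      define v where "v = w - of_int \<lfloor>Re w\<rfloor>"
      have ev: "e2pi v = e2pi w" using e2pi_plus_int[of v "\<lfloor>Re w\<rfloor>"] unfolding v_def by simp
      have "0 \<le> Re v" "Re v \<le> 1" "Im v = Im w" unfolding v_def by (auto simp: le_diff_eq) linarith
      moreover have "norm v \<ge> \<delta>" "norm (v - 1) \<ge> \<delta>"
        using w[rule_format, of "\<lfloor>Re w\<rfloor>"] w[rule_format, of "\<lfloor>Re w\<rfloor> + 1"] by (simp_all add: v_def algebra_simps)
      ultimately have "v \<in> ?K" using True by (auto simp: in_cbox_complex_iff dist_norm norm_minus_commute)
      from bspec[OF B imageI[OF this]] show ?thesis unfolding ev by simp
    next
      case False
      have x: "2 \<le> exp (2 * pi)" using exp_ge_add_one_self[of "2 * pi"] pi_ge_two by linarith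
      have "1 / 2 \<le> norm (e2pi w - 1)"
      proof (cases "Im w \<ge> 0")
        case True
        hence "2 * pi \<le> 2 * pi * Im w" using False by simp
        hence "2 \<le> exp (2 * pi * Im w)" using x by (meson exp_le_cancel_iff order_trans)
        hence "norm (e2pi w) \<le> 1 / 2" unfolding norm_e2pi by (simp add: exp_minus field_simps)
        thus ?thesis using norm_triangle_ineq3[of 1 "e2pi w"] by (simp add: norm_minus_commute)
      next
        case neg: False
        hence "2 * pi \<le> - 2 * pi * Im w" using False mult_left_mono[of 1 "- Im w" "2 * pi"] by simp
        hence "2 \<le> norm (e2pi w)" unfolding norm_e2pi using x by (meson exp_le_cancel_iff order_trans)
        thus ?thesis using norm_triangle_ineq3[of "e2pi w" 1] by simp
      qed
      from le_imp_inverse_le[OF this] show ?thesis by (simp add: norm_inverse)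
    qed
    moreover have "e2pi w \<noteq> 1" by (metis d diff_self e2pi_eq_1_iff norm_zero not_less w)
    hence "(e2pi w + 1) / (e2pi w - 1) = 1 + 2 * ?g w" by (simp add: field_simps)
    ultimately show ?thesis using norm_triangle_ineq[of 1 "2 * ?g w"] by (simp add: norm_mult)
  qed
  thus ?thesis by blast
qed

text \<open>The poles zs - k t + n of all summands are torsion points, so near any other point the
  cotangent factors are bounded uniformly in k, and the Gaussian factor provides a summable
  majorant.\<close>

lemma polar_term_holomorphic:
  assumes m: "m > 0" and t: "Im t > 0" and zs: "zs \<in> torsion_points m t"
  shows "Av m (\<lambda>y. (y / e2pi zs) powr of_int c * ((y / e2pi zs + 1) / (y / e2pi zs - 1))) t holomorphic_on - torsion_points m t"
proof -
  let ?S = "- torsion_points m t"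
  let ?w = "\<lambda>k z. of_int k * t + z - zs"
  let ?f = "\<lambda>k z. e2pi (of_int (int m * k\<^sup>2) * t + of_int (2 * int m * k) * z + of_int c * ?w k z) * ((e2pi (?w k z) + 1) / (e2pi (?w k z) - 1))"
  have av: "e2pi t powi (int m * k\<^sup>2) * e2pi z powi (2 * int m * k) *
      ((e2pi t powi k * e2pi z / e2pi zs) powr of_int c * ((e2pi t powi k * e2pi z / e2pi zs + 1) / (e2pi t powi k * e2pi z / e2pi zs - 1))) = ?f k z" for k z
  proof -
    have 1: "e2pi t powi k * e2pi z / e2pi zs = e2pi (?w k z)" by (simp add: e2pi_powi e2pi_add e2pi_diff)
    have 2: "e2pi (?w k z) powr of_int c = e2pi (of_int c * ?w k z)" by (simp add: complex_powr_of_int e2pi_powi)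
    show ?thesis unfolding 1 2 by (simp only: e2pi_powi e2pi_add mult.assoc)
  qed
  have ev: "Av m (\<lambda>y. (y / e2pi zs) powr of_int c * ((y / e2pi zs + 1) / (y / e2pi zs - 1))) t z = (\<Sum>\<^sub>\<infinity>k. ?f k z)" for z unfolding Av_def av ..
  obtain a b where zs': "zs = (of_int a * t + of_int b) / of_nat m" using zs unfolding torsion_points_def by blast
  have tors: "zs - of_int k * t + of_int n \<in> torsion_points m t" for k n
  proof -
    have "zs - of_int k * t + of_int n = (of_int (a - int m * k) * t + of_int (b + int m * n)) / of_nat m" using m unfolding zs' by (simp add: field_simps)
    thus ?thesis unfolding torsion_points_def by blast
  qed
  have nz: "e2pi (?w k z) - 1 \<noteq> 0" if z: "z \<in> ?S" for k z
  proof
    assume "e2pi (?w k z) - 1 = 0"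
    then obtain n where "?w k z = of_int n" using e2pi_eq_1_iff[of "?w k z"] by auto
    hence "z = zs - of_int k * t + of_int n" by (simp add: algebra_simps)
    thus False using tors[of k n] z by simp
  qed
  have bd: "\<exists>r>0. \<exists>M. M summable_on UNIV \<and> cball x r \<subseteq> ?S \<and> (\<forall>k. \<forall>y\<in>cball x r. norm (?f k y) \<le> M k)" if x: "x \<in> ?S" for x
  proof -
    obtain e where e: "e > 0" "cball x e \<subseteq> ?S" using open_non_torsion[OF m t] x open_contains_cball by blast
    define r where "r = e / 2"
    have r: "r > 0" using e unfolding r_def by simp
    have "cball x r \<subseteq> cball x e" by (rule subset_cball) (use e in \<open>simp add: r_def\<close>)
    hence r': "cball x r \<subseteq> ?S" using e(2) by (rule subset_trans)
    have far: "norm (?w k y - of_int n) \<ge> r" if y: "y \<in> cball x r" for k y n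
    proof (rule ccontr)
      assume "\<not> ?thesis"
      hence "dist y (zs - of_int k * t + of_int n) < r" by (simp add: dist_norm algebra_simps)
      hence "dist x (zs - of_int k * t + of_int n) < e" using dist_triangle[of x "zs - of_int k * t + of_int n" y] y unfolding r_def mem_cball by linarith
      hence "zs - of_int k * t + of_int n \<in> cball x e" by simp
      thus False using e(2) tors[of k n] by blast
    qed
    obtain B where B: "\<And>w. (\<forall>n::int. norm (w - of_int n) \<ge> r) ==> norm ((e2pi w + 1) / (e2pi w - 1)) \<le> B" using cot_bounded[OF r] by blast
    define v where "v = \<bar>Im x\<bar> + r"
    have v: "\<bar>Im y\<bar> \<le> v" if "y \<in> cball x r" for y using that abs_Im_le_cmod[of "y - x"] by (simp add: dist_norm norm_minus_commute v_def)
    define A where "A = 2 * pi * (\<bar>of_int c\<bar> * (v + \<bar>Im zs\<bar>))"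
    define \<beta> where "\<beta> = 2 * pi * (\<bar>of_int c\<bar> * Im t + 2 * real m * v)"
    define M where "M = (\<lambda>k::int. exp A * \<bar>B\<bar> * exp (- (2 * pi * real m * Im t) * (real_of_int k)\<^sup>2 + \<beta> * \<bar>real_of_int k\<bar>))"
    have "M summable_on UNIV" unfolding M_def by (intro summable_on_cmult_right gauss_summable) (use m t in simp)
    moreover have "norm (?f k y) \<le> M k" if y: "y \<in> cball x r" for k y
    proof -
      let ?I = "Im (of_int (int m * k\<^sup>2) * t + of_int (2 * int m * k) * y + of_int c * ?w k y)"
      have ab: "- (p * q) \<le> \<bar>p\<bar> * Q" if "\<bar>q\<bar> \<le> Q" for p q Q :: real using abs_ge_minus_self[of "p * q"] mult_left_mono[OF that, of "\<bar>p\<bar>"] by (simp add: abs_mult)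
      have "\<bar>Im y - Im zs\<bar> \<le> v + \<bar>Im zs\<bar>" using v[OF y] by linarith
      from ab[OF this, of "of_int c"] have "- ?I \<le> - (real m * Im t) * (real_of_int k)\<^sup>2
          + (\<bar>of_int c\<bar> * Im t + 2 * real m * v) * \<bar>real_of_int k\<bar> + \<bar>of_int c\<bar> * (v + \<bar>Im zs\<bar>)"
        using ab[OF v[OF y], of "2 * real m * real_of_int k"] ab[of "Im t" "Im t" "of_int c * real_of_int k"] t by (simp add: abs_mult algebra_simps)
      from mult_left_mono[OF this, of "2 * pi"]
      have "- 2 * pi * ?I \<le> A + (- (2 * pi * real m * Im t) * (real_of_int k)\<^sup>2 + \<beta> * \<bar>real_of_int k\<bar>)" unfolding A_def \<beta>_def by (simp add: algebra_simps)
      hence 1: "norm (e2pi (of_int (int m * k\<^sup>2) * t + of_int (2 * int m * k) * y + of_int c * ?w k y)) \<le>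
          exp A * exp (- (2 * pi * real m * Im t) * (real_of_int k)\<^sup>2 + \<beta> * \<bar>real_of_int k\<bar>)" unfolding norm_e2pi exp_add[symmetric] exp_le_cancel_iff .
      have "norm ((e2pi (?w k y) + 1) / (e2pi (?w k y) - 1)) \<le> \<bar>B\<bar>" using B[of "?w k y"] far[OF y] by force
      from mult_mono[OF 1 this] show ?thesis unfolding M_def norm_mult[symmetric] by (simp only: mult_ac) simp
    qed
    ultimately show ?thesis using r r' by blast
  qed
  have hf: "?f k holomorphic_on ?S" for k using nz by (intro holomorphic_intros) auto
  have hs: "((\<lambda>k. ?f k x) has_sum (\<Sum>\<^sub>\<infinity>k. ?f k x)) UNIV" if x: "x \<in> ?S" for x
  proof -
    obtain r M where "r > 0" "M summable_on UNIV" "\<forall>k. \<forall>y\<in>cball x r. norm (?f k y) \<le> M k" using bd[OF x] by blast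
    hence le: "norm (?f k x) \<le> M k" for k by simp
    have "(\<lambda>k. norm (?f k x)) summable_on UNIV" by (rule summable_on_comparison_test[OF \<open>M summable_on UNIV\<close> le]) auto
    thus ?thesis by (rule has_sum_infsum[OF abs_summable_summable])
  qed
  have "(\<lambda>z. \<Sum>\<^sub>\<infinity>k. ?f k z) holomorphic_on ?S" by (rule holomorphic_on_has_sum[OF open_non_torsion[OF m t] hf hs bd])
  thus ?thesis unfolding ev[abs_def] .
qed

lemma holomorphic2_z:
  assumes "holomorphic2_on f S" "(t, z) \<in> S"
  shows "f t field_differentiable at z"
proof -
  obtain a b where D: "((\<lambda>(t, z). f t z) has_derivative (\<lambda>(h, k). a * h + b * k)) (at (t, z))" using assms unfolding holomorphic2_on_def by blast
  have "((\<lambda>z. (t, z)) has_derivative (\<lambda>k. (0, k))) (at z)" by (auto intro!: derivative_eq_intros)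
  from has_derivative_compose[OF this D] have "DERIV (f t) z :> b" by (simp add: has_field_derivative_def)
  thus ?thesis by (auto simp: field_differentiable_def)
qed

lemma holomorphic2_t:
  assumes "holomorphic2_on f S" "(t, z) \<in> S"
  shows "(\<lambda>t. f t z) field_differentiable at t"
proof -
  obtain a b where D: "((\<lambda>(t, z). f t z) has_derivative (\<lambda>(h, k). a * h + b * k)) (at (t, z))" using assms unfolding holomorphic2_on_def by blast
  have "((\<lambda>t. (t, z)) has_derivative (\<lambda>k. (k, 0))) (at t)" by (auto intro!: derivative_eq_intros)
  from has_derivative_compose[OF this D] have "DERIV (\<lambda>t. f t z) t :> a" by (simp add: has_field_derivative_def)
  thus ?thesis by (auto simp: field_differentiable_def)
qed

text \<open>Poles of \<psi> are torsion points, so m \<alpha> is an integer, the power of y/ys is an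
  integral one and \<open>polar_term_holomorphic\<close> covers each summand.\<close>

lemma polar_part_isCont:
  assumes m: "m > 0" and t: "Im t > 0" and sp: "simple_poles_at_torsion m \<psi>" and z: "z \<notin> torsion_points m t"
  shows "isCont (polar_part m \<psi> t) z"
proof -
  let ?S = "{(\<alpha>, \<beta>). \<alpha> \<in> {-1<..0} \<and> \<beta> \<in> {-1<..0} \<and> is_pole (\<psi> t) (of_real \<alpha> * t + of_real \<beta>)}"
  have hol: "\<psi> t field_differentiable at w" if "w \<notin> torsion_points m t" for w
    using sp that t unfolding simple_poles_at_torsion_def by (intro holomorphic2_z[of _ "{(t, z). Im t > 0 \<and> z \<notin> torsion_points m t}"]) auto
  have "isCont (polar_part_at m \<psi> \<alpha> \<beta> t) z" if ab: "(\<alpha>, \<beta>) \<in> ?S" for \<alpha> \<beta>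
  proof -
    let ?zs = "of_real \<alpha> * t + of_real \<beta>"
    have pole: "is_pole (\<psi> t) ?zs" using ab by simp
    have zs: "?zs \<in> torsion_points m t"
    proof (rule ccontr)
      assume "?zs \<notin> torsion_points m t"
      hence "isCont (\<psi> t) ?zs" by (intro field_differentiable_imp_continuous_at hol)
      hence "(\<psi> t \<longlongrightarrow> \<psi> t ?zs) (at ?zs)" by (simp add: isCont_def)
      thus False using pole not_tendsto_and_filterlim_at_infinity[of "at ?zs"] unfolding is_pole_def by auto
    qed
    then obtain a b where z_ab: "?zs = (of_int a * t + of_int b) / of_nat m" unfolding torsion_points_def by blast
    have "of_nat m * ?zs = of_int a * t + of_int b" using m unfolding z_ab by simp
    hence "Im (of_nat m * ?zs) = Im (of_int a * t + of_int b)" by (rule arg_cong)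
    hence "real m * \<alpha> = of_int a" using t by simp
    hence c: "complex_of_real (- 2 * real m * \<alpha>) = of_int (- 2 * a)" by (metis (no_types, lifting) mult.assoc of_int_minus of_int_mult of_int_numeral of_real_of_int_eq)
    have "(\<lambda>x. of_real pi * \<i> * residue (\<psi> t) ?zs *
        Av m (\<lambda>y. (y / e2pi ?zs) powr of_int (- 2 * a) * ((y / e2pi ?zs + 1) / (y / e2pi ?zs - 1))) t x) holomorphic_on - torsion_points m t"
      by (intro holomorphic_intros polar_term_holomorphic[OF m t zs])
    hence "polar_part_at m \<psi> \<alpha> \<beta> t holomorphic_on - torsion_points m t" unfolding polar_part_at_def[abs_def] Let_def c .
    thus ?thesis using z open_non_torsion[OF m t] by (intro field_differentiable_imp_continuous_at holomorphic_on_imp_differentiable_at[of _ "- torsion_points m t"]) auto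
  qed
  hence "continuous (at z) (\<lambda>z. \<Sum>x\<in>?S. (case x of (\<alpha>, \<beta>) => polar_part_at m \<psi> \<alpha> \<beta> t z))" by (intro continuous_sum) auto
  moreover have "polar_part m \<psi> t = (\<lambda>z. \<Sum>x\<in>?S. (case x of (\<alpha>, \<beta>) => polar_part_at m \<psi> \<alpha> \<beta> t z))" by (rule ext) (simp only: polar_part_def)
  ultimately show ?thesis by simp
qed

text \<open>The difference is continuous off the torsion points, and \<open>remove_sings\<close>
  keeps the values at points of continuity.\<close>

lemma finite_part_eq:
  assumes m: "m > 0" and t: "Im t > 0" and sp: "simple_poles_at_torsion m \<psi>" and z: "z \<notin> torsion_points m t"
  shows "finite_part m \<psi> t z = \<psi> t z - polar_part m \<psi> t z"
proof -
  have "\<psi> t field_differentiable at z" using sp z t unfolding simple_poles_at_torsion_def by (intro holomorphic2_z[of _ "{(t, z). Im t > 0 \<and> z \<notin> torsion_points m t}"]) auto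
  hence "isCont (\<lambda>z. \<psi> t z - polar_part m \<psi> t z) z" by (intro continuous_intros field_differentiable_imp_continuous_at polar_part_isCont[OF m t sp z])
  thus ?thesis unfolding finite_part_def isCont_def by (rule remove_sings_eqI)
qed

section \<open>Theta expansions\<close>

text \<open>q^(-M) g with M the ceiling of x is a function of q on the punctured disc. The growth
  bound makes the singularity at 0 removable, so the expansion of g starts at M.\<close>

lemma periodic_growth_expansion:
  fixes g :: "complex => complex" and x :: real
  assumes hol: "g holomorphic_on upper" and per: "\<And>t. Im t > 0 ==> g (t + 1) = g t"
    and bd: "\<And>t. Im t \<ge> Y ==> Im t > 0 ==> norm (e2pi (- of_real x * t) * g t) \<le> B"
  shows "\<exists>v. expands (\<lambda>t z. g t) (col v) \<and> (\<forall>n. v n \<noteq> 0 --> x \<le> of_int n)"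
proof -
  define M where "M = \<lceil>x\<rceil>"
  define h where "h = (\<lambda>t. e2pi (of_int (- M) * t) * g t)"
  define V where "V = (\<lambda>q. h (Ln q / tpi))"
  have hh: "h holomorphic_on upper" unfolding h_def by (intro holomorphic_intros hol)
  have hp: "h (t + 1) = h t" if "Im t > 0" for t using e2pi_plus_int[of "of_int (- M) * t" "- M"] by (simp only: h_def per[OF that] distrib_left mult_1_right)
  have peri: "h (t + of_int n) = h t" if "Im t > 0" for t n
  proof (induction n rule: int_induct[where k = 0])
    case (step2 i)
    thus ?case using hp[of "t + of_int (i - 1)"] that by (simp add: add_ac)
  qed (use that hp in \<open>simp_all add: add.assoc[symmetric]\<close>)
  have heq: "h s = h t" if "e2pi s = e2pi t" "Im t > 0" for s t
  proof -
    have "e2pi (s - t) = 1" using that by (simp add: e2pi_diff)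
    then obtain n where "s = t + of_int n" unfolding e2pi_eq_1_iff by (metis add.commute diff_add_cancel)
    thus ?thesis using peri[OF that(2)] by simp
  qed
  have eL: "e2pi (Ln q / tpi) = q" if "q \<noteq> 0" for q using that by (simp add: e2pi_def)
  have V: "V q = h u" if "e2pi u = q" "norm q < 1" for u q unfolding V_def by (rule heq) (use that eL[of q] in \<open>auto simp: norm_e2pi zero_less_mult_iff\<close>)
  \<comment> \<open>Two logarithms, with cuts along the negative (c = 1) and the positive reals (c =
    -1), show holomorphy on two slit discs that cover the punctured disc.\<close>
  have Vh: "V holomorphic_on (ball 0 1 - {0}) \<inter> (\<lambda>q. c * q) -` (- \<real>\<^sub>\<le>\<^sub>0)" (is "_ holomorphic_on ?S")
    and S: "open ((ball 0 1 - {0}) \<inter> (\<lambda>q. c * q) -` (- \<real>\<^sub>\<le>\<^sub>0))" if c: "norm c = 1" "c * e2pi d = 1" for c d :: complex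
  proof -
    let ?u = "\<lambda>q. Ln (c * q) / tpi + d"
    have e: "e2pi (?u q) = q" if "q \<in> ?S" for q
    proof -
      have "c * q \<noteq> 0" using that by auto
      from eL[OF this] show ?thesis using c(2) by (simp add: e2pi_add mult_ac)
    qed
    have "?u holomorphic_on ?S" by (intro holomorphic_intros) auto
    moreover have "?u ` ?S \<subseteq> upper"
    proof (rule image_subsetI)
      fix q assume q: "q \<in> ?S"
      hence "norm (e2pi (?u q)) < 1" unfolding e[OF q] by simp
      thus "?u q \<in> upper" by (simp add: norm_e2pi zero_less_mult_iff)
    qed
    ultimately have "(\<lambda>q. h (?u q)) holomorphic_on ?S" using holomorphic_on_compose_gen[OF _ hh, of ?u ?S] by (simp add: o_def)
    thus "V holomorphic_on ?S" by (rule holomorphic_transform) (use V[OF e] in simp)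
    show "open ?S" by (intro open_Int open_vimage continuous_intros) auto
  qed
  have "ball 0 1 - {0} = (ball 0 1 - {0}) \<inter> (\<lambda>q. 1 * q) -` (- \<real>\<^sub>\<le>\<^sub>0) \<union> (ball 0 1 - {0}) \<inter> (\<lambda>q. (- 1 :: complex) * q) -` (- \<real>\<^sub>\<le>\<^sub>0)"
    by (auto simp: complex_nonpos_Reals_iff complex_eq_iff)
  hence "V holomorphic_on ball 0 1 - {0}" using holomorphic_on_Un[OF Vh[of 1 0] Vh[of "- 1" "1 / 2"] S[of 1 0] S[of "- 1" "1 / 2"]] by (simp add: e2pi_half)
  moreover have "((\<lambda>q. (q - 0) * V q) \<longlongrightarrow> 0) (at 0)"
  proof (rule Lim_null_comparison)
    \<comment> \<open>Rounding up loses less than one, so q V(q) still tends to 0.\<close>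
    have p: "1 - (of_int M - x) > 0" unfolding M_def by linarith
    have "((\<lambda>q::complex. norm q powr (1 - (of_int M - x)) * \<bar>B\<bar>) \<longlongrightarrow> 0 powr (1 - (of_int M - x)) * \<bar>B\<bar>) (at 0)"
      by (intro tendsto_intros tendsto_powr' tendsto_norm_zero) (use p in auto)
    thus "((\<lambda>q::complex. norm q powr (1 - (of_int M - x)) * \<bar>B\<bar>) \<longlongrightarrow> 0) (at 0)" by simp
    have "eventually (\<lambda>q. q \<in> ball 0 (min 1 (exp (- 2 * pi * Y))) - {0}) (at (0::complex))" by (rule eventually_at_in_open) auto
    thus "eventually (\<lambda>q. norm ((q - 0) * V q) \<le> norm q powr (1 - (of_int M - x)) * \<bar>B\<bar>) (at 0)"
    proof eventually_elim
      case (elim q)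
      define t where "t = Ln q / tpi"
      have q: "q \<noteq> 0" "norm q < 1" "norm q < exp (- 2 * pi * Y)" "q = e2pi t" using elim eL[of q] by (auto simp: t_def)
      have t: "Im t > 0" "Im t \<ge> Y" using q(2,3) unfolding q(4) norm_e2pi by (auto simp: zero_less_mult_iff)
      have "(of_int (- M) :: complex) * t = of_real (x - of_int M) * t + - of_real x * t" by (simp add: algebra_simps)
      hence "h t = e2pi (of_real (x - of_int M) * t) * (e2pi (- of_real x * t) * g t)" unfolding h_def by (simp only: e2pi_add mult.assoc)
      hence "norm (h t) \<le> norm (e2pi (of_real (x - of_int M) * t)) * \<bar>B\<bar>"
        using bd[OF t(2,1)] by (simp only: norm_mult[of "e2pi (of_real (x - of_int M) * t)"]) (intro mult_left_mono, auto)
      hence "norm q * norm (V q) \<le> norm q * (norm (e2pi (of_real (x - of_int M) * t)) * \<bar>B\<bar>)" using V[OF q(4)[symmetric] q(2)] by (intro mult_left_mono) auto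
      also have "\<dots> = norm q powr (1 - (of_int M - x)) * \<bar>B\<bar>" unfolding q(4) norm_e2pi by (simp add: powr_def exp_add[symmetric] algebra_simps)
      finally show ?case by (simp add: norm_mult)
    qed
  qed
  ultimately obtain W where W: "W holomorphic_on ball 0 1" "\<And>q. q \<in> ball 0 1 - {0} ==> W q = V q" using holomorphic_on_extend_lim[of V "ball 0 1" 0] by auto
  have "h t = W (e2pi t)" if "Im t > 0" for t using that W(2)[of "e2pi t"] V[OF refl, of t] by (simp add: norm_e2pi)
  from holomorphic_disc_expands[OF W(1) this]
  obtain w where w: "\<forall>n<0. w n = 0" "expands (\<lambda>t z. h t) (col w)" by blast
  define v where "v = (\<lambda>n. w (n - M))"
  have "expands (\<lambda>t z. g t) (col v)"
  proof (rule expandsI)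
    fix t z :: complex assume t: "Im t > 0"
    have "((\<lambda>n. w n * e2pi (of_int n * t)) has_sum h t) UNIV" using expandsD[OF w(2) t] unfolding has_sum_col .
    from has_sum_cmult_right[OF this, where c = "e2pi (of_int M * t)"]
    have "((\<lambda>n. e2pi (of_int M * t) * (w n * e2pi (of_int n * t))) has_sum g t) UNIV" unfolding h_def mult.assoc[symmetric] e2pi_add[symmetric] by simp
    also have "?this \<longleftrightarrow> ((\<lambda>n. v n * e2pi (of_int n * t)) has_sum g t) UNIV" by (rule has_sum_reindex_bij_witness[where i = "\<lambda>n. n - M" and j = "\<lambda>n. n + M"])
        (simp_all add: v_def e2pi_add[symmetric] algebra_simps)
    finally show "(fterm (col v) t z has_sum g t) UNIV" unfolding has_sum_col .
  qed
  moreover have "x \<le> of_int n" if "v n \<noteq> 0" for n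
  proof -
    have "n - M \<ge> 0" using that w(1) unfolding v_def by force
    thus ?thesis unfolding M_def by linarith
  qed
  ultimately show ?thesis by blast
qed

text \<open>The series \<open>vt m u\<close> built from this is theta_(m,u) divided by q^(u^2/4m).
  On the class r = u mod 2m the division is exact; elsewhere the coefficient \<open>vs\<close> is
  0.\<close>

definition vi :: "nat => int => int => int" where "vi m u r = (r\<^sup>2 - u\<^sup>2) div (4 * int m)"

definition vs :: "nat => int => int => complex" where "vs m u r = (if [r = u] (mod 2 * int m) then 1 else 0)"

definition vt :: "nat => int => complex => complex => complex" where "vt m u = curve_series (vi m u) (vs m u)"

definition varr :: "nat => int => int => int => complex" where "varr m u n r = (if n = vi m u r then vs m u r else 0)"

lemma vi_eq:
  assumes "m > 0" "vs m u r \<noteq> 0"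
  shows "\<exists>l. r = u + 2 * int m * l" "r\<^sup>2 = u\<^sup>2 + 4 * int m * vi m u r"
proof -
  have "2 * int m dvd r - u" using assms(2) by (auto simp: vs_def cong_iff_dvd_diff split: if_splits)
  then obtain l where "r - u = 2 * int m * l" by blast
  hence l: "r = u + 2 * int m * l" by simp
  thus "\<exists>l. r = u + 2 * int m * l" by blast
  have "r\<^sup>2 - u\<^sup>2 = 4 * int m * (l * u + int m * l\<^sup>2)" unfolding l by (simp add: power2_eq_square algebra_simps)
  thus "r\<^sup>2 = u\<^sup>2 + 4 * int m * vi m u r" using assms(1) by (simp add: vi_def)
qed

lemma quad_growth_vi: "m > 0 ==> quad_growth (vi m u)"
proof -
  assume m: "m > 0"
  let ?b = "(real_of_int u)\<^sup>2 / (4 * real m) + 1"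
  have "1 / (4 * real m) * (real_of_int r)\<^sup>2 - ?b * \<bar>real_of_int r\<bar> - ?b \<le> real_of_int (vi m u r)" for r
  proof -
    have "real_of_int (r\<^sup>2 - u\<^sup>2) / real_of_int (4 * int m) - 1 \<le> real_of_int (vi m u r)" unfolding vi_def floor_divide_of_int_eq[symmetric, where ?'a = real] by linarith
    moreover have "0 \<le> ?b * \<bar>real_of_int r\<bar>" by (intro mult_nonneg_nonneg add_nonneg_nonneg) auto
    moreover have "1 / (4 * real m) * (real_of_int r)\<^sup>2 - (real_of_int u)\<^sup>2 / (4 * real m) = real_of_int (r\<^sup>2 - u\<^sup>2) / real_of_int (4 * int m)"
      by (simp add: diff_divide_distrib)
    ultimately show ?thesis by linarith
  qed
  thus ?thesis unfolding quad_growth_def using m by (intro exI[of _ "1 / (4 * real m)"]) auto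
qed

lemma norm_vs: "norm (vs m u r) \<le> 1" by (simp add: vs_def)

lemma vt_has_sum: "m > 0 ==> Im t > 0 ==> ((\<lambda>r. vs m u r * e2pi (of_int (vi m u r) * t + of_int r * z)) has_sum vt m u t z) UNIV"
  unfolding vt_def by (rule curve_series_has_sum[OF quad_growth_vi norm_vs])

lemma vt_expands: "m > 0 ==> expands (vt m u) (varr m u)" using curve_series_expands[OF quad_growth_vi norm_vs] unfolding vt_def varr_def[abs_def] .

lemma varr_disc: "m > 0 ==> varr m u n r \<noteq> 0 ==> r\<^sup>2 = u\<^sup>2 + 4 * int m * n" using vi_eq(2)[of m u r] by (auto simp: varr_def split: if_splits)

text \<open>For |u| \<le> m no element of the class of u mod 2m has smaller modulus than u, so the
  exponents (r^2 - u^2)/4m are nonnegative.\<close>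

lemma varr_nice:
  assumes m: "m > 0" and u: "\<bar>u\<bar> \<le> int m"
  shows "fourier_nice (varr m u)" unfolding fourier_nice_def
proof (intro conjI allI impI)
  show "0 \<le> n" if nz: "varr m u n r \<noteq> 0" for n r
  proof -
    have "vs m u r \<noteq> 0" using nz by (auto simp: varr_def split: if_splits)
    then obtain l where l: "r = u + 2 * int m * l" using vi_eq(1)[OF m] by blast
    have "\<bar>u\<bar> \<le> \<bar>r\<bar>"
    proof (cases "l = 0")
      case False
      hence "2 * int m * 1 \<le> 2 * int m * \<bar>l\<bar>" by (intro mult_left_mono) auto
      also have "\<dots> = \<bar>r - u\<bar>" unfolding l by (simp add: abs_mult)
      finally show ?thesis using u by linarith
    qed (simp add: l)
    hence "0 \<le> int m * n" using varr_disc[OF m nz] power2_le_iff_abs_le[of "\<bar>r\<bar>" u] by (simp add: mult.commute)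
    thus ?thesis using m by (simp add: zero_le_mult_iff)
  qed
  fix n
  have "{r. varr m u n r \<noteq> 0} \<subseteq> {- \<bar>u\<^sup>2 + 4 * int m * n\<bar>..\<bar>u\<^sup>2 + 4 * int m * n\<bar>}"
  proof
    fix r assume "r \<in> {r. varr m u n r \<noteq> 0}"
    hence "r\<^sup>2 \<le> \<bar>u\<^sup>2 + 4 * int m * n\<bar>" using varr_disc[OF m, of u n r] by simp
    moreover have "\<bar>r\<bar> \<le> r\<^sup>2" using mult_mono[of 1 "\<bar>r\<bar>" "\<bar>r\<bar>" "\<bar>r\<bar>"] by (cases "r = 0") (auto simp: power2_eq_square)
    ultimately show "r \<in> {- \<bar>u\<^sup>2 + 4 * int m * n\<bar>..\<bar>u\<^sup>2 + 4 * int m * n\<bar>}" by auto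
  qed
  thus "finite {r. varr m u n r \<noteq> 0}" by (rule finite_subset) simp
qed

text \<open>For r = u mod 2m the numbers r j/2m and u j/2m differ by an integer; thus translation by
  j/2m separates the residue classes by characters.\<close>

lemma vt_torsion_shift:
  assumes m: "m > 0" and t: "Im t > 0"
  shows "vt m u t (z + of_nat j / of_nat (2 * m)) = e2pi (of_int u * of_nat j / of_nat (2 * m)) * vt m u t z"
proof -
  let ?u = "of_nat j / of_nat (2 * m) :: complex"
  let ?x = "of_int u * of_nat j / of_nat (2 * m)"
  have e: "vs m u r * e2pi (of_int (vi m u r) * t + of_int r * (z + ?u)) = e2pi ?x * (vs m u r * e2pi (of_int (vi m u r) * t + of_int r * z))" for r
  proof (cases "vs m u r = 0")
    case False
    then obtain l where "r = u + 2 * int m * l" using vi_eq(1)[OF m] by blast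
    hence "of_int r * ?u = ?x + of_int (l * int j)" using m by (simp add: field_simps)
    hence "e2pi (of_int r * ?u) = e2pi ?x" by (simp only: e2pi_plus_int)
    thus ?thesis by (simp only: distrib_left e2pi_add mult_ac)
  qed simp
  from has_sum_cmult_right[OF vt_has_sum[OF m t, of u z], where c = "e2pi ?x"] show ?thesis unfolding e[symmetric] by (rule has_sum_unique[OF vt_has_sum[OF m t]])
qed

lemma vt_not_identically_zero:
  assumes m: "m > 0" and t: "Im t > 0"
  shows "\<exists>z. vt m u t z \<noteq> 0"
proof (rule ccontr)
  assume "\<not> ?thesis"
  hence "((\<lambda>k. (vs m u k * e2pi (of_int (vi m u k) * t)) * e2pi (of_int k * of_real x)) has_sum 0) UNIV" for x using vt_has_sum[OF m t, of u "of_real x"] by (simp add: e2pi_add mult.assoc)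
  hence "vs m u u * e2pi (of_int (vi m u u) * t) = 0" by (rule fourier_coeff_unique)
  thus False by (simp add: vs_def)
qed

lemma theta_vt:
  assumes m: "m > 0" and t: "Im t > 0" and r: "[r = u] (mod 2 * int m)"
  shows "theta m r t z = e2pi ((of_int u)\<^sup>2 / (4 * of_nat m) * t) * vt m u t z"
proof -
  let ?g = "\<lambda>k. e2pi ((of_int k)\<^sup>2 / (4 * of_nat m) * t) * e2pi z powi k"
  let ?E = "e2pi ((of_int u)\<^sup>2 / (4 * of_nat m) * t)"
  have v: "vs m u k \<noteq> 0 \<longleftrightarrow> [k = r] (mod 2 * int m)" for k using r unfolding vs_def by (auto intro: cong_trans cong_sym)
  have e: "?E * (vs m u k * e2pi (of_int (vi m u k) * t + of_int k * z)) = ?g k" if "vs m u k \<noteq> 0" for k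
  proof -
    have "(of_int k :: complex)\<^sup>2 = (of_int u)\<^sup>2 + 4 * of_nat m * of_int (vi m u k)" using arg_cong[OF vi_eq(2)[OF m that], of complex_of_int] by simp
    hence "(of_int k)\<^sup>2 / (4 * of_nat m) * t = (of_int u)\<^sup>2 / (4 * of_nat m) * t + of_int (vi m u k) * t" using m by (simp add: field_simps)
    moreover have "vs m u k = 1" using that by (auto simp: vs_def split: if_splits)
    ultimately show ?thesis by (simp only: e2pi_powi e2pi_add mult_1_left mult.assoc)
  qed
  have "((\<lambda>k. ?E * (vs m u k * e2pi (of_int (vi m u k) * t + of_int k * z))) has_sum ?E * vt m u t z) UNIV" by (rule has_sum_cmult_right[OF vt_has_sum[OF m t]])
  also have "?this \<longleftrightarrow> (?g has_sum ?E * vt m u t z) {k. [k = r] (mod 2 * int m)}" by (rule has_sum_cong_neutral) (use v e in auto)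
  finally show ?thesis unfolding theta_def by (rule infsumI)
qed

text \<open>On 0, ..., 2m - 1 this gives the representatives of least modulus, in (-m, m].\<close>

definition rep :: "nat => int => int" where
  "rep m r = (if r \<le> int m then r else r - 2 * int m)"

lemma rep_bound: "r \<in> {0..<2 * int m} ==> \<bar>rep m r\<bar> \<le> int m" by (auto simp: rep_def)

lemma rep_cong: "[r = rep m r] (mod 2 * int m)" by (simp add: rep_def cong_iff_dvd_diff)

lemma rep_eq:
  assumes "r \<in> {0..<2 * int m}" "s \<in> {0..<2 * int m}"
  shows "2 * int m dvd rep m r - rep m s \<longleftrightarrow> r = s"
proof -
  have "2 * int m dvd rep m r - rep m s \<longleftrightarrow> [rep m r = rep m s] (mod 2 * int m)" by (simp add: cong_iff_dvd_diff)
  also have "\<dots> \<longleftrightarrow> [r = s] (mod 2 * int m)" using rep_cong[of r m] rep_cong[of s m] by (meson cong_sym cong_trans)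
  also have "\<dots> \<longleftrightarrow> r = s" using assms by (auto simp: cong_def)
  finally show ?thesis .
qed

text \<open>A theta combination is recovered from its values by a finite Fourier transform.\<close>

lemma theta_projection:
  assumes m: "m > 0" and t: "Im t > 0" and s: "s \<in> {0..<2 * int m}"
  shows "(\<Sum>j<2 * m. e2pi (- of_int (rep m s) * of_nat j / of_nat (2 * m)) *
      (\<Sum>r\<in>{0..<2 * int m}. g r * vt m (rep m r) t (z + of_nat j / of_nat (2 * m)))) = of_nat (2 * m) * (g s * vt m (rep m s) t z)"
proof -
  let ?R = "{0..<2 * int m}"
  have m2: "2 * m > 0" using m by simp
  have "(\<Sum>j<2 * m. e2pi (- of_int (rep m s) * of_nat j / of_nat (2 * m)) *
      (\<Sum>r\<in>?R. g r * vt m (rep m r) t (z + of_nat j / of_nat (2 * m))))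
    = (\<Sum>j<2 * m. \<Sum>r\<in>?R. e2pi (of_int (rep m r - rep m s) * of_nat j / of_nat (2 * m)) * (g r * vt m (rep m r) t z))"
  proof (rule sum.cong[OF refl])
    fix j
    have P: "e2pi (- of_int (rep m s) * of_nat j / of_nat (2 * m)) * e2pi (of_int (rep m r) * of_nat j / of_nat (2 * m)) =
        e2pi (of_int (rep m r - rep m s) * of_nat j / of_nat (2 * m))" for r unfolding e2pi_add[symmetric] by (rule arg_cong) (simp add: diff_divide_distrib left_diff_distrib)
    show "e2pi (- of_int (rep m s) * of_nat j / of_nat (2 * m)) * (\<Sum>r\<in>?R. g r * vt m (rep m r) t (z + of_nat j / of_nat (2 * m)))
      = (\<Sum>r\<in>?R. e2pi (of_int (rep m r - rep m s) * of_nat j / of_nat (2 * m)) * (g r * vt m (rep m r) t z))" unfolding vt_torsion_shift[OF m t] sum_distrib_left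
    proof (intro sum.cong refl)
      fix r
      have Q: "x * (y * (w * v)) = (x * w) * (y * v)" for x y w v :: complex by (simp only: mult_ac)
      show "e2pi (- of_int (rep m s) * of_nat j / of_nat (2 * m)) * (g r * (e2pi (of_int (rep m r) * of_nat j / of_nat (2 * m)) * vt m (rep m r) t z)) =
        e2pi (of_int (rep m r - rep m s) * of_nat j / of_nat (2 * m)) * (g r * vt m (rep m r) t z)" unfolding Q P ..
    qed
  qed
  also have "\<dots> = (\<Sum>r\<in>?R. \<Sum>j<2 * m. e2pi (of_int (rep m r - rep m s) * of_nat j / of_nat (2 * m)) * (g r * vt m (rep m r) t z))" by (rule sum.swap)
  also have "\<dots> = (\<Sum>r\<in>?R. (if r = s then of_nat (2 * m) else 0) * (g r * vt m (rep m r) t z))"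
  proof (rule sum.cong[OF refl])
    fix r assume r: "r \<in> ?R"
    have "int (2 * m) = 2 * int m" by simp
    thus "(\<Sum>j<2 * m. e2pi (of_int (rep m r - rep m s) * of_nat j / of_nat (2 * m)) * (g r * vt m (rep m r) t z)) = (if r = s then of_nat (2 * m) else 0) * (g r * vt m (rep m r) t z)"
      unfolding sum_distrib_right[symmetric] sum_roots_of_unity[OF m2] using rep_eq[OF r s] by simp
  qed
  also have "\<dots> = (\<Sum>r\<in>?R. if r = s then of_nat (2 * m) * (g r * vt m (rep m r) t z) else 0)" by (rule sum.cong) auto
  also have "\<dots> = of_nat (2 * m) * (g s * vt m (rep m s) t z)" using s by (subst sum.delta) auto
  finally show ?thesis .
qed

text \<open>The torsion points lie on the lines Im z = a Im t / m, and the strip is the gap between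
  a = 0 and a = 1. It is stable under real translations, so all points of the finite Fourier
  transform stay in it.\<close>

lemma strip_not_torsion:
  assumes m: "m > 0" and t: "Im t > 0" and z: "0 < Im z" "real m * Im z < Im t"
  shows "z + of_real x \<notin> torsion_points m t"
proof
  assume "z + of_real x \<in> torsion_points m t"
  then obtain a b where ab: "z + of_real x = (of_int a * t + of_int b) / of_nat m" unfolding torsion_points_def by blast
  hence "of_nat m * (z + of_real x) = of_int a * t + of_int b" using m by (simp add: field_simps)
  hence "Im (of_nat m * (z + of_real x)) = Im (of_int a * t + of_int b)" by (rule arg_cong)
  hence e: "real m * Im z = of_int a * Im t" by simp
  have "0 < real m * Im z" using m z by simp
  hence "0 < of_int a * Im t" unfolding e .
  hence "a > 0" using t by (simp add: zero_less_mult_iff)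
  hence "1 * Im t \<le> of_int a * Im t" using t by (intro mult_right_mono) auto
  thus False using z(2) e by simp
qed

lemma torsion_T:
  assumes m: "m > 0" and t: "Im t > 0"
  shows "z \<in> torsion_points m (t + 1) \<longleftrightarrow> z \<in> torsion_points m t" using t by (simp add: torsion_points_iff[OF m] expands_T[OF th_expands t])

lemma torsion_shift:
  assumes m: "m > 0" and t: "Im t > 0"
  shows "z + t \<in> torsion_points m t \<longleftrightarrow> z \<in> torsion_points m t"
proof -
  have "th t (of_nat m * z + of_int (int k) * t) = 0 \<longleftrightarrow> th t (of_nat m * z) = 0" for k by (rule int_translation_iff[where P = "\<lambda>z. th t z = 0"]) (simp add: th_shift[OF t])
  from this[of m] show ?thesis unfolding torsion_points_iff[OF m t] by (simp add: algebra_simps)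
qed

lemma torsion_S:
  assumes m: "m > 0" and t: "Im t > 0" and z: "z / t \<in> torsion_points m (- 1 / t)"
  shows "z \<in> torsion_points m t"
proof -
  have t0: "t \<noteq> 0" using t by auto
  obtain a b where ab: "z / t = (of_int a * (- 1 / t) + of_int b) / of_nat m" using z unfolding torsion_points_def by blast
  have "z = z / t * t" using t0 by simp
  also have "\<dots> = (of_int b * t + of_int (- a)) / of_nat m" unfolding ab using t0 m by (simp add: field_simps)
  finally show ?thesis unfolding torsion_points_def by blast
qed

lemma entire_eq_off_torsion:
  assumes m: "m > 0" and t: "Im t > 0" and u: "u holomorphic_on UNIV" and v: "v holomorphic_on UNIV"
    and e: "\<And>z. z \<notin> torsion_points m t ==> u z = v z"
  shows "u z = v z"
proof -
  obtain w where "th t w \<noteq> 0" using th_not_identically_zero[OF t] by blast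
  hence w: "th t (of_nat m * (w / of_nat m)) \<noteq> 0" using m by simp
  have "u x * th t (of_nat m * x) = v x * th t (of_nat m * x)" for x using e[of x] torsion_points_iff[OF m t, of x] by (cases "x \<in> torsion_points m t") auto
  from entire_cancel[OF u v th_scaled_holomorphic[OF t] this w] show ?thesis .
qed

text \<open>The theta coefficients H come without any regularity in t. Multiplied by q^(u^2/4m) they
  are recovered from D by a finite Fourier transform, which yields holomorphy and period 1. The
  growth bound then gives q-expansions, and \<Phi>, the entire continuation of D in z, satisfies
  \<open>jac\<close> with support r^2 \<le> 4mn + 1.\<close>

theorem weak_form_zero:
  fixes D :: "complex => complex => complex" and H :: "int => complex => complex"
  assumes m: "m > 0"
    and hol: "\<And>t z. Im t > 0 ==> z \<notin> torsion_points m t ==> (\<lambda>t. D t z) field_differentiable at t"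
    and ell: "\<And>t z. Im t > 0 ==> z \<notin> torsion_points m t ==> D t z = e2pi (of_nat m * (t + 2 * z)) * D t (z + t)"
    and T: "\<And>t z. Im t > 0 ==> z \<notin> torsion_points m t ==> D t z = D (t + 1) z"
    and S: "\<And>t z. Im t > 0 ==> z \<notin> torsion_points m t ==>
      D t z = e2pi (- (of_nat m * z\<^sup>2 / t)) * inverse t * D (- 1 / t) (z / t)"
    and theta: "\<And>t z. Im t > 0 ==> z \<notin> torsion_points m t ==> D t z = (\<Sum>r\<in>{0..<2 * int m}. H r t * theta m r t z)"
    and growth: "\<And>r. r \<in> {0..<2 * int m} ==> \<exists>Y B. \<forall>t. Im t \<ge> Y --> norm (e2pi (t / (4 * of_nat m)) * H r t) \<le> B"
    and t: "Im t > 0" and z: "z \<notin> torsion_points m t"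
  shows "D t z = 0"
proof -
  let ?R = "{0..<2 * int m}"
  have m0: "of_nat m \<noteq> (0 :: complex)" using m by simp
  \<comment> \<open>Moving q^(u^2/4m), u the least representative, from the theta series to H leaves
    integral exponents on both sides.\<close>
  define g where "g = (\<lambda>r t. H r t * e2pi ((of_int (rep m r))\<^sup>2 / (4 * of_nat m) * t))"
  define \<Phi> where "\<Phi> = (\<lambda>t z. \<Sum>r\<in>?R. g r t * vt m (rep m r) t z)"
  have D: "D t z = \<Phi> t z" if "Im t > 0" "z \<notin> torsion_points m t" for t z unfolding theta[OF that] \<Phi>_def g_def theta_vt[OF m that(1) rep_cong] by (simp only: mult.assoc)
  have \<Phi>_entire: "\<Phi> t holomorphic_on UNIV" if "Im t > 0" for t unfolding \<Phi>_def by (intro holomorphic_intros expands_holomorphic_z[OF vt_expands[OF m] that])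
  have vT: "vt m u (t + 1) z = vt m u t z" if "Im t > 0" for u t z by (rule expands_T[OF vt_expands[OF m] that])
  have \<Phi>T: "\<Phi> (t + 1) z = \<Phi> t z" if t: "Im t > 0" for t z
  proof (rule entire_eq_off_torsion[OF m t, of "\<Phi> (t + 1)" "\<Phi> t"])
    show "\<Phi> (t + 1) holomorphic_on UNIV" "\<Phi> t holomorphic_on UNIV" using \<Phi>_entire t by simp_all
    fix z assume z: "z \<notin> torsion_points m t"
    hence z': "z \<notin> torsion_points m (t + 1)" using torsion_T[OF m t] by simp
    have t': "Im (t + 1) > 0" using t by simp
    show "\<Phi> (t + 1) z = \<Phi> t z" using T[OF t z] D[OF t z] D[OF t' z'] by simp
  qed
  have proj: "(\<Sum>j<2 * m. e2pi (- of_int (rep m s) * of_nat j / of_nat (2 * m)) * \<Phi> t (z + of_nat j / of_nat (2 * m)))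
      = of_nat (2 * m) * (g s t * vt m (rep m s) t z)" if "Im t > 0" "s \<in> ?R" for s t z unfolding \<Phi>_def by (rule theta_projection[OF m that])
  have m2: "of_nat (2 * m) \<noteq> (0 :: complex)" using m by simp
  have gT: "g s (t + 1) = g s t" if t: "Im t > 0" and s: "s \<in> ?R" for s t
  proof -
    obtain w where w: "vt m (rep m s) t w \<noteq> 0" using vt_not_identically_zero[OF m t] by blast
    have t': "Im (t + 1) > 0" using t by simp
    have "of_nat (2 * m) * (g s (t + 1) * vt m (rep m s) (t + 1) w) = of_nat (2 * m) * (g s t * vt m (rep m s) t w)" unfolding proj[OF t s, symmetric] proj[OF t' s, symmetric] \<Phi>T[OF t] ..
    thus ?thesis unfolding vT[OF t] mult_cancel_left using m2 w by simp
  qed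
  have ghol: "g s holomorphic_on upper" if s: "s \<in> ?R" for s
  proof -
    have "g s field_differentiable at t0" if "t0 \<in> upper" for t0
    proof -
      have t0: "Im t0 > 0" using that by simp
      \<comment> \<open>The base point must avoid the torsion points for all t near t0 and the zeros
        of \<open>vt\<close>; the identity theorem on the strip provides it.\<close>
      have "\<exists>z0. 0 < Im z0 \<and> real m * Im z0 < Im t0 \<and> vt m (rep m s) t0 z0 \<noteq> 0"
      proof (rule ccontr)
        assume no: "\<not> ?thesis"
        let ?S = "{z. 0 < Im z} \<inter> {z. real m * Im z < Im t0}"
        have "open ?S" by (intro open_Int open_Collect_less continuous_intros)
        moreover have "\<i> * of_real (Im t0 / (2 * real m)) \<in> ?S" using t0 m by simp
        hence "?S \<noteq> {}" by blast
        moreover have "vt m (rep m s) t0 x = 0" if "x \<in> ?S" for x using no that by blast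
        ultimately have "vt m (rep m s) t0 w = 0" for w using analytic_continuation_open[of ?S UNIV "vt m (rep m s) t0" "\<lambda>_. 0" w]
            expands_holomorphic_z[OF vt_expands[OF m] t0] connected_UNIV by simp
        thus False using vt_not_identically_zero[OF m t0] by blast
      qed
      then obtain z0 where z0: "0 < Im z0" "real m * Im z0 < Im t0" "vt m (rep m s) t0 z0 \<noteq> 0" by blast
      have vh: "(\<lambda>t. vt m (rep m s) t z0) holomorphic_on upper" by (rule expands_holomorphic_tau[OF vt_expands[OF m]])
      let ?Q = "\<lambda>t. (\<Sum>j<2 * m. e2pi (- of_int (rep m s) * of_nat j / of_nat (2 * m)) * D t (z0 + of_nat j / of_nat (2 * m))) / (of_nat (2 * m) * vt m (rep m s) t z0)"
      have nt: "z0 + of_nat j / of_nat (2 * m) \<notin> torsion_points m t" if "Im t > 0" "real m * Im z0 < Im t" for t j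
        using strip_not_torsion[OF m that(1) z0(1) that(2), of "real j / real (2 * m)"] by simp
      have "?Q field_differentiable at t0" using hol[OF t0 nt[OF t0 z0(2)]] holomorphic_on_imp_differentiable_at[OF vh open_upper, of t0] t0 z0(3) m2
        by (intro field_differentiable_divide field_differentiable_sum field_differentiable_mult field_differentiable_const) auto
      moreover have "eventually (\<lambda>t. ?Q t = g s t) (nhds t0)"
      proof -
        have "isCont (\<lambda>t. vt m (rep m s) t z0) t0" using holomorphic_on_imp_differentiable_at[OF vh open_upper, of t0] t0 by (intro field_differentiable_imp_continuous_at) auto
        hence "((\<lambda>t. vt m (rep m s) t z0) \<longlongrightarrow> vt m (rep m s) t0 z0) (nhds t0)"
          unfolding isCont_def by (rule tendsto_at_iff_tendsto_nhds[of "\<lambda>t. vt m (rep m s) t z0" t0, THEN iffD1])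
        hence e1: "eventually (\<lambda>t. vt m (rep m s) t z0 \<noteq> 0) (nhds t0)" using z0(3) by (rule tendsto_imp_eventually_ne)
        have "open {t. 0 < Im t \<and> real m * Im z0 < Im t}" by (intro open_Collect_conj open_Collect_less continuous_intros)
        hence e2: "eventually (\<lambda>t. 0 < Im t \<and> real m * Im z0 < Im t) (nhds t0)" using eventually_nhds_in_open[of _ t0] t0 z0(2) by force
        from e1 e2 show ?thesis
        proof eventually_elim
          case (elim t)
          have "(\<Sum>j<2 * m. e2pi (- of_int (rep m s) * of_nat j / of_nat (2 * m)) * D t (z0 + of_nat j / of_nat (2 * m))) =
              of_nat (2 * m) * (g s t * vt m (rep m s) t z0)" unfolding proj[OF conjunct1[OF elim(2)] s, symmetric]
            using D nt elim(2) by (intro sum.cong refl arg_cong[where f = "\<lambda>x. _ * x"]) blast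
          thus ?case using elim(1) m2 by simp
        qed
      qed
      ultimately show ?thesis unfolding field_differentiable_def using DERIV_cong_ev[OF refl _ refl, of ?Q "g s" t0] by blast
    qed
    thus ?thesis by (simp add: holomorphic_on_def field_differentiable_at_within)
  qed
  \<comment> \<open>Boundedness of q^(1/4m) H bounds the exponents of g = q^(u^2/4m) H below by (u^2
    - 1)/4m. Adding the exponents of \<open>vt\<close> gives r^2 - 4mn \<le> 1.\<close>
  have "\<forall>s\<in>?R. \<exists>v. expands (\<lambda>t z. g s t) (col v) \<and> (\<forall>n. v n \<noteq> 0 --> real_of_int ((rep m s)\<^sup>2 - 1) / (4 * real m) \<le> of_int n)"
  proof
    fix s assume s: "s \<in> ?R"
    obtain Y B where YB: "\<forall>t. Im t \<ge> Y --> norm (e2pi (t / (4 * of_nat m)) * H s t) \<le> B" using growth[OF s] by blast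
    show "\<exists>v. expands (\<lambda>t z. g s t) (col v) \<and> (\<forall>n. v n \<noteq> 0 --> real_of_int ((rep m s)\<^sup>2 - 1) / (4 * real m) \<le> of_int n)"
    proof (rule periodic_growth_expansion[OF ghol[OF s] gT[OF _ s], where Y = Y and B = B])
      fix t assume Y: "Im t \<ge> Y"
      have "- of_real (real_of_int ((rep m s)\<^sup>2 - 1) / (4 * real m)) * t + (of_int (rep m s))\<^sup>2 / (4 * of_nat m) * t = t / (4 * of_nat m)" using m0 by (simp add: field_simps)
      hence "e2pi (- of_real (real_of_int ((rep m s)\<^sup>2 - 1) / (4 * real m)) * t) * e2pi ((of_int (rep m s))\<^sup>2 / (4 * of_nat m) * t) = e2pi (t / (4 * of_nat m))"
        unfolding e2pi_add[symmetric] by (rule arg_cong)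
      hence "e2pi (- of_real (real_of_int ((rep m s)\<^sup>2 - 1) / (4 * real m)) * t) * g s t = e2pi (t / (4 * of_nat m)) * H s t" unfolding g_def by (simp only: mult_ac)
      thus "norm (e2pi (- of_real (real_of_int ((rep m s)\<^sup>2 - 1) / (4 * real m)) * t) * g s t) \<le> B" using YB Y by simp
    qed
  qed
  from bchoice[OF this] obtain v where v: "\<And>s. s \<in> ?R ==> expands (\<lambda>t z. g s t) (col (v s))"
    "\<And>s n. s \<in> ?R ==> v s n \<noteq> 0 ==> real_of_int ((rep m s)\<^sup>2 - 1) / (4 * real m) \<le> of_int n" by blast
  have v4: "(rep m s)\<^sup>2 - 1 \<le> 4 * int m * n" if "s \<in> ?R" "v s n \<noteq> 0" for s n
  proof -
    have "real_of_int ((rep m s)\<^sup>2 - 1) \<le> of_int n * (4 * real m)" using v(2)[OF that] m by (simp add: pos_divide_le_eq)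
    also have "of_int n * (4 * real m) = real_of_int (4 * int m * n)" by simp
    finally show ?thesis by (simp only: of_int_le_iff)
  qed
  have vn: "v s n = 0" if s: "s \<in> ?R" and n: "n < 0" for s n
  proof (rule ccontr)
    assume "v s n \<noteq> 0"
    from v4[OF s this] have "- 1 \<le> 4 * (int m * n)" using zero_le_power2[of "rep m s"] by linarith
    moreover have "int m * n \<le> int m * (- 1)" using n by (intro mult_left_mono) auto
    ultimately show False using m by simp
  qed
  define c where "c = (\<lambda>n k. \<Sum>s\<in>?R. conv (col (v s)) (varr m (rep m s)) n k)"
  have ce: "expands \<Phi> c" unfolding \<Phi>_def c_def by (intro expands_sum expands_mult v(1) vt_expands[OF m] fourier_nice_col vn varr_nice[OF m] rep_bound) auto
  have cs: "k\<^sup>2 \<le> 4 * int m * n + 1" if nz: "c n k \<noteq> 0" for n k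
  proof -
    obtain s where s: "s \<in> ?R" "conv (col (v s)) (varr m (rep m s)) n k \<noteq> 0" using nz unfolding c_def by (rule sum.not_neutral_contains_not_neutral)
    obtain a where a: "v s a * varr m (rep m s) (n - a) k \<noteq> 0" using s(2) unfolding conv_col_left by (rule sum.not_neutral_contains_not_neutral)
    hence "v s a \<noteq> 0" "varr m (rep m s) (n - a) k \<noteq> 0" by auto
    hence "(rep m s)\<^sup>2 - 1 \<le> 4 * int m * a" "k\<^sup>2 = (rep m s)\<^sup>2 + 4 * int m * (n - a)" using v4[OF s(1)] varr_disc[OF m] by blast+
    thus ?thesis by (simp add: algebra_simps)
  qed
  have "jac m \<Phi> c" unfolding jac_def
  proof (intro conjI allI impI)
    show "expands \<Phi> c" by (rule ce)
    fix t z :: complex assume t: "Im t > 0"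
    have t0: "t \<noteq> 0" using t by auto
    have s: "Im (- 1 / t) > 0" using t by simp
    show "e2pi (of_nat m * (t + 2 * z)) * \<Phi> t (z + t) = \<Phi> t z"
    proof (rule entire_eq_off_torsion[OF m t, of "\<lambda>z. e2pi (of_nat m * (t + 2 * z)) * \<Phi> t (z + t)" "\<Phi> t"])
      show "(\<lambda>z. e2pi (of_nat m * (t + 2 * z)) * \<Phi> t (z + t)) holomorphic_on UNIV" by (intro holomorphic_intros entire_shift \<Phi>_entire t)
      show "\<Phi> t holomorphic_on UNIV" by (rule \<Phi>_entire[OF t])
      fix z assume z: "z \<notin> torsion_points m t"
      hence z': "z + t \<notin> torsion_points m t" using torsion_shift[OF m t] by simp
      show "e2pi (of_nat m * (t + 2 * z)) * \<Phi> t (z + t) = \<Phi> t z" using ell[OF t z] unfolding D[OF t z] D[OF t z'] by simp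
    qed
    have "(\<lambda>z. \<Phi> (- 1 / t) (1 / t * z)) holomorphic_on UNIV" by (rule entire_scale[OF \<Phi>_entire[OF s]])
    hence h1: "(\<lambda>z. \<Phi> (- 1 / t) (z / t)) holomorphic_on UNIV" by simp
    have h2: "(\<lambda>z. t * e2pi (of_nat m * z\<^sup>2 / t) * \<Phi> t z) holomorphic_on UNIV" using t0 by (intro holomorphic_intros \<Phi>_entire[OF t]) auto
    show "\<Phi> (- 1 / t) (z / t) = t * e2pi (of_nat m * z\<^sup>2 / t) * \<Phi> t z"
    proof (rule entire_eq_off_torsion[OF m t h1 h2])
      fix z assume z: "z \<notin> torsion_points m t"
      hence z': "z / t \<notin> torsion_points m (- 1 / t)" using torsion_S[OF m t] by blast
      have i: "e2pi (of_nat m * z\<^sup>2 / t) * e2pi (- (of_nat m * z\<^sup>2 / t)) = 1" by (simp add: e2pi_add[symmetric])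
      have "t * e2pi (of_nat m * z\<^sup>2 / t) * \<Phi> t z = (t * inverse t) * (e2pi (of_nat m * z\<^sup>2 / t) * e2pi (- (of_nat m * z\<^sup>2 / t))) * \<Phi> (- 1 / t) (z / t)"
        using S[OF t z] unfolding D[OF t z] D[OF s z'] by (simp only: mult_ac)
      thus "\<Phi> (- 1 / t) (z / t) = t * e2pi (of_nat m * z\<^sup>2 / t) * \<Phi> t z" unfolding i using t0 by simp
    qed
  qed
  hence "c n k = 0" for n k by (rule weak_jac_zero[OF m _ cs])
  hence "(fterm c t z has_sum 0) UNIV" by (intro has_sum_0) auto
  hence "\<Phi> t z = 0" using has_sum_unique[OF expandsD[OF ce t]] by blast
  thus ?thesis using D[OF t z] by simp
qed

text \<open>A Euclidean space has a nonzero basis vector, so the spanning set X is nonempty and has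
  a component, whose Coxeter number is positive.\<close>

lemma coxeter_number_pos:
  fixes X :: "'a::euclidean_space set"
  assumes X: "root_system X" and m: "\<forall>C\<in>root_components X. has_coxeter_number C m"
  shows "m > 0"
proof -
  have "X \<noteq> {}"
  proof
    assume "X = {}"
    hence "(UNIV :: 'a set) = {0}" using X unfolding root_system_def by (metis span_empty)
    moreover obtain b :: 'a where "b \<in> Basis" using nonempty_Basis by blast
    ultimately show False using nonzero_Basis by blast
  qed
  hence "root_components X \<noteq> {}" unfolding root_components_def quotient_def by blast
  thus ?thesis using m unfolding has_coxeter_number_def by blast
qed

lemma bigo_cusp_bound:
  assumes "f \<in> O[at_cusp](\<lambda>_. 1)"
  shows "\<exists>Y B. \<forall>t. Im t \<ge> Y --> norm (f t :: complex) \<le> B"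
proof -
  obtain c where "eventually (\<lambda>t. norm (f t) \<le> c * norm (1 :: complex)) at_cusp" using assms by (elim landau_o.bigE)
  then obtain P where P: "eventually P at_top" "\<And>t. P (Im t) ==> norm (f t) \<le> c" unfolding at_cusp_def eventually_filtercomap by auto
  thus ?thesis unfolding eventually_at_top_linorder by blast
qed

theorem theorem4p1:
  fixes X :: "'a::euclidean_space set"
    and m :: nat
    and \<psi> \<psi>' :: "complex \<Rightarrow> complex \<Rightarrow> complex"
  assumes "simply_laced_root_system X"
    and "\<forall>C\<in>root_components X. has_coxeter_number C m"
    and "meromorphic_jacobi_form_wt1 m \<psi>"
    and "mero_eq m (polar_part m \<psi>) (EZ_root_system X (mu0 m))"
    and "optimal_growth m (finite_part m \<psi>)"
    and "meromorphic_jacobi_form_wt1 m \<psi>'"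
    and "mero_eq m (polar_part m \<psi>') (EZ_root_system X (mu0 m))"
    and "optimal_growth m (finite_part m \<psi>')"
  shows "mero_eq m \<psi> \<psi>'"
proof -
  have m: "m > 0" by (rule coxeter_number_pos[OF _ assms(2)]) (use assms(1) in \<open>simp add: simply_laced_root_system_def\<close>)
  have sp: "simple_poles_at_torsion m \<psi>" "simple_poles_at_torsion m \<psi>'"
    and el: "elliptic_invariant m \<psi>" "elliptic_invariant m \<psi>'"
    and mo: "modular_invariant_wt1 m \<psi>" "modular_invariant_wt1 m \<psi>'" using assms(3,6) unfolding meromorphic_jacobi_form_wt1_def by auto
  obtain h where h: "\<And>t z. Im t > 0 ==> finite_part m \<psi> t z = (\<Sum>r\<in>{0..<2 * int m}. h r t * theta m r t z)"
    "\<And>r. r \<in> {0..<2 * int m} ==> (\<lambda>t. e2pi (t / (4 * of_nat m)) * h r t) \<in> O[at_cusp](\<lambda>_. 1)" using assms(5) unfolding optimal_growth_def by blast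
  obtain h' where h': "\<And>t z. Im t > 0 ==> finite_part m \<psi>' t z = (\<Sum>r\<in>{0..<2 * int m}. h' r t * theta m r t z)"
    "\<And>r. r \<in> {0..<2 * int m} ==> (\<lambda>t. e2pi (t / (4 * of_nat m)) * h' r t) \<in> O[at_cusp](\<lambda>_. 1)" using assms(8) unfolding optimal_growth_def by blast
  define D where "D = (\<lambda>t z. \<psi> t z - \<psi>' t z)"
  have ell: "f t z = e2pi (of_nat m * (t + 2 * z)) * f t (z + t)"
    if "elliptic_invariant m f" "Im t > 0" "z \<notin> torsion_points m t" for f t z using that(1)[unfolded elliptic_invariant_def mero_eq_def, rule_format, of t z 1 0] that(2,3) by simp
  \<comment> \<open>In \<open>of\<close> the matrix entries come in the order a, d, b, c: here (1 1;
    0 1), and for \<open>S\<close> the matrix (0 -1; 1 0).\<close>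
  have T: "f t z = f (t + 1) z"
    if "modular_invariant_wt1 m f" "Im t > 0" "z \<notin> torsion_points m t" for f t z using that(1)[unfolded modular_invariant_wt1_def mero_eq_def, rule_format, of 1 1 1 0 t z] that(2,3)
    by (simp add: e2pi_def)
  have S: "f t z = e2pi (- (of_nat m * z\<^sup>2 / t)) * inverse t * f (- 1 / t) (z / t)"
    if "modular_invariant_wt1 m f" "Im t > 0" "z \<notin> torsion_points m t" for f t z using that(1)[unfolded modular_invariant_wt1_def mero_eq_def, rule_format, of 0 0 "- 1" 1 t z] that(2,3) by simp
  have "D t z = 0" if t: "Im t > 0" and z: "z \<notin> torsion_points m t" for t z
  proof (rule weak_form_zero[OF m, where D = D and H = "\<lambda>r t. h r t - h' r t"])
    fix t z :: complex assume t: "Im t > 0" and z: "z \<notin> torsion_points m t"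
    show "(\<lambda>t. D t z) field_differentiable at t" unfolding D_def by (intro field_differentiable_diff holomorphic2_t) (use sp t z in \<open>auto simp: simple_poles_at_torsion_def\<close>)
    show "D t z = e2pi (of_nat m * (t + 2 * z)) * D t (z + t)" unfolding D_def right_diff_distrib ell[OF el(1) t z, symmetric] ell[OF el(2) t z, symmetric] ..
    show "D t z = D (t + 1) z" unfolding D_def T[OF mo(1) t z, symmetric] T[OF mo(2) t z, symmetric] ..
    show "D t z = e2pi (- (of_nat m * z\<^sup>2 / t)) * inverse t * D (- 1 / t) (z / t)" unfolding D_def right_diff_distrib S[OF mo(1) t z, symmetric] S[OF mo(2) t z, symmetric] ..
    have "polar_part m \<psi> t z = polar_part m \<psi>' t z" using assms(4,7) t z unfolding mero_eq_def by simp
    hence "D t z = finite_part m \<psi> t z - finite_part m \<psi>' t z" unfolding finite_part_eq[OF m t sp(1) z] finite_part_eq[OF m t sp(2) z] D_def by simp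
    thus "D t z = (\<Sum>r\<in>{0..<2 * int m}. (h r t - h' r t) * theta m r t z)" by (simp add: h(1)[OF t] h'(1)[OF t] left_diff_distrib sum_subtractf)
  next
    fix r assume r: "r \<in> {0..<2 * int m}"
    have "(\<lambda>t. e2pi (t / (4 * of_nat m)) * h r t - e2pi (t / (4 * of_nat m)) * h' r t) \<in> O[at_cusp](\<lambda>_. 1)" by (rule sum_in_bigo(2)[OF h(2)[OF r] h'(2)[OF r]])
    hence "(\<lambda>t. e2pi (t / (4 * of_nat m)) * (h r t - h' r t)) \<in> O[at_cusp](\<lambda>_. 1)" unfolding right_diff_distrib .
    thus "\<exists>Y B. \<forall>t. Im t \<ge> Y --> norm (e2pi (t / (4 * of_nat m)) * (h r t - h' r t)) \<le> B" by (rule bigo_cusp_bound)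
  qed (rule t z)+
  thus ?thesis unfolding mero_eq_def D_def by simp
qed

end
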